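(* Let $G$ be a finitely presented group and let $p$ be a prime. Suppose that $G$ has an infinite nested sequence of subnormal subgroups, each with index a power of $p$ in $G$, and with linear growth of mod $p$ homology. Then $G$ has an infinite nested sequence of subnormal subgroups, each with index a power of $p$ in $G$ and with linear growth of mod $p$ homology, such that $G$ also has Property $(\tau)$ with respect to this sequence.
   Context: An infinite nested sequence of subgroups is a sequence $G_1 \geq G_2 \geq \dots$ having infinitely many distinct terms. A subgroup $H$ of $G$ is subnormal if there is a finite chain $G = H_0 \triangleright H_1 \triangleright \dots \triangleright H_k = H$ with each term normal in the preceding one. For a group $H$ and prime $p$, $d_p(H)$ denotes the dimension of $H_1(H;\mathbb{F}_p)$ over the field $\mathbb{F}_p$ of order $p$. A collection $\{G_i\}$ of finite index subgroups of $G$ has linear growth of mod $p$ homology if $\inf_i d_p(G_i)/[G:G_i] > 0$. Property $(\tau)$: for a finite graph $X$ with vertex set $V(X)$ (loops and multiple edges allowed) and $A \subset V(X)$, $\partial A$ is the set of edges with one endpoint in $A$ and one not in $A$. The Cheeger constant is $h(X) = \min\{|\partial A|/|A| : A \subset V(X),\ 0<|A|\leq |V(X)|/2\}$ (a one-vertex graph is given $h=+\infty$). For a finite generating set $S$ of $G$ and a finite index subgroup $G_i$, $X(G/G_i;S)$ is the Schreier coset graph: vertices are the right cosets $G_i g$, with one edge from $G_i g$ to $G_i g s$ for each coset and each $s\in S$. A finitely generated group $G$ has Property $(\tau)$ with respect to a collection $\{G_i\}$ of finite index subgroups if $\inf_i h(X(G/G_i;S))>0$ for some (equivalently, any) finite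 generating set $S$ of $G$. *)

theory Defs
  imports
    "HOL-Algebra.Generated_Groups"
    "HOL-Number_Theory.Residues"
    "HOL-Library.Extended_Real"
    "Jordan_Normal_Form.Missing_VectorSpace"
    "Graph_Theory.Digraph"
begin

section \<open>Free groups and finite presentations\<close>

text \<open>The letter \<open>(x, True)\<close> stands for the generator \<open>x\<close>, and \<open>(x, False)\<close> for its inverse.\<close>

definition free_words :: "'x set \<Rightarrow> ('x \<times> bool) list set" where
  "free_words X = lists (X \<times> UNIV)"

definition cancellation :: "'x set \<Rightarrow> (('x \<times> bool) list \<times> ('x \<times> bool) list) set" where
  "cancellation X = {(u @ [(x, b), (x, \<not> b)] @ v, u @ v) | u v x b.
     u \<in> free_words X \<and> v \<in> free_words X \<and> x \<in> X}"

definition free_equiv :: "'x set \<Rightarrow> (('x \<times> bool) list \<times> ('x \<times> bool) list) set" where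
  "free_equiv X = (cancellation X \<union> (cancellation X)\<inverse>)\<^sup>*"

definition free_group :: "'x set \<Rightarrow> ('x \<times> bool) list set monoid" where
  "free_group X =
    \<lparr>carrier = free_words X // free_equiv X,
     monoid.mult = (\<lambda>A B. \<Union>u\<in>A. \<Union>v\<in>B. free_equiv X `` {u @ v}),
     one = free_equiv X `` {[]}\<rparr>"

definition normal_closure :: "('a, 'b) monoid_scheme \<Rightarrow> 'a set \<Rightarrow> 'a set" where
  "normal_closure G R = \<Inter>{N. N \<lhd> G \<and> R \<subseteq> N}"

text \<open>Taking generators from \<^typ>\<open>nat\<close> is no restriction, as only finite generating sets occur.\<close>

definition finitely_presented :: "('a, 'b) monoid_scheme \<Rightarrow> bool" where
  "finitely_presented G \<longleftrightarrow>
    (\<exists>(X :: nat set) R. finite X \<and> finite R \<and> R \<subseteq> carrier (free_group X) \<and>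
       G \<cong> (free_group X) Mod (normal_closure (free_group X) R))"


section \<open>Sequences of subgroups\<close>

definition subgroup_index :: "('a, 'b) monoid_scheme \<Rightarrow> 'a set \<Rightarrow> nat" where
  "subgroup_index G H = card (rcosets\<^bsub>G\<^esub> H)"

definition subnormal :: "'a set \<Rightarrow> ('a, 'b) monoid_scheme \<Rightarrow> bool" where
  "subnormal H G \<longleftrightarrow>
    (\<exists>k (C :: nat \<Rightarrow> 'a set). C 0 = carrier G \<and> C k = H \<and>
       (\<forall>i<k. C (Suc i) \<lhd> G\<lparr>carrier := C i\<rparr>))"

definition infinite_nested_sequence :: "('a, 'b) monoid_scheme \<Rightarrow> (nat \<Rightarrow> 'a set) \<Rightarrow> bool" where
  "infinite_nested_sequence G K \<longleftrightarrow>
    (\<forall>i. subgroup (K i) G) \<and> (\<forall>i. K (Suc i) \<subseteq> K i) \<and> infinite (range K)"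


section \<open>Group homology with trivial coefficients\<close>

text \<open>
  Homology of \<open>G\<close> with coefficients in the trivial module \<open>R\<close> (a commutative ring), computed by
  the inhomogeneous bar complex: \<open>C\<^sub>n\<close> is the free \<open>R\<close>-module on \<open>G\<^sup>n\<close> and
  \<open>\<partial>[g\<^sub>1|...|g\<^sub>n] = [g\<^sub>2|...|g\<^sub>n] + (\<Sum>0<i<n. (-1)\<^sup>i [g\<^sub>1|...|g\<^sub>ig\<^sub>i\<^sub>+\<^sub>1|...|g\<^sub>n]) + (-1)\<^sup>n [g\<^sub>1|...|g\<^sub>n\<^sub>-\<^sub>1]\<close>
  for \<open>n > 0\<close>. Chains are finitely supported functions on lists of length \<open>n\<close>. The multiplicative
  fields of the \<^type>\<open>module\<close> records below play no role.
\<close>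

definition bar_chains ::
  "('r, 'm) ring_scheme \<Rightarrow> ('a, 'b) monoid_scheme \<Rightarrow> nat \<Rightarrow> ('r, 'a list \<Rightarrow> 'r) module" where
  "bar_chains R G n =
    \<lparr>carrier = {c. (\<forall>xs. c xs \<in> carrier R) \<and> finite {xs. c xs \<noteq> \<zero>\<^bsub>R\<^esub>} \<and>
                   (\<forall>xs. c xs \<noteq> \<zero>\<^bsub>R\<^esub> \<longrightarrow> length xs = n \<and> set xs \<subseteq> carrier G)},
     monoid.mult = undefined,
     one = undefined,
     zero = (\<lambda>xs. \<zero>\<^bsub>R\<^esub>),
     add = (\<lambda>c d xs. c xs \<oplus>\<^bsub>R\<^esub> d xs),
     smult = (\<lambda>a c xs. a \<otimes>\<^bsub>R\<^esub> c xs)\<rparr>"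

definition bar_face :: "('a, 'b) monoid_scheme \<Rightarrow> nat \<Rightarrow> 'a list \<Rightarrow> 'a list" where
  "bar_face G i xs =
    (if i = 0 then tl xs
     else if i = length xs then butlast xs
     else take (i - 1) xs @ [xs ! (i - 1) \<otimes>\<^bsub>G\<^esub> xs ! i] @ drop (i + 1) xs)"

definition bar_boundary ::
  "('r, 'm) ring_scheme \<Rightarrow> ('a, 'b) monoid_scheme \<Rightarrow> nat \<Rightarrow> ('a list \<Rightarrow> 'r) \<Rightarrow> 'a list \<Rightarrow> 'r" where
  "bar_boundary R G n c =
    (if n = 0 then (\<lambda>ys. \<zero>\<^bsub>R\<^esub>)
     else (\<lambda>ys. \<Oplus>\<^bsub>R\<^esub>xs\<in>{xs. c xs \<noteq> \<zero>\<^bsub>R\<^esub>}. \<Oplus>\<^bsub>R\<^esub>i\<in>{i. i \<le> n \<and> bar_face G i xs = ys}.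
             add_pow R ((- 1 :: int) ^ i) (c xs)))"

definition bar_cycles ::
  "('r, 'm) ring_scheme \<Rightarrow> ('a, 'b) monoid_scheme \<Rightarrow> nat \<Rightarrow> ('a list \<Rightarrow> 'r) set" where
  "bar_cycles R G n = {c \<in> carrier (bar_chains R G n). bar_boundary R G n c = (\<lambda>ys. \<zero>\<^bsub>R\<^esub>)}"

definition bar_boundaries ::
  "('r, 'm) ring_scheme \<Rightarrow> ('a, 'b) monoid_scheme \<Rightarrow> nat \<Rightarrow> ('a list \<Rightarrow> 'r) set" where
  "bar_boundaries R G n = bar_boundary R G (Suc n) ` carrier (bar_chains R G (Suc n))"

definition quotient_module :: "('r, 'v, 'm) module_scheme \<Rightarrow> 'v set \<Rightarrow> ('r, 'v set) module" where
  "quotient_module M N =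
    \<lparr>carrier = a_rcosets\<^bsub>M\<^esub> N,
     monoid.mult = undefined,
     one = undefined,
     zero = N,
     add = (\<lambda>A B. A <+>\<^bsub>M\<^esub> B),
     smult = (\<lambda>a A. \<Union>x\<in>A. N +>\<^bsub>M\<^esub> (a \<odot>\<^bsub>M\<^esub> x))\<rparr>"

definition group_homology ::
  "('r, 'm) ring_scheme \<Rightarrow> ('a, 'b) monoid_scheme \<Rightarrow> nat \<Rightarrow> ('r, ('a list \<Rightarrow> 'r) set) module" where
  "group_homology R G n =
    quotient_module ((bar_chains R G n)\<lparr>carrier := bar_cycles R G n\<rparr>) (bar_boundaries R G n)"

text \<open>
  The dimension \<^const>\<open>vectorspace.dim\<close> is a natural number, meaningful for finite-dimensional
  spaces; this covers all finite index subgroups of a finitely generated group.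
\<close>

definition mod_homology_dim :: "nat \<Rightarrow> ('a, 'b) monoid_scheme \<Rightarrow> nat" where
  "mod_homology_dim p G =
    vectorspace.dim (residue_ring (int p)) (group_homology (residue_ring (int p)) G 1)"

definition linear_growth_mod_homology :: "nat \<Rightarrow> ('a, 'b) monoid_scheme \<Rightarrow> 'a set set \<Rightarrow> bool" where
  "linear_growth_mod_homology p G \<H> \<longleftrightarrow>
    (\<forall>H\<in>\<H>. subgroup H G \<and> finite (rcosets\<^bsub>G\<^esub> H)) \<and>
    (INF H\<in>\<H>. ereal (real (mod_homology_dim p (G\<lparr>carrier := H\<rparr>)) / real (subgroup_index G H))) > 0"


section \<open>Cheeger constants and Property \<open>(\<tau>)\<close>\<close>

text \<open>
  A \<^type>\<open>pre_digraph\<close> admits loops and multiple arcs; forgetting the orientation of its arcs gives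
  an undirected multigraph, and the next two notions do not depend on the orientation.
\<close>

definition edge_boundary :: "('v, 'e) pre_digraph \<Rightarrow> 'v set \<Rightarrow> 'e set" where
  "edge_boundary X A = {e \<in> arcs X. (tail X e \<in> A) \<noteq> (head X e \<in> A)}"

text \<open>The infimum over the empty family, as for a one-vertex graph, is \<open>\<infinity>\<close>.\<close>

definition cheeger_constant :: "('v, 'e) pre_digraph \<Rightarrow> ereal" where
  "cheeger_constant X =
    (INF A\<in>{A. A \<subseteq> verts X \<and> 0 < card A \<and> real (card A) \<le> real (card (verts X)) / 2}.
       ereal (real (card (edge_boundary X A)) / real (card A)))"

definition schreier_graph ::
  "('a, 'b) monoid_scheme \<Rightarrow> 'a set \<Rightarrow> 'a set \<Rightarrow> ('a set, 'a set \<times> 'a) pre_digraph" where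
  "schreier_graph G H S =
    \<lparr>verts = rcosets\<^bsub>G\<^esub> H,
     arcs = (rcosets\<^bsub>G\<^esub> H) \<times> S,
     tail = (\<lambda>(C, s). C),
     head = (\<lambda>(C, s). C #>\<^bsub>G\<^esub> s)\<rparr>"

definition property_tau :: "('a, 'b) monoid_scheme \<Rightarrow> 'a set set \<Rightarrow> bool" where
  "property_tau G \<H> \<longleftrightarrow>
    (\<forall>H\<in>\<H>. subgroup H G \<and> finite (rcosets\<^bsub>G\<^esub> H)) \<and>
    (\<exists>S. finite S \<and> S \<subseteq> carrier G \<and> generate G S = carrier G \<and>
       (INF H\<in>\<H>. cheeger_constant (schreier_graph G H S)) > 0)"

end

theory Submission
  imports Defs "HOL-Algebra.Group_Action" "HOL-Algebra.Sylow"
begin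

text \<open>
  If the given sequence does not already have Property \<open>(\<tau>)\<close>, the coset graph of some subgroup \<open>N\<close> of \<open>p\<close>-power index,
  of index \<open>p\<close> in a subgroup whose coset graph still expands, is cut into two connected pieces of comparable size by
  very few edges. Since the dimension of the mod \<open>p\<close> homology divided by the index hardly decreases from one term to the
  next far down the sequence, \<open>N\<close> has so many homomorphisms to \<open>\<int>/p\<close> that, even among those vanishing near the cut, many
  are seen by loops inside either piece. Labelling the edges of the cut by elements of a group, in dependence on the
  values of these homomorphisms along the path walked so far, produces a subgroup \<open>J\<close> of \<open>p\<close>-power index with elements
  \<open>k\<^sub>0, k\<^sub>1, k\<^sub>2, k\<^sub>3\<close> that some homomorphism defined on \<open>J\<close> sends to any prescribed elements of any group: \<open>J\<close> retracts
  onto a free group.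

  Let \<open>J\<close> act on \<open>\<int>\<^sup>2\<close> through the two unit translations and the two elementary shears with entry \<open>p\<close>. The new sequence
  consists of the stabilisers of \<open>0\<close> modulo the powers of \<open>p\<close>. These have linear growth of homology because the action can
  be extended to \<open>\<int>\<^sup>2 \<times> \<int>\<close> by arbitrary cocycles on the generators, and Property \<open>(\<tau>)\<close> because translations and shears
  generate expanders on the tori \<open>(\<int>/p\<^sup>n)\<^sup>2\<close>.
\<close>

section \<open>Subgroups of prime power index\<close>

context group begin

text \<open>If one piece had few loop values, the homomorphisms vanishing near the cut would be
  determined, up to few choices, by data on the cosets in the other piece. That piece has at most a
  proportion \<open>1 - 1 / (4 * p)\<close> of those cosets that matter, whereas far down the
  sequence the dimension loses only a proportion \<open>1 / (8 * p)\<close> of what the index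
  allows. The pieces must be of comparable size for this, and to this end \<open>N\<close> has index
  \<open>p\<close> under a subgroup that still expands. Finite presentability bounds the price of
  vanishing near the cut: only finitely many words are tested, so it is a fixed multiple of the
  number of cut edges. A constant label would achieve nothing, since a closed path crosses the cut
  alternately in the two directions and its labels cancel. Labels that vary with the values break
  the cancellation for some loops, while relators that cross the cut meet only zero values and keep
  trivial label. No free group is built as target; its universal property is used directly, with one
  target group that serves all powers of \<open>p\<close>. The shears have entry \<open>p\<close> so
  that together with the translations they act on each torus through a finite
  \<open>p\<close>-group.\<close>

lemma rcos_eq_iff:
  assumes "subgroup H G" "x \<in> carrier G" "y \<in> carrier G"
  shows "H #> x = H #> y \<longleftrightarrow> x \<otimes> inv y \<in> H"
  using assms by (metis is_group rcos_self repr_independence subgroup.rcos_module)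

lemma rcosets_mult_closed:
  assumes "subgroup H G" "C \<in> rcosets H" "g \<in> carrier G"
  shows "C #> g \<in> rcosets H"
  using assms unfolding RCOSETS_def
  by (auto simp: coset_mult_assoc subgroup.subset)

lemma rcosets_mult_assoc:
  assumes "subgroup H G" "C \<in> rcosets H" "g \<in> carrier G" "h \<in> carrier G"
  shows "C #> g #> h = C #> (g \<otimes> h)"
  using assms coset_mult_assoc subgroup.rcosets_carrier is_group by metis

lemma rcosets_mult_one:
  assumes "subgroup H G" "C \<in> rcosets H"
  shows "C #> \<one> = C"
  using assms subgroup.rcosets_carrier is_group coset_mult_one by metis

lemma rcosets_obtain:
  assumes "C \<in> rcosets H"
  obtains g where "g \<in> carrier G" "C = H #> g"
  using assms unfolding RCOSETS_def by auto

lemma rcosets_transitive: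
  assumes "subgroup H G" "C \<in> rcosets H" "D \<in> rcosets H"
  obtains g where "g \<in> carrier G" "D = C #> g"
proof -
  obtain c d where c: "c \<in> carrier G" "C = H #> c" and d: "d \<in> carrier G" "D = H #> d"
    using assms rcosets_obtain by metis
  show thesis
  proof (rule that[of "inv c \<otimes> d"])
    show "D = C #> (inv c \<otimes> d)"
      using c d assms(1) by (simp add: coset_mult_assoc subgroup.subset inv_solve_left m_assoc[symmetric])
  qed (use c d in simp)
qed

lemma self_in_rcosets: "subgroup H G \<Longrightarrow> H \<in> rcosets H"
  using subgroup.subgroup_in_rcosets is_group by blast

lemma pow_mem_subgroup: "subgroup H G \<Longrightarrow> x \<in> H \<Longrightarrow> x [^] (n::nat) \<in> H"
  by (induction n) (auto simp: subgroup.one_closed subgroup.m_closed)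

text \<open>Cauchy's theorem, as the case of exponent 1 of Sylow's theorem: a prime \<open>r\<close>
  other than \<open>p\<close> dividing the order would give a nontrivial element whose order divides
  both \<open>r\<close> and \<open>p ^ k\<close>.\<close>

lemma order_prime_power_if_exponent:
  assumes "finite (carrier G)" "prime p" "\<forall>g\<in>carrier G. g [^] (p ^ k) = \<one>"
  shows "\<exists>n. order G = p ^ n"
proof (rule ccontr)
  assume no: "\<not> ?thesis"
  have pos: "order G > 0" using assms(1) order_gt_0_iff_finite by blast
  have "\<exists>r. prime r \<and> r dvd order G \<and> r \<noteq> p"
  proof (rule ccontr)
    assume "\<not> ?thesis"
    hence "prime_factors (order G) \<subseteq> {p}" by (auto simp: prime_factors_dvd)
    hence "order G = p ^ multiplicity p (order G)"
    proof -
      have "order G = (\<Prod>q\<in>prime_factors (order G). q ^ multiplicity q (order G))"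
        using pos prime_factorization_nat by auto
      also have "\<dots> = (\<Prod>q\<in>{p}. q ^ multiplicity q (order G))"
        by (rule prod.mono_neutral_left)
           (use \<open>prime_factors _ \<subseteq> _\<close> assms(2) pos in \<open>auto simp: prime_factors_multiplicity\<close>)
      finally show ?thesis by simp
    qed
    with no show False by blast
  qed
  then obtain r where r: "prime r" "r dvd order G" "r \<noteq> p" by blast
  then obtain m where m: "order G = r ^ 1 * m" by (auto simp: dvd_def)
  obtain H where H: "subgroup H G" "card H = r ^ 1"
    using sylow_thm[OF r(1) is_group m assms(1)] by blast
  have "card H > 1" using H(2) prime_gt_1_nat[OF r(1)] by simp
  then obtain x where x: "x \<in> H" "x \<noteq> \<one>"
    by (metis is_singletonI' is_singleton_altdef less_irrefl subgroup.one_closed[OF H(1)] empty_iff)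
  interpret HG: group "G\<lparr>carrier := H\<rparr>" using H(1) subgroup_imp_group by blast
  have "x [^]\<^bsub>G\<lparr>carrier := H\<rparr>\<^esub> (card H) = \<one>"
    using HG.pow_order_eq_1[of x] x by (simp add: order_def)
  hence 1: "x [^] r = \<one>" using H by (simp add: nat_pow_def)
  have xc: "x \<in> carrier G" using x H(1) subgroup.mem_carrier by metis
  have "ord x dvd r" "ord x dvd p ^ k"
    using 1 assms(3) xc pow_eq_id by blast+
  moreover have "coprime r (p ^ k)" using r assms(2) by (simp add: primes_coprime)
  ultimately have "ord x = 1" by (metis coprime_common_divisor_nat)
  thus False using ord_eq_1 xc x by blast
qed

text \<open>\<open>L\<close> acts on its own right cosets. Orbits have \<open>p\<close>-power size,
  the number of cosets is divisible by \<open>p\<close>, and the coset \<open>L\<close> is fixed;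
  hence another coset \<open>L #> g\<close> is fixed, which means that \<open>g\<close> normalizes
  \<open>L\<close>.\<close>

lemma normalizer_grows:
  assumes fin: "finite (carrier G)" and ord: "order G = p ^ n" and p: "prime p"
    and L: "subgroup L G" "L \<noteq> carrier G"
  obtains g where "g \<in> carrier G" "g \<notin> L" "\<forall>l\<in>L. g \<otimes> l \<otimes> inv g \<in> L"
proof -
  let ?E = "rcosets L" and ?L = "G\<lparr>carrier := L\<rparr>"
  have Lc: "L \<subseteq> carrier G" using L(1) subgroup.subset by blast
  \<comment> \<open>The inverse turns multiplication from the right into a left action, as
    \<open>group_action\<close> requires.\<close>
  define \<phi> where "\<phi> = (\<lambda>l. \<lambda>D\<in>rcosets L. D #> inv l)"
  interpret LG: group ?L using L(1) subgroup_imp_group by blast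
  have bij: "bij_betw (\<phi> l) ?E ?E" if "l \<in> L" for l
  proof (rule bij_betw_byWitness[where f' = "\<lambda>D. D #> l"])
    have l: "l \<in> carrier G" using that Lc by blast
    show "\<forall>a\<in>?E. \<phi> l a #> l = a" "\<forall>a\<in>?E. \<phi> l (a #> l) = a"
      "\<phi> l ` ?E \<subseteq> ?E" "(\<lambda>D. D #> l) ` ?E \<subseteq> ?E"
      using l L(1) by (auto simp: \<phi>_def rcosets_mult_assoc rcosets_mult_closed rcosets_mult_one)
  qed
  have hom: "\<phi> \<in> hom ?L (BijGroup ?E)"
  proof (rule homI)
    show "\<phi> x \<in> carrier (BijGroup ?E)" if "x \<in> carrier ?L" for x
      using bij[of x] that by (auto simp: BijGroup_def Bij_def \<phi>_def)
    fix x y assume xy: "x \<in> carrier ?L" "y \<in> carrier ?L"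
    have "\<phi> (x \<otimes> y) D = compose ?E (\<phi> x) (\<phi> y) D" for D
      using xy Lc L(1)
      by (cases "D \<in> ?E") (auto simp: \<phi>_def compose_def rcosets_mult_closed rcosets_mult_assoc subset_iff inv_mult_group)
    thus "\<phi> (x \<otimes>\<^bsub>?L\<^esub> y) = \<phi> x \<otimes>\<^bsub>BijGroup ?E\<^esub> \<phi> y"
      using bij xy by (auto simp: BijGroup_def Bij_def \<phi>_def fun_eq_iff)
  qed
  interpret A: group_action ?L ?E \<phi>
    using hom LG.group_axioms group_BijGroup[of ?E]
    by (simp add: group_action_def group_hom_def group_hom_axioms_def)
  have finE: "finite ?E" using fin L(1) Lc by (metis rcosets_subset_PowG finite_Pow_iff finite_subset)
  have lag: "card ?E * card L = p ^ n" using lagrange[OF L(1)] ord by simp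
  have "card ?E \<noteq> 1"
  proof
    assume "card ?E = 1"
    hence "card L = card (carrier G)" using lag ord by (simp add: order_def)
    thus False using L(2) Lc fin card_subset_eq by blast
  qed
  moreover obtain j where j: "card ?E = p ^ j" using lag divides_primepow_nat[OF p] by (metis dvd_triv_left)
  ultimately have dvdE: "p dvd card ?E" by (cases j) auto
  obtain i where i: "card L = p ^ i" using lag divides_primepow_nat[OF p] by (metis dvd_triv_right)
  let ?orb = "orbit ?L \<phi>"
  have orb_dvd: "card R = 1 \<or> p dvd card R" if R: "R \<in> orbits ?L ?E \<phi>" for R
  proof -
    obtain x where x: "x \<in> ?E" "R = ?orb x" using R by (auto simp: orbits_def)
    have "card R * card (stabilizer ?L \<phi> x) = order ?L"
      using A.orbit_stabilizer_theorem[OF x(1)] x(2) by simp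
    hence "card R * card (stabilizer ?L \<phi> x) = p ^ i" using i by (simp add: order_def)
    hence "card R dvd p ^ i" by (metis dvd_triv_left)
    then obtain t where "card R = p ^ t" using divides_primepow_nat[OF p] by blast
    thus ?thesis by (cases t) auto
  qed
  have LE: "L \<in> ?E" using L(1) self_in_rcosets by blast
  have orbL: "?orb L = {L}"
  proof -
    have "\<phi> l L = L" if "l \<in> L" for l
      using L(1) LE Lc that by (simp add: \<phi>_def coset_join2 subset_iff subgroup.m_inv_closed)
    moreover have "L \<in> ?orb L" using A.orbit_refl LE by auto
    ultimately show ?thesis by (auto simp: orbit_def)
  qed
  have "\<exists>R\<in>orbits ?L ?E \<phi>. R \<noteq> {L} \<and> card R = 1"
  proof (rule ccontr)
    assume "\<not> ?thesis"
    hence d: "\<forall>R\<in>orbits ?L ?E \<phi> - {{L}}. p dvd card R" using orb_dvd by blast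
    have finO: "finite (orbits ?L ?E \<phi>)" using finE by (simp add: orbits_def)
    have Lorb: "{L} \<in> orbits ?L ?E \<phi>"
      unfolding orbits_def using orbL[symmetric] LE by blast
    have "card ?E = (\<Sum>R\<in>orbits ?L ?E \<phi>. card R)"
      using A.disjoint_sum[OF finE, of "\<lambda>_. 1::nat"] by simp
    also have "\<dots> = card {L} + (\<Sum>R\<in>orbits ?L ?E \<phi> - {{L}}. card R)"
      by (rule sum.remove[OF finO Lorb])
    finally have "p dvd 1 + (\<Sum>R\<in>orbits ?L ?E \<phi> - {{L}}. card R)" using dvdE by simp
    moreover have "p dvd (\<Sum>R\<in>orbits ?L ?E \<phi> - {{L}}. card R)" using d by (intro dvd_sum) auto
    ultimately have "p dvd 1" using dvd_add_left_iff by blast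
    thus False using p by (metis not_prime_unit)
  qed
  then obtain R where R: "R \<in> orbits ?L ?E \<phi>" "R \<noteq> {L}" "card R = 1" by blast
  obtain x where x: "x \<in> ?E" "R = ?orb x" using R by (auto simp: orbits_def)
  have "x \<in> R" using x A.orbit_refl by auto
  hence Rx: "R = {x}" using R(3) by (auto simp: card_1_singleton_iff)
  obtain g where g: "g \<in> carrier G" "x = L #> g" using x(1) rcosets_obtain by metis
  show thesis
  proof (rule that[OF g(1)])
    show "g \<notin> L" using R(2) Rx g coset_join2[OF g(1) L(1)] by auto
    show "\<forall>l\<in>L. g \<otimes> l \<otimes> inv g \<in> L"
    proof
      fix l assume l: "l \<in> L"
      have "inv l \<in> L" by (rule subgroup.m_inv_closed[OF L(1) l])
      hence "inv l \<in> carrier ?L" by simp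
      hence "\<phi> (inv l) x \<in> R" unfolding x(2) orbit_def by blast
      hence "x #> l = x" using Rx x(1) l Lc by (auto simp: \<phi>_def subset_iff)
      hence "L #> (g \<otimes> l) = L #> g" using g l Lc by (auto simp: coset_mult_assoc subset_iff)
      thus "g \<otimes> l \<otimes> inv g \<in> L" using rcos_eq_iff[OF L(1)] g l Lc by (auto simp: subset_iff)
    qed
  qed
qed

lemma finite_subgroupI:
  assumes "finite (carrier G)" "M \<subseteq> carrier G" "\<one> \<in> M" "\<And>x y. x \<in> M \<Longrightarrow> y \<in> M \<Longrightarrow> x \<otimes> y \<in> M"
  shows "subgroup M G"
proof (rule subgroupI)
  show "inv x \<in> M" if x: "x \<in> M" for x
  proof -
    have xc: "x \<in> carrier G" using x assms(2) by blast
    have "x [^] (order G - 1) \<otimes> x = x [^] order G"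
      using assms(1) order_gt_0_iff_finite by (metis Suc_diff_1 nat_pow_Suc)
    hence "inv x = x [^] (order G - 1)"
      using xc pow_order_eq_1 by (simp add: inv_equality)
    moreover have "x [^] n \<in> M" for n :: nat using x assms by (induction n) auto
    ultimately show ?thesis by simp
  qed
qed (use assms in auto)

end

text \<open>Residues as values and extensionality make equality a matter of the carrier, so that
  these homomorphisms to the cyclic group of order \<open>p\<close> can be counted.\<close>

definition fp_homs :: "nat \<Rightarrow> ('a, 'b) monoid_scheme \<Rightarrow> ('a \<Rightarrow> int) set" where
  "fp_homs p G = {f \<in> carrier G \<rightarrow>\<^sub>E {0..<int p}.
     \<forall>x\<in>carrier G. \<forall>y\<in>carrier G. f (x \<otimes>\<^bsub>G\<^esub> y) = (f x + f y) mod int p}"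

lemma fp_homs_range: "f \<in> fp_homs p G \<Longrightarrow> x \<in> carrier G \<Longrightarrow> 0 \<le> f x \<and> f x < int p"
  by (auto simp: fp_homs_def PiE_iff)

lemma fp_homs_mult:
  "f \<in> fp_homs p G \<Longrightarrow> x \<in> carrier G \<Longrightarrow> y \<in> carrier G \<Longrightarrow> f (x \<otimes>\<^bsub>G\<^esub> y) = (f x + f y) mod int p"
  by (auto simp: fp_homs_def)

context group begin

text \<open>Enlarge \<open>L\<close> by an element \<open>h\<close> that normalizes it and has its
  \<open>p\<close>-th power in it. Either the larger subgroup is still proper and induction applies,
  or it is everything and the exponent of \<open>h\<close> modulo \<open>p\<close> is the
  homomorphism.\<close>

lemma finite_p_group_hom:
  assumes fin: "finite (carrier G)" and ord: "order G = p ^ n" and p: "prime p"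
    and L: "subgroup L G" "L \<noteq> carrier G"
  shows "\<exists>f\<in>fp_homs p G. (\<forall>x\<in>L. f x = 0) \<and> (\<exists>x\<in>carrier G. f x \<noteq> 0)"
  using L
proof (induction "card (carrier G) - card L" arbitrary: L rule: less_induct)
  case less
  note L = less.prems
  have Lc: "L \<subseteq> carrier G" using L(1) subgroup.subset by blast
  obtain g where g: "g \<in> carrier G" "g \<notin> L" "\<forall>l\<in>L. g \<otimes> l \<otimes> inv g \<in> L"
    using normalizer_grows[OF fin ord p L] by blast
  define j where "j = (LEAST j. g [^] (p ^ j) \<in> L)"
  have ex: "g [^] (p ^ n) \<in> L" using g ord pow_order_eq_1 subgroup.one_closed[OF L(1)] by metis
  have jL: "g [^] (p ^ j) \<in> L" unfolding j_def using ex by (rule LeastI)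
  have "j \<noteq> 0" using jL g by (metis nat_pow_eone power_0)
  then obtain i where i: "j = Suc i" using not0_implies_Suc by blast
  \<comment> \<open>By minimality of \<open>j\<close> this is the last of the iterated
    \<open>p\<close>-th powers of \<open>g\<close> outside \<open>L\<close>.\<close>
  define h where "h = g [^] (p ^ i)"
  have h: "h \<in> carrier G" "h \<notin> L" "h [^] p \<in> L"
    using g jL not_less_Least[of i "\<lambda>j. g [^] (p ^ j) \<in> L"]
    unfolding h_def j_def[symmetric] i by (auto simp: nat_pow_pow mult.commute)
  have conj_pow: "x [^] (m::nat) \<otimes> l \<otimes> inv (x [^] m) \<in> L"
    if x: "x \<in> carrier G" "\<forall>l\<in>L. x \<otimes> l \<otimes> inv x \<in> L" and l: "l \<in> L" for x m l
    using l
  proof (induction m arbitrary: l)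
    case 0 thus ?case using Lc by auto
  next
    case (Suc m)
    have "x [^] m \<otimes> (x \<otimes> l \<otimes> inv x) \<otimes> inv (x [^] m) \<in> L" using Suc x by blast
    thus ?case using x Suc.prems Lc by (simp add: m_assoc inv_mult_group subset_iff)
  qed
  have hconj: "\<forall>l\<in>L. h \<otimes> l \<otimes> inv h \<in> L" using conj_pow[OF g(1,3)] unfolding h_def by blast
  have hpowconj: "h [^] m \<otimes> l \<otimes> inv (h [^] m) \<in> L" if "l \<in> L" for m :: nat and l
    using conj_pow[OF h(1) hconj that] .
  have mult_eq: "(l \<otimes> h [^] a) \<otimes> (l' \<otimes> h [^] b) = (l \<otimes> (h [^] a \<otimes> l' \<otimes> inv (h [^] a))) \<otimes> h [^] (a + b)"
    if "l \<in> L" "l' \<in> L" for l l' and a b :: nat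
  proof -
    have c: "l \<in> carrier G" "l' \<in> carrier G" using that Lc by auto
    have "inv (h [^] a) \<otimes> h [^] (a + b) = h [^] b"
      using h by (simp add: nat_pow_mult[symmetric] m_assoc[symmetric])
    thus ?thesis using c h by (simp add: m_assoc)
  qed
  define M where "M = {l \<otimes> h [^] m | l m. l \<in> L \<and> m \<in> (UNIV :: nat set)}"
  have one: "\<one> \<in> L" using subgroup.one_closed[OF L(1)] .
  have LM: "L \<subseteq> M"
  proof
    fix l assume "l \<in> L"
    hence "l = l \<otimes> h [^] (0::nat)" using Lc by auto
    thus "l \<in> M" unfolding M_def using \<open>l \<in> L\<close> by blast
  qed
  have hM: "h \<in> M" unfolding M_def using one h(1) by (force intro: exI[of _ \<one>] exI[of _ "1::nat"])
  have M: "subgroup M G"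
  proof (rule finite_subgroupI[OF fin])
    show "M \<subseteq> carrier G" using Lc h by (auto simp: M_def)
    show "\<one> \<in> M" using one LM by blast
    fix x y assume "x \<in> M" "y \<in> M"
    then obtain l a l' b where e: "l \<in> L" "l' \<in> L" "x = l \<otimes> h [^] (a::nat)" "y = l' \<otimes> h [^] (b::nat)"
      unfolding M_def by blast
    have "l \<otimes> (h [^] a \<otimes> l' \<otimes> inv (h [^] a)) \<in> L"
      using e hpowconj subgroup.m_closed[OF L(1)] by blast
    thus "x \<otimes> y \<in> M" unfolding M_def using mult_eq e by blast
  qed
  show ?case
  proof (cases "M = carrier G")
    case False
    have "L \<subset> M" using LM hM h by blast
    moreover have "M \<subseteq> carrier G" using M subgroup.subset by blast
    ultimately have "card L < card M" "card M \<le> card (carrier G)"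
      using fin by (meson finite_subset psubset_card_mono, meson card_mono)
    hence "\<exists>f\<in>fp_homs p G. (\<forall>x\<in>M. f x = 0) \<and> (\<exists>x\<in>carrier G. f x \<noteq> 0)"
      by (intro less.hyps[OF _ M False]) auto
    thus ?thesis using LM by blast
  next
    case True
    \<comment> \<open>Otherwise Bezout's identity would write \<open>h\<close> as a product of
      powers of \<open>h [^] m\<close> and \<open>h [^] p\<close>, which lie in \<open>L\<close>.
      This makes the exponent of \<open>h\<close> well defined modulo \<open>p\<close>.\<close>
    have dvd: "p dvd m" if "h [^] (m::nat) \<in> L" for m
    proof (rule ccontr)
      assume nd: "\<not> p dvd m"
      hence "gcd m p = 1" using p by (metis coprime_commute coprime_imp_gcd_eq_1 prime_imp_coprime)
      moreover have "m \<noteq> 0" using nd by (cases m) auto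
      ultimately obtain x y where xy: "m * x = p * y + 1" using bezout_nat[of m p] by metis
      have "h [^] (m * x) \<in> L" "h [^] (p * y) \<in> L"
        using that h(1,3) pow_mem_subgroup[OF L(1)] by (metis nat_pow_pow)+
      moreover have "h = inv (h [^] (p * y)) \<otimes> h [^] (m * x)"
        using h unfolding xy by (simp add: nat_pow_mult[symmetric] m_assoc[symmetric])
      ultimately show False using h(2) L(1) by (metis subgroup.m_closed subgroup.m_inv_closed)
    qed
    have wd0: "[a = b] (mod p)"
      if eq: "l \<otimes> h [^] a = l' \<otimes> h [^] b" and ll: "l \<in> L" "l' \<in> L" and ab: "a \<le> b" for l l' and a b :: nat
    proof -
      have c: "l \<in> carrier G" "l' \<in> carrier G" using ll Lc by auto
      have "l \<otimes> h [^] a = l' \<otimes> h [^] (b - a) \<otimes> h [^] a"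
        using eq ab c h by (simp add: m_assoc nat_pow_mult)
      hence "l = l' \<otimes> h [^] (b - a)" using c h by (metis m_closed nat_pow_closed right_cancel)
      hence "h [^] (b - a) = inv l' \<otimes> l" using c h by (simp add: m_assoc[symmetric])
      hence "p dvd b - a" using dvd ll L(1) by (metis subgroup.m_closed subgroup.m_inv_closed)
      thus ?thesis using ab cong_sym by (metis cong_altdef_nat)
    qed
    have wd: "[a = b] (mod p)" if "l \<otimes> h [^] a = l' \<otimes> h [^] b" "l \<in> L" "l' \<in> L" for l l' and a b :: nat
      using wd0[of l a l' b] wd0[of l' b l a] that cong_sym by (metis linear)
    define e where "e x = (SOME m::nat. \<exists>l\<in>L. x = l \<otimes> h [^] m)" for x
    define f where "f = (\<lambda>x\<in>carrier G. int (e x) mod int p)"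
    have f_eq: "f (l \<otimes> h [^] m) = int m mod int p" if l: "l \<in> L" for l and m :: nat
    proof -
      let ?x = "l \<otimes> h [^] m"
      have "\<exists>l'\<in>L. ?x = l' \<otimes> h [^] e ?x" unfolding e_def using l by (rule_tac someI_ex) blast
      hence "[m = e ?x] (mod p)" using wd l by blast
      moreover have "?x \<in> carrier G" using l Lc h by auto
      ultimately show ?thesis unfolding f_def
        by (metis cong_def cong_int_iff restrict_apply')
    qed
    have p0: "p > 0" using p prime_gt_0_nat by blast
    have "f \<in> fp_homs p G"
      unfolding fp_homs_def
    proof (intro CollectI conjI ballI)
      show "f \<in> carrier G \<rightarrow>\<^sub>E {0..<int p}" using p0 by (auto simp: f_def)
      fix x y assume "x \<in> carrier G" "y \<in> carrier G"
      then obtain l a l' b where e: "l \<in> L" "l' \<in> L" "x = l \<otimes> h [^] (a::nat)" "y = l' \<otimes> h [^] (b::nat)"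
        unfolding M_def True[symmetric] by blast
      have "l \<otimes> (h [^] a \<otimes> l' \<otimes> inv (h [^] a)) \<in> L"
        using e hpowconj subgroup.m_closed[OF L(1)] by blast
      hence "f (x \<otimes> y) = int (a + b) mod int p" unfolding e mult_eq[OF e(1,2)] by (rule f_eq)
      thus "f (x \<otimes> y) = (f x + f y) mod int p" using e f_eq by (simp add: mod_simps)
    qed
    moreover have "f l = 0" if "l \<in> L" for l
      using f_eq[OF that, of 0] that Lc by auto
    moreover have "f h = 1"
      using f_eq[OF one, of 1] h prime_gt_1_nat[OF p] by simp
    ultimately show ?thesis using h(1) by (metis zero_neq_one)
  qed
qed

lemma rcosets_subgroup: "rcosets\<^bsub>G\<lparr>carrier := H\<rparr>\<^esub> K = (\<lambda>h. K #> h) ` H"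
  by (auto simp: RCOSETS_def r_coset_def)

text \<open>A bijection, and not an equation of cardinalities, since the multiplicativity of the
  index and the equivalence of finiteness are both read off from it, the latter without presupposing
  that an index is finite.\<close>

lemma index_bij:
  assumes H: "subgroup H G" and K: "subgroup K G" "K \<subseteq> H"
  shows "\<exists>f. bij_betw f ((rcosets\<^bsub>G\<lparr>carrier := H\<rparr>\<^esub> K) \<times> (rcosets H)) (rcosets K)"
proof -
  have Hc: "H \<subseteq> carrier G" and Kc: "K \<subseteq> carrier G" using H K subgroup.subset by blast+
  define r where "r C = (SOME g. g \<in> carrier G \<and> C = H #> g)" for C
  have r: "r C \<in> carrier G" "H #> r C = C" if "C \<in> rcosets H" for C
  proof -
    have "\<exists>g. g \<in> carrier G \<and> C = H #> g" using that rcosets_obtain by metis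
    hence "r C \<in> carrier G \<and> C = H #> r C" unfolding r_def by (rule someI_ex)
    thus "r C \<in> carrier G" "H #> r C = C" by auto
  qed
  have "bij_betw (\<lambda>(E, C). E #> r C) ((rcosets\<^bsub>G\<lparr>carrier := H\<rparr>\<^esub> K) \<times> (rcosets H)) (rcosets K)"
    unfolding bij_betw_def
  proof
    show "inj_on (\<lambda>(E, C). E #> r C) ((rcosets\<^bsub>G\<lparr>carrier := H\<rparr>\<^esub> K) \<times> (rcosets H))"
    proof (rule inj_onI, clarify)
      fix E C E' C'
      assume a: "E \<in> rcosets\<^bsub>G\<lparr>carrier := H\<rparr>\<^esub> K" "E' \<in> rcosets\<^bsub>G\<lparr>carrier := H\<rparr>\<^esub> K"
        and C: "C \<in> rcosets H" "C' \<in> rcosets H" and eq: "E #> r C = E' #> r C'"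
      obtain h h' where h: "h \<in> H" "h' \<in> H" "E = K #> h" "E' = K #> h'"
        using a unfolding rcosets_subgroup by auto
      have hc: "h \<in> carrier G" "h' \<in> carrier G" using h Hc by auto
      have "K #> (h \<otimes> r C) = K #> (h' \<otimes> r C')"
        using eq h hc r C Kc by (simp add: coset_mult_assoc)
      hence m: "(h \<otimes> r C) \<otimes> inv (h' \<otimes> r C') \<in> K"
        using rcos_eq_iff[OF K(1)] hc r C by auto
      hence "H #> (h \<otimes> r C) = H #> (h' \<otimes> r C')"
        using rcos_eq_iff[OF H] hc r C K(2) by auto
      hence "C = C'" using h hc r[OF C(1)] r[OF C(2)] Hc H
        by (metis coset_join2 coset_mult_assoc)
      moreover have "h \<otimes> inv h' \<in> K"
        using m hc r[OF C(2)] unfolding \<open>C = C'\<close> by (simp add: inv_mult_group m_assoc inv_solve_left r_inv[symmetric] del: r_inv) (simp add: m_assoc[symmetric])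
      hence "E = E'" using rcos_eq_iff[OF K(1)] hc h by auto
      ultimately show "E = E' \<and> C = C'" by blast
    qed
    show "(\<lambda>(E, C). E #> r C) ` ((rcosets\<^bsub>G\<lparr>carrier := H\<rparr>\<^esub> K) \<times> (rcosets H)) = rcosets K" (is "?l = ?r")
    proof
      show "?l \<subseteq> ?r" using Hc Kc r
        by (auto simp: rcosets_subgroup coset_mult_assoc subset_iff intro!: rcosetsI)
      show "?r \<subseteq> ?l"
      proof
        fix D assume "D \<in> rcosets K"
        then obtain g where g: "g \<in> carrier G" "D = K #> g" using rcosets_obtain by metis
        let ?C = "H #> g"
        have C: "?C \<in> rcosets H" using g Hc rcosetsI by blast
        have "g \<otimes> inv (r ?C) \<in> H" using iffD1[OF rcos_eq_iff[OF H g(1) r(1)[OF C]]] r(2)[OF C] by simp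
        moreover have "D = (K #> (g \<otimes> inv (r ?C))) #> r ?C"
          using g r[OF C] Kc by (simp add: coset_mult_assoc m_assoc)
        ultimately show "D \<in> ?l" using C unfolding rcosets_subgroup by force
      qed
    qed
  qed
  thus ?thesis by blast
qed

lemma index_mult:
  assumes "subgroup H G" "subgroup K G" "K \<subseteq> H"
  shows "card (rcosets K) = card (rcosets\<^bsub>G\<lparr>carrier := H\<rparr>\<^esub> K) * card (rcosets H)"
  using index_bij[OF assms] by (metis bij_betw_same_card card_cartesian_product)

lemma finite_index_iff:
  assumes "subgroup H G" "subgroup K G" "K \<subseteq> H"
  shows "finite (rcosets K) \<longleftrightarrow> finite (rcosets\<^bsub>G\<lparr>carrier := H\<rparr>\<^esub> K) \<and> finite (rcosets H)"
proof -
  interpret GH: group "G\<lparr>carrier := H\<rparr>" using assms(1) subgroup_imp_group by blast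
  have "rcosets\<^bsub>G\<lparr>carrier := H\<rparr>\<^esub> K \<noteq> {}" "rcosets H \<noteq> {}"
    using assms(1) self_in_rcosets subgroup.one_closed by (auto simp: rcosets_subgroup)
  thus ?thesis using index_bij[OF assms] by (metis bij_betw_finite finite_cartesian_product_iff)
qed

text \<open>The normal core of \<open>H\<close>, written as the kernel of the right action on
  cosets; normality and finite index are visible in this form.\<close>

definition coset_core :: "'a set \<Rightarrow> 'a set" where
  "coset_core H = {c \<in> carrier G. \<forall>D\<in>rcosets H. D #> c = D}"

lemma coset_core_subset:
  assumes "subgroup H G" shows "coset_core H \<subseteq> H"
  using assms self_in_rcosets[OF assms] coset_join1 unfolding coset_core_def by blast

lemma coset_core_normal:
  assumes H: "subgroup H G" shows "coset_core H \<lhd> G"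
  unfolding normal_inv_iff
proof
  have inv_fix: "D #> inv c = D" if "c \<in> coset_core H" "D \<in> rcosets H" for c D
  proof -
    have "D #> c = D" "c \<in> carrier G" using that by (auto simp: coset_core_def)
    thus ?thesis using rcosets_mult_assoc[OF H that(2), of c "inv c"] that rcosets_mult_one[OF H] by auto
  qed
  show "subgroup (coset_core H) G"
  proof (rule subgroupI)
    show "coset_core H \<noteq> {}" using rcosets_mult_one[OF H] by (auto simp: coset_core_def)
    show "inv a \<in> coset_core H" if "a \<in> coset_core H" for a
      using that inv_fix by (auto simp: coset_core_def)
    show "a \<otimes> b \<in> coset_core H" if "a \<in> coset_core H" "b \<in> coset_core H" for a b
      using that by (auto simp: coset_core_def rcosets_mult_assoc[OF H, symmetric])
  qed (auto simp: coset_core_def)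
  show "\<forall>x\<in>carrier G. \<forall>h\<in>coset_core H. x \<otimes> h \<otimes> inv x \<in> coset_core H"
  proof (intro ballI)
    fix x h assume x: "x \<in> carrier G" and h: "h \<in> coset_core H"
    have hc: "h \<in> carrier G" using h by (auto simp: coset_core_def)
    have "D #> (x \<otimes> h \<otimes> inv x) = D" if D: "D \<in> rcosets H" for D
    proof -
      have Dx: "D #> x \<in> rcosets H" using rcosets_mult_closed[OF H D x] .
      have "D #> (x \<otimes> h \<otimes> inv x) = ((D #> x) #> h) #> inv x"
        using x hc D Dx by (simp add: rcosets_mult_assoc[OF H])
      also have "(D #> x) #> h = D #> x" using h Dx by (auto simp: coset_core_def)
      finally show ?thesis using x D by (simp add: rcosets_mult_assoc[OF H] rcosets_mult_one[OF H])
    qed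
    thus "x \<otimes> h \<otimes> inv x \<in> coset_core H" using x hc by (auto simp: coset_core_def)
  qed
qed

text \<open>Elements that permute the cosets of \<open>H\<close> in the same way lie in one coset of
  the core, so the cosets of the core embed into the self-maps of a finite set.\<close>

lemma coset_core_finite_index:
  assumes H: "subgroup H G" and fin: "finite (rcosets H)"
  shows "finite (rcosets (coset_core H))"
proof -
  let ?C = "coset_core H"
  have C: "subgroup ?C G" using coset_core_normal[OF H] normal_imp_subgroup by blast
  define F where "F X = (\<lambda>D\<in>rcosets H. D #> (SOME g. g \<in> carrier G \<and> X = ?C #> g))" for X
  have r: "(SOME g. g \<in> carrier G \<and> X = ?C #> g) \<in> carrier G \<and> X = ?C #> (SOME g. g \<in> carrier G \<and> X = ?C #> g)"
    if "X \<in> rcosets ?C" for X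
  proof -
    have "\<exists>g. g \<in> carrier G \<and> X = ?C #> g" using that rcosets_obtain by metis
    thus ?thesis by (rule someI_ex)
  qed
  have "F ` (rcosets ?C) \<subseteq> (rcosets H) \<rightarrow>\<^sub>E (rcosets H)"
    using r rcosets_mult_closed[OF H] by (auto simp: F_def)
  moreover have "finite ((rcosets H) \<rightarrow>\<^sub>E (rcosets H))" using fin by (intro finite_PiE) auto
  moreover have "inj_on F (rcosets ?C)"
  proof (rule inj_onI)
    fix X Y assume X: "X \<in> rcosets ?C" and Y: "Y \<in> rcosets ?C" and eq: "F X = F Y"
    obtain g h where g: "g \<in> carrier G" "X = ?C #> g" "F X = (\<lambda>D\<in>rcosets H. D #> g)"
      and h: "h \<in> carrier G" "Y = ?C #> h" "F Y = (\<lambda>D\<in>rcosets H. D #> h)"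
      using r[OF X] r[OF Y] unfolding F_def by blast
    have "D #> (g \<otimes> inv h) = D" if D: "D \<in> rcosets H" for D
    proof -
      have "D #> g = D #> h" using eq g h D by (metis restrict_apply')
      hence "(D #> g) #> inv h = (D #> h) #> inv h" by simp
      thus ?thesis using g h D by (simp add: rcosets_mult_assoc[OF H] rcosets_mult_one[OF H])
    qed
    hence "g \<otimes> inv h \<in> ?C" using g h by (auto simp: coset_core_def)
    thus "X = Y" using rcos_eq_iff[OF C g(1) h(1)] g h by auto
  qed
  ultimately show ?thesis by (meson finite_subset finite_imageD)
qed

text \<open>A conjugate of an \<open>n\<close>-th power is the \<open>n\<close>-th power of a
  conjugate, so a power condition on \<open>H\<close> holds for all conjugates of \<open>H\<close>
  at once.\<close>

lemma pow_mem_coset_core: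
  assumes H: "subgroup H G" and pw: "\<forall>g\<in>carrier G. g [^] (n::nat) \<in> H" and g: "g \<in> carrier G"
  shows "g [^] n \<in> coset_core H"
proof -
  have conj: "(x \<otimes> g \<otimes> inv x) [^] m = x \<otimes> g [^] m \<otimes> inv x" if x: "x \<in> carrier G" for x and m :: nat
  proof (induction m)
    case 0 thus ?case using x by simp
  next
    case (Suc m)
    have "x \<otimes> g [^] m \<otimes> inv x \<otimes> (x \<otimes> g \<otimes> inv x) = x \<otimes> g [^] m \<otimes> (inv x \<otimes> x) \<otimes> g \<otimes> inv x"
      using x g by (simp only: m_assoc m_closed inv_closed nat_pow_closed)
    thus ?case using Suc x g by (simp add: m_assoc)
  qed
  have "D #> g [^] n = D" if D: "D \<in> rcosets H" for D
  proof -
    obtain x where x: "x \<in> carrier G" "D = H #> x" using D rcosets_obtain by metis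
    have "x \<otimes> g [^] n \<otimes> inv x \<in> H" using conj[OF x(1), of n] pw x g by (metis m_closed inv_closed)
    hence "H #> (x \<otimes> g [^] n) = H #> x" using rcos_eq_iff[OF H] x g by auto
    thus ?thesis using x g subgroup.subset[OF H] by (simp add: coset_mult_assoc)
  qed
  thus ?thesis using g by (auto simp: coset_core_def)
qed

end

text \<open>This says that the quotient by the normal core is a finite \<open>p\<close>-group, and
  for prime \<open>p\<close> it is equivalent to being subnormal of \<open>p\<close>-power index.
  Bounding an exponent, instead of naming a chain, makes it obvious that the property is transitive
  and passes to the subgroups in between.\<close>

definition p_open :: "nat \<Rightarrow> ('a, 'b) monoid_scheme \<Rightarrow> 'a set \<Rightarrow> bool" where
  "p_open p G H \<longleftrightarrow> subgroup H G \<and> finite (rcosets\<^bsub>G\<^esub> H) \<and>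
     (\<exists>k. \<forall>g\<in>carrier G. g [^]\<^bsub>G\<^esub> (p ^ k) \<in> H)"

context group begin

lemma p_open_trans:
  assumes H: "p_open p G H" and K: "p_open p (G\<lparr>carrier := H\<rparr>) K"
  shows "p_open p G K"
proof -
  have Hs: "subgroup H G" using H by (simp add: p_open_def)
  have Ks: "subgroup K (G\<lparr>carrier := H\<rparr>)" "K \<subseteq> H"
    using K subgroup.subset by (force simp: p_open_def)+
  have KG: "subgroup K G" using Ks(1) Hs incl_subgroup by blast
  obtain a b where a: "\<forall>g\<in>carrier G. g [^] (p ^ a) \<in> H" and b: "\<forall>g\<in>H. g [^] (p ^ b) \<in> K"
    using H K by (auto simp: p_open_def nat_pow_def)
  have "\<forall>g\<in>carrier G. g [^] (p ^ (a + b)) \<in> K"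
    using a b by (metis nat_pow_pow power_add)
  thus ?thesis using KG finite_index_iff[OF Hs KG Ks(2)] H K unfolding p_open_def by blast
qed

lemma p_open_between:
  assumes K: "p_open p G K" and H: "subgroup H G" "K \<subseteq> H"
  shows "p_open p G H" "p_open p (G\<lparr>carrier := H\<rparr>) K"
proof -
  have Ks: "subgroup K G" and pw: "\<exists>k. \<forall>g\<in>carrier G. g [^] (p ^ k) \<in> K" using K by (auto simp: p_open_def)
  have fin: "finite (rcosets\<^bsub>G\<lparr>carrier := H\<rparr>\<^esub> K)" "finite (rcosets H)"
    using finite_index_iff[OF H(1) Ks H(2)] K by (auto simp: p_open_def)
  show "p_open p G H" using H fin pw unfolding p_open_def by blast
  show "p_open p (G\<lparr>carrier := H\<rparr>) K"
    using pw fin subgroup_incl[OF Ks H] subgroup.mem_carrier[OF H(1)]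
    by (fastforce simp: p_open_def nat_pow_def)
qed

lemma coset_core_quotient:
  assumes H: "p_open p G H" and p: "prime p"
  shows "finite (carrier (G Mod coset_core H))" "\<exists>n. order (G Mod coset_core H) = p ^ n"
proof -
  have Hs: "subgroup H G" using H by (simp add: p_open_def)
  interpret N: normal "coset_core H" G using coset_core_normal[OF Hs] .
  interpret Q: group "G Mod coset_core H" by (rule N.factorgroup_is_group)
  show fin: "finite (carrier (G Mod coset_core H))"
    using coset_core_finite_index[OF Hs] H by (simp add: FactGroup_def p_open_def)
  obtain k where k: "\<forall>g\<in>carrier G. g [^] (p ^ k) \<in> H" using H by (auto simp: p_open_def)
  have "x [^]\<^bsub>G Mod coset_core H\<^esub> (p ^ k) = \<one>\<^bsub>G Mod coset_core H\<^esub>" if "x \<in> carrier (G Mod coset_core H)" for x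
  proof -
    have "x \<in> rcosets (coset_core H)" using that by (simp add: FactGroup_def)
    then obtain g where g: "g \<in> carrier G" "x = coset_core H #> g" by (rule rcosets_obtain)
    have "x [^]\<^bsub>G Mod coset_core H\<^esub> (p ^ k) = coset_core H #> (g [^] (p ^ k))"
      using N.FactGroup_pow g by simp
    also have "\<dots> = coset_core H"
      using pow_mem_coset_core[OF Hs k g(1)] N.subgroup_axioms g by (simp add: coset_join2)
    finally show ?thesis by (simp add: FactGroup_def)
  qed
  thus "\<exists>n. order (G Mod coset_core H) = p ^ n"
    using Q.order_prime_power_if_exponent[OF fin p] by blast
qed

lemma p_open_index:
  assumes H: "p_open p G H" and p: "prime p"
  shows "\<exists>n. card (rcosets H) = p ^ n"
proof -
  have Hs: "subgroup H G" using H by (simp add: p_open_def)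
  have C: "subgroup (coset_core H) G" using coset_core_normal[OF Hs] normal_imp_subgroup by blast
  obtain n where "card (rcosets (coset_core H)) = p ^ n"
    using coset_core_quotient[OF H p] by (auto simp: FactGroup_def order_def)
  hence "card (rcosets H) dvd p ^ n"
    using index_mult[OF Hs C coset_core_subset[OF Hs]] by (metis dvd_triv_right)
  thus ?thesis using divides_primepow_nat[OF p] by blast
qed

text \<open>Pull back along the quotient by the core: it is a finite \<open>p\<close>-group, and the
  image of \<open>L\<close> stays proper because \<open>L\<close> contains the core.\<close>

lemma p_open_hom:
  assumes L: "p_open p G L" "L \<noteq> carrier G" and p: "prime p"
  shows "\<exists>f\<in>fp_homs p G. (\<forall>x\<in>L. f x = 0) \<and> (\<exists>x\<in>carrier G. f x \<noteq> 0)"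
proof -
  have Ls: "subgroup L G" using L by (simp add: p_open_def)
  let ?C = "coset_core L" and ?Q = "G Mod coset_core L"
  interpret N: normal "?C" G using coset_core_normal[OF Ls] .
  interpret Q: group ?Q by (rule N.factorgroup_is_group)
  let ?q = "\<lambda>x. ?C #> x"
  have Lc: "L \<subseteq> carrier G" using Ls subgroup.subset by blast
  have q: "?q \<in> hom G ?Q" by (rule N.r_coset_hom_Mod)
  interpret q: group_hom G ?Q ?q by (unfold_locales) (rule q)
  have qL: "subgroup (?q ` L) ?Q" using q.subgroup_img_is_subgroup[OF Ls] .
  have "?q ` L \<noteq> carrier ?Q"
  proof
    assume eq: "?q ` L = carrier ?Q"
    have "x \<in> L" if x: "x \<in> carrier G" for x
    proof -
      have "?q x \<in> ?q ` L" using eq x q.hom_closed by blast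
      then obtain l where l: "l \<in> L" "?q x = ?q l" by blast
      hence "x \<otimes> inv l \<in> L"
        using rcos_eq_iff[OF N.subgroup_axioms, of x l] x Lc coset_core_subset[OF Ls] by auto
      moreover have "x = (x \<otimes> inv l) \<otimes> l" using l x Lc by (simp add: m_assoc subset_iff)
      ultimately show ?thesis using subgroup.m_closed[OF Ls _ l(1)] by metis
    qed
    thus False using L(2) Lc by blast
  qed
  then obtain f where f: "f \<in> fp_homs p ?Q" "\<forall>x\<in>?q ` L. f x = 0" "\<exists>x\<in>carrier ?Q. f x \<noteq> 0"
    using Q.finite_p_group_hom[OF _ _ p qL] coset_core_quotient[OF L(1) p] by blast
  define g where "g = (\<lambda>x\<in>carrier G. f (?q x))"
  have "g \<in> fp_homs p G"
    using fp_homs_range[OF f(1)] fp_homs_mult[OF f(1)] q.hom_closed q.hom_mult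
    by (auto simp: fp_homs_def g_def)
  moreover have "\<forall>x\<in>L. g x = 0" using f(2) Lc by (auto simp: g_def)
  moreover have "\<exists>x\<in>carrier G. g x \<noteq> 0"
  proof -
    obtain X where X: "X \<in> rcosets ?C" "f X \<noteq> 0" using f(3) by (auto simp: FactGroup_def)
    obtain x where "x \<in> carrier G" "X = ?C #> x" using X(1) by (rule rcosets_obtain)
    thus ?thesis using X(2) by (auto simp: g_def)
  qed
  ultimately show ?thesis by blast
qed

lemma fp_homs_one:
  assumes "f \<in> fp_homs p G" shows "f \<one> = 0"
proof -
  have "f \<one> = (f \<one> + f \<one>) mod int p" using fp_homs_mult[OF assms, of \<one> \<one>] by simp
  moreover have "0 \<le> f \<one>" "f \<one> < int p" using fp_homs_range[OF assms, of \<one>] by auto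
  ultimately show ?thesis
    by (smt (verit) mod_pos_pos_trivial mod_add_self2 minus_mod_self2)
qed

lemma fp_homs_inv:
  assumes "f \<in> fp_homs p G" "x \<in> carrier G" shows "[f (inv x) = - f x] (mod int p)"
proof -
  have "(f x + f (inv x)) mod int p = 0"
    using fp_homs_mult[OF assms(1,2), of "inv x"] fp_homs_one[OF assms(1)] assms(2) by simp
  thus ?thesis by (metis cong_0_iff add.commute cong_iff_dvd_diff diff_minus_eq_add mod_eq_0_iff_dvd)
qed

lemma fp_homs_pow:
  assumes "f \<in> fp_homs p G" "x \<in> carrier G" shows "f (x [^] (n::nat)) = (int n * f x) mod int p"
proof (induction n)
  case (Suc n)
  thus ?case using fp_homs_mult[OF assms(1), of "x [^] n" x] assms(2)
    by (simp add: mod_simps algebra_simps)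
qed (use fp_homs_one[OF assms(1)] in simp)

lemma fp_hom_kernel:
  assumes f: "f \<in> fp_homs p G" and p: "prime p"
  defines "N \<equiv> {x \<in> carrier G. f x = 0}"
  shows "N \<lhd> G" "p_open p G N" "(\<exists>x\<in>carrier G. f x \<noteq> 0) \<Longrightarrow> card (rcosets N) = p"
proof -
  have inv0: "f (inv x) = 0" if "x \<in> N" for x
    using fp_homs_inv[OF f, of x] fp_homs_range[OF f, of "inv x"] that
    by (auto simp: N_def cong_def)
  have N: "subgroup N G"
    by (rule subgroupI) (use fp_homs_one[OF f] fp_homs_mult[OF f] inv0 in \<open>auto simp: N_def\<close>)
  show "N \<lhd> G"
    unfolding normal_inv_iff
  proof (intro conjI ballI)
    fix x h assume x: "x \<in> carrier G" and h: "h \<in> N"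
    have hc: "h \<in> carrier G" "f h = 0" using h by (auto simp: N_def)
    have "f (x \<otimes> h \<otimes> inv x) = (f x + f (inv x)) mod int p"
      using fp_homs_mult[OF f] x hc by (simp add: mod_simps)
    also have "\<dots> = 0" using fp_homs_mult[OF f x, of "inv x"] fp_homs_one[OF f] x by simp
    finally show "x \<otimes> h \<otimes> inv x \<in> N" using x hc by (simp add: N_def)
  qed (rule N)
  have eq_iff: "N #> x = N #> y \<longleftrightarrow> f x = f y" if "x \<in> carrier G" "y \<in> carrier G" for x y
  proof -
    have "x \<otimes> inv y \<in> N \<longleftrightarrow> [f x + f (inv y) = 0] (mod int p)"
      using that fp_homs_mult[OF f, of x "inv y"] by (simp add: N_def cong_def)
    also have "\<dots> \<longleftrightarrow> [f x - f y = 0] (mod int p)"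
    proof -
      have "[f x + f (inv y) = f x + (- f y)] (mod int p)"
        using fp_homs_inv[OF f that(2)] cong_add cong_refl by blast
      thus ?thesis by (metis cong_sym cong_trans diff_conv_add_uminus)
    qed
    also have "\<dots> \<longleftrightarrow> [f x = f y] (mod int p)" by (simp add: cong_diff_iff_cong_0)
    also have "\<dots> \<longleftrightarrow> f x = f y"
      using fp_homs_range[OF f] that by (auto simp: cong_def)
    finally show ?thesis using rcos_eq_iff[OF N that] by simp
  qed
  define F where "F X = f (SOME x. x \<in> carrier G \<and> X = N #> x)" for X
  have F: "F (N #> x) = f x" if x: "x \<in> carrier G" for x
  proof -
    let ?y = "SOME y. y \<in> carrier G \<and> N #> x = N #> y"
    have "?y \<in> carrier G \<and> N #> x = N #> ?y" by (rule someI[where x = x]) (use x in simp)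
    thus ?thesis using eq_iff[OF x, of ?y] unfolding F_def by simp
  qed
  have inj: "inj_on F (rcosets N)"
  proof (rule inj_onI)
    fix X Y assume XY: "X \<in> rcosets N" "Y \<in> rcosets N" "F X = F Y"
    obtain x where x: "x \<in> carrier G" "X = N #> x" using XY(1) by (rule rcosets_obtain)
    obtain y where y: "y \<in> carrier G" "Y = N #> y" using XY(2) by (rule rcosets_obtain)
    show "X = Y" using XY(3) eq_iff[OF x(1) y(1)] F[OF x(1)] F[OF y(1)] x(2) y(2) by simp
  qed
  have "rcosets N = (\<lambda>x. N #> x) ` carrier G" by (auto simp: RCOSETS_def)
  hence im: "F ` (rcosets N) = f ` carrier G" using F by (simp add: image_image)
  have sub: "f ` carrier G \<subseteq> {0..<int p}" using fp_homs_range[OF f] by auto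
  have fin: "finite (rcosets N)" using inj im sub by (metis finite_imageD finite_subset finite_atLeastLessThan_int)
  have "x [^] (p ^ 1) \<in> N" if "x \<in> carrier G" for x
    using fp_homs_pow[OF f that, of p] that by (simp add: N_def)
  thus "p_open p G N" unfolding p_open_def using N fin by blast
  show "card (rcosets N) = p" if ex: "\<exists>x\<in>carrier G. f x \<noteq> 0"
  proof -
    obtain x where x: "x \<in> carrier G" "f x \<noteq> 0" using ex by blast
    have cop: "coprime (f x) (int p)"
      using x fp_homs_range[OF f x(1)] p
      by (metis coprime_commute prime_imp_coprime prime_nat_int_transfer zdvd_not_zless order_le_less)
    have "{0..<int p} \<subseteq> f ` carrier G"
    proof
      fix c assume c: "c \<in> {0..<int p}"
      obtain y where y: "[f x * y = c] (mod int p)" using cong_solve_coprime_int[OF cop]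
        by (metis cong_scalar_right mult.assoc mult.left_neutral)
      define n where "n = nat (y mod int p)"
      have "int n = y mod int p" using p prime_gt_0_nat by (simp add: n_def)
      hence "f (x [^] n) = (f x * y) mod int p"
        using fp_homs_pow[OF f x(1)] by (simp add: mod_simps mult.commute)
      also have "\<dots> = c" using y c by (simp add: cong_def)
      finally show "c \<in> f ` carrier G" using x by (metis imageI nat_pow_closed)
    qed
    hence "f ` carrier G = {0..<int p}" using sub by blast
    thus ?thesis using card_image[OF inj] im by simp
  qed
qed

lemma p_open_normal_prime_index:
  assumes L: "p_open p G L" "L \<noteq> carrier G" and p: "prime p"
  obtains N where "N \<lhd> G" "L \<subseteq> N" "p_open p G N" "card (rcosets N) = p"
proof -
  obtain f where f: "f \<in> fp_homs p G" "\<forall>x\<in>L. f x = 0" "\<exists>x\<in>carrier G. f x \<noteq> 0"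
    using p_open_hom[OF assms] by blast
  let ?N = "{x \<in> carrier G. f x = 0}"
  show thesis
  proof (rule that[of ?N])
    have "L \<subseteq> carrier G" using L(1) subgroup.subset by (auto simp: p_open_def)
    thus "L \<subseteq> ?N" using f(2) by auto
  qed (use fp_hom_kernel[OF f(1) p] f(3) in blast)+
qed

end

text \<open>Insert a normal subgroup \<open>N\<close> of index \<open>p\<close> above
  \<open>H\<close> and induct on the index, which drops by the factor \<open>p\<close>.\<close>

lemma p_open_imp_subnormal:
  assumes "group G" "p_open p G H" "prime p"
  shows "subnormal H G"
  using assms(1,2)
proof (induction "card (rcosets\<^bsub>G\<^esub> H)" arbitrary: G rule: less_induct)
  case less
  interpret group G by fact
  have H: "subgroup H G" "finite (rcosets\<^bsub>G\<^esub> H)" using less.prems by (auto simp: p_open_def)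
  show ?case
  proof (cases "H = carrier G")
    case True
    show ?thesis unfolding subnormal_def
      by (rule exI[of _ 0], rule exI[of _ "\<lambda>_. H"]) (use True in auto)
  next
    case False
    obtain N where N: "N \<lhd> G" "H \<subseteq> N" "p_open p G N" "card (rcosets\<^bsub>G\<^esub> N) = p"
      using p_open_normal_prime_index[OF less.prems(2) False assms(3)] .
    have Ns: "subgroup N G" using N(3) by (simp add: p_open_def)
    let ?N = "G\<lparr>carrier := N\<rparr>"
    have HN: "p_open p ?N H" using p_open_between(2)[OF less.prems(2) Ns N(2)] .
    have grpN: "group ?N" using Ns subgroup_imp_group by blast
    have "H \<in> rcosets\<^bsub>G\<^esub> H" using H self_in_rcosets by blast
    hence "card (rcosets\<^bsub>G\<^esub> H) > 0" using H(2) card_gt_0_iff by blast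
    moreover have "card (rcosets\<^bsub>G\<^esub> H) = card (rcosets\<^bsub>?N\<^esub> H) * p"
      using index_mult[OF Ns H(1) N(2)] N(4) by simp
    ultimately have "card (rcosets\<^bsub>?N\<^esub> H) < card (rcosets\<^bsub>G\<^esub> H)"
      using prime_gt_1_nat[OF assms(3)] by (metis One_nat_def n_less_n_mult_m nat_0_less_mult_iff)
    then have "subnormal H ?N" using less.hyps grpN HN by blast
    then obtain k C where C: "C 0 = N" "C k = H" "\<forall>i<k. C (Suc i) \<lhd> G\<lparr>carrier := C i\<rparr>"
      unfolding subnormal_def by auto
    show ?thesis unfolding subnormal_def
    proof (intro exI conjI allI impI)
      let ?D = "\<lambda>i. case i of 0 \<Rightarrow> carrier G | Suc j \<Rightarrow> C j"
      show "?D 0 = carrier G" "?D (Suc k) = H" using C by auto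
      fix i assume "i < Suc k"
      thus "?D (Suc i) \<lhd> G\<lparr>carrier := ?D i\<rparr>" using C N(1) by (cases i) auto
    qed
  qed
qed

text \<open>Each factor of the chain has order dividing \<open>p ^ m\<close>, and raising an element
  to that order moves it one step down the chain.\<close>

lemma subnormal_imp_p_open:
  fixes G (structure)
  assumes G: "group G" and sn: "subnormal H G" and ix: "subgroup_index G H = p ^ m" and p: "prime p"
  shows "p_open p G H"
proof -
  interpret group G by fact
  obtain k C where C: "C 0 = carrier G" "C k = H" "\<forall>i<k. C (Suc i) \<lhd> G\<lparr>carrier := C i\<rparr>"
    using sn unfolding subnormal_def by auto
  have sub: "subgroup (C i) G" if "i \<le> k" for i
    using that
  proof (induction i)
    case 0 thus ?case using C(1) subgroup_self by simp
  next
    case (Suc i)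
    thus ?case using C(3) incl_subgroup normal_imp_subgroup by (metis Suc_le_lessD le_less)
  qed
  have step: "C (Suc i) \<subseteq> C i" if "i < k" for i
    using C(3) that normal_imp_subgroup subgroup.subset by fastforce
  have HC: "H \<subseteq> C (k - i)" if "i \<le> k" for i
    using that
  proof (induction i)
    case (Suc i)
    hence "C (k - i) \<subseteq> C (k - Suc i)" using step[of "k - Suc i"] by (simp add: Suc_diff_Suc)
    thus ?case using Suc by auto
  qed (use C in simp)
  have HC: "H \<subseteq> C i" if "i \<le> k" for i using HC[of "k - i"] that by simp
  have Hs: "subgroup H G" using sub[of k] C by simp
  \<comment> \<open>\<open>card\<close> of an infinite set is 0, so a positive index already
    contains the finiteness.\<close>
  have p0: "p ^ m > 0" using p prime_gt_0_nat by simp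
  hence finH: "finite (rcosets H)" using ix unfolding subgroup_index_def by (metis card.infinite less_irrefl)
  have "\<exists>a. \<forall>g\<in>carrier G. g [^] (p ^ a) \<in> C i" if "i \<le> k" for i
    using that
  proof (induction i)
    case 0 thus ?case using C(1) by auto
  next
    case (Suc i)
    then obtain a where a: "\<forall>g\<in>carrier G. g [^] (p ^ a) \<in> C i" by auto
    let ?Gi = "G\<lparr>carrier := C i\<rparr>"
    have i: "i < k" "i \<le> k" "Suc i \<le> k" using Suc by auto
    have fin: "finite (rcosets (C (Suc i)))"
      using finite_index_iff[OF sub[OF i(3)] Hs HC[OF i(3)]] finH by blast
    have fini: "finite (rcosets\<^bsub>?Gi\<^esub> (C (Suc i)))"
      using finite_index_iff[OF sub[OF i(2)] sub[OF i(3)] step[OF i(1)]] fin by blast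
    have "card (rcosets (C (Suc i))) dvd p ^ m"
      using index_mult[OF sub[OF i(3)] Hs HC[OF i(3)]] ix unfolding subgroup_index_def by (metis dvd_triv_right)
    moreover have "card (rcosets\<^bsub>?Gi\<^esub> (C (Suc i))) dvd card (rcosets (C (Suc i)))"
      using index_mult[OF sub[OF i(2)] sub[OF i(3)] step[OF i(1)]] by simp
    ultimately obtain b where b: "card (rcosets\<^bsub>?Gi\<^esub> (C (Suc i))) = p ^ b"
      using divides_primepow_nat[OF p] dvd_trans by metis
    interpret N: normal "C (Suc i)" ?Gi using C(3) i by blast
    interpret Q: group "?Gi Mod C (Suc i)" by (rule N.factorgroup_is_group)
    have ordQ: "order (?Gi Mod C (Suc i)) = p ^ b" using b by (simp add: order_def FactGroup_def)
    have "g [^] (p ^ (a + b)) \<in> C (Suc i)" if g: "g \<in> carrier G" for g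
    proof -
      let ?x = "g [^] (p ^ a)"
      have x: "?x \<in> C i" using a g by blast
      have "(C (Suc i) #>\<^bsub>?Gi\<^esub> ?x) [^]\<^bsub>?Gi Mod C (Suc i)\<^esub> (p ^ b) = \<one>\<^bsub>?Gi Mod C (Suc i)\<^esub>"
        using Q.pow_order_eq_1[of "C (Suc i) #>\<^bsub>?Gi\<^esub> ?x"] x ordQ
        by (auto simp: FactGroup_def RCOSETS_def)
      hence "C (Suc i) #>\<^bsub>?Gi\<^esub> (?x [^]\<^bsub>?Gi\<^esub> (p ^ b)) = C (Suc i)"
        using N.FactGroup_pow[of ?x "p ^ b"] x by (simp add: FactGroup_def)
      hence "C (Suc i) #> (?x [^] (p ^ b)) = C (Suc i)" by (simp add: r_coset_def nat_pow_def)
      hence "?x [^] (p ^ b) \<in> C (Suc i)" using coset_join1[OF _ _ sub[OF i(3)]] g by simp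
      thus ?thesis using g by (simp add: nat_pow_pow power_add)
    qed
    thus ?case by blast
  qed
  thus ?thesis unfolding p_open_def using Hs finH C(2) by blast
qed

section \<open>Homomorphisms to a cyclic group and first homology\<close>

definition (in vectorspace) dual :: "('c \<Rightarrow> 'a) set" where
  "dual = {\<phi> \<in> carrier V \<rightarrow>\<^sub>E carrier K.
     (\<forall>v\<in>carrier V. \<forall>w\<in>carrier V. \<phi> (v \<oplus>\<^bsub>V\<^esub> w) = \<phi> v \<oplus>\<^bsub>K\<^esub> \<phi> w) \<and>
     (\<forall>a\<in>carrier K. \<forall>v\<in>carrier V. \<phi> (a \<odot>\<^bsub>V\<^esub> v) = a \<otimes>\<^bsub>K\<^esub> \<phi> v)}"

lemma (in vectorspace) dual_zero:
  assumes "\<phi> \<in> dual" shows "\<phi> \<zero>\<^bsub>V\<^esub> = \<zero>\<^bsub>K\<^esub>"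
proof -
  have "\<phi> (\<zero>\<^bsub>K\<^esub> \<odot>\<^bsub>V\<^esub> \<zero>\<^bsub>V\<^esub>) = \<zero>\<^bsub>K\<^esub> \<otimes>\<^bsub>K\<^esub> \<phi> \<zero>\<^bsub>V\<^esub>"
    using assms M.zero_closed R.zero_closed unfolding dual_def by blast
  moreover have "\<phi> \<zero>\<^bsub>V\<^esub> \<in> carrier K" using assms by (auto simp: dual_def)
  ultimately show ?thesis by simp
qed

lemma (in vectorspace) dual_eqI:
  assumes "\<phi> \<in> dual" "\<psi> \<in> dual" "S \<subseteq> carrier V" "span S = carrier V" "\<And>v. v \<in> S \<Longrightarrow> \<phi> v = \<psi> v"
  shows "\<phi> = \<psi>"
proof -
  let ?E = "{v\<in>carrier V. \<phi> v = \<psi> v}"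
  have h: "\<chi> (v \<oplus>\<^bsub>V\<^esub> w) = \<chi> v \<oplus>\<^bsub>K\<^esub> \<chi> w" "\<chi> (a \<odot>\<^bsub>V\<^esub> v) = a \<otimes>\<^bsub>K\<^esub> \<chi> v"
    if "\<chi> \<in> dual" "v \<in> carrier V" "w \<in> carrier V" "a \<in> carrier K" for \<chi> v w a
    using that unfolding dual_def by blast+
  have mod: "Module.module K V" by unfold_locales
  have z: "\<phi> \<zero>\<^bsub>V\<^esub> = \<psi> \<zero>\<^bsub>V\<^esub>" using dual_zero assms(1,2) by metis
  have "submodule K ?E V"
    unfolding submodule_def
  proof (intro conjI allI impI)
    show "\<zero>\<^bsub>V\<^esub> \<in> ?E" using z M.zero_closed by blast
    fix v w assume "v \<in> ?E" "w \<in> ?E"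
    thus "v \<oplus>\<^bsub>V\<^esub> w \<in> ?E"
      using h(1)[OF assms(1) _ _ R.zero_closed] h(1)[OF assms(2) _ _ R.zero_closed] M.a_closed by auto
  next
    fix c v assume "c \<in> carrier K" "v \<in> ?E"
    thus "c \<odot>\<^bsub>V\<^esub> v \<in> ?E"
      using h(2)[OF assms(1) _ M.zero_closed] h(2)[OF assms(2) _ M.zero_closed] smult_closed by auto
  qed (use mod in auto)
  hence "span S \<subseteq> ?E" using assms(3,5) by (intro span_is_subset) auto
  hence "\<phi> v = \<psi> v" if "v \<in> carrier V" for v using that assms(4) by blast
  thus ?thesis using assms(1,2) by (intro PiE_ext[of \<phi> "carrier V" "\<lambda>_. carrier K"]) (auto simp: dual_def)
qed

text \<open>Counting functionals turns a dimension into a cardinality, which can be compared with a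
  number of homomorphisms. A functional is the same as its values on a basis.\<close>

lemma (in vectorspace) card_dual:
  assumes fd: fin_dim and K: "finite (carrier K)"
  shows "card dual = card (carrier K) ^ dim"
proof -
  obtain \<beta> where \<beta>: "finite \<beta>" "basis \<beta>" using finite_basis_exists[OF fd] by blast
  have \<beta>V: "\<beta> \<subseteq> carrier V" and gen: "span \<beta> = carrier V" using \<beta>(2) by (auto simp: basis_def)
  have ex1: "\<exists>!a. a \<in> \<beta> \<rightarrow>\<^sub>E carrier K \<and> lincomb a \<beta> = v" if "v \<in> carrier V" for v
    using basis_criterion[OF \<beta>(1) \<beta>V] \<beta>(2) that by blast
  define co where "co v = (THE a. a \<in> \<beta> \<rightarrow>\<^sub>E carrier K \<and> lincomb a \<beta> = v)" for v
  have co: "co v \<in> \<beta> \<rightarrow>\<^sub>E carrier K" "lincomb (co v) \<beta> = v" if "v \<in> carrier V" for v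
    using theI'[OF ex1[OF that]] by (auto simp: co_def)
  have lin_restrict: "lincomb (restrict a \<beta>) \<beta> = lincomb a \<beta>" if "a \<in> \<beta> \<rightarrow> carrier K" for a
    using that \<beta>V unfolding lincomb_def by (intro finsum_cong') auto
  have co_eq: "co (lincomb a \<beta>) = restrict a \<beta>" if "a \<in> \<beta> \<rightarrow> carrier K" for a
  proof -
    have v: "lincomb a \<beta> \<in> carrier V" using that \<beta> \<beta>V by (intro lincomb_closed) auto
    have "restrict a \<beta> \<in> \<beta> \<rightarrow>\<^sub>E carrier K \<and> lincomb (restrict a \<beta>) \<beta> = lincomb a \<beta>"
      using that lin_restrict[OF that] by auto
    thus ?thesis using ex1[OF v] co[OF v] by blast
  qed
  have co_car: "co v b \<in> carrier K" if "v \<in> carrier V" "b \<in> \<beta>" for v b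
    using co(1)[OF that(1)] that(2) by auto
  have co_add: "co (v \<oplus>\<^bsub>V\<^esub> w) = (\<lambda>b\<in>\<beta>. co v b \<oplus>\<^bsub>K\<^esub> co w b)" if "v \<in> carrier V" "w \<in> carrier V" for v w
  proof -
    have "lincomb (\<lambda>b. co v b \<oplus>\<^bsub>K\<^esub> co w b) \<beta> = v \<oplus>\<^bsub>V\<^esub> w"
      using lincomb_sum[OF \<beta>(1) \<beta>V, of "co v" "co w"] co that co_car by auto
    thus ?thesis using co_eq[of "\<lambda>b. co v b \<oplus>\<^bsub>K\<^esub> co w b"] co_car that by auto
  qed
  have co_smult: "co (a \<odot>\<^bsub>V\<^esub> v) = (\<lambda>b\<in>\<beta>. a \<otimes>\<^bsub>K\<^esub> co v b)" if "v \<in> carrier V" "a \<in> carrier K" for v a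
  proof -
    have "lincomb (\<lambda>b. a \<otimes>\<^bsub>K\<^esub> co v b) \<beta> = a \<odot>\<^bsub>V\<^esub> v"
      using lincomb_smult[OF \<beta>V, of "co v" a] co that co_car by auto
    thus ?thesis using co_eq[of "\<lambda>b. a \<otimes>\<^bsub>K\<^esub> co v b"] co_car that by auto
  qed
  have co_basis: "co b = (\<lambda>x\<in>\<beta>. if b = x then \<one>\<^bsub>K\<^esub> else \<zero>\<^bsub>K\<^esub>)" if "b \<in> \<beta>" for b
  proof -
    have "lincomb (\<lambda>x. if b = x then \<one>\<^bsub>K\<^esub> else \<zero>\<^bsub>K\<^esub>) \<beta> = (\<Oplus>\<^bsub>V\<^esub>x\<in>\<beta>. if b = x then x else \<zero>\<^bsub>V\<^esub>)"
      unfolding lincomb_def using \<beta>V that by (intro finsum_cong') (auto simp: subset_iff)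
    also have "\<dots> = b" using M.add.finprod_singleton[OF that \<beta>(1), of "\<lambda>x. x"] \<beta>V by auto
    finally show ?thesis using co_eq[of "\<lambda>x. if b = x then \<one>\<^bsub>K\<^esub> else \<zero>\<^bsub>K\<^esub>"] by auto
  qed
  have "bij_betw (\<lambda>\<phi>. restrict \<phi> \<beta>) dual (\<beta> \<rightarrow>\<^sub>E carrier K)"
    unfolding bij_betw_def
  proof
    show "inj_on (\<lambda>\<phi>. restrict \<phi> \<beta>) dual"
    proof (rule inj_onI)
      fix \<phi> \<psi> assume d: "\<phi> \<in> dual" "\<psi> \<in> dual" "restrict \<phi> \<beta> = restrict \<psi> \<beta>"
      have "\<phi> v = \<psi> v" if "v \<in> \<beta>" for v using d(3) that by (metis restrict_apply')
      thus "\<phi> = \<psi>" using dual_eqI[OF d(1,2) \<beta>V gen] by blast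
    qed
    show "(\<lambda>\<phi>. restrict \<phi> \<beta>) ` dual = \<beta> \<rightarrow>\<^sub>E carrier K"
    proof
      show "(\<lambda>\<phi>. restrict \<phi> \<beta>) ` dual \<subseteq> \<beta> \<rightarrow>\<^sub>E carrier K" using \<beta>V by (auto simp: dual_def)
      show "\<beta> \<rightarrow>\<^sub>E carrier K \<subseteq> (\<lambda>\<phi>. restrict \<phi> \<beta>) ` dual"
      proof
        fix c assume c: "c \<in> \<beta> \<rightarrow>\<^sub>E carrier K"
        define \<phi> where "\<phi> = (\<lambda>v\<in>carrier V. \<Oplus>\<^bsub>K\<^esub>b\<in>\<beta>. co v b \<otimes>\<^bsub>K\<^esub> c b)"
        have cK: "c b \<in> carrier K" if "b \<in> \<beta>" for b using c that by auto
        have car: "\<phi> v \<in> carrier K" if "v \<in> carrier V" for v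
          unfolding \<phi>_def using that co_car cK by auto
        have "\<phi> \<in> dual"
          unfolding dual_def
        proof (intro CollectI conjI ballI)
          show "\<phi> \<in> carrier V \<rightarrow>\<^sub>E carrier K" using car by (auto simp: \<phi>_def)
        next
          fix v w assume v: "v \<in> carrier V" and w: "w \<in> carrier V"
          have "\<phi> (v \<oplus>\<^bsub>V\<^esub> w) = (\<Oplus>\<^bsub>K\<^esub>b\<in>\<beta>. co v b \<otimes>\<^bsub>K\<^esub> c b \<oplus>\<^bsub>K\<^esub> co w b \<otimes>\<^bsub>K\<^esub> c b)"
          proof -
            have "\<phi> (v \<oplus>\<^bsub>V\<^esub> w) = (\<Oplus>\<^bsub>K\<^esub>b\<in>\<beta>. co (v \<oplus>\<^bsub>V\<^esub> w) b \<otimes>\<^bsub>K\<^esub> c b)" using v w by (simp add: \<phi>_def)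
            also have "\<dots> = (\<Oplus>\<^bsub>K\<^esub>b\<in>\<beta>. co v b \<otimes>\<^bsub>K\<^esub> c b \<oplus>\<^bsub>K\<^esub> co w b \<otimes>\<^bsub>K\<^esub> c b)"
              by (rule R.finsum_cong') (use v w co_car cK in \<open>auto simp: co_add R.l_distr\<close>)
            finally show ?thesis .
          qed
          also have "\<dots> = \<phi> v \<oplus>\<^bsub>K\<^esub> \<phi> w"
            unfolding \<phi>_def using v w co_car cK by (simp add: R.finsum_addf Pi_def)
          finally show "\<phi> (v \<oplus>\<^bsub>V\<^esub> w) = \<phi> v \<oplus>\<^bsub>K\<^esub> \<phi> w" .
        next
          fix a v assume a: "a \<in> carrier K" and v: "v \<in> carrier V"
          have "\<phi> (a \<odot>\<^bsub>V\<^esub> v) = (\<Oplus>\<^bsub>K\<^esub>b\<in>\<beta>. a \<otimes>\<^bsub>K\<^esub> (co v b \<otimes>\<^bsub>K\<^esub> c b))"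
            unfolding \<phi>_def using v a co_car cK by (auto simp: co_smult R.m_assoc intro!: R.finsum_cong')
          also have "\<dots> = a \<otimes>\<^bsub>K\<^esub> \<phi> v"
            unfolding \<phi>_def using v a co_car cK \<beta>(1) by (simp add: R.finsum_rdistr Pi_def)
          finally show "\<phi> (a \<odot>\<^bsub>V\<^esub> v) = a \<otimes>\<^bsub>K\<^esub> \<phi> v" .
        qed
        moreover have "restrict \<phi> \<beta> = c"
        proof (rule ext)
          fix b show "restrict \<phi> \<beta> b = c b"
          proof (cases "b \<in> \<beta>")
            case True
            have "\<phi> b = (\<Oplus>\<^bsub>K\<^esub>x\<in>\<beta>. if b = x then c x else \<zero>\<^bsub>K\<^esub>)"
              unfolding \<phi>_def using True \<beta>V cK by (auto simp: co_basis intro!: R.finsum_cong')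
            also have "\<dots> = c b" using R.add.finprod_singleton[OF True \<beta>(1), of c] cK by auto
            finally show ?thesis using True by simp
          qed (use c in auto)
        qed
        ultimately show "c \<in> (\<lambda>\<phi>. restrict \<phi> \<beta>) ` dual" by blast
      qed
    qed
  qed
  hence "card dual = card (\<beta> \<rightarrow>\<^sub>E carrier K)" by (rule bij_betw_same_card)
  also have "\<dots> = card (carrier K) ^ card \<beta>" using \<beta>(1) by (simp add: card_PiE)
  finally show ?thesis using dim_basis[OF \<beta>] by simp
qed

text \<open>Scalar multiplication on \<open>quotient_module\<close> is a union over a coset; once
  this union is seen to be a single coset, every module law is inherited from
  \<open>M\<close>.\<close>

lemma (in module) quotient_module:
  assumes N: "submodule R N M"
  shows "module R (quotient_module M N)"
    "\<And>x y. x \<in> carrier M \<Longrightarrow> y \<in> carrier M \<Longrightarrow> (N +>\<^bsub>M\<^esub> x) \<oplus>\<^bsub>quotient_module M N\<^esub> (N +>\<^bsub>M\<^esub> y) = N +>\<^bsub>M\<^esub> (x \<oplus>\<^bsub>M\<^esub> y)"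
    "\<And>a x. a \<in> carrier R \<Longrightarrow> x \<in> carrier M \<Longrightarrow> a \<odot>\<^bsub>quotient_module M N\<^esub> (N +>\<^bsub>M\<^esub> x) = N +>\<^bsub>M\<^esub> (a \<odot>\<^bsub>M\<^esub> x)"
    "\<And>x y. x \<in> carrier M \<Longrightarrow> y \<in> carrier M \<Longrightarrow> N +>\<^bsub>M\<^esub> x = N +>\<^bsub>M\<^esub> y \<longleftrightarrow> (\<exists>n\<in>N. x = n \<oplus>\<^bsub>M\<^esub> y)"
    "carrier (quotient_module M N) = (\<lambda>x. N +>\<^bsub>M\<^esub> x) ` carrier M"
    "\<zero>\<^bsub>quotient_module M N\<^esub> = N +>\<^bsub>M\<^esub> \<zero>\<^bsub>M\<^esub>"
proof -
  interpret N: submodule R N M by fact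
  let ?Q = "quotient_module M N" and ?c = "\<lambda>x. N +>\<^bsub>M\<^esub> x"
  have neg: "\<ominus>\<^bsub>M\<^esub> x \<in> N" if "x \<in> N" for x
  proof -
    have xc: "x \<in> carrier M" using that N.subset by blast
    have "(\<ominus> \<one>) \<odot>\<^bsub>M\<^esub> x = \<ominus>\<^bsub>M\<^esub> x" using xc smult_l_minus[of \<one> x] by simp
    thus ?thesis using N.smult_closed[OF _ that, of "\<ominus> \<one>"] by simp
  qed
  have sub: "subgroup N (add_monoid M)"
  proof (rule M.add.subgroupI)
    show "N \<noteq> {}" using N.zero_closed by blast
  qed (use N.subset neg N.m_closed in auto)
  interpret S: abelian_subgroup N M
    by (rule abelian_subgroupI2[OF M.a_comm_group sub])
  have mem: "y \<in> ?c x \<longleftrightarrow> (\<exists>n\<in>N. y = n \<oplus>\<^bsub>M\<^esub> x)" for x y by (auto simp: a_r_coset_def')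
  show eq: "?c x = ?c y \<longleftrightarrow> (\<exists>n\<in>N. x = n \<oplus>\<^bsub>M\<^esub> y)" if "x \<in> carrier M" "y \<in> carrier M" for x y
  proof
    assume "?c x = ?c y"
    thus "\<exists>n\<in>N. x = n \<oplus>\<^bsub>M\<^esub> y" using S.a_rcos_self[OF that(1)] mem by blast
  next
    assume "\<exists>n\<in>N. x = n \<oplus>\<^bsub>M\<^esub> y"
    hence "x \<in> ?c y" using mem by blast
    from a_repr_independence[OF this that(2) sub] show "?c x = ?c y" by (rule sym)
  qed
  show add: "?c x \<oplus>\<^bsub>?Q\<^esub> ?c y = ?c (x \<oplus>\<^bsub>M\<^esub> y)" if "x \<in> carrier M" "y \<in> carrier M" for x y
    using S.a_rcos_sum[OF that] by (simp add: quotient_module_def)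
  show smult: "a \<odot>\<^bsub>?Q\<^esub> ?c x = ?c (a \<odot>\<^bsub>M\<^esub> x)" if a: "a \<in> carrier R" and x: "x \<in> carrier M" for a x
  proof -
    have "?c (a \<odot>\<^bsub>M\<^esub> y) = ?c (a \<odot>\<^bsub>M\<^esub> x)" if "y \<in> ?c x" for y
    proof -
      have "\<exists>n\<in>N. y = n \<oplus>\<^bsub>M\<^esub> x" using that mem[of y x] by simp
      then obtain n where n: "n \<in> N" "y = n \<oplus>\<^bsub>M\<^esub> x" by (rule bexE)
      have "n \<in> carrier M" using n N.subset by blast
      hence "a \<odot>\<^bsub>M\<^esub> y = a \<odot>\<^bsub>M\<^esub> n \<oplus>\<^bsub>M\<^esub> a \<odot>\<^bsub>M\<^esub> x" "y \<in> carrier M" using n a x smult_r_distr by auto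
      thus ?thesis using eq[of "a \<odot>\<^bsub>M\<^esub> y" "a \<odot>\<^bsub>M\<^esub> x"] a x N.smult_closed[OF a n(1)] smult_closed by blast
    qed
    moreover have "x \<in> ?c x" using S.a_rcos_self[OF x] .
    ultimately have "(\<Union>y\<in>?c x. ?c (a \<odot>\<^bsub>M\<^esub> y)) = ?c (a \<odot>\<^bsub>M\<^esub> x)" by blast
    thus ?thesis by (simp add: quotient_module_def)
  qed
  show car: "carrier ?Q = ?c ` carrier M" by (auto simp: quotient_module_def A_RCOSETS_def')
  show zero: "\<zero>\<^bsub>?Q\<^esub> = ?c \<zero>\<^bsub>M\<^esub>"
    using a_coset_add_zero[of N] N.subset by (simp add: quotient_module_def)
  show "module R ?Q"
  proof (rule module_criteria)
    show "cring R" by (rule is_cring)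
    show "\<forall>v\<in>carrier ?Q. \<exists>w\<in>carrier ?Q. v \<oplus>\<^bsub>?Q\<^esub> w = \<zero>\<^bsub>?Q\<^esub>"
    proof
      fix v assume "v \<in> carrier ?Q"
      then obtain x where x: "x \<in> carrier M" "v = ?c x" by (auto simp: car)
      have "v \<oplus>\<^bsub>?Q\<^esub> ?c (\<ominus>\<^bsub>M\<^esub> x) = \<zero>\<^bsub>?Q\<^esub>" using x add[of x "\<ominus>\<^bsub>M\<^esub> x"] M.r_neg[OF x(1)] by (simp add: zero)
      thus "\<exists>w\<in>carrier ?Q. v \<oplus>\<^bsub>?Q\<^esub> w = \<zero>\<^bsub>?Q\<^esub>" using x by (auto simp: car)
    qed
  qed (auto simp: car add smult zero smult_closed M.a_ac smult_assoc1 smult_l_distr smult_r_distr)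
qed

lemma residue_field: "prime p \<Longrightarrow> field (residue_ring (int p))"
proof -
  assume "prime p"
  then interpret residues_prime p "residue_ring (int p)" by (simp add: residues_prime_def)
  show ?thesis by (rule is_field)
qed

lemma residue_finsum:
  assumes p: "prime p" and A: "finite A" and f: "\<And>x. x \<in> A \<Longrightarrow> 0 \<le> f x \<and> f x < int p"
  shows "finsum (residue_ring (int p)) f A = (\<Sum>x\<in>A. f x) mod int p"
proof -
  interpret R: field "residue_ring (int p)" by (rule residue_field[OF p])
  have car: "carrier (residue_ring (int p)) = {0..int p - 1}" by (simp add: residue_ring_def)
  show ?thesis using A f
  proof (induction A rule: finite_induct)
    case (insert x F)
    have "finsum (residue_ring (int p)) f (insert x F) = f x \<oplus>\<^bsub>residue_ring (int p)\<^esub> finsum (residue_ring (int p)) f F"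
      by (rule R.finsum_insert) (use insert car in \<open>auto simp: Pi_def zle_diff1_eq\<close>)
    thus ?case using insert by (simp add: residue_ring_def mod_simps)
  next
    case empty
    have "finsum (residue_ring (int p)) f {} = \<zero>\<^bsub>residue_ring (int p)\<^esub>" by (rule R.finsum_empty)
    thus ?case by (simp add: residue_ring_def)
  qed
qed

text \<open>Only the signs 1 and -1 occur as exponents in the boundary, so \<open>add_pow\<close> is
  the identity or the negation.\<close>

lemma residue_add_pow_sign:
  assumes p: "prime p" and x: "0 \<le> x" "x < int p"
  shows "add_pow (residue_ring (int p)) ((-1 :: int) ^ i) x = ((-1) ^ i * x) mod int p"
proof -
  interpret R: residues_prime p "residue_ring (int p)" using p by (simp add: residues_prime_def)
  have xc: "x \<in> carrier (residue_ring (int p))" using x by (simp add: residue_ring_def)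
  show ?thesis
  proof (cases "even i")
    case True
    thus ?thesis using xc x by (simp add: add_pow_int_ge)
  next
    case False
    thus ?thesis using xc x R.res_neg_eq[of x] by (simp add: add_pow_int_lt)
  qed
qed

text \<open>The coefficient of \<open>ys\<close> in the boundary of the basis element
  \<open>xs\<close>, kept as an integer: sums are taken in the integers and reduced modulo
  \<open>p\<close> only at the end.\<close>

definition face_sign :: "('a, 'b) monoid_scheme \<Rightarrow> nat \<Rightarrow> 'a list \<Rightarrow> 'a list \<Rightarrow> int" where
  "face_sign G n xs ys = (\<Sum>i\<in>{i. i \<le> n \<and> bar_face G i xs = ys}. (- 1) ^ i)"

section \<open>Bar chains of degree one and two modulo p\<close>

locale bar_mod_p = group +
  fixes p :: nat
  assumes p: "prime p"
  notes One_nat_def [simp del]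
begin

abbreviation "R \<equiv> residue_ring (int p)"

lemma p_pos: "int p > 0" "p > 0" using prime_gt_0_nat[OF p] by auto

lemma mem_R: "x \<in> carrier R \<longleftrightarrow> 0 \<le> x \<and> x < int p" by (auto simp: residue_ring_def)

lemma R_zero: "\<zero>\<^bsub>R\<^esub> = 0" by (simp add: residue_ring_def)

lemma chain_range: "c \<in> carrier (bar_chains R G n) \<Longrightarrow> 0 \<le> c xs \<and> c xs < int p"
  using mem_R by (auto simp: bar_chains_def)

lemma chain_finite: "c \<in> carrier (bar_chains R G n) \<Longrightarrow> finite {xs. c xs \<noteq> 0}"
  by (simp add: bar_chains_def R_zero)

lemma chain_support: "c \<in> carrier (bar_chains R G n) \<Longrightarrow> c xs \<noteq> 0 \<Longrightarrow> length xs = n \<and> set xs \<subseteq> carrier G"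
  by (auto simp: bar_chains_def R_zero)

lemma chainI:
  assumes "\<And>xs. 0 \<le> c xs \<and> c xs < int p" "finite S" "\<And>xs. c xs \<noteq> 0 \<Longrightarrow> xs \<in> S \<and> length xs = n \<and> set xs \<subseteq> carrier G"
  shows "c \<in> carrier (bar_chains R G n)"
proof -
  have "finite {xs. c xs \<noteq> 0}" by (rule finite_subset[OF _ assms(2)]) (use assms(3) in auto)
  thus ?thesis using assms mem_R by (auto simp: bar_chains_def R_zero)
qed

lemma boundary_eq:
  assumes c: "c \<in> carrier (bar_chains R G n)" and n: "n > 0" and S: "finite S" "\<And>xs. c xs \<noteq> 0 \<Longrightarrow> xs \<in> S"
  shows "bar_boundary R G n c ys = (\<Sum>xs\<in>S. c xs * face_sign G n xs ys) mod int p"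
proof -
  have r: "0 \<le> c xs \<and> c xs < int p" for xs using chain_range[OF c] by blast
  have inner: "(\<Oplus>\<^bsub>R\<^esub>i\<in>{i. i \<le> n \<and> bar_face G i xs = ys}. add_pow R ((- 1 :: int) ^ i) (c xs))
      = (c xs * face_sign G n xs ys) mod int p" for xs
  proof -
    let ?I = "{i. i \<le> n \<and> bar_face G i xs = ys}"
    have "(\<Oplus>\<^bsub>R\<^esub>i\<in>?I. add_pow R ((- 1 :: int) ^ i) (c xs)) = (\<Sum>i\<in>?I. add_pow R ((- 1 :: int) ^ i) (c xs)) mod int p"
      by (rule residue_finsum[OF p]) (use residue_add_pow_sign[OF p] r p_pos in auto)
    also have "\<dots> = (\<Sum>i\<in>?I. ((- 1) ^ i * c xs) mod int p) mod int p"
      using residue_add_pow_sign[OF p] r by simp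
    also have "\<dots> = (\<Sum>i\<in>?I. (- 1) ^ i * c xs) mod int p" by (rule mod_sum_eq)
    also have "(\<Sum>i\<in>?I. (- 1) ^ i * c xs) = c xs * face_sign G n xs ys"
      by (simp add: face_sign_def sum_distrib_left mult.commute)
    finally show ?thesis .
  qed
  have "bar_boundary R G n c ys = (\<Oplus>\<^bsub>R\<^esub>xs\<in>{xs. c xs \<noteq> 0}. (c xs * face_sign G n xs ys) mod int p)"
    using n by (simp add: bar_boundary_def inner R_zero)
  also have "\<dots> = (\<Sum>xs\<in>{xs. c xs \<noteq> 0}. (c xs * face_sign G n xs ys) mod int p) mod int p"
    by (rule residue_finsum[OF p]) (use chain_finite[OF c] p_pos in auto)
  also have "\<dots> = (\<Sum>xs\<in>{xs. c xs \<noteq> 0}. c xs * face_sign G n xs ys) mod int p" by (rule mod_sum_eq)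
  also have "(\<Sum>xs\<in>{xs. c xs \<noteq> 0}. c xs * face_sign G n xs ys) = (\<Sum>xs\<in>S. c xs * face_sign G n xs ys)"
    by (rule sum.mono_neutral_left) (use S in auto)
  finally show ?thesis .
qed

lemma face_sign_1:
  assumes "length xs = 1" shows "face_sign G 1 xs ys = 0"
proof -
  obtain g where g: "xs = [g]" using assms by (auto simp: length_Suc_conv One_nat_def)
  have "{i. i \<le> 1 \<and> bar_face G i xs = ys} = (if ys = [] then {0, 1} else {})"
    using g by (auto simp: bar_face_def le_Suc_eq)
  thus ?thesis by (simp add: face_sign_def)
qed

text \<open>With trivial coefficients both faces of a one-element list are the empty list, with
  opposite signs.\<close>

lemma cycles_1: "bar_cycles R G 1 = carrier (bar_chains R G 1)"
proof -
  have "bar_boundary R G 1 c = (\<lambda>ys. \<zero>\<^bsub>R\<^esub>)" if c: "c \<in> carrier (bar_chains R G 1)" for c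
  proof
    fix ys
    have "bar_boundary R G 1 c ys = (\<Sum>xs\<in>{xs. c xs \<noteq> 0}. c xs * face_sign G 1 xs ys) mod int p"
      by (rule boundary_eq[OF c]) (use chain_finite[OF c] in auto)
    also have "(\<Sum>xs\<in>{xs. c xs \<noteq> 0}. c xs * face_sign G 1 xs ys) = 0"
      using chain_support[OF c] face_sign_1 by (intro sum.neutral) auto
    finally show "bar_boundary R G 1 c ys = \<zero>\<^bsub>R\<^esub>" by (simp add: R_zero)
  qed
  thus ?thesis by (auto simp: bar_cycles_def)
qed

lemma face_sign_2:
  "face_sign G 2 [g, h] ys = (if ys = [h] then 1 else 0) - (if ys = [g \<otimes> h] then 1 else 0) + (if ys = [g] then 1 else 0)"
proof -
  have "face_sign G 2 [g, h] ys = (\<Sum>i\<in>{0, 1, 2} \<inter> {i. bar_face G i [g, h] = ys}. (- 1) ^ i)"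
    unfolding face_sign_def by (rule sum.cong) (auto simp: le_Suc_eq numeral_2_eq_2)
  also have "\<dots> = (\<Sum>i\<in>{0, 1, 2}. if bar_face G i [g, h] = ys then (- 1) ^ i else 0)"
    by (subst sum.inter_restrict) auto
  finally show ?thesis by (auto simp: bar_face_def)
qed

abbreviation "C1 \<equiv> bar_chains R G 1"

lemma C1_cycles: "C1\<lparr>carrier := bar_cycles R G 1\<rparr> = C1"
  unfolding cycles_1 by (simp add: bar_chains_def)

lemma C1_ops:
  "c \<oplus>\<^bsub>C1\<^esub> d = (\<lambda>xs. (c xs + d xs) mod int p)" "a \<odot>\<^bsub>C1\<^esub> c = (\<lambda>xs. (a * c xs) mod int p)"
  "\<zero>\<^bsub>C1\<^esub> = (\<lambda>xs. 0)"
  by (simp_all add: bar_chains_def residue_ring_def)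

lemma R_ops: "a \<oplus>\<^bsub>R\<^esub> b = (a + b) mod int p" "a \<otimes>\<^bsub>R\<^esub> b = (a * b) mod int p" "\<one>\<^bsub>R\<^esub> = 1"
  by (simp_all add: residue_ring_def)

lemma C1_mod: "c \<in> carrier C1 \<Longrightarrow> c xs mod int p = c xs"
  using chain_range by auto

lemma C1_module: "module R C1"
proof (rule module_criteria)
  show "cring R" using residue_field[OF p] by (simp add: field_def domain_def)
  show "\<zero>\<^bsub>C1\<^esub> \<in> carrier C1" unfolding C1_ops by (rule chainI[of _ "{}"]) (use p_pos in auto)
  show "\<forall>v w. v \<in> carrier C1 \<and> w \<in> carrier C1 \<longrightarrow> v \<oplus>\<^bsub>C1\<^esub> w \<in> carrier C1"
  proof (intro allI impI)
    fix v w assume vw: "v \<in> carrier C1 \<and> w \<in> carrier C1"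
    show "v \<oplus>\<^bsub>C1\<^esub> w \<in> carrier C1" unfolding C1_ops
    proof (rule chainI[of _ "{xs. v xs \<noteq> 0} \<union> {xs. w xs \<noteq> 0}"])
      fix xs assume "(v xs + w xs) mod int p \<noteq> 0"
      hence "v xs \<noteq> 0 \<or> w xs \<noteq> 0" by auto
      thus "xs \<in> {xs. v xs \<noteq> 0} \<union> {xs. w xs \<noteq> 0} \<and> length xs = 1 \<and> set xs \<subseteq> carrier G"
        using chain_support vw by auto
    qed (use p_pos chain_finite vw in auto)
  qed
  show "\<forall>c v. c \<in> carrier R \<and> v \<in> carrier C1 \<longrightarrow> c \<odot>\<^bsub>C1\<^esub> v \<in> carrier C1"
  proof (intro allI impI)
    fix a v assume av: "a \<in> carrier R \<and> v \<in> carrier C1"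
    show "a \<odot>\<^bsub>C1\<^esub> v \<in> carrier C1" unfolding C1_ops
    proof (rule chainI[of _ "{xs. v xs \<noteq> 0}"])
      fix xs assume "(a * v xs) mod int p \<noteq> 0"
      hence "v xs \<noteq> 0" by auto
      thus "xs \<in> {xs. v xs \<noteq> 0} \<and> length xs = 1 \<and> set xs \<subseteq> carrier G"
        using chain_support av by auto
    qed (use p_pos chain_finite av in auto)
  qed
  show "\<forall>v\<in>carrier C1. \<exists>neg_v\<in>carrier C1. v \<oplus>\<^bsub>C1\<^esub> neg_v = \<zero>\<^bsub>C1\<^esub>"
  proof
    fix v assume v: "v \<in> carrier C1"
    have "(\<lambda>xs. (- v xs) mod int p) \<in> carrier C1"
    proof (rule chainI[of _ "{xs. v xs \<noteq> 0}"])
      fix xs assume "(- v xs) mod int p \<noteq> 0"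
      hence "v xs \<noteq> 0" by auto
      thus "xs \<in> {xs. v xs \<noteq> 0} \<and> length xs = 1 \<and> set xs \<subseteq> carrier G"
        using chain_support[OF v] by auto
    qed (use p_pos chain_finite[OF v] in auto)
    moreover have "v \<oplus>\<^bsub>C1\<^esub> (\<lambda>xs. (- v xs) mod int p) = \<zero>\<^bsub>C1\<^esub>"
      unfolding C1_ops by (simp add: mod_simps)
    ultimately show "\<exists>neg_v\<in>carrier C1. v \<oplus>\<^bsub>C1\<^esub> neg_v = \<zero>\<^bsub>C1\<^esub>" by blast
  qed
qed (unfold C1_ops R_ops, auto simp: C1_mod mod_simps algebra_simps)

definition single :: "'a \<Rightarrow> 'a list \<Rightarrow> int" where
  "single g xs = (if xs = [g] then 1 else 0)"

lemma single_C1: "g \<in> carrier G \<Longrightarrow> single g \<in> carrier C1"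
  by (rule chainI[of _ "{[g]}"]) (use prime_gt_1_nat[OF p] in \<open>auto simp: single_def split: if_splits\<close>)

abbreviation "B1 \<equiv> bar_boundaries R G 1"

lemma C2_add:
  assumes "c \<in> carrier (bar_chains R G n)" "d \<in> carrier (bar_chains R G n)" "0 \<le> a" "a < int p"
  shows "(\<lambda>xs. (a * c xs + d xs) mod int p) \<in> carrier (bar_chains R G n)"
proof (rule chainI[of _ "{xs. c xs \<noteq> 0} \<union> {xs. d xs \<noteq> 0}"])
  fix xs assume "(a * c xs + d xs) mod int p \<noteq> 0"
  hence "c xs \<noteq> 0 \<or> d xs \<noteq> 0" by auto
  thus "xs \<in> {xs. c xs \<noteq> 0} \<union> {xs. d xs \<noteq> 0} \<and> length xs = n \<and> set xs \<subseteq> carrier G"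
    using chain_support assms by auto
qed (use p_pos chain_finite assms in auto)

lemma boundary_linear:
  assumes c: "c \<in> carrier (bar_chains R G 2)" and d: "d \<in> carrier (bar_chains R G 2)" and a: "0 \<le> a" "a < int p"
  shows "bar_boundary R G 2 (\<lambda>xs. (a * c xs + d xs) mod int p) ys
    = (a * bar_boundary R G 2 c ys + bar_boundary R G 2 d ys) mod int p"
proof -
  let ?S = "{xs. c xs \<noteq> 0} \<union> {xs. d xs \<noteq> 0}" and ?f = "\<lambda>xs. face_sign G 2 xs ys"
  have fin: "finite ?S" using chain_finite c d by auto
  have "bar_boundary R G 2 (\<lambda>xs. (a * c xs + d xs) mod int p) ys = (\<Sum>xs\<in>?S. ((a * c xs + d xs) mod int p) * ?f xs) mod int p"
    by (rule boundary_eq[OF C2_add[OF c d a] _ fin]) auto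
  also have "\<dots> = (\<Sum>xs\<in>?S. (a * c xs + d xs) * ?f xs) mod int p"
    by (subst mod_sum_eq[symmetric], subst (2) mod_sum_eq[symmetric]) (simp add: mod_simps)
  also have "(\<Sum>xs\<in>?S. (a * c xs + d xs) * ?f xs) = a * (\<Sum>xs\<in>?S. c xs * ?f xs) + (\<Sum>xs\<in>?S. d xs * ?f xs)"
    by (simp add: sum_distrib_left sum.distrib algebra_simps)
  finally have main: "bar_boundary R G 2 (\<lambda>xs. (a * c xs + d xs) mod int p) ys = (a * (\<Sum>xs\<in>?S. c xs * ?f xs) + (\<Sum>xs\<in>?S. d xs * ?f xs)) mod int p" .
  show ?thesis
  proof -
    have e: "(a * X + Y) mod int p = (a * (X mod int p) + Y mod int p) mod int p" for X Y
      by (metis mod_add_left_eq mod_add_right_eq mod_mult_right_eq)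
    have b1: "bar_boundary R G 2 c ys = (\<Sum>xs\<in>?S. c xs * ?f xs) mod int p"
      by (rule boundary_eq[OF c zero_less_numeral fin]) simp
    have b2: "bar_boundary R G 2 d ys = (\<Sum>xs\<in>?S. d xs * ?f xs) mod int p"
      by (rule boundary_eq[OF d zero_less_numeral fin]) simp
    show ?thesis unfolding main b1 b2 by (rule e)
  qed
qed

lemma C2_elim:
  assumes "c \<in> carrier (bar_chains R G 2)" "c xs \<noteq> 0"
  obtains g h where "xs = [g, h]" "g \<in> carrier G" "h \<in> carrier G"
proof -
  have l: "length xs = 2" "set xs \<subseteq> carrier G" using chain_support[OF assms] by auto
  obtain g h where "xs = [g, h]" using l(1) by (auto simp: numeral_2_eq_2 length_Suc_conv)
  thus thesis using l(2) that by auto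
qed

lemma boundary_in_C1:
  assumes c: "c \<in> carrier (bar_chains R G 2)"
  shows "bar_boundary R G 2 c \<in> carrier C1"
proof (rule chainI)
  let ?S = "{xs. c xs \<noteq> 0}"
  have eq: "bar_boundary R G 2 c ys = (\<Sum>xs\<in>?S. c xs * face_sign G 2 xs ys) mod int p" for ys
    by (rule boundary_eq[OF c]) (use chain_finite[OF c] in auto)
  show "0 \<le> bar_boundary R G 2 c ys \<and> bar_boundary R G 2 c ys < int p" for ys
    unfolding eq using p_pos by simp
  let ?T = "(\<lambda>xs. [xs ! 1]) ` ?S \<union> (\<lambda>xs. [xs ! 0 \<otimes> xs ! 1]) ` ?S \<union> (\<lambda>xs. [xs ! 0]) ` ?S"
  show "finite ?T" using chain_finite[OF c] by auto
  fix ys assume "bar_boundary R G 2 c ys \<noteq> 0"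
  then obtain xs where xs: "c xs \<noteq> 0" "face_sign G 2 xs ys \<noteq> 0"
    unfolding eq by (metis (mono_tags, lifting) mem_Collect_eq mod_0 mult_zero_right sum.neutral)
  obtain g h where gh: "xs = [g, h]" "g \<in> carrier G" "h \<in> carrier G" using C2_elim[OF c xs(1)] .
  have "ys = [h] \<or> ys = [g \<otimes> h] \<or> ys = [g]"
    using xs(2) unfolding gh face_sign_2 by (auto split: if_splits)
  thus "ys \<in> ?T \<and> length ys = 1 \<and> set ys \<subseteq> carrier G"
    using xs(1) gh by (auto intro!: image_eqI[of _ _ xs])
qed

lemma zero_chain: "(\<lambda>xs. 0) \<in> carrier (bar_chains R G n)"
  by (rule chainI[of _ "{}"]) (use p_pos in auto)

lemma B1_eq: "B1 = bar_boundary R G 2 ` carrier (bar_chains R G 2)"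
  by (simp add: bar_boundaries_def numeral_2_eq_2)

lemma B1_submodule: "submodule R B1 C1"
  unfolding submodule_def
proof (intro conjI allI impI)
  show "module R C1" by (rule C1_module)
  show "B1 \<subseteq> carrier C1" using boundary_in_C1 by (auto simp: B1_eq)
  have lin: "(\<lambda>ys. (a * v ys + w ys) mod int p) \<in> B1"
    if v: "v \<in> B1" and w: "w \<in> B1" and a: "0 \<le> a" "a < int p" for v w a
  proof -
    obtain c d where cd: "v = bar_boundary R G 2 c" "w = bar_boundary R G 2 d"
      "c \<in> carrier (bar_chains R G 2)" "d \<in> carrier (bar_chains R G 2)"
      using v w by (auto simp: B1_eq)
    have "(\<lambda>ys. (a * v ys + w ys) mod int p) = bar_boundary R G 2 (\<lambda>xs. (a * c xs + d xs) mod int p)"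
      using boundary_linear[OF cd(3,4) a] by (simp add: cd fun_eq_iff)
    thus ?thesis using C2_add[OF cd(3,4) a] unfolding B1_eq by blast
  qed
  have "bar_boundary R G 2 (\<lambda>xs. 0) = (\<lambda>ys. 0)"
    using boundary_eq[OF zero_chain, of 2 "{}"] by auto
  hence zB: "(\<lambda>ys. 0) \<in> B1" using zero_chain[of 2] unfolding B1_eq by force
  thus "\<zero>\<^bsub>C1\<^esub> \<in> B1" unfolding C1_ops .
  show "v \<oplus>\<^bsub>C1\<^esub> w \<in> B1" if "v \<in> B1" "w \<in> B1" for v w
    unfolding C1_ops using lin[of v w 1] that prime_gt_1_nat[OF p] by simp
  show "c \<odot>\<^bsub>C1\<^esub> v \<in> B1" if "c \<in> carrier R" "v \<in> B1" for c v
    unfolding C1_ops using lin[of v "\<lambda>_. 0" c] that zB by (simp add: mem_R)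
qed

abbreviation "H1 \<equiv> group_homology R G 1"

lemma H1_eq: "H1 = quotient_module C1 B1"
  unfolding group_homology_def C1_cycles ..

sublocale C1: Module.module R C1 by (rule C1_module)

lemmas H1_facts = C1.quotient_module[OF B1_submodule, folded H1_eq]

sublocale H1: vectorspace R H1
  by (rule vectorspace.intro[OF H1_facts(1) residue_field[OF p]])

abbreviation "cl c \<equiv> B1 +>\<^bsub>C1\<^esub> c"

text \<open>The boundary of \<open>[g, h]\<close> is [h] - [gh] + [g].\<close>

lemma cl_mult:
  assumes g: "g \<in> carrier G" and h: "h \<in> carrier G"
  shows "cl (single (g \<otimes> h)) = cl (single g) \<oplus>\<^bsub>H1\<^esub> cl (single h)"
proof -
  let ?c = "\<lambda>xs. if xs = [g, h] then 1 else (0 :: int)"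
  have c: "?c \<in> carrier (bar_chains R G 2)"
    by (rule chainI[of _ "{[g, h]}"]) (use g h prime_gt_1_nat[OF p] in \<open>auto split: if_splits\<close>)
  have b: "bar_boundary R G 2 ?c \<in> B1" using c unfolding B1_eq by blast
  have "bar_boundary R G 2 ?c ys = (single h ys - single (g \<otimes> h) ys + single g ys) mod int p" for ys
  proof -
    have "bar_boundary R G 2 ?c ys = (\<Sum>xs\<in>{[g, h]}. ?c xs * face_sign G 2 xs ys) mod int p"
      by (rule boundary_eq[OF c zero_less_numeral]) (auto split: if_splits)
    thus ?thesis by (simp add: face_sign_2 single_def)
  qed
  hence "single g \<oplus>\<^bsub>C1\<^esub> single h = bar_boundary R G 2 ?c \<oplus>\<^bsub>C1\<^esub> single (g \<otimes> h)"
    unfolding C1_ops by (auto simp: mod_simps algebra_simps)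
  hence "cl (single g \<oplus>\<^bsub>C1\<^esub> single h) = cl (single (g \<otimes> h))"
    using H1_facts(4) b single_C1 g h by (metis C1.M.a_closed m_closed)
  thus ?thesis using H1_facts(2) single_C1 g h by metis
qed

lemma cl_carrier: "g \<in> carrier G \<Longrightarrow> cl (single g) \<in> carrier H1"
  using H1_facts(5) single_C1 by blast

lemma cl_one: "cl (single \<one>) = \<zero>\<^bsub>H1\<^esub>"
  using cl_mult[of \<one> \<one>] cl_carrier[of \<one>] by (simp add: H1.M.add.r_cancel_one')

text \<open>Classes being multiplicative, the elements whose class lies in the span form a subgroup,
  and it contains \<open>X\<close>. A general chain is reached by splitting off one point of its
  support at a time. For finite \<open>X\<close> this is what makes the homology
  finite-dimensional.\<close>

lemma span_single:
  assumes X: "X \<subseteq> carrier G" and gen: "generate G X = carrier G"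
  shows "H1.span ((\<lambda>x. cl (single x)) ` X) = carrier H1"
proof -
  let ?S = "(\<lambda>x. cl (single x)) ` X"
  have S: "?S \<subseteq> carrier H1" using X cl_carrier by auto
  interpret U: submodule R "H1.span ?S" H1 by (rule H1.span_is_submodule[OF S])
  have XS: "cl (single x) \<in> H1.span ?S" if "x \<in> X" for x using H1.in_own_span[OF S] that by blast
  let ?D = "{g\<in>carrier G. cl (single g) \<in> H1.span ?S}"
  have "subgroup ?D G"
  proof (rule subgroupI)
    show "?D \<noteq> {}" using cl_one U.zero_closed by auto
    fix a assume a: "a \<in> ?D"
    hence ac: "a \<in> carrier G" by simp
    have "cl (single (inv a)) \<oplus>\<^bsub>H1\<^esub> cl (single a) = \<zero>\<^bsub>H1\<^esub>" using ac cl_mult[of "inv a" a] cl_one by simp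
    hence "cl (single (inv a)) = \<ominus>\<^bsub>H1\<^esub> cl (single a)"
      by (rule H1.M.minus_equality[OF _ cl_carrier cl_carrier, symmetric]) (use ac in auto)
    also have "\<dots> = (\<ominus>\<^bsub>R\<^esub> \<one>\<^bsub>R\<^esub>) \<odot>\<^bsub>H1\<^esub> cl (single a)"
      using a cl_carrier H1.smult_l_minus[of "\<one>\<^bsub>R\<^esub>" "cl (single a)"] by simp
    also have "\<dots> \<in> H1.span ?S" using a by (intro U.smult_closed) auto
    finally show "inv a \<in> ?D" using a by simp
  next
    fix a b assume "a \<in> ?D" "b \<in> ?D"
    thus "a \<otimes> b \<in> ?D" using cl_mult U.m_closed by auto
  qed auto
  hence "generate G X \<subseteq> ?D" using XS X by (intro generate_subgroup_incl) auto
  hence single: "cl (single g) \<in> H1.span ?S" if "g \<in> carrier G" for g using gen that by auto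
  have "cl c \<in> H1.span ?S" if "c \<in> carrier C1" "card {xs. c xs \<noteq> 0} = n" for c n
    using that
  proof (induction n arbitrary: c)
    case 0
    hence "{xs. c xs \<noteq> 0} = {}" using chain_finite[OF 0(1)] by simp
    hence "c = \<zero>\<^bsub>C1\<^esub>" unfolding C1_ops by auto
    thus ?case using H1_facts(6) U.zero_closed by metis
  next
    case (Suc n)
    then obtain xs where xs: "c xs \<noteq> 0" by (metis (mono_tags, lifting) card.empty empty_Collect_eq nat.distinct(1))
    have "length xs = 1" "set xs \<subseteq> carrier G" using chain_support[OF Suc(2) xs] by auto
    then obtain g where g: "xs = [g]" "g \<in> carrier G" by (auto simp: length_Suc_conv One_nat_def)
    define d where "d = (\<lambda>ys. if ys = [g] then 0 else c ys)"
    have d: "d \<in> carrier C1"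
      by (rule chainI[OF _ chain_finite[OF Suc(2)]])
         (use chain_range[OF Suc(2)] chain_support[OF Suc(2)] p_pos in \<open>auto simp: d_def split: if_splits\<close>)
    have supp: "{xs. c xs \<noteq> 0} = insert [g] {xs. d xs \<noteq> 0}" "[g] \<notin> {xs. d xs \<noteq> 0}"
      using xs g by (auto simp: d_def)
    hence "card {xs. d xs \<noteq> 0} = n" using Suc(3) chain_finite[OF d] by simp
    hence dS: "cl d \<in> H1.span ?S" using Suc.IH d by blast
    have cg: "c [g] \<in> carrier R" using chain_range[OF Suc(2)] mem_R by blast
    have "c = d \<oplus>\<^bsub>C1\<^esub> (c [g] \<odot>\<^bsub>C1\<^esub> single g)"
      unfolding C1_ops using C1_mod[OF Suc(2)] by (auto simp: d_def single_def)
    hence "cl c = cl d \<oplus>\<^bsub>H1\<^esub> (c [g] \<odot>\<^bsub>H1\<^esub> cl (single g))"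
      using H1_facts(2,3) d cg single_C1[OF g(2)] by (metis C1.smult_closed)
    thus ?case using dS single[OF g(2)] cg by (simp add: U.m_closed U.smult_closed)
  qed
  hence "carrier H1 \<subseteq> H1.span ?S" using H1_facts(5) by auto
  thus ?thesis using U.subset by blast
qed

text \<open>The linear extension of \<open>f\<close> to chains of degree 1, whose support consists
  of one-element lists; \<open>hd\<close> reads off the group element.\<close>

definition chain_eval :: "('a \<Rightarrow> int) \<Rightarrow> ('a list \<Rightarrow> int) \<Rightarrow> int" where
  "chain_eval f c = (\<Sum>xs\<in>{xs. c xs \<noteq> 0}. c xs * f (hd xs)) mod int p"

lemma chain_eval_eq:
  assumes "finite S" "\<And>xs. c xs \<noteq> 0 \<Longrightarrow> xs \<in> S"
  shows "chain_eval f c = (\<Sum>xs\<in>S. c xs * f (hd xs)) mod int p"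
proof -
  have "(\<Sum>xs\<in>{xs. c xs \<noteq> 0}. c xs * f (hd xs)) = (\<Sum>xs\<in>S. c xs * f (hd xs))"
    by (rule sum.mono_neutral_left) (use assms in auto)
  thus ?thesis by (simp add: chain_eval_def)
qed

lemma chain_eval_add:
  assumes "c \<in> carrier C1" "d \<in> carrier C1"
  shows "chain_eval f (c \<oplus>\<^bsub>C1\<^esub> d) = (chain_eval f c + chain_eval f d) mod int p"
proof -
  let ?S = "{xs. c xs \<noteq> 0} \<union> {xs. d xs \<noteq> 0}"
  have fin: "finite ?S" using chain_finite assms by auto
  have "chain_eval f (c \<oplus>\<^bsub>C1\<^esub> d) = (\<Sum>xs\<in>?S. ((c xs + d xs) mod int p) * f (hd xs)) mod int p"
    unfolding C1_ops by (rule chain_eval_eq[OF fin]) auto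
  also have "\<dots> = (\<Sum>xs\<in>?S. (c xs + d xs) * f (hd xs)) mod int p"
    by (subst mod_sum_eq[symmetric], subst (2) mod_sum_eq[symmetric]) (simp add: mod_simps)
  finally show ?thesis
    using chain_eval_eq[OF fin, of c f] chain_eval_eq[OF fin, of d f]
    by (simp add: ring_distribs sum.distrib mod_simps)
qed

lemma chain_eval_smult:
  assumes "c \<in> carrier C1"
  shows "chain_eval f (a \<odot>\<^bsub>C1\<^esub> c) = (a * chain_eval f c) mod int p"
proof -
  let ?S = "{xs. c xs \<noteq> 0}"
  have fin: "finite ?S" using chain_finite assms by auto
  have "chain_eval f (a \<odot>\<^bsub>C1\<^esub> c) = (\<Sum>xs\<in>?S. ((a * c xs) mod int p) * f (hd xs)) mod int p"
    unfolding C1_ops by (rule chain_eval_eq[OF fin]) auto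
  also have "\<dots> = (\<Sum>xs\<in>?S. (a * c xs) * f (hd xs)) mod int p"
    by (subst mod_sum_eq[symmetric], subst (2) mod_sum_eq[symmetric]) (simp add: mod_simps)
  finally show ?thesis
    by (simp add: chain_eval_def sum_distrib_left mod_simps mult.assoc)
qed

lemma chain_eval_boundary:
  assumes f: "f \<in> fp_homs p G" and b: "b \<in> B1"
  shows "chain_eval f b = 0"
proof -
  obtain c where c: "c \<in> carrier (bar_chains R G 2)" "b = bar_boundary R G 2 c" using b by (auto simp: B1_eq)
  let ?S = "{xs. c xs \<noteq> 0}" and ?T = "{ys. b ys \<noteq> 0} \<union> (\<lambda>xs. [xs ! 1]) ` {xs. c xs \<noteq> 0} \<union> (\<lambda>xs. [xs ! 0 \<otimes> xs ! 1]) ` {xs. c xs \<noteq> 0} \<union> (\<lambda>xs. [xs ! 0]) ` {xs. c xs \<noteq> 0}"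
  have finS: "finite ?S" using chain_finite[OF c(1)] .
  have finT: "finite ?T" using finS chain_finite[OF boundary_in_C1[OF c(1)]] c(2) by auto
  have "chain_eval f b = (\<Sum>ys\<in>?T. b ys * f (hd ys)) mod int p" by (rule chain_eval_eq[OF finT]) auto
  also have "\<dots> = (\<Sum>ys\<in>?T. (\<Sum>xs\<in>?S. c xs * face_sign G 2 xs ys) * f (hd ys)) mod int p"
    unfolding c(2) boundary_eq[OF c(1) _ finS, simplified]
    by (subst mod_sum_eq[symmetric], subst (2) mod_sum_eq[symmetric]) (simp add: mod_simps)
  also have "(\<Sum>ys\<in>?T. (\<Sum>xs\<in>?S. c xs * face_sign G 2 xs ys) * f (hd ys))
     = (\<Sum>xs\<in>?S. c xs * (\<Sum>ys\<in>?T. face_sign G 2 xs ys * f (hd ys)))"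
    by (simp only: sum_distrib_right sum_distrib_left mult.assoc) (rule sum.swap)
  also have "\<dots> mod int p = (\<Sum>xs\<in>?S. (c xs * (\<Sum>ys\<in>?T. face_sign G 2 xs ys * f (hd ys))) mod int p) mod int p"
    by (rule mod_sum_eq[symmetric])
  also have "\<dots> = (\<Sum>xs\<in>?S. 0) mod int p"
  proof (intro arg_cong[where f = "\<lambda>x. x mod int p"] sum.cong refl)
    fix xs assume xs: "xs \<in> ?S"
    obtain g h where gh: "xs = [g, h]" "g \<in> carrier G" "h \<in> carrier G" using C2_elim[OF c(1)] xs by blast
    have m: "[h] \<in> ?T" "[g \<otimes> h] \<in> ?T" "[g] \<in> ?T" using xs gh by (auto intro!: image_eqI[of _ _ xs])
    have pick: "(\<Sum>ys\<in>?T. (if ys = [z] then 1 else 0) * f (hd ys)) = f z" if "[z] \<in> ?T" for z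
    proof -
      have "(\<Sum>ys\<in>?T. (if ys = [z] then 1 else 0) * f (hd ys)) = (\<Sum>ys\<in>?T. if ys = [z] then f z else 0)"
        by (rule sum.cong) auto
      thus ?thesis using that finT by (simp only: sum.delta if_True)
    qed
    have "(\<Sum>ys\<in>?T. face_sign G 2 xs ys * f (hd ys)) = f h - f (g \<otimes> h) + f g"
      unfolding gh(1) face_sign_2 ring_distribs sum.distrib sum_subtractf pick[OF m(1)] pick[OF m(2)] pick[OF m(3)] ..
    also have "\<dots> mod int p = (f h - (f g + f h) + f g) mod int p"
      unfolding fp_homs_mult[OF f gh(2,3)] by (intro mod_add_cong mod_diff_cong; simp)
    also have "\<dots> = 0" by simp
    finally have "(\<Sum>ys\<in>?T. face_sign G 2 xs ys * f (hd ys)) mod int p = 0" .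
    moreover have z0: "(u * v) mod int p = 0" if "v mod int p = 0" for u v using that by auto
    ultimately show "(c xs * (\<Sum>ys\<in>?T. face_sign G 2 xs ys * f (hd ys))) mod int p = 0" by (intro z0)
  qed
  finally show ?thesis by simp
qed

lemma chain_eval_single:
  assumes "f \<in> fp_homs p G" "g \<in> carrier G" shows "chain_eval f (single g) = f g"
proof -
  have "chain_eval f (single g) = (\<Sum>xs\<in>{[g]}. single g xs * f (hd xs)) mod int p"
    by (rule chain_eval_eq) (auto simp: single_def split: if_splits)
  thus ?thesis using fp_homs_range[OF assms] by (simp add: single_def)
qed

text \<open>Evaluation on chains and restriction to the chains \<open>single g\<close> are mutually
  inverse: the first homology is the abelianization modulo \<open>p\<close>, and its dual is the
  group of homomorphisms to the cyclic group of order \<open>p\<close>.\<close>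

lemma card_fp_homs_dual: "card (fp_homs p G) = card H1.dual"
proof -
  define rep where "rep A = (SOME c. c \<in> carrier C1 \<and> A = cl c)" for A
  have rep: "rep A \<in> carrier C1 \<and> A = cl (rep A)" if "A \<in> carrier H1" for A
  proof -
    have "\<exists>c. c \<in> carrier C1 \<and> A = cl c" using that H1_facts(5) by auto
    thus ?thesis unfolding rep_def by (rule someI_ex)
  qed
  define \<Phi> where "\<Phi> f = (\<lambda>A\<in>carrier H1. chain_eval f (rep A))" for f
  define \<Psi> where "\<Psi> \<phi> = (\<lambda>g\<in>carrier G. \<phi> (cl (single g)))" for \<phi> :: "('a list \<Rightarrow> int) set \<Rightarrow> int"
  have clH: "cl c \<in> carrier H1" if "c \<in> carrier C1" for c using that H1_facts(5) by blast
  have \<Phi>_cl: "\<Phi> f (cl c) = chain_eval f c" if f: "f \<in> fp_homs p G" and c: "c \<in> carrier C1" for f c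
  proof -
    have r: "rep (cl c) \<in> carrier C1" "cl (rep (cl c)) = cl c" using rep[OF clH[OF c]] by auto
    then obtain b where b: "b \<in> B1" "rep (cl c) = b \<oplus>\<^bsub>C1\<^esub> c" using H1_facts(4)[OF r(1) c] by blast
    have "b \<in> carrier C1" using b B1_submodule by (auto simp: submodule_def)
    hence "chain_eval f (rep (cl c)) = (0 + chain_eval f c) mod int p"
      using chain_eval_add[OF _ c] chain_eval_boundary[OF f b(1)] b(2) by metis
    thus ?thesis using clH[OF c] by (simp add: \<Phi>_def chain_eval_def)
  qed
  have \<Phi>: "\<Phi> f \<in> H1.dual" if f: "f \<in> fp_homs p G" for f
    unfolding H1.dual_def
  proof (intro CollectI conjI ballI)
    show "\<Phi> f \<in> carrier H1 \<rightarrow>\<^sub>E carrier R"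
      using p_pos mem_R by (auto simp: \<Phi>_def chain_eval_def)
  next
    fix v w assume "v \<in> carrier H1" "w \<in> carrier H1"
    then obtain c d where cd: "c \<in> carrier C1" "d \<in> carrier C1" "v = cl c" "w = cl d" using H1_facts(5) by auto
    show "\<Phi> f (v \<oplus>\<^bsub>H1\<^esub> w) = \<Phi> f v \<oplus>\<^bsub>R\<^esub> \<Phi> f w"
      unfolding cd(3,4) H1_facts(2)[OF cd(1,2)] \<Phi>_cl[OF f C1.M.a_closed[OF cd(1,2)]] \<Phi>_cl[OF f cd(1)] \<Phi>_cl[OF f cd(2)]
      by (simp only: chain_eval_add[OF cd(1,2)] R_ops)
  next
    fix a v assume a: "a \<in> carrier R" and "v \<in> carrier H1"
    then obtain c where c: "c \<in> carrier C1" "v = cl c" using H1_facts(5) by auto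
    show "\<Phi> f (a \<odot>\<^bsub>H1\<^esub> v) = a \<otimes>\<^bsub>R\<^esub> \<Phi> f v"
      unfolding c(2) H1_facts(3)[OF a c(1)] \<Phi>_cl[OF f C1.smult_closed[OF a c(1)]] \<Phi>_cl[OF f c(1)]
      by (simp only: chain_eval_smult[OF c(1)] R_ops)
  qed
  have \<Psi>: "\<Psi> \<phi> \<in> fp_homs p G" if \<phi>: "\<phi> \<in> H1.dual" for \<phi>
  proof -
    have "\<phi> \<in> carrier H1 \<rightarrow> carrier R" and
      ad: "\<And>v w. v \<in> carrier H1 \<Longrightarrow> w \<in> carrier H1 \<Longrightarrow> \<phi> (v \<oplus>\<^bsub>H1\<^esub> w) = \<phi> v \<oplus>\<^bsub>R\<^esub> \<phi> w"
      using \<phi> by (auto simp: H1.dual_def)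
    thus ?thesis
      using cl_carrier cl_mult ad[OF cl_carrier cl_carrier] mem_R
      by (auto simp: fp_homs_def \<Psi>_def R_ops Pi_iff)
  qed
  have gen: "generate G (carrier G) = carrier G"
    using generate_incl[of "carrier G"] generate.incl[of _ "carrier G" G] by blast
  have "bij_betw \<Phi> (fp_homs p G) H1.dual"
  proof (rule bij_betw_byWitness[where f' = \<Psi>])
    show "\<forall>f\<in>fp_homs p G. \<Psi> (\<Phi> f) = f"
    proof
      fix f assume f: "f \<in> fp_homs p G"
      show "\<Psi> (\<Phi> f) = f"
      proof
        fix g show "\<Psi> (\<Phi> f) g = f g"
          using \<Phi>_cl[OF f single_C1] chain_eval_single[OF f] f
          by (cases "g \<in> carrier G") (auto simp: \<Psi>_def fp_homs_def PiE_def extensional_def)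
      qed
    qed
    show "\<forall>\<phi>\<in>H1.dual. \<Phi> (\<Psi> \<phi>) = \<phi>"
    proof
      fix \<phi> assume \<phi>: "\<phi> \<in> H1.dual"
      show "\<Phi> (\<Psi> \<phi>) = \<phi>"
      proof (rule H1.dual_eqI[OF \<Phi>[OF \<Psi>[OF \<phi>]] \<phi> _ span_single[OF order_refl gen]])
        show "(\<lambda>x. cl (single x)) ` carrier G \<subseteq> carrier H1" using cl_carrier by auto
        fix v assume "v \<in> (\<lambda>x. cl (single x)) ` carrier G"
        then obtain g where g: "g \<in> carrier G" "v = cl (single g)" by auto
        show "\<Phi> (\<Psi> \<phi>) v = \<phi> v"
          using \<Phi>_cl[OF \<Psi>[OF \<phi>] single_C1[OF g(1)]] chain_eval_single[OF \<Psi>[OF \<phi>] g(1)] g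
          by (simp add: \<Psi>_def)
      qed
    qed
  qed (use \<Phi> \<Psi> in auto)
  thus ?thesis by (rule bij_betw_same_card)
qed

end

text \<open>From here on the homology enters only through this count. The finite generating set puts
  \<open>dim\<close> into the finite-dimensional case, where it has its meaning.\<close>

theorem card_fp_homs:
  assumes "group G" "prime p" "finite X" "X \<subseteq> carrier G" "generate G X = carrier G"
  shows "card (fp_homs p G) = p ^ mod_homology_dim p G"
proof -
  interpret bar_mod_p G p using assms by (simp add: bar_mod_p_def bar_mod_p_axioms_def)
  have "H1.fin_dim"
    unfolding H1.fin_dim_def
  proof (intro exI conjI)
    show "(\<lambda>x. cl (single x)) ` X \<subseteq> carrier H1" using assms(4) cl_carrier by auto
    show "H1.span ((\<lambda>x. cl (single x)) ` X) = carrier H1" by (rule span_single[OF assms(4,5)])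
  qed (use assms(3) in simp)
  moreover have "card (carrier R) = p" "finite (carrier R)" by (auto simp: residue_ring_def)
  ultimately show ?thesis
    using card_fp_homs_dual H1.card_dual by (simp add: mod_homology_dim_def)
qed

section \<open>Presentations by words\<close>

definition word_step :: "'l set \<Rightarrow> 'l list set \<Rightarrow> ('l list \<times> 'l list) set" where
  "word_step L R = {(u @ r @ v, u @ v) | u r v. u \<in> lists L \<and> v \<in> lists L \<and> r \<in> R}"

definition word_equiv :: "'l set \<Rightarrow> 'l list set \<Rightarrow> ('l list \<times> 'l list) set" where
  "word_equiv L R = (word_step L R \<union> (word_step L R)\<inverse>)\<^sup>*"

fun word_val :: "('a, 'b) monoid_scheme \<Rightarrow> ('l \<Rightarrow> 'a) \<Rightarrow> 'l list \<Rightarrow> 'a" where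
  "word_val G ev [] = \<one>\<^bsub>G\<^esub>"
| "word_val G ev (l # w) = ev l \<otimes>\<^bsub>G\<^esub> word_val G ev w"

text \<open>A finite presentation as a monoid: inverses of letters are values of letters, and
  cancellations are consequences of the relators. A function of words then descends to the group as
  soon as it ignores inserted relators (\<open>word_equiv_invariant\<close>), which is how all maps
  out of subgroups are constructed later.\<close>

definition monoid_presentation ::
  "('a, 'b) monoid_scheme \<Rightarrow> 'l set \<Rightarrow> ('l \<Rightarrow> 'a) \<Rightarrow> 'l list set \<Rightarrow> bool" where
  "monoid_presentation G L ev R \<longleftrightarrow>
     finite L \<and> finite R \<and> R \<subseteq> lists L \<and> ev \<in> L \<rightarrow> carrier G \<and>
     (\<forall>l\<in>L. \<exists>l'\<in>L. ev l' = inv\<^bsub>G\<^esub> (ev l)) \<and>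
     (\<forall>g\<in>carrier G. \<exists>w\<in>lists L. word_val G ev w = g) \<and>
     (\<forall>r\<in>R. word_val G ev r = \<one>\<^bsub>G\<^esub>) \<and>
     (\<forall>w\<in>lists L. \<forall>w'\<in>lists L. word_val G ev w = word_val G ev w' \<longrightarrow> (w, w') \<in> word_equiv L R)"

lemma word_equiv_sym: "(w, w') \<in> word_equiv L R \<Longrightarrow> (w', w) \<in> word_equiv L R"
  unfolding word_equiv_def
  by (metis converse_Un converse_converse rtrancl_converseI sup_commute)

lemma word_equiv_trans: "(u, v) \<in> word_equiv L R \<Longrightarrow> (v, w) \<in> word_equiv L R \<Longrightarrow> (u, w) \<in> word_equiv L R"
  unfolding word_equiv_def by (rule rtrancl_trans)

lemma word_equiv_cong:
  assumes "(w, w') \<in> word_equiv L R" "a \<in> lists L" "b \<in> lists L"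
  shows "(a @ w @ b, a @ w' @ b) \<in> word_equiv L R"
  using assms(1) unfolding word_equiv_def
proof (induction rule: rtrancl_induct)
  case (step y z)
  have st: "(a @ y @ b, a @ z @ b) \<in> word_step L R" if "(y, z) \<in> word_step L R" for y z
  proof -
    obtain u r v where e: "y = u @ r @ v" "z = u @ v" "u \<in> lists L" "v \<in> lists L" "r \<in> R"
      using \<open>(y, z) \<in> word_step L R\<close> by (auto simp: word_step_def)
    moreover have "(a @ y @ b, a @ z @ b) = ((a @ u) @ r @ (v @ b), (a @ u) @ (v @ b))" using e by simp
    moreover have "a @ u \<in> lists L" "v @ b \<in> lists L" using assms e by auto
    ultimately show ?thesis unfolding word_step_def by blast
  qed
  have "(a @ y @ b, a @ z @ b) \<in> word_step L R \<union> (word_step L R)\<inverse>"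
    using step(2) st[of y z] st[of z y] by auto
  thus ?case using step(3) by (meson rtrancl.rtrancl_into_rtrancl)
qed auto

lemma word_equiv_relator: "r \<in> R \<Longrightarrow> (r, []) \<in> word_equiv L R"
proof -
  assume "r \<in> R"
  hence "([] @ r @ [], [] @ []) \<in> word_step L R" unfolding word_step_def by blast
  thus ?thesis unfolding word_equiv_def by auto
qed

context group begin

lemma word_val_closed: "ev \<in> L \<rightarrow> carrier G \<Longrightarrow> w \<in> lists L \<Longrightarrow> word_val G ev w \<in> carrier G"
  by (induction w) auto

lemma word_val_append:
  assumes "ev \<in> L \<rightarrow> carrier G" "u \<in> lists L" "v \<in> lists L"
  shows "word_val G ev (u @ v) = word_val G ev u \<otimes> word_val G ev v"
  using assms(2)
proof (induction u)
  case Nil thus ?case using word_val_closed[OF assms(1,3)] by simp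
next
  case (Cons l u)
  hence "ev l \<in> carrier G" "word_val G ev u \<in> carrier G" using assms(1) word_val_closed by auto
  thus ?case using Cons word_val_closed[OF assms(1,3)] by (simp add: m_assoc)
qed

end

section \<open>Free groups as words modulo cancellation\<close>

lemma free_equiv_word_equiv:
  "free_equiv X = word_equiv (X \<times> UNIV) {[(x, b), (x, \<not> b)] | x b. x \<in> X}"
proof -
  have "cancellation X = word_step (X \<times> UNIV) {[(x, b), (x, \<not> b)] | x b. x \<in> X}"
    unfolding cancellation_def word_step_def free_words_def by blast
  thus ?thesis by (simp add: free_equiv_def word_equiv_def)
qed

definition inverse_word :: "('x \<times> bool) list \<Rightarrow> ('x \<times> bool) list" where
  "inverse_word w = map (\<lambda>(x, b). (x, \<not> b)) (rev w)"

lemma inverse_word_closed: "w \<in> free_words X \<Longrightarrow> inverse_word w \<in> free_words X"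
  by (auto simp: inverse_word_def free_words_def lists_eq_set)

lemma inverse_word_left:
  assumes "\<And>x b. x \<in> X \<Longrightarrow> [(x, b), (x, \<not> b)] \<in> R" "w \<in> free_words X"
  shows "(inverse_word w @ w, []) \<in> word_equiv (X \<times> UNIV) R"
  using assms(2)
proof (induction w)
  case Nil thus ?case by (simp add: inverse_word_def word_equiv_def)
next
  case (Cons l w)
  obtain x b where l: "l = (x, b)" "x \<in> X" using Cons.prems by (cases l) (auto simp: free_words_def)
  have w: "w \<in> free_words X" using Cons.prems by (simp add: free_words_def)
  have "([(x, \<not> b), (x, \<not> \<not> b)], []) \<in> word_equiv (X \<times> UNIV) R"
    using assms(1)[OF l(2)] word_equiv_relator by blast
  from word_equiv_cong[OF this, of "inverse_word w" w] w inverse_word_closed[OF w]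
  have "(inverse_word (l # w) @ l # w, inverse_word w @ w) \<in> word_equiv (X \<times> UNIV) R"
    by (simp add: inverse_word_def l free_words_def)
  thus ?case using Cons.IH[OF w] word_equiv_trans by blast
qed

context
  fixes X :: "'x set"
begin

abbreviation "cls \<equiv> \<lambda>u. free_equiv X `` {u}"

lemma cls_eq_iff: "cls u = cls v \<longleftrightarrow> (u, v) \<in> free_equiv X"
proof
  assume "cls u = cls v"
  moreover have "v \<in> cls v" by (simp add: free_equiv_def)
  ultimately show "(u, v) \<in> free_equiv X" by auto
next
  assume "(u, v) \<in> free_equiv X"
  thus "cls u = cls v"
    unfolding free_equiv_word_equiv by (auto intro: word_equiv_trans word_equiv_sym)
qed

lemma free_equiv_append:
  assumes "(u, u') \<in> free_equiv X" "(v, v') \<in> free_equiv X" "u' \<in> free_words X" "v \<in> free_words X"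
  shows "(u @ v, u' @ v') \<in> free_equiv X"
proof -
  have "(u @ v, u' @ v) \<in> free_equiv X"
    using word_equiv_cong[OF assms(1)[unfolded free_equiv_word_equiv], of "[]" v] assms(4)
    by (simp add: free_equiv_word_equiv free_words_def)
  moreover have "(u' @ v, u' @ v') \<in> free_equiv X"
    using word_equiv_cong[OF assms(2)[unfolded free_equiv_word_equiv], of u' "[]"] assms(3)
    by (simp add: free_equiv_word_equiv free_words_def)
  ultimately show ?thesis unfolding free_equiv_word_equiv by (rule word_equiv_trans)
qed

lemma free_equiv_closed: "(u, v) \<in> free_equiv X \<Longrightarrow> u \<in> free_words X \<Longrightarrow> v \<in> free_words X"
  unfolding free_equiv_def
  by (induction rule: rtrancl_induct) (auto simp: cancellation_def free_words_def)

lemma free_group_carrier: "carrier (free_group X) = cls ` free_words X"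
  by (auto simp: free_group_def quotient_def)

lemma free_group_mult:
  assumes "u \<in> free_words X" "v \<in> free_words X"
  shows "cls u \<otimes>\<^bsub>free_group X\<^esub> cls v = cls (u @ v)"
proof -
  have "cls (u' @ v') = cls (u @ v)" if "u' \<in> cls u" "v' \<in> cls v" for u' v'
  proof -
    have e: "(u, u') \<in> free_equiv X" "(v, v') \<in> free_equiv X" using that by auto
    hence "(u @ v, u' @ v') \<in> free_equiv X"
      using free_equiv_append e assms free_equiv_closed by blast
    thus ?thesis by (metis cls_eq_iff)
  qed
  moreover have "u \<in> cls u" "v \<in> cls v" by (auto simp: free_equiv_def)
  ultimately have "(\<Union>u'\<in>cls u. \<Union>v'\<in>cls v. cls (u' @ v')) = cls (u @ v)"
    by blast
  thus ?thesis by (simp add: free_group_def)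
qed

lemma free_group_one: "\<one>\<^bsub>free_group X\<^esub> = cls []"
  by (simp add: free_group_def)

lemma free_words_append: "u \<in> free_words X \<Longrightarrow> v \<in> free_words X \<Longrightarrow> u @ v \<in> free_words X"
  by (simp add: free_words_def)

lemma free_words_Nil: "[] \<in> free_words X"
  by (simp add: free_words_def)

lemma cls_inverse_word:
  assumes "u \<in> free_words X" shows "cls (inverse_word u @ u) = cls []"
proof -
  have "(inverse_word u @ u, []) \<in> free_equiv X"
    unfolding free_equiv_word_equiv by (rule inverse_word_left) (use assms in auto)
  thus ?thesis by (rule iffD2[OF cls_eq_iff])
qed

lemma free_group_group: "group (free_group X)"
proof (rule groupI)
  show "\<one>\<^bsub>free_group X\<^esub> \<in> carrier (free_group X)"
    using free_words_Nil by (auto simp: free_group_one free_group_carrier)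
  fix a assume "a \<in> carrier (free_group X)"
  then obtain u where u: "u \<in> free_words X" "a = cls u" by (auto simp: free_group_carrier)
  show "\<one>\<^bsub>free_group X\<^esub> \<otimes>\<^bsub>free_group X\<^esub> a = a"
    using u free_group_mult[OF free_words_Nil u(1)] by (simp add: free_group_one)
  have "cls (inverse_word u @ u) = cls []" using cls_inverse_word u(1) by blast
  thus "\<exists>b\<in>carrier (free_group X). b \<otimes>\<^bsub>free_group X\<^esub> a = \<one>\<^bsub>free_group X\<^esub>"
    using u free_group_mult[OF inverse_word_closed[OF u(1)] u(1)] inverse_word_closed[OF u(1)]
    by (auto simp: free_group_one free_group_carrier)
next
  fix a b assume "a \<in> carrier (free_group X)" "b \<in> carrier (free_group X)"
  then obtain u v where "u \<in> free_words X" "a = cls u" "v \<in> free_words X" "b = cls v"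
    by (auto simp: free_group_carrier)
  thus "a \<otimes>\<^bsub>free_group X\<^esub> b \<in> carrier (free_group X)"
    using free_group_mult free_words_append by (auto simp: free_group_carrier)
next
  fix a b c assume "a \<in> carrier (free_group X)" "b \<in> carrier (free_group X)" "c \<in> carrier (free_group X)"
  then obtain u v w where "u \<in> free_words X" "a = cls u" "v \<in> free_words X" "b = cls v"
     "w \<in> free_words X" "c = cls w"
    by (auto simp: free_group_carrier)
  thus "a \<otimes>\<^bsub>free_group X\<^esub> b \<otimes>\<^bsub>free_group X\<^esub> c = a \<otimes>\<^bsub>free_group X\<^esub> (b \<otimes>\<^bsub>free_group X\<^esub> c)"
    by (simp add: free_group_mult free_words_append)
qed

lemma free_group_inv:
  assumes "u \<in> free_words X" shows "inv\<^bsub>free_group X\<^esub> (cls u) = cls (inverse_word u)"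
proof -
  have "cls (inverse_word u @ u) = cls []" using cls_inverse_word assms by blast
  thus ?thesis
    using assms free_group_mult[OF inverse_word_closed[OF assms] assms] inverse_word_closed[OF assms]
    by (intro group.inv_equality[OF free_group_group]) (auto simp: free_group_one free_group_carrier)
qed

end

lemma normal_closure_normal:
  assumes "group G" "R \<subseteq> carrier G" shows "normal_closure G R \<lhd> G" "R \<subseteq> normal_closure G R"
proof -
  interpret group G by fact
  have c: "carrier G \<lhd> G" unfolding normal_inv_iff using subgroup_self by auto
  show "normal_closure G R \<lhd> G"
    unfolding normal_inv_iff
  proof (intro conjI ballI)
    show "subgroup (normal_closure G R) G"
      unfolding normal_closure_def
      by (rule subgroups_Inter) (use c assms normal_imp_subgroup in auto)
    fix x h assume "x \<in> carrier G" "h \<in> normal_closure G R"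
    thus "x \<otimes>\<^bsub>G\<^esub> h \<otimes>\<^bsub>G\<^esub> inv\<^bsub>G\<^esub> x \<in> normal_closure G R"
      unfolding normal_closure_def using normal.inv_op_closed2 by fastforce
  qed
  show "R \<subseteq> normal_closure G R" by (auto simp: normal_closure_def)
qed

text \<open>The classes of words that all relators together reduce to the empty word form a normal
  subgroup \<open>M\<close> of the free group. It contains the given relators, hence their normal
  closure \<open>N\<close>, so words with the same value in the quotient by \<open>N\<close> are
  equivalent.\<close>

lemma finitely_presented_monoid_presentation:
  fixes G (structure)
  assumes G: "group G" and fp: "finitely_presented G"
  shows "\<exists>(L :: (nat \<times> bool) set) ev R. monoid_presentation G L ev R"
proof -
  interpret group G by fact
  obtain X :: "nat set" and R where XR: "finite X" "finite R" "R \<subseteq> carrier (free_group X)"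
    and iso: "G \<cong> free_group X Mod normal_closure (free_group X) R"
    using fp unfolding finitely_presented_def by blast
  define F where "F = free_group X"
  define N where "N = normal_closure F R"
  have gF: "group F" unfolding F_def by (rule free_group_group)
  have N: "N \<lhd> F" "R \<subseteq> N" using normal_closure_normal[OF gF] XR by (auto simp: N_def F_def)
  interpret F: group F by fact
  interpret N: normal N F by fact
  interpret Q: group "F Mod N" by (rule N.factorgroup_is_group)
  obtain \<psi> where \<psi>: "\<psi> \<in> iso (F Mod N) G"
    using iso iso_set_sym unfolding is_iso_def N_def F_def by blast
  hence bij: "bij_betw \<psi> (carrier (F Mod N)) (carrier G)" and hom\<psi>: "\<psi> \<in> hom (F Mod N) G" by (auto simp: iso_def)
  let ?cls = "\<lambda>u. free_equiv X `` {u}"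
  define \<pi> where "\<pi> u = \<psi> (N #>\<^bsub>F\<^esub> ?cls u)" for u
  have clsF: "?cls u \<in> carrier F" if "u \<in> free_words X" for u
    using that by (auto simp: F_def free_group_carrier)
  have inQ: "N #>\<^bsub>F\<^esub> ?cls u \<in> carrier (F Mod N)" if "u \<in> free_words X" for u
    using clsF[OF that] N.subset by (auto simp: FactGroup_def intro: F.rcosetsI)
  have \<pi>_app: "\<pi> (u @ v) = \<pi> u \<otimes> \<pi> v" if "u \<in> free_words X" "v \<in> free_words X" for u v
  proof -
    have "N #>\<^bsub>F\<^esub> ?cls (u @ v) = (N #>\<^bsub>F\<^esub> ?cls u) \<otimes>\<^bsub>F Mod N\<^esub> (N #>\<^bsub>F\<^esub> ?cls v)"
      using free_group_mult[OF that] N.rcos_sum[OF clsF[OF that(1)] clsF[OF that(2)]] by (simp add: FactGroup_def F_def)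
    thus ?thesis using hom\<psi> inQ that by (auto simp: \<pi>_def hom_def)
  qed
  have \<pi>_Nil: "\<pi> [] = \<one>"
    using hom_one[OF hom\<psi> Q.is_group G] N.subset free_group_one[of X] F.coset_mult_one[of N]
    by (simp add: \<pi>_def FactGroup_def F_def)
  define ev where "ev l = \<pi> [l]" for l
  let ?L = "X \<times> (UNIV :: bool set)"
  have val: "word_val G ev w = \<pi> w" if "w \<in> lists ?L" for w
    using that
  proof (induction w)
    case (Cons l w)
    thus ?case using \<pi>_app[of "[l]" w] by (simp add: ev_def free_words_def)
  qed (simp add: \<pi>_Nil)
  have \<pi>_car: "\<pi> u \<in> carrier G" if "u \<in> free_words X" for u
    using inQ[OF that] hom\<psi> by (auto simp: \<pi>_def hom_def)
  have ev: "ev \<in> ?L \<rightarrow> carrier G" using \<pi>_car by (auto simp: ev_def free_words_def)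
  define canc where "canc = (\<lambda>(x, b). [(x, b), (x, \<not> b)]) ` ?L"
  have canc: "canc = {[(x, b), (x, \<not> b)] | x b. x \<in> X}" by (auto simp: canc_def)
  define rep where "rep A = (SOME u. u \<in> free_words X \<and> A = ?cls u)" for A
  have rep: "rep A \<in> free_words X" "?cls (rep A) = A" if "A \<in> R" for A
  proof -
    have "\<exists>u. u \<in> free_words X \<and> A = ?cls u" using XR(3) that by (auto simp: free_group_carrier)
    hence "rep A \<in> free_words X \<and> A = ?cls (rep A)" unfolding rep_def by (rule someI_ex)
    thus "rep A \<in> free_words X" "?cls (rep A) = A" by auto
  qed
  let ?R = "canc \<union> rep ` R" and ?E = "word_equiv ?L (canc \<union> rep ` R)"
  have free_sub: "free_equiv X \<subseteq> ?E"
    unfolding free_equiv_word_equiv canc[symmetric] word_equiv_def word_step_def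
    by (intro rtrancl_mono Un_mono converse_mono[THEN iffD2]) auto
  have \<pi>_canc: "\<pi> [(x, b), (x, \<not> b)] = \<one>" if "x \<in> X" for x b
  proof -
    have "([(x, b), (x, \<not> b)], []) \<in> free_equiv X"
      unfolding free_equiv_word_equiv by (rule word_equiv_relator) (use that in blast)
    thus ?thesis using \<pi>_Nil cls_eq_iff[of X "[(x, b), (x, \<not> b)]" "[]"] by (simp add: \<pi>_def)
  qed
  define M where "M = ?cls ` {u \<in> free_words X. (u, []) \<in> ?E}"
  have inv_left: "(inverse_word u @ u, []) \<in> ?E" if "u \<in> free_words X" for u
    by (rule inverse_word_left[OF _ that]) (auto simp: canc)
  have inv_inv: "inverse_word (inverse_word u) = u" for u :: "(nat \<times> bool) list"
    by (induction u) (auto simp: inverse_word_def)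
  have inv_right: "(u @ inverse_word u, []) \<in> ?E" if "u \<in> free_words X" for u
    using inv_left[OF inverse_word_closed[OF that]] inv_inv by simp
  have M: "M \<lhd> F"
    unfolding F.normal_inv_iff
  proof (intro conjI ballI)
    show "subgroup M F"
    proof (rule F.subgroupI)
      show "M \<subseteq> carrier F" using clsF by (auto simp: M_def)
      show "M \<noteq> {}" using free_words_Nil by (auto simp: M_def word_equiv_def)
    next
      fix a assume "a \<in> M"
      then obtain u where u: "a = ?cls u" "u \<in> free_words X" "(u, []) \<in> ?E" by (auto simp: M_def)
      have "(inverse_word u @ u @ [], inverse_word u @ [] @ []) \<in> ?E"
        using word_equiv_cong[OF u(3), of "inverse_word u" "[]"] inverse_word_closed[OF u(2)]
        by (simp add: free_words_def)
      hence "(inverse_word u, []) \<in> ?E" using inv_left[OF u(2)] word_equiv_sym word_equiv_trans by fastforce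
      thus "inv\<^bsub>F\<^esub> a \<in> M" using u free_group_inv[OF u(2)] inverse_word_closed[OF u(2)] by (auto simp: M_def F_def)
    next
      fix a b assume "a \<in> M" "b \<in> M"
      then obtain u v where u: "a = ?cls u" "u \<in> free_words X" "(u, []) \<in> ?E"
        and v: "b = ?cls v" "v \<in> free_words X" "(v, []) \<in> ?E" by (auto simp: M_def)
      have "([] @ u @ v, [] @ [] @ v) \<in> ?E"
        using word_equiv_cong[OF u(3), of "[]" v] v by (simp add: free_words_def)
      hence "(u @ v, []) \<in> ?E" using v(3) word_equiv_trans by fastforce
      thus "a \<otimes>\<^bsub>F\<^esub> b \<in> M" using u v free_group_mult[OF u(2) v(2)] by (auto simp: M_def F_def free_words_append)
    qed
    fix x h assume "x \<in> carrier F" "h \<in> M"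
    then obtain u v where u: "x = ?cls u" "u \<in> free_words X"
        and v: "h = ?cls v" "v \<in> free_words X" "(v, []) \<in> ?E" by (auto simp: M_def F_def free_group_carrier)
    have "(u @ v @ inverse_word u, u @ [] @ inverse_word u) \<in> ?E"
      using word_equiv_cong[OF v(3), of u "inverse_word u"] u inverse_word_closed[OF u(2)] by (simp add: free_words_def)
    hence "(u @ v @ inverse_word u, []) \<in> ?E" using inv_right[OF u(2)] word_equiv_trans by fastforce
    thus "x \<otimes>\<^bsub>F\<^esub> h \<otimes>\<^bsub>F\<^esub> inv\<^bsub>F\<^esub> x \<in> M"
      using u v inverse_word_closed[OF u(2)]
      by (auto simp: M_def F_def free_group_inv free_group_mult free_words_append)
  qed
  have "R \<subseteq> M"
  proof
    fix A assume A: "A \<in> R"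
    have "(rep A, []) \<in> ?E" by (rule word_equiv_relator) (use A in blast)
    thus "A \<in> M" using rep[OF A] by (force simp: M_def)
  qed
  hence NM: "N \<subseteq> M" using M unfolding N_def normal_closure_def by blast
  \<comment> \<open>Once the word \<open>w @ inverse_word w'\<close> is equivalent to the empty
    word, so are \<open>w\<close>, \<open>w @ inverse_word w' @ w'\<close> and \<open>w'\<close> to
    one another.\<close>
  have main: "(w, w') \<in> ?E" if w: "w \<in> free_words X" "w' \<in> free_words X" "\<pi> w = \<pi> w'" for w w'
  proof -
    have "N #>\<^bsub>F\<^esub> ?cls w = N #>\<^bsub>F\<^esub> ?cls w'"
      using w bij inQ by (auto simp: \<pi>_def bij_betw_def dest: inj_onD)
    hence "?cls w \<otimes>\<^bsub>F\<^esub> inv\<^bsub>F\<^esub> ?cls w' \<in> N"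
      using w clsF N.rcos_module[OF gF] F.rcos_self[OF _ N.subgroup_axioms] by metis
    hence "?cls (w @ inverse_word w') \<in> M"
      using NM w by (auto simp: F_def free_group_inv free_group_mult inverse_word_closed)
    then obtain u where u: "(u, []) \<in> ?E" "?cls (w @ inverse_word w') = ?cls u" by (auto simp: M_def)
    have "(w @ inverse_word w', u) \<in> ?E" using u(2) free_sub cls_eq_iff by blast
    hence "(w @ inverse_word w', []) \<in> ?E" using u(1) word_equiv_trans by blast
    from word_equiv_cong[OF this, of "[]" w']
    have "(w @ inverse_word w' @ w', w') \<in> ?E" using w by (simp add: free_words_def)
    moreover have "(w @ inverse_word w' @ w', w) \<in> ?E"
      using word_equiv_cong[OF inv_left[OF w(2)], of w "[]"] w by (simp add: free_words_def)
    ultimately show ?thesis using word_equiv_sym word_equiv_trans by blast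
  qed
  have "monoid_presentation G ?L ev ?R"
    unfolding monoid_presentation_def
  proof (intro conjI ballI impI)
    show "finite ?L" "finite ?R" using XR by (auto simp: canc_def)
    show "?R \<subseteq> lists ?L" using rep by (auto simp: canc free_words_def)
    show "ev \<in> ?L \<rightarrow> carrier G" by (rule ev)
  next
    fix l assume l: "l \<in> ?L"
    obtain x b where xb: "l = (x, b)" "x \<in> X" using l by auto
    have "ev (x, \<not> b) \<otimes> ev (x, b) = \<one>"
      using \<pi>_app[of "[(x, \<not> b)]" "[(x, b)]"] \<pi>_canc[OF xb(2), of "\<not> b"] xb by (simp add: ev_def free_words_def)
    hence "inv (ev (x, b)) = ev (x, \<not> b)" using ev xb by (intro inv_equality) auto
    thus "\<exists>l'\<in>?L. ev l' = inv (ev l)" using xb by force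
  next
    fix g assume "g \<in> carrier G"
    hence "g \<in> \<psi> ` carrier (F Mod N)" using bij by (simp add: bij_betw_def)
    then obtain A where A: "A \<in> carrier (F Mod N)" "\<psi> A = g" by (metis imageE)
    then obtain B where "B \<in> carrier F" "A = N #>\<^bsub>F\<^esub> B" by (auto simp: FactGroup_def RCOSETS_def)
    then obtain u where "u \<in> free_words X" "A = N #>\<^bsub>F\<^esub> ?cls u" by (auto simp: F_def free_group_carrier)
    thus "\<exists>w\<in>lists ?L. word_val G ev w = g" using A val by (auto simp: \<pi>_def free_words_def)
  next
    fix r assume "r \<in> ?R"
    thus "word_val G ev r = \<one>"
    proof
      assume "r \<in> canc"
      thus ?thesis using \<pi>_canc val[of r] by (auto simp: canc)
    next
      assume "r \<in> rep ` R"
      then obtain A where A: "A \<in> R" "r = rep A" by blast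
      have "A \<in> N" using A N(2) by blast
      hence "N #>\<^bsub>F\<^esub> ?cls r = N #>\<^bsub>F\<^esub> ?cls []"
        using rep[OF A(1)] A N.subset free_group_one[of X] F.coset_join2[OF _ N.subgroup_axioms, of A] F.coset_mult_one[of N]
        by (auto simp: F_def)
      hence "\<pi> r = \<one>" using \<pi>_Nil by (simp add: \<pi>_def)
      thus ?thesis using val[of r] rep[OF A(1)] A by (simp add: free_words_def)
    qed
  next
    fix w w' assume "w \<in> lists ?L" "w' \<in> lists ?L" "word_val G ev w = word_val G ev w'"
    thus "(w, w') \<in> ?E" using main val by (auto simp: free_words_def)
  qed
  thus ?thesis by blast
qed

section \<open>Cheeger constants of coset graphs\<close>

text \<open>The lower bound \<open>e\<close> for the Cheeger constant with denominators cleared. For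
  a single coset it holds vacuously, in accordance with the value infinity.\<close>

definition expands :: "('a, 'b) monoid_scheme \<Rightarrow> 'a set \<Rightarrow> 'a set \<Rightarrow> real \<Rightarrow> bool" where
  "expands G H S e \<longleftrightarrow> (\<forall>A. A \<subseteq> rcosets\<^bsub>G\<^esub> H \<longrightarrow> 0 < card A \<longrightarrow> 2 * card A \<le> card (rcosets\<^bsub>G\<^esub> H) \<longrightarrow>
     e * real (card A) \<le> real (card (edge_boundary (schreier_graph G H S) A)))"

lemma cheeger_ge_iff: "ereal e \<le> cheeger_constant (schreier_graph G H S) \<longleftrightarrow> expands G H S e"
proof -
  have "ereal e \<le> cheeger_constant (schreier_graph G H S) \<longleftrightarrow>
    (\<forall>A. A \<subseteq> rcosets\<^bsub>G\<^esub> H \<longrightarrow> 0 < card A \<longrightarrow> real (card A) \<le> real (card (rcosets\<^bsub>G\<^esub> H)) / 2 \<longrightarrow>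
      e \<le> real (card (edge_boundary (schreier_graph G H S) A)) / real (card A))"
    unfolding cheeger_constant_def le_INF_iff by (auto simp: schreier_graph_def)
  also have "\<dots> \<longleftrightarrow> expands G H S e"
    unfolding expands_def
  proof (intro iff_allI imp_cong refl)
    fix A :: "'a set set"
    show "real (card A) \<le> real (card (rcosets\<^bsub>G\<^esub> H)) / 2 \<longleftrightarrow> 2 * card A \<le> card (rcosets\<^bsub>G\<^esub> H)" by linarith
    assume "0 < card A"
    thus "(e \<le> real (card (edge_boundary (schreier_graph G H S) A)) / real (card A)) =
       (e * real (card A) \<le> real (card (edge_boundary (schreier_graph G H S) A)))"
      by (simp add: pos_le_divide_eq)
  qed
  finally show ?thesis .
qed

context group begin

abbreviation boundary :: "'a set \<Rightarrow> 'a set \<Rightarrow> 'a set set \<Rightarrow> ('a set \<times> 'a) set" where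
  "boundary H S A \<equiv> edge_boundary (schreier_graph G H S) A"

lemma boundary_eq: "boundary H S A = {(C, s). C \<in> rcosets H \<and> s \<in> S \<and> (C \<in> A) \<noteq> (C #> s \<in> A)}"
  by (auto simp: edge_boundary_def schreier_graph_def)

lemma finite_boundary: "finite (rcosets H) \<Longrightarrow> finite S \<Longrightarrow> finite (boundary H S A)"
  by (rule finite_subset[of _ "(rcosets H) \<times> S"]) (auto simp: boundary_eq)

section \<open>Displacement of sets of cosets\<close>

lemma rcosets_mult_bij:
  assumes H: "subgroup H G" and g: "g \<in> carrier G"
  shows "bij_betw (\<lambda>C. C #> g) (rcosets H) (rcosets H)"
  by (rule bij_betw_byWitness[where f' = "\<lambda>C. C #> inv g"])
     (use g in \<open>auto simp: rcosets_mult_assoc[OF H] rcosets_mult_one[OF H] rcosets_mult_closed[OF H]\<close>)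

text \<open>The boundary of \<open>A\<close> with respect to one element \<open>g\<close>, which
  need not be a generator.\<close>

definition displaced :: "'a set \<Rightarrow> 'a set set \<Rightarrow> 'a \<Rightarrow> 'a set set" where
  "displaced H A g = {C \<in> rcosets H. (C \<in> A) \<noteq> (C #> g \<in> A)}"

lemma displaced_gen:
  assumes "subgroup H G" "finite (rcosets H)" "finite S" "s \<in> S"
  shows "card (displaced H A s) \<le> card (boundary H S A)"
proof -
  have "(\<lambda>C. (C, s)) ` displaced H A s \<subseteq> boundary H S A"
    using assms(4) by (auto simp: displaced_def boundary_eq)
  hence "card ((\<lambda>C. (C, s)) ` displaced H A s) \<le> card (boundary H S A)"
    using finite_boundary[OF assms(2,3)] by (rule card_mono[rotated])
  thus ?thesis by (simp add: card_image inj_on_def)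
qed

lemma displaced_inv:
  assumes H: "subgroup H G" and fin: "finite (rcosets H)" and g: "g \<in> carrier G"
  shows "card (displaced H A (inv g)) = card (displaced H A g)"
proof -
  have "bij_betw (\<lambda>C. C #> g) (displaced H A g) (displaced H A (inv g))"
    by (rule bij_betw_byWitness[where f' = "\<lambda>C. C #> inv g"])
       (use g in \<open>auto simp: displaced_def rcosets_mult_assoc[OF H] rcosets_mult_one[OF H] rcosets_mult_closed[OF H]\<close>)
  thus ?thesis by (metis bij_betw_same_card)
qed

lemma displaced_mult:
  assumes H: "subgroup H G" and fin: "finite (rcosets H)" and g: "g \<in> carrier G" and h: "h \<in> carrier G"
  shows "card (displaced H A (g \<otimes> h)) \<le> card (displaced H A g) + card (displaced H A h)"
proof -
  let ?f = "\<lambda>C. C #> g"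
  have "displaced H A (g \<otimes> h) \<subseteq> displaced H A g \<union> {C \<in> rcosets H. ?f C \<in> displaced H A h}"
    using g h by (auto simp: displaced_def rcosets_mult_assoc[OF H] rcosets_mult_closed[OF H])
  hence "card (displaced H A (g \<otimes> h)) \<le> card (displaced H A g \<union> {C \<in> rcosets H. ?f C \<in> displaced H A h})"
    using fin by (intro card_mono) (auto simp: displaced_def)
  also have "\<dots> \<le> card (displaced H A g) + card {C \<in> rcosets H. ?f C \<in> displaced H A h}" by (rule card_Un_le)
  also have "card {C \<in> rcosets H. ?f C \<in> displaced H A h} \<le> card (displaced H A h)"
  proof (rule card_inj_on_le[of ?f])
    show "inj_on ?f {C \<in> rcosets H. ?f C \<in> displaced H A h}"
      by (rule inj_on_subset[OF bij_betw_imp_inj_on[OF rcosets_mult_bij[OF H g]]]) auto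
    show "finite (displaced H A h)" using fin by (simp add: displaced_def)
  qed auto
  finally show ?thesis by simp
qed

text \<open>Displacement is subadditive and invariant under inversion, so the length of a word for
  \<open>g\<close> serves as constant. The point is the uniformity in \<open>H\<close> and
  \<open>A\<close>: estimates for one generating set, or for elements of a subgroup, carry over to
  \<open>S\<close> at all levels simultaneously.\<close>

lemma displaced_bound:
  assumes S: "finite S" "S \<subseteq> carrier G" and g: "g \<in> generate G S"
  shows "\<exists>k. \<forall>H A. subgroup H G \<longrightarrow> finite (rcosets H) \<longrightarrow> card (displaced H A g) \<le> k * card (boundary H S A)"
  using g
proof (induction rule: generate.induct)
  case one
  have "displaced H A \<one> = {}" if "subgroup H G" for H A
    using rcosets_mult_one[OF that] by (auto simp: displaced_def)
  thus ?case by (metis card.empty zero_le)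
next
  case (incl h)
  thus ?case using displaced_gen[OF _ _ S(1)] by (intro exI[of _ 1]) simp
next
  case (inv h)
  thus ?case using displaced_gen[OF _ _ S(1)] displaced_inv S(2) by (intro exI[of _ 1]) (simp add: subset_iff)
next
  case (eng g h)
  then obtain k l where
    k: "\<And>H A. subgroup H G \<Longrightarrow> finite (rcosets H) \<Longrightarrow> card (displaced H A g) \<le> k * card (boundary H S A)" and
    l: "\<And>H A. subgroup H G \<Longrightarrow> finite (rcosets H) \<Longrightarrow> card (displaced H A h) \<le> l * card (boundary H S A)"
    by blast
  have gh: "g \<in> carrier G" "h \<in> carrier G" using eng.hyps generate_in_carrier[OF S(2)] by auto
  have "card (displaced H A (g \<otimes> h)) \<le> (k + l) * card (boundary H S A)"
    if "subgroup H G" "finite (rcosets H)" for H A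
    using displaced_mult[OF that gh, of A] k[OF that, of A] l[OF that, of A] by (simp add: ring_distribs)
  thus ?case by blast
qed

lemma boundary_nonempty:
  assumes H: "subgroup H G" and fin: "finite (rcosets H)" and S: "finite S" "S \<subseteq> carrier G" "generate G S = carrier G"
    and A: "A \<subseteq> rcosets H" "A \<noteq> {}" "A \<noteq> rcosets H"
  shows "card (boundary H S A) > 0"
proof (rule ccontr)
  assume "\<not> ?thesis"
  hence b0: "card (boundary H S A) = 0" by simp
  obtain C D where CD: "C \<in> A" "D \<in> rcosets H" "D \<notin> A" using A by blast
  obtain g where g: "g \<in> carrier G" "D = C #> g" using rcosets_transitive[OF H _ CD(2), of C] CD A by blast
  obtain k where "card (displaced H A g) \<le> k * card (boundary H S A)"
    using displaced_bound[OF S(1,2), of g] g S(3) H fin by blast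
  hence "card (displaced H A g) = 0" using b0 by simp
  hence "displaced H A g = {}" using fin by (simp add: displaced_def)
  thus False using CD g A by (auto simp: displaced_def)
qed

text \<open>Connectivity alone gives a constant, the reciprocal of the index. It depends on
  \<open>H\<close>, so it helps for finitely many subgroups only.\<close>

lemma expands_positive:
  assumes H: "subgroup H G" and fin: "finite (rcosets H)" and S: "finite S" "S \<subseteq> carrier G" "generate G S = carrier G"
  shows "\<exists>e>0. expands G H S e"
proof (intro exI conjI)
  let ?V = "card (rcosets H)"
  have V: "?V > 0" using fin self_in_rcosets[OF H] by (metis card_gt_0_iff empty_iff)
  show "1 / real ?V > 0" using V by simp
  show "expands G H S (1 / real ?V)"
    unfolding expands_def
  proof (intro allI impI)
    fix A assume A: "A \<subseteq> rcosets H" "0 < card A" "2 * card A \<le> ?V"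
    have "A \<noteq> {}" "A \<noteq> rcosets H" using A by auto
    hence "card (boundary H S A) \<ge> 1" using boundary_nonempty[OF H fin S A(1)] by simp
    moreover have "1 / real ?V * real (card A) \<le> 1" using A V by simp
    ultimately show "1 / real ?V * real (card A) \<le> real (card (boundary H S A))" by linarith
  qed
qed

lemma expands_mono: "expands G H S e \<Longrightarrow> e' \<le> e \<Longrightarrow> expands G H S e'"
  unfolding expands_def by (meson mult_right_mono of_nat_0_le_iff order_trans)

section \<open>Projection to the coset graph of a larger subgroup\<close>

lemma rcosets_project:
  assumes M: "subgroup M G" and N: "subgroup N G" "N \<subseteq> M"
  obtains \<pi> where "\<And>g. g \<in> carrier G \<Longrightarrow> \<pi> (N #> g) = M #> g"
proof -
  define \<pi> where "\<pi> C = M #> (SOME g. g \<in> carrier G \<and> C = N #> g)" for C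
  have "\<pi> (N #> g) = M #> g" if g: "g \<in> carrier G" for g
  proof -
    let ?h = "SOME h. h \<in> carrier G \<and> N #> g = N #> h"
    have h: "?h \<in> carrier G \<and> N #> g = N #> ?h" by (rule someI[where x = g]) (use g in simp)
    hence "g \<otimes> inv ?h \<in> N" using rcos_eq_iff[OF N(1) g, of ?h] by blast
    hence "M #> g = M #> ?h" using rcos_eq_iff[OF M g, of ?h] h N(2) by blast
    thus ?thesis by (simp add: \<pi>_def)
  qed
  thus thesis using that by blast
qed

lemma card_level_sets:
  fixes a b T :: nat
  assumes "a \<le> T" "b \<le> T"
  shows "card {t \<in> {1..T}. (t \<le> a) \<noteq> (t \<le> b)} = (a - b) + (b - a)"
proof -
  have "{t \<in> {1..T}. (t \<le> a) \<noteq> (t \<le> b)} = {Suc (min a b)..max a b}" using assms by auto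
  thus ?thesis by (simp add: min_def max_def)
qed

text \<open>A set with small boundary cannot sit over a small part of a quotient graph that expands: apply the
  expansion of the quotient to the level sets of the function counting the points in each fibre.\<close>

lemma sparse_projection_boundary:
  assumes M: "subgroup M G" and N: "subgroup N G" "N \<subseteq> M" and finN: "finite (rcosets N)"
    and S: "finite S" "S \<subseteq> carrier G" and ex: "expands G M S e"
    and A: "A \<subseteq> rcosets N" and small: "real (card (boundary N S A)) < e * real (card A)"
  shows "card (rcosets M) < 2 * card A"
proof (rule ccontr)
  assume "\<not> ?thesis"
  hence half: "2 * card A \<le> card (rcosets M)" by simp
  have finM: "finite (rcosets M)" using finite_index_iff[OF M N] finN by blast
  have finA: "finite A" using A finN finite_subset by blast
  obtain \<pi> where \<pi>: "\<And>g. g \<in> carrier G \<Longrightarrow> \<pi> (N #> g) = M #> g" using rcosets_project[OF M N] by blast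
  have \<pi>M: "\<pi> C \<in> rcosets M" if "C \<in> rcosets N" for C
    using that \<pi> M by (auto elim!: rcosets_obtain intro!: rcosetsI subgroup.subset)
  have \<pi>_mult: "\<pi> (C #> s) = \<pi> C #> s" if C: "C \<in> rcosets N" and s: "s \<in> carrier G" for C s
  proof -
    obtain g where g: "g \<in> carrier G" "C = N #> g" using C by (rule rcosets_obtain)
    thus ?thesis using \<pi> s subgroup.subset[OF M] subgroup.subset[OF N(1)] by (simp add: coset_mult_assoc)
  qed
  define f where "f D = card {C \<in> A. \<pi> C = D}" for D
  define T where "T = card A"
  have fT: "f D \<le> T" for D unfolding f_def T_def using finA by (intro card_mono) auto
  define L where "L t = {D \<in> rcosets M. t \<le> f D}" for t
  have finL: "finite (L t)" for t using finM by (simp add: L_def)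
  have sumL: "(\<Sum>t\<in>{1..T}. card (L t)) = T"
  proof -
    have "(\<Sum>t\<in>{1..T}. card (L t)) = (\<Sum>t\<in>{1..T}. \<Sum>D\<in>rcosets M. if t \<le> f D then 1 else 0)"
      using finM by (simp add: L_def sum.If_cases Int_def)
    also have "\<dots> = (\<Sum>D\<in>rcosets M. \<Sum>t\<in>{1..T}. if t \<le> f D then 1 else 0)" by (rule sum.swap)
    also have "\<dots> = (\<Sum>D\<in>rcosets M. f D)"
    proof (rule sum.cong[OF refl])
      fix D
      have "{1..T} \<inter> {t. t \<le> f D} = {1..f D}" using fT[of D] by auto
      thus "(\<Sum>t\<in>{1..T}. if t \<le> f D then 1 else 0) = f D" by (simp add: sum.If_cases)
    qed
    also have "\<dots> = card (\<Union>D\<in>rcosets M. {C \<in> A. \<pi> C = D})"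
      unfolding f_def using finM finA by (intro card_UN_disjoint[symmetric]) auto
    also have "(\<Union>D\<in>rcosets M. {C \<in> A. \<pi> C = D}) = A" using \<pi>M A by auto
    finally show ?thesis by (simp add: T_def)
  qed
  \<comment> \<open>A level set lies in the projection of \<open>A\<close>, which under the
    assumption to be refuted fills at most half of the quotient graph, so the expansion of the
    quotient applies to it.\<close>
  have L1: "card (L t) \<le> card A" if "t \<ge> 1" for t
  proof -
    have "L t \<subseteq> \<pi> ` A"
    proof
      fix D assume "D \<in> L t"
      hence "f D \<noteq> 0" using that by (simp add: L_def)
      hence "{C \<in> A. \<pi> C = D} \<noteq> {}" unfolding f_def by (metis card.empty)
      thus "D \<in> \<pi> ` A" by blast
    qed
    thus ?thesis using finA by (meson card_image_le card_mono finite_imageI order_trans)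
  qed
  have eL: "e * real (card (L t)) \<le> real (card (boundary M S (L t)))" if "t \<ge> 1" for t
  proof (cases "card (L t) = 0")
    case False
    moreover have "2 * card (L t) \<le> card (rcosets M)" using L1[OF that] half by linarith
    moreover have "L t \<subseteq> rcosets M" by (auto simp: L_def)
    ultimately show ?thesis using ex unfolding expands_def by blast
  qed simp
  let ?E = "(rcosets M) \<times> S"
  have finE: "finite ?E" using finM S by simp
  \<comment> \<open>Discrete coarea formula: after exchanging the sums, an edge is in the boundary
    of exactly as many level sets as \<open>f\<close> changes along it. The absolute difference is a
    sum of two truncated subtractions.\<close>
  have "(\<Sum>t\<in>{1..T}. card (boundary M S (L t))) = (\<Sum>t\<in>{1..T}. \<Sum>x\<in>?E. if (t \<le> f (fst x)) \<noteq> (t \<le> f (fst x #> snd x)) then 1 else 0)"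
  proof (rule sum.cong[OF refl])
    fix t
    have "boundary M S (L t) = {x \<in> ?E. (t \<le> f (fst x)) \<noteq> (t \<le> f (fst x #> snd x))}"
      using S(2) rcosets_mult_closed[OF M] by (auto simp: boundary_eq L_def)
    thus "card (boundary M S (L t)) = (\<Sum>x\<in>?E. if (t \<le> f (fst x)) \<noteq> (t \<le> f (fst x #> snd x)) then 1 else 0)"
      using finE by (simp add: sum.If_cases Int_def)
  qed
  also have "\<dots> = (\<Sum>x\<in>?E. \<Sum>t\<in>{1..T}. if (t \<le> f (fst x)) \<noteq> (t \<le> f (fst x #> snd x)) then 1 else 0)" by (rule sum.swap)
  also have "\<dots> = (\<Sum>x\<in>?E. (f (fst x) - f (fst x #> snd x)) + (f (fst x #> snd x) - f (fst x)))"
  proof (rule sum.cong[OF refl])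
    fix x
    have "(\<Sum>t\<in>{1..T}. if (t \<le> f (fst x)) \<noteq> (t \<le> f (fst x #> snd x)) then 1 else 0)
      = card {t \<in> {1..T}. (t \<le> f (fst x)) \<noteq> (t \<le> f (fst x #> snd x))}"
      by (simp add: sum.If_cases Int_def)
    thus "(\<Sum>t\<in>{1..T}. if (t \<le> f (fst x)) \<noteq> (t \<le> f (fst x #> snd x)) then 1 else 0)
      = (f (fst x) - f (fst x #> snd x)) + (f (fst x #> snd x) - f (fst x))"
      using card_level_sets[OF fT fT] by simp
  qed
  \<comment> \<open>Multiplication by \<open>s\<close> matches the fibres over the two ends of an
    edge, so a difference between their counts is paid for by boundary edges of \<open>A\<close>
    above that edge.\<close>
  also have "\<dots> \<le> (\<Sum>x\<in>?E. card {y \<in> boundary N S A. (\<pi> (fst y), snd y) = x})"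
  proof (rule sum_mono)
    fix x assume "x \<in> ?E"
    then obtain D s where x: "x = (D, s)" "D \<in> rcosets M" "s \<in> S" by auto
    have s: "s \<in> carrier G" using x S by auto
    let ?F = "{C \<in> rcosets N. \<pi> C = D}"
    let ?X = "{C \<in> ?F. C \<in> A}" and ?Y = "{C \<in> ?F. C #> s \<in> A}"
    let ?Z = "{C \<in> ?F. (C \<in> A) \<noteq> (C #> s \<in> A)}"
    have finF: "finite ?F" using finN by simp
    have X: "f D = card ?X" unfolding f_def using A by (intro arg_cong[where f = card]) auto
    have inv1: "C #> s #> inv s = C" and inv2: "C #> inv s #> s = C" if "C \<in> rcosets N" for C
      using s that by (simp_all add: rcosets_mult_assoc[OF N(1)] rcosets_mult_one[OF N(1)])
    have DM: "D #> s #> inv s = D" using s x(2) by (simp add: rcosets_mult_assoc[OF M] rcosets_mult_one[OF M])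
    have "bij_betw (\<lambda>C. C #> s) ?Y {C \<in> A. \<pi> C = D #> s}"
    proof (rule bij_betw_byWitness[where f' = "\<lambda>C. C #> inv s"])
      show "\<forall>C\<in>?Y. C #> s #> inv s = C" using inv1 by blast
      show "\<forall>C\<in>{C \<in> A. \<pi> C = D #> s}. C #> inv s #> s = C" using inv2 A by blast
      show "(\<lambda>C. C #> s) ` ?Y \<subseteq> {C \<in> A. \<pi> C = D #> s}" using \<pi>_mult s by auto
      show "(\<lambda>C. C #> inv s) ` {C \<in> A. \<pi> C = D #> s} \<subseteq> ?Y"
      proof (rule image_subsetI)
        fix C assume "C \<in> {C \<in> A. \<pi> C = D #> s}"
        hence C: "C \<in> A" "\<pi> C = D #> s" by auto
        have CN: "C \<in> rcosets N" using C A by blast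
        have "\<pi> (C #> inv s) = D" using \<pi>_mult[OF CN, of "inv s"] s C(2) DM by simp
        thus "C #> inv s \<in> ?Y"
          using rcosets_mult_closed[OF N(1) CN, of "inv s"] s C(1) inv2[OF CN] by simp
      qed
    qed
    from bij_betw_same_card[OF this] have Y: "f (D #> s) = card ?Y" unfolding f_def by (rule sym)
    have finFQ: "finite {C \<in> ?F. Q C}" for Q by (rule finite_subset[OF _ finF]) auto
    let ?P1 = "{C \<in> ?F. C \<in> A \<and> C #> s \<notin> A}" and ?P2 = "{C \<in> ?F. C \<notin> A \<and> C #> s \<in> A}"
    have "card ?X \<le> card (?Y \<union> ?P1)" by (rule card_mono[OF finite_UnI[OF finFQ finFQ]]) auto
    also have "\<dots> \<le> card ?Y + card ?P1" by (rule card_Un_le)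
    finally have 1: "card ?X - card ?Y \<le> card ?P1" by simp
    have "card ?Y \<le> card (?X \<union> ?P2)" by (rule card_mono[OF finite_UnI[OF finFQ finFQ]]) auto
    also have "\<dots> \<le> card ?X + card ?P2" by (rule card_Un_le)
    finally have 2: "card ?Y - card ?X \<le> card ?P2" by simp
    have "card ?Z = card (?P1 \<union> ?P2)"
      by (rule arg_cong[where f = card]) auto
    also have "\<dots> = card ?P1 + card ?P2"
      by (rule card_Un_disjoint[OF finFQ finFQ]) auto
    finally have 3: "card ?Z = card ?P1 + card ?P2" .
    have "{y \<in> boundary N S A. (\<pi> (fst y), snd y) = x} = (\<lambda>C. (C, s)) ` ?Z"
      unfolding x(1) boundary_eq using x(3) by auto
    hence "card {y \<in> boundary N S A. (\<pi> (fst y), snd y) = x} = card ?Z" by (simp add: card_image inj_on_def)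
    thus "(f (fst x) - f (fst x #> snd x)) + (f (fst x #> snd x) - f (fst x)) \<le> card {y \<in> boundary N S A. (\<pi> (fst y), snd y) = x}"
      using 1 2 3 X Y x(1) by simp
  qed
  also have "\<dots> = card (\<Union>x\<in>?E. {y \<in> boundary N S A. (\<pi> (fst y), snd y) = x})"
    using finE finite_boundary[OF finN S(1)] by (intro card_UN_disjoint[symmetric]) auto
  also have "\<dots> \<le> card (boundary N S A)"
    by (rule card_mono[OF finite_boundary[OF finN S(1)]]) auto
  finally have "(\<Sum>t\<in>{1..T}. card (boundary M S (L t))) \<le> card (boundary N S A)" .
  hence "real (\<Sum>t\<in>{1..T}. card (boundary M S (L t))) \<le> real (card (boundary N S A))" by (simp only: of_nat_le_iff)
  moreover have "e * real T \<le> real (\<Sum>t\<in>{1..T}. card (boundary M S (L t)))"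
  proof -
    have "e * real T = (\<Sum>t\<in>{1..T}. e * real (card (L t)))"
      by (subst sumL[symmetric]) (simp add: sum_distrib_left)
    also have "\<dots> \<le> (\<Sum>t\<in>{1..T}. real (card (boundary M S (L t))))" by (rule sum_mono) (use eL in auto)
    finally show ?thesis by simp
  qed
  ultimately show False using small by (simp add: T_def)
qed

section \<open>Cuts with both sides connected\<close>

definition coset_connected :: "'a set \<Rightarrow> 'a set set \<Rightarrow> bool" where
  "coset_connected S A \<longleftrightarrow> (\<forall>A1. A1 \<subseteq> A \<longrightarrow> A1 \<noteq> {} \<longrightarrow> A1 \<noteq> A \<longrightarrow>
     (\<exists>C\<in>A. \<exists>s\<in>S. C #> s \<in> A \<and> (C \<in> A1) \<noteq> (C #> s \<in> A1)))"

lemma boundary_disconnected: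
  assumes fin: "finite (rcosets H)" "finite S" and A1: "A1 \<subseteq> A" "A \<subseteq> rcosets H"
    and no: "\<not> (\<exists>C\<in>A. \<exists>s\<in>S. C #> s \<in> A \<and> (C \<in> A1) \<noteq> (C #> s \<in> A1))"
  shows "card (boundary H S A) = card (boundary H S A1) + card (boundary H S (A - A1))"
proof -
  have "(C \<in> A) \<noteq> (C #> s \<in> A) \<longleftrightarrow> (C \<in> A1) \<noteq> (C #> s \<in> A1) \<or> (C \<in> A - A1) \<noteq> (C #> s \<in> A - A1)" if "s \<in> S" for C s
    using A1(1) no that by blast
  hence "boundary H S A = boundary H S A1 \<union> boundary H S (A - A1)" unfolding boundary_eq by blast
  moreover have "\<not> ((C \<in> A1) \<noteq> (C #> s \<in> A1) \<and> (C \<in> A - A1) \<noteq> (C #> s \<in> A - A1))" if "s \<in> S" for C s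
    using A1(1) no that by blast
  hence "boundary H S A1 \<inter> boundary H S (A - A1) = {}" unfolding boundary_eq by blast
  ultimately show ?thesis using card_Un_disjoint finite_boundary[OF fin] by metis
qed

lemma boundary_compl:
  assumes H: "subgroup H G" and S: "S \<subseteq> carrier G" and A: "A \<subseteq> rcosets H"
  shows "boundary H S (rcosets H - A) = boundary H S A"
  using rcosets_mult_closed[OF H] S by (auto simp: boundary_eq)

text \<open>Among the sets that violate the bound \<open>e\<close> take one with the fewest boundary
  edges. If it or its complement fell apart, one of the pieces would lead to a violating set with
  fewer boundary edges.\<close>

lemma connected_small_boundary:
  assumes H: "subgroup H G" and fin: "finite (rcosets H)" and S: "finite S" "S \<subseteq> carrier G" "generate G S = carrier G"
    and nex: "\<not> expands G H S e"
  obtains A where "A \<subseteq> rcosets H" "0 < card A" "2 * card A \<le> card (rcosets H)"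
    "real (card (boundary H S A)) < e * real (card A)"
    "coset_connected S A" "coset_connected S (rcosets H - A)"
proof -
  let ?V = "rcosets H"
  define P where "P A \<longleftrightarrow> A \<subseteq> ?V \<and> 0 < card A \<and> 2 * card A \<le> card ?V \<and>
    real (card (boundary H S A)) < e * real (card A)" for A
  have "\<exists>A. P A" using nex unfolding expands_def P_def by (meson not_le)
  then obtain A0 where "P A0" by blast
  then obtain A where PA: "P A" and min: "\<And>A'. P A' \<Longrightarrow> card (boundary H S A) \<le> card (boundary H S A')"
    using ex_has_least_nat[of P A0 "\<lambda>A. card (boundary H S A)"] by blast
  have A: "A \<subseteq> ?V" "0 < card A" "2 * card A \<le> card ?V" "real (card (boundary H S A)) < e * real (card A)"
    using PA by (auto simp: P_def)
  have pos: "card (boundary H S X) > 0" if "X \<subseteq> ?V" "X \<noteq> {}" "X \<noteq> ?V" for X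
    using boundary_nonempty[OF H fin S that] .
  have finsub: "finite X" if "X \<subseteq> ?V" for X using that fin finite_subset by blast
  have e: "e > 0"
  proof (rule ccontr)
    assume "\<not> e > 0"
    hence "e * real (card A) \<le> 0" by (simp add: mult_nonpos_nonneg)
    thus False using A(4) by linarith
  qed
  \<comment> \<open>Sizes and boundaries both add up over the two pieces, so one piece has boundary
    ratio below \<open>e\<close>; its boundary is strictly smaller because that of the other piece
    is not empty.\<close>
  have split: "\<exists>Y\<in>{X1, X - X1}. Y \<noteq> {} \<and> real (card (boundary H S Y)) < e * real (card Y) \<and> card (boundary H S Y) < card (boundary H S X)"
    if X: "X \<subseteq> ?V" "X1 \<subseteq> X" "X1 \<noteq> {}" "X1 \<noteq> X"
      and no: "\<not> (\<exists>C\<in>X. \<exists>s\<in>S. C #> s \<in> X \<and> (C \<in> X1) \<noteq> (C #> s \<in> X1))"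
      and le: "real (card (boundary H S X)) < e * real (card X)" for X X1
  proof -
    have b: "card (boundary H S X) = card (boundary H S X1) + card (boundary H S (X - X1))"
      by (rule boundary_disconnected[OF fin S(1) X(2,1) no])
    have c: "card X = card X1 + card (X - X1)"
      using finsub[OF X(1)] X(2) by (metis card_Diff_subset card_mono finite_subset le_add_diff_inverse)
    have "X1 \<subseteq> ?V" "X - X1 \<subseteq> ?V" "X1 \<noteq> ?V" "X - X1 \<noteq> {}" "X - X1 \<noteq> ?V" using X by auto
    hence "card (boundary H S X1) > 0" "card (boundary H S (X - X1)) > 0" using pos[of X1] pos[of "X - X1"] X(3) by blast+
    moreover have "real (card (boundary H S X1)) < e * real (card X1) \<or>
       real (card (boundary H S (X - X1))) < e * real (card (X - X1))"
      using le b c by (auto simp: ring_distribs)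
    ultimately show ?thesis using b X by auto
  qed
  have conA: "coset_connected S A"
  proof (rule ccontr)
    assume "\<not> ?thesis"
    then obtain A1 where A1: "A1 \<subseteq> A" "A1 \<noteq> {}" "A1 \<noteq> A"
      "\<not> (\<exists>C\<in>A. \<exists>s\<in>S. C #> s \<in> A \<and> (C \<in> A1) \<noteq> (C #> s \<in> A1))"
      unfolding coset_connected_def by blast
    obtain Y where Y: "Y \<in> {A1, A - A1}" "Y \<noteq> {}" "real (card (boundary H S Y)) < e * real (card Y)"
      "card (boundary H S Y) < card (boundary H S A)"
      using split[OF A(1) A1(1-3) A1(4) A(4)] by blast
    have "Y \<subseteq> A" using Y A1 by auto
    hence "card Y \<le> card A" "finite Y" using finsub[OF A(1)] card_mono finite_subset by blast+
    hence "P Y" using Y A \<open>Y \<subseteq> A\<close> by (auto simp: P_def card_gt_0_iff)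
    thus False using min Y(4) by fastforce
  qed
  let ?B = "?V - A"
  have cB: "card ?B = card ?V - card A" by (rule card_Diff_subset[OF finsub[OF A(1)] A(1)])
  have conB: "coset_connected S ?B"
  proof (rule ccontr)
    assume "\<not> ?thesis"
    then obtain B1 where B1: "B1 \<subseteq> ?B" "B1 \<noteq> {}" "B1 \<noteq> ?B"
      "\<not> (\<exists>C\<in>?B. \<exists>s\<in>S. C #> s \<in> ?B \<and> (C \<in> B1) \<noteq> (C #> s \<in> B1))"
      unfolding coset_connected_def by blast
    have bB: "boundary H S ?B = boundary H S A" by (rule boundary_compl[OF H S(2) A(1)])
    have "e * real (card A) \<le> e * real (card ?B)" using A(3) cB e by simp
    hence le: "real (card (boundary H S ?B)) < e * real (card ?B)" unfolding bB using A(4) by linarith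
    have b: "card (boundary H S ?B) = card (boundary H S B1) + card (boundary H S (?B - B1))"
      by (rule boundary_disconnected[OF fin S(1) B1(1) _ B1(4)]) auto
    have p1: "card (boundary H S B1) > 0" "card (boundary H S (?B - B1)) > 0"
    proof -
      have "A \<noteq> {}" using A(2) by auto
      hence "B1 \<subseteq> ?V" "B1 \<noteq> ?V" "?B - B1 \<subseteq> ?V" "?B - B1 \<noteq> ?V" "?B - B1 \<noteq> {}" using B1 A(1) by blast+
      thus "card (boundary H S B1) > 0" "card (boundary H S (?B - B1)) > 0" using pos B1(2) by blast+
    qed
    \<comment> \<open>A piece of the complement with more than half of the vertices is exchanged for
      its own complement: this contains \<open>A\<close>, has at most half of the vertices and the
      same small boundary, against the choice of \<open>A\<close>.\<close>
    have large: False if X: "X \<subseteq> ?B" "card ?V < 2 * card X" "card (boundary H S X) < card (boundary H S A)" for X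
    proof -
      let ?W = "?V - X"
      have XV: "X \<subseteq> ?V" using X by blast
      have cW: "card ?W = card ?V - card X" by (rule card_Diff_subset[OF finsub[OF XV] XV])
      have "A \<subseteq> ?W" using X A by blast
      hence "card A \<le> card ?W" using finsub[of ?W] card_mono by blast
      moreover have "boundary H S ?W = boundary H S X" by (rule boundary_compl[OF H S(2) XV])
      moreover have "e * real (card A) \<le> e * real (card ?W)" using calculation(1) e by simp
      ultimately have "P ?W" unfolding P_def using X A cW by auto
      thus False using min[of ?W] X(3) \<open>boundary H S ?W = boundary H S X\<close> by simp
    qed
    have "2 * card B1 \<le> card ?V" using large[of B1] B1 b p1 bB by fastforce
    moreover have "2 * card (?B - B1) \<le> card ?V" using large[of "?B - B1"] b p1 bB by fastforce
    moreover obtain Y where Y: "Y \<in> {B1, ?B - B1}" "Y \<noteq> {}" "real (card (boundary H S Y)) < e * real (card Y)"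
      "card (boundary H S Y) < card (boundary H S ?B)"
      using split[OF _ B1(1-3) B1(4) le] by blast
    ultimately have "P Y" using B1 finsub[of Y] by (auto simp: P_def card_gt_0_iff)
    thus False using min[of Y] Y(4) bB by simp
  qed
  show thesis by (rule that[OF A conA conB])
qed

end

text \<open>Descend from \<open>K\<close> to \<open>L\<close> in steps of index \<open>p\<close> and
  stop where \<open>P\<close> fails for the first time. It is applied with expansion as
  \<open>P\<close>.\<close>

lemma p_open_chain:
  fixes G (structure)
  assumes G: "group G" and p: "prime p"
    and K: "subgroup K G" and L: "p_open p (G\<lparr>carrier := K\<rparr>) L" and PK: "P K" and PL: "\<not> P L"
  shows "\<exists>M N. subgroup M G \<and> subgroup N G \<and> L \<subseteq> N \<and> N \<subseteq> M \<and> M \<subseteq> K \<and>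
     card (rcosets\<^bsub>G\<lparr>carrier := M\<rparr>\<^esub> N) = p \<and> P M \<and> \<not> P N"
  using K L PK
proof (induction "card (rcosets\<^bsub>G\<lparr>carrier := K\<rparr>\<^esub> L)" arbitrary: K rule: less_induct)
  case less
  interpret group G by fact
  let ?K = "G\<lparr>carrier := K\<rparr>"
  interpret K: group ?K using less.prems(1) subgroup_imp_group by blast
  have "L \<noteq> carrier ?K" using less.prems(3) PL by auto
  then obtain N where N: "N \<lhd> ?K" "L \<subseteq> N" "p_open p ?K N" "card (rcosets\<^bsub>?K\<^esub> N) = p"
    using K.p_open_normal_prime_index[OF less.prems(2) _ p] by metis
  have NK: "subgroup N ?K" "N \<subseteq> K" using N(3) subgroup.subset[of N ?K] by (auto simp: p_open_def)
  have NG: "subgroup N G" using NK(1) less.prems(1) incl_subgroup by blast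
  show ?case
  proof (cases "P N")
    case False
    thus ?thesis using less.prems N NK NG by blast
  next
    case True
    have LN: "p_open p (G\<lparr>carrier := N\<rparr>) L" using K.p_open_between(2)[OF less.prems(2) NK(1) N(2)] by simp
    have LK: "subgroup L ?K" "finite (rcosets\<^bsub>?K\<^esub> L)" using less.prems(2) by (auto simp: p_open_def)
    have "card (rcosets\<^bsub>?K\<^esub> L) > 0" using LK K.self_in_rcosets[OF LK(1)] by (metis card_gt_0_iff empty_iff)
    moreover have "card (rcosets\<^bsub>?K\<^esub> L) = card (rcosets\<^bsub>G\<lparr>carrier := N\<rparr>\<^esub> L) * p"
      using K.index_mult[OF NK(1) LK(1) N(2)] N(4) by simp
    ultimately have "card (rcosets\<^bsub>G\<lparr>carrier := N\<rparr>\<^esub> L) < card (rcosets\<^bsub>?K\<^esub> L)"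
      using prime_gt_1_nat[OF p] by (metis One_nat_def n_less_n_mult_m nat_0_less_mult_iff)
    from less.hyps[OF this NG LN True] show ?thesis using NK(2) by blast
  qed
qed

section \<open>An expanding family of actions on tori\<close>

definition res_pair :: "int \<Rightarrow> int \<times> int \<Rightarrow> int \<times> int" where
  "res_pair N w = (fst w mod N, snd w mod N)"

definition torus :: "int \<Rightarrow> (int \<times> int) set" where
  "torus N = {0..<N} \<times> {0..<N}"

text \<open>Maps of the integral plane and not of the torus, so that one formula serves all moduli;
  map and inverse have to respect congruence modulo \<open>N\<close>.\<close>

definition torus_automorphism :: "int \<Rightarrow> (int \<times> int \<Rightarrow> int \<times> int) \<Rightarrow> (int \<times> int \<Rightarrow> int \<times> int) \<Rightarrow> bool" where
  "torus_automorphism N \<theta> \<theta>' \<longleftrightarrow>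
     (\<forall>w. res_pair N (\<theta> (res_pair N w)) = res_pair N (\<theta> w)) \<and>
     (\<forall>w. res_pair N (\<theta>' (res_pair N w)) = res_pair N (\<theta>' w)) \<and>
     (\<forall>w. \<theta>' (\<theta> w) = w) \<and> (\<forall>w. \<theta> (\<theta>' w) = w)"

lemma torus_automorphism_sym: "torus_automorphism N \<theta> \<theta>' \<Longrightarrow> torus_automorphism N \<theta>' \<theta>"
  by (auto simp: torus_automorphism_def)

lemma finite_torus [simp]: "finite (torus N)"
  by (simp add: torus_def)

lemma res_pair_torus: "N > 0 \<Longrightarrow> res_pair N w \<in> torus N"
  by (simp add: res_pair_def torus_def)

lemma res_pair_id: "w \<in> torus N \<Longrightarrow> res_pair N w = w"
  by (cases w) (auto simp: res_pair_def torus_def)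

lemma torus_automorphism_bij:
  assumes "N > 0" "torus_automorphism N \<theta> \<theta>'"
  shows "bij_betw (\<lambda>w. res_pair N (\<theta> w)) (torus N) (torus N)"
proof (rule bij_betw_byWitness[where f' = "\<lambda>w. res_pair N (\<theta>' w)"])
  have h: "res_pair N (\<theta> (res_pair N w)) = res_pair N (\<theta> w)"
    "res_pair N (\<theta>' (res_pair N w)) = res_pair N (\<theta>' w)" "\<theta>' (\<theta> w) = w" "\<theta> (\<theta>' w) = w" for w
    using assms(2) unfolding torus_automorphism_def by blast+
  show "\<forall>w\<in>torus N. res_pair N (\<theta>' (res_pair N (\<theta> w))) = w"
    "\<forall>w\<in>torus N. res_pair N (\<theta> (res_pair N (\<theta>' w))) = w"
    using h res_pair_id by metis+
qed (simp_all add: image_subset_iff res_pair_torus assms(1))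

lemma torus_sum_automorphism:
  fixes g :: "int \<times> int \<Rightarrow> 'c::comm_monoid_add"
  assumes "N > 0" "torus_automorphism N \<theta> \<theta>'" "\<And>w. g (res_pair N w) = g w"
  shows "(\<Sum>w\<in>torus N. g (\<theta> w)) = (\<Sum>w\<in>torus N. g w)"
proof -
  have "(\<Sum>w\<in>torus N. g (\<theta> w)) = (\<Sum>w\<in>torus N. g (res_pair N (\<theta> w)))" by (simp only: assms(3))
  also have "\<dots> = (\<Sum>w\<in>torus N. g w)"
    by (rule sum.reindex_bij_betw[OF torus_automorphism_bij[OF assms(1,2)]])
  finally show ?thesis .
qed

text \<open>Representatives of least absolute value, for which comparing the sizes of the two
  coordinates makes sense. The bounds are right for odd and even \<open>N\<close>.\<close>

definition centered :: "int \<Rightarrow> (int \<times> int) set" where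
  "centered N = {- (N div 2)..<N - N div 2} \<times> {- (N div 2)..<N - N div 2}"

lemma finite_centered [simp]: "finite (centered N)"
  by (simp add: centered_def)

lemma centered_sum:
  fixes g :: "int \<times> int \<Rightarrow> 'c::comm_monoid_add"
  assumes N: "N > 0" and g: "\<And>w. g (res_pair N w) = g w"
  shows "(\<Sum>w\<in>centered N. g w) = (\<Sum>w\<in>torus N. g w)"
proof -
  let ?h = "N div 2"
  define c where "c x = (x + ?h) mod N - ?h" for x
  have c1: "c (x mod N) = x" if "- ?h \<le> x" "x < N - ?h" for x
  proof -
    have "c (x mod N) = (x + ?h) mod N - ?h" by (simp add: c_def mod_simps)
    also have "(x + ?h) mod N = x + ?h" using that by simp
    finally show ?thesis by simp
  qed
  have c2: "c x mod N = x" if "0 \<le> x" "x < N" for x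
  proof -
    have "c x mod N = (x + ?h - ?h) mod N" unfolding c_def by (simp only: mod_diff_left_eq)
    thus ?thesis using that by simp
  qed
  have c3: "- ?h \<le> c x \<and> c x < N - ?h" for x using N by (simp add: c_def)
  have "bij_betw (res_pair N) (centered N) (torus N)"
    by (rule bij_betw_byWitness[where f' = "\<lambda>w. (c (fst w), c (snd w))"])
       (use N c1 c2 c3 in \<open>auto simp: centered_def torus_def res_pair_def\<close>)
  thus ?thesis using sum.reindex_bij_betw[of "res_pair N" _ _ g] g by simp
qed

section \<open>Characters and Fourier transform on the torus\<close>

definition int_char :: "int \<Rightarrow> int \<Rightarrow> complex" where
  "int_char N t = cis (2 * pi * of_int t / of_int N)"

definition pairing :: "int \<times> int \<Rightarrow> int \<times> int \<Rightarrow> int" where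
  "pairing k w = fst k * fst w + snd k * snd w"

definition torus_fourier :: "int \<Rightarrow> (int \<times> int \<Rightarrow> real) \<Rightarrow> int \<times> int \<Rightarrow> complex" where
  "torus_fourier N f k = (\<Sum>w\<in>torus N. of_real (f w) * int_char N (pairing k w))"

lemma int_char_add: "int_char N (s + t) = int_char N s * int_char N t"
  by (simp add: int_char_def cis_mult add_divide_distrib ring_distribs)

lemma int_char_cnj: "cnj (int_char N t) = int_char N (- t)"
  by (simp add: int_char_def cis_cnj)

lemma norm_int_char [simp]: "norm (int_char N t) = 1"
  by (simp add: int_char_def)

lemma int_char_eq_1_iff: "N > 0 \<Longrightarrow> int_char N t = 1 \<longleftrightarrow> N dvd t"
proof -
  assume N: "N > 0"
  have "int_char N t = 1 \<longleftrightarrow> cos (2 * pi * of_int t / of_int N) = 1"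
    unfolding int_char_def
    by (metis cis.simps(1) cis_conv_exp one_complex.simps(1) cos_one_sin_zero complex_eqI one_complex.simps(2) cis.simps(2))
  also have "\<dots> \<longleftrightarrow> (\<exists>n::int. real_of_int t = real_of_int (n * N))"
    unfolding cos_one_2pi_int using N by (simp add: field_simps)
  also have "\<dots> \<longleftrightarrow> N dvd t" unfolding of_int_eq_iff by (auto simp: dvd_def mult.commute)
  finally show ?thesis .
qed

lemma int_char_mod: assumes "N > 0" shows "int_char N (t mod N) = int_char N t"
proof -
  have "int_char N t = int_char N (t mod N) * int_char N (N * (t div N))"
    by (subst int_char_add[symmetric]) simp
  moreover have "int_char N (N * (t div N)) = 1" using int_char_eq_1_iff[OF assms] by simp
  ultimately show ?thesis by simp
qed

lemma int_char_cong: "N > 0 \<Longrightarrow> s mod N = t mod N \<Longrightarrow> int_char N s = int_char N t"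
  by (metis int_char_mod)

lemma translation_automorphism:
  "torus_automorphism N (\<lambda>w. (fst w + a, snd w + b)) (\<lambda>w. (fst w - a, snd w - b))"
  by (simp add: torus_automorphism_def res_pair_def mod_simps)

lemma shear1_automorphism:
  "torus_automorphism N (\<lambda>w. (fst w + q * snd w, snd w)) (\<lambda>w. (fst w - q * snd w, snd w))"
proof -
  have "(x mod N + q * (y mod N)) mod N = (x + q * y) mod N" "(x mod N - q * (y mod N)) mod N = (x - q * y) mod N" for x y
    by (intro mod_add_cong mod_diff_cong mod_mult_cong; simp)+
  thus ?thesis by (simp add: torus_automorphism_def res_pair_def)
qed

lemma shear2_automorphism:
  "torus_automorphism N (\<lambda>w. (fst w, snd w + q * fst w)) (\<lambda>w. (fst w, snd w - q * fst w))"
proof -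
  have "(x mod N + q * (y mod N)) mod N = (x + q * y) mod N" "(x mod N - q * (y mod N)) mod N = (x - q * y) mod N" for x y
    by (intro mod_add_cong mod_diff_cong mod_mult_cong; simp)+
  thus ?thesis by (simp add: torus_automorphism_def res_pair_def)
qed

lemma pairing_add: "pairing (k1 + a, k2 + b) w = pairing (k1, k2) w + pairing (a, b) w"
  by (simp add: pairing_def algebra_simps)

lemma int_char_pairing_res:
  assumes "N > 0"
  shows "int_char N (pairing (res_pair N k) w) = int_char N (pairing k w)"
    "int_char N (pairing k (res_pair N w)) = int_char N (pairing k w)"
proof -
  have "((x mod N) * a + (y mod N) * b) mod N = (x * a + y * b) mod N" for x y a b
    by (intro mod_add_cong mod_mult_cong; simp)
  thus "int_char N (pairing (res_pair N k) w) = int_char N (pairing k w)"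
    by (intro int_char_cong[OF assms]) (simp add: pairing_def res_pair_def)
  have "(a * (x mod N) + b * (y mod N)) mod N = (a * x + b * y) mod N" for x y a b
    by (intro mod_add_cong mod_mult_cong; simp)
  thus "int_char N (pairing k (res_pair N w)) = int_char N (pairing k w)"
    by (intro int_char_cong[OF assms]) (simp add: pairing_def res_pair_def)
qed

lemma torus_fourier_periodic: "N > 0 \<Longrightarrow> torus_fourier N f (res_pair N k) = torus_fourier N f k"
  by (simp add: torus_fourier_def int_char_pairing_res)

text \<open>Translating the summation index multiplies the sum by a character value, and unless
  \<open>u\<close> vanishes modulo \<open>N\<close> some unit translation makes this value different
  from 1.\<close>

lemma int_char_sum:
  assumes N: "N > 0"
  shows "(\<Sum>k\<in>torus N. int_char N (pairing k u)) = (if res_pair N u = (0, 0) then of_int (N ^ 2) else 0)"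
proof (cases "res_pair N u = (0, 0)")
  case True
  hence "N dvd fst u" "N dvd snd u" by (auto simp: res_pair_def)
  hence "int_char N (pairing k u) = 1" for k using int_char_eq_1_iff[OF N] by (simp add: pairing_def)
  thus ?thesis using True N by (simp add: torus_def power2_eq_square)
next
  case False
  let ?S = "\<Sum>k\<in>torus N. int_char N (pairing k u)"
  have shift: "int_char N (pairing (a, b) u) * ?S = ?S" for a b
  proof -
    have "int_char N (pairing (a, b) u) * ?S = (\<Sum>k\<in>torus N. int_char N (pairing (fst k + a, snd k + b) u))"
      by (simp add: sum_distrib_left pairing_add int_char_add mult.commute)
    also have "\<dots> = ?S"
      by (rule torus_sum_automorphism[OF N translation_automorphism]) (rule int_char_pairing_res(1)[OF N])
    finally show ?thesis .
  qed
  have "\<exists>a b. int_char N (pairing (a, b) u) \<noteq> 1"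
  proof (rule ccontr)
    assume "\<not> ?thesis"
    hence "int_char N (pairing (1, 0) u) = 1" "int_char N (pairing (0, 1) u) = 1" by blast+
    thus False using False int_char_eq_1_iff[OF N] by (simp add: pairing_def res_pair_def)
  qed
  then obtain a b where "int_char N (pairing (a, b) u) \<noteq> 1" by blast
  thus ?thesis using shift[of a b] False by simp
qed

lemma torus_parseval:
  assumes N: "N > 0"
  shows "(\<Sum>k\<in>torus N. (norm (torus_fourier N f k))\<^sup>2) = of_int (N ^ 2) * (\<Sum>w\<in>torus N. (f w)\<^sup>2)"
proof -
  let ?W = "torus N"
  have "complex_of_real (\<Sum>k\<in>?W. (norm (torus_fourier N f k))\<^sup>2)
      = (\<Sum>k\<in>?W. torus_fourier N f k * cnj (torus_fourier N f k))"
    by (simp add: complex_norm_square[symmetric])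
  also have "\<dots> = (\<Sum>k\<in>?W. \<Sum>w\<in>?W. \<Sum>v\<in>?W. of_real (f w * f v) * int_char N (pairing k (fst w - fst v, snd w - snd v)))"
  proof (rule sum.cong[OF refl])
    fix k
    have e: "int_char N (pairing k (fst w - fst v, snd w - snd v)) = int_char N (pairing k w) * int_char N (- pairing k v)" for w v
      by (subst int_char_add[symmetric]) (simp add: pairing_def algebra_simps)
    show "torus_fourier N f k * cnj (torus_fourier N f k) =
       (\<Sum>w\<in>?W. \<Sum>v\<in>?W. of_real (f w * f v) * int_char N (pairing k (fst w - fst v, snd w - snd v)))"
      unfolding torus_fourier_def cnj_sum sum_product e
      by (simp add: int_char_cnj mult_ac)
  qed
  also have "\<dots> = (\<Sum>w\<in>?W. \<Sum>v\<in>?W. of_real (f w * f v) * (\<Sum>k\<in>?W. int_char N (pairing k (fst w - fst v, snd w - snd v))))"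
    by (subst sum.swap, rule sum.cong[OF refl], subst sum.swap) (simp add: sum_distrib_left)
  also have "\<dots> = (\<Sum>w\<in>?W. \<Sum>v\<in>?W. if v = w then of_real ((f w)\<^sup>2) * of_int (N ^ 2) else 0)"
  proof (intro sum.cong refl)
    fix w v assume wv: "w \<in> ?W" "v \<in> ?W"
    have "res_pair N (fst w - fst v, snd w - snd v) = (0, 0) \<longleftrightarrow> res_pair N w = res_pair N v"
      by (auto simp: res_pair_def mod_eq_dvd_iff dvd_eq_mod_eq_0)
    hence "res_pair N (fst w - fst v, snd w - snd v) = (0, 0) \<longleftrightarrow> v = w"
      using wv res_pair_id by metis
    thus "of_real (f w * f v) * (\<Sum>k\<in>?W. int_char N (pairing k (fst w - fst v, snd w - snd v)))
       = (if v = w then of_real ((f w)\<^sup>2) * of_int (N ^ 2) else 0)"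
      by (simp add: int_char_sum[OF N] power2_eq_square)
  qed
  also have "\<dots> = complex_of_real (of_int (N ^ 2) * (\<Sum>w\<in>?W. (f w)\<^sup>2))"
    by (simp add: sum_distrib_left mult.commute)
  finally show ?thesis by (simp only: of_real_eq_iff)
qed

lemma torus_fourier_diff:
  "torus_fourier N (\<lambda>w. f w - g w) k = torus_fourier N f k - torus_fourier N g k"
  by (simp add: torus_fourier_def sum_subtractf ring_distribs)

text \<open>Substitution moves the automorphism from the function to the character, where it appears
  inverted.\<close>

lemma torus_fourier_comp:
  assumes N: "N > 0" and \<theta>: "torus_automorphism N \<theta> \<theta>'" and f: "\<And>w. f (res_pair N w) = f w"
  shows "torus_fourier N (\<lambda>w. f (\<theta> w)) k = (\<Sum>w\<in>torus N. of_real (f w) * int_char N (pairing k (\<theta>' w)))"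
proof -
  have "int_char N (pairing k (\<theta>' (res_pair N w))) = int_char N (pairing k (\<theta>' w))" for w
    using \<theta> int_char_pairing_res(2)[OF N] unfolding torus_automorphism_def by metis
  hence "(\<Sum>w\<in>torus N. of_real (f (\<theta> w)) * int_char N (pairing k (\<theta>' (\<theta> w))))
     = (\<Sum>w\<in>torus N. of_real (f w) * int_char N (pairing k (\<theta>' w)))"
    using f by (intro torus_sum_automorphism[OF N \<theta>]) simp
  moreover have "\<theta>' (\<theta> w) = w" for w using \<theta> unfolding torus_automorphism_def by blast
  ultimately show ?thesis by (simp add: torus_fourier_def)
qed

definition escape :: "int \<Rightarrow> (int \<times> int) set \<Rightarrow> (int \<times> int \<Rightarrow> int \<times> int) \<Rightarrow> nat" where
  "escape N B \<theta> = card {w \<in> B. res_pair N (\<theta> w) \<notin> B}"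

text \<open>A bijection moves as many points into \<open>B\<close> as out of it, and
  \<open>f\<close> changes by 1 at each of them; hence the factor 2. The constant \<open>c\<close>
  cancels here and is later chosen so that the sum of \<open>f\<close> vanishes.\<close>

lemma escape_sum:
  fixes c :: real
  assumes N: "N > 0" and \<theta>: "torus_automorphism N \<theta> \<theta>'" and B: "B \<subseteq> torus N"
  defines "f \<equiv> \<lambda>w. (if res_pair N w \<in> B then 1 else 0) - c"
  shows "(\<Sum>w\<in>torus N. (f (\<theta> w) - f w)\<^sup>2) = 2 * real (escape N B \<theta>)"
proof -
  let ?W = "torus N" and ?t = "\<lambda>w. res_pair N (\<theta> w)"
  have finB: "finite B" using finite_subset[OF B finite_torus] .
  have bij: "bij_betw ?t ?W ?W" by (rule torus_automorphism_bij[OF N \<theta>])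
  have 1: "card {w \<in> ?W. ?t w \<in> B} = card B"
  proof -
    have "bij_betw ?t {w \<in> ?W. ?t w \<in> B} B"
    proof (rule bij_betw_imageI)
      show "inj_on ?t {w \<in> ?W. ?t w \<in> B}"
        by (rule inj_on_subset[OF bij_betw_imp_inj_on[OF bij]]) blast
      have "B \<subseteq> ?t ` ?W" using B bij_betw_imp_surj_on[OF bij] by simp
      thus "?t ` {w \<in> ?W. ?t w \<in> B} = B" by blast
    qed
    thus ?thesis by (rule bij_betw_same_card)
  qed
  let ?I = "{w \<in> B. ?t w \<in> B}" and ?O = "{w \<in> ?W - B. ?t w \<in> B}" and ?E = "{w \<in> B. ?t w \<notin> B}"
  have "{w \<in> ?W. ?t w \<in> B} = ?I \<union> ?O" using B by blast
  hence "card ?I + card ?O = card B"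
    using 1 card_Un_disjoint[of ?I ?O] finB by (simp add: disjoint_iff)
  moreover have "card ?I + card ?E = card B"
  proof -
    have "card (?I \<union> ?E) = card ?I + card ?E" by (rule card_Un_disjoint) (use finB in auto)
    moreover have "?I \<union> ?E = B" by blast
    ultimately show ?thesis by simp
  qed
  ultimately have OE: "card ?O = card ?E" by simp
  define S where "S = ?O \<union> ?E"
  have "(f (\<theta> w) - f w)\<^sup>2 = (if w \<in> S then 1 else 0)" if "w \<in> ?W" for w
    using that res_pair_id[OF that] by (auto simp: f_def S_def)
  hence "(\<Sum>w\<in>?W. (f (\<theta> w) - f w)\<^sup>2) = (\<Sum>w\<in>?W. if w \<in> S then 1 else 0)" by simp
  also have "\<dots> = real (card (?W \<inter> S))" by (simp add: sum.If_cases)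
  also have "?W \<inter> S = ?O \<union> ?E" using B by (auto simp: S_def)
  also have "card (?O \<union> ?E) = card ?O + card ?E"
    by (rule card_Un_disjoint) (use finB in auto)
  finally show ?thesis using OE by (simp add: escape_def)
qed

text \<open>The inequality of means with weight \<open>s\<close>, applied to |u - v| (|u| + |v|). It
  converts closeness of two transforms in square mean into closeness of their squared absolute
  values in mean.\<close>

lemma square_diff_bound:
  fixes u v :: complex and s :: real
  assumes "s > 0"
  shows "\<bar>(norm u)\<^sup>2 - (norm v)\<^sup>2\<bar> \<le> (norm (u - v))\<^sup>2 / (2 * s) + s * ((norm u)\<^sup>2 + (norm v)\<^sup>2)"
proof -
  let ?a = "norm u" and ?b = "norm v" and ?d = "norm (u - v)"
  have "\<bar>?a\<^sup>2 - ?b\<^sup>2\<bar> = \<bar>?a - ?b\<bar> * (?a + ?b)"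
    by (simp add: power2_eq_square square_diff_square_factored abs_mult mult.commute)
  also have "\<dots> \<le> ?d * (?a + ?b)" by (intro mult_right_mono norm_triangle_ineq3) auto
  also have "\<dots> \<le> ?d\<^sup>2 / (2 * s) + s * (?a + ?b)\<^sup>2 / 2"
  proof -
    have "0 \<le> (?d - s * (?a + ?b))\<^sup>2" by simp
    hence "2 * s * (?d * (?a + ?b)) \<le> ?d\<^sup>2 + s\<^sup>2 * (?a + ?b)\<^sup>2" by (simp add: power2_eq_square algebra_simps)
    thus ?thesis using assms by (simp add: field_simps power2_eq_square)
  qed
  also have "(?a + ?b)\<^sup>2 \<le> 2 * (?a\<^sup>2 + ?b\<^sup>2)"
    using sum_squares_ge_zero[of "?a - ?b" 0] by (simp add: power2_eq_square algebra_simps)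
  finally show ?thesis using assms by (simp add: field_simps)
qed

text \<open>The squared distance is 2 - 2 cos x, where x = 2 pi t / N, and the assumptions put the
  absolute value of the angle x between 2 pi / R and pi, where the cosine decreases.\<close>

lemma character_gap:
  assumes N: "N > 0" and R: "R \<ge> 2" and t: "2 * \<bar>t\<bar> \<le> N" "N \<le> R * \<bar>t\<bar>"
  shows "2 - 2 * cos (2 * pi / of_int R) \<le> (norm (int_char N t - 1))\<^sup>2"
proof -
  let ?x = "2 * pi * of_int t / of_int N"
  have "(norm (int_char N t - 1))\<^sup>2 = (cos ?x - 1)\<^sup>2 + (sin ?x)\<^sup>2"
    by (simp add: int_char_def cmod_power2)
  also have "\<dots> = 2 - 2 * cos ?x"
    using sin_cos_squared_add[of ?x] by (simp add: power2_eq_square algebra_simps)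
  finally have 1: "(norm (int_char N t - 1))\<^sup>2 = 2 - 2 * cos ?x" .
  have ax: "\<bar>?x\<bar> = 2 * pi * \<bar>real_of_int t\<bar> / real_of_int N" using N by (simp add: abs_mult)
  have "cos ?x = cos \<bar>?x\<bar>" by (rule cos_abs_real[symmetric])
  also have "\<dots> \<le> cos (2 * pi / of_int R)"
  proof (rule cos_monotone_0_pi_le)
    show "0 \<le> 2 * pi / of_int R" using R by simp
    have "real_of_int N \<le> real_of_int R * \<bar>real_of_int t\<bar>" using t(2) by (metis of_int_abs of_int_le_iff of_int_mult)
    hence "1 / real_of_int R \<le> \<bar>real_of_int t\<bar> / real_of_int N" using N R by (simp add: field_simps)
    hence "2 * pi * (1 / real_of_int R) \<le> 2 * pi * (\<bar>real_of_int t\<bar> / real_of_int N)"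
      by (intro mult_left_mono) auto
    thus "2 * pi / of_int R \<le> \<bar>?x\<bar>" unfolding ax by simp
    have "real_of_int (2 * \<bar>t\<bar>) \<le> real_of_int N" using t(1) by (simp only: of_int_le_iff)
    hence "2 * \<bar>real_of_int t\<bar> \<le> real_of_int N" by simp
    hence "2 * \<bar>real_of_int t\<bar> / real_of_int N \<le> 1" using N by simp
    hence "pi * (2 * \<bar>real_of_int t\<bar> / real_of_int N) \<le> pi * 1" by (intro mult_left_mono) auto
    thus "\<bar>?x\<bar> \<le> pi" unfolding ax by (simp add: mult_ac)
  qed
  finally show ?thesis using 1 by simp
qed

lemma cis_gap_pos: "R \<ge> 2 \<Longrightarrow> 2 - 2 * cos (2 * pi / real_of_int R) > 0"
proof -
  assume R: "R \<ge> 2"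
  have "cos (2 * pi / real_of_int R) < cos 0"
    by (rule cos_monotone_0_pi) (use R in \<open>simp_all add: field_simps\<close>)
  thus ?thesis by simp
qed

definition torus_gens :: "int \<Rightarrow> (int \<times> int \<Rightarrow> int \<times> int) list" where
  "torus_gens q = [\<lambda>w. (fst w + 1, snd w), \<lambda>w. (fst w, snd w + 1),
     \<lambda>w. (fst w + q * snd w, snd w), \<lambda>w. (fst w, snd w + q * fst w)]"

section \<open>Ping-pong with the transposed shears\<close>

locale torus_almost_invariant =
  fixes N q :: int and \<mu> :: "int \<times> int \<Rightarrow> real" and out err T :: real
  assumes N: "N > 0" and q: "q \<ge> 2"
    and nonneg: "\<And>k. \<mu> k \<ge> 0" and per: "\<And>k. \<mu> (res_pair N k) = \<mu> k" and zero: "\<mu> (0, 0) = 0"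
    and total: "T = (\<Sum>k\<in>centered N. \<mu> k)"
    and outside: "(\<Sum>k\<in>{k\<in>centered N. N \<le> 2 * (q + 1) * \<bar>fst k\<bar> \<or> N \<le> 2 * (q + 1) * \<bar>snd k\<bar>}. \<mu> k) \<le> out"
    and inv1: "(\<Sum>k\<in>centered N. \<bar>\<mu> (fst k, snd k - q * fst k) - \<mu> k\<bar>) \<le> err"
    and inv2: "(\<Sum>k\<in>centered N. \<bar>\<mu> (fst k - q * snd k, snd k) - \<mu> k\<bar>) \<le> err"
begin

text \<open>Substituting the shear in the sum exchanges it with its inverse; the substitution takes
  place on the torus, since \<open>centered\<close> is not preserved.\<close>

lemma inv1': "(\<Sum>k\<in>centered N. \<bar>\<mu> (fst k, snd k + q * fst k) - \<mu> k\<bar>) \<le> err"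
proof -
  let ?g = "\<lambda>k. \<bar>\<mu> k - \<mu> (fst k, snd k - q * fst k)\<bar>"
  have p: "?g (res_pair N w) = ?g w" for w
    using shear2_automorphism[of N q] per unfolding torus_automorphism_def by metis
  have p2: "?g (fst (res_pair N w), snd (res_pair N w) + q * fst (res_pair N w)) = ?g (fst w, snd w + q * fst w)" for w
    using shear2_automorphism[of N q] p unfolding torus_automorphism_def by metis
  have "(\<Sum>k\<in>centered N. ?g (fst k, snd k + q * fst k)) = (\<Sum>k\<in>torus N. ?g (fst k, snd k + q * fst k))"
    by (rule centered_sum[OF N]) (rule p2)
  also have "\<dots> = (\<Sum>k\<in>torus N. ?g k)" by (rule torus_sum_automorphism[OF N shear2_automorphism]) (rule p)
  also have "\<dots> = (\<Sum>k\<in>centered N. ?g k)" by (rule centered_sum[OF N, symmetric]) (rule p)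
  finally show ?thesis using inv1 by (simp add: abs_minus_commute)
qed

lemma inv2': "(\<Sum>k\<in>centered N. \<bar>\<mu> (fst k + q * snd k, snd k) - \<mu> k\<bar>) \<le> err"
proof -
  let ?g = "\<lambda>k. \<bar>\<mu> k - \<mu> (fst k - q * snd k, snd k)\<bar>"
  have p: "?g (res_pair N w) = ?g w" for w
    using shear1_automorphism[of N q] per unfolding torus_automorphism_def by metis
  have p2: "?g (fst (res_pair N w) + q * snd (res_pair N w), snd (res_pair N w)) = ?g (fst w + q * snd w, snd w)" for w
    using shear1_automorphism[of N q] p unfolding torus_automorphism_def by metis
  have "(\<Sum>k\<in>centered N. ?g (fst k + q * snd k, snd k)) = (\<Sum>k\<in>torus N. ?g (fst k + q * snd k, snd k))"
    by (rule centered_sum[OF N]) (rule p2)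
  also have "\<dots> = (\<Sum>k\<in>torus N. ?g k)" by (rule torus_sum_automorphism[OF N shear1_automorphism]) (rule p)
  also have "\<dots> = (\<Sum>k\<in>centered N. ?g k)" by (rule centered_sum[OF N, symmetric]) (rule p)
  finally show ?thesis using inv2 by (simp add: abs_minus_commute)
qed

text \<open>The factor \<open>2 * (q + 1)\<close> is chosen so that a shear of a near point does not
  wrap around: |a| + q |b| stays below N / 2.\<close>

definition "far = {k\<in>centered N. N \<le> 2 * (q + 1) * \<bar>fst k\<bar> \<or> N \<le> 2 * (q + 1) * \<bar>snd k\<bar>}"
definition "near = centered N - far"

lemma finite_sets: "finite far" "finite near" by (auto simp: far_def near_def)

lemma near_centered:
  assumes "k \<in> near"
  shows "k \<in> centered N" "(fst k, snd k - q * fst k) \<in> centered N" "(fst k, snd k + q * fst k) \<in> centered N"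
    "(fst k - q * snd k, snd k) \<in> centered N" "(fst k + q * snd k, snd k) \<in> centered N"
proof -
  have k: "k \<in> centered N" "2 * (q + 1) * \<bar>fst k\<bar> < N" "2 * (q + 1) * \<bar>snd k\<bar> < N"
    using assms by (auto simp: near_def far_def)
  show "k \<in> centered N" by (rule k)
  have small: "- (N div 2) \<le> x \<and> x < N - N div 2" if "2 * \<bar>x\<bar> < N" for x using that by linarith
  have sum: "2 * \<bar>a + q * b\<bar> < N" "2 * \<bar>a - q * b\<bar> < N" if "2 * (q + 1) * \<bar>a\<bar> < N" "2 * (q + 1) * \<bar>b\<bar> < N" for a b
  proof -
    have "\<bar>a + q * b\<bar> \<le> \<bar>a\<bar> + q * \<bar>b\<bar>" "\<bar>a - q * b\<bar> \<le> \<bar>a\<bar> + q * \<bar>b\<bar>"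
      using abs_triangle_ineq[of a "q * b"] abs_triangle_ineq4[of a "q * b"] q by (auto simp: abs_mult)
    moreover have "2 * (\<bar>a\<bar> + q * \<bar>b\<bar>) < N"
    proof -
      have "(q + 1) * (2 * (\<bar>a\<bar> + q * \<bar>b\<bar>)) = 2 * (q + 1) * \<bar>a\<bar> + q * (2 * (q + 1) * \<bar>b\<bar>)"
        by (simp add: algebra_simps)
      also have "\<dots> < N + q * N" using that q by (intro add_strict_mono mult_strict_left_mono) auto
      also have "\<dots> = (q + 1) * N" by (simp add: algebra_simps)
      finally show ?thesis using q by simp
    qed
    moreover have "2 * u < N" if "u \<le> v" "2 * v < N" for u v :: int using that by linarith
    ultimately show "2 * \<bar>a + q * b\<bar> < N" "2 * \<bar>a - q * b\<bar> < N" by blast+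
  qed
  have c: "- (N div 2) \<le> fst k \<and> fst k < N - N div 2" "- (N div 2) \<le> snd k \<and> snd k < N - N div 2"
    using k(1) by (auto simp: centered_def)
  show "(fst k, snd k - q * fst k) \<in> centered N" "(fst k, snd k + q * fst k) \<in> centered N"
    using c small[OF sum(1)[OF k(3,2)]] small[OF sum(2)[OF k(3,2)]] by (auto simp: centered_def)
  show "(fst k - q * snd k, snd k) \<in> centered N" "(fst k + q * snd k, snd k) \<in> centered N"
    using c small[OF sum(1)[OF k(2,3)]] small[OF sum(2)[OF k(2,3)]] by (auto simp: centered_def)
qed

lemma moved_mass:
  assumes E: "E \<subseteq> centered N" and bound: "(\<Sum>k\<in>centered N. \<bar>\<mu> (\<theta> k) - \<mu> k\<bar>) \<le> err" and inj: "inj_on \<theta> E"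
  shows "(\<Sum>k\<in>E. \<mu> k) \<le> (\<Sum>k\<in>\<theta> ` E. \<mu> k) + err"
proof -
  have "(\<Sum>k\<in>E. \<mu> k) - (\<Sum>k\<in>E. \<mu> (\<theta> k)) = (\<Sum>k\<in>E. \<mu> k - \<mu> (\<theta> k))" by (simp add: sum_subtractf)
  also have "\<dots> \<le> (\<Sum>k\<in>E. \<bar>\<mu> (\<theta> k) - \<mu> k\<bar>)" by (intro sum_mono) auto
  also have "\<dots> \<le> (\<Sum>k\<in>centered N. \<bar>\<mu> (\<theta> k) - \<mu> k\<bar>)" by (rule sum_mono2) (use E in auto)
  finally show ?thesis using bound by (simp add: sum.reindex[OF inj])
qed

text \<open>For \<open>q \<ge> 2\<close> a shear makes the smaller coordinate the larger one, and
  the two opposite shears land in quadrants with opposite sign of the product, which keeps their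
  images disjoint.\<close>

lemma shear_abs_less:
  fixes a b :: int
  assumes "\<bar>b\<bar> < \<bar>a\<bar>"
  shows "\<bar>a\<bar> < \<bar>b - q * a\<bar>" "\<bar>a\<bar> < \<bar>b + q * a\<bar>" "a * (b - q * a) < 0" "0 < a * (b + q * a)"
proof -
  have "q * \<bar>a\<bar> \<ge> 2 * \<bar>a\<bar>" using q by (intro mult_right_mono) auto
  hence qa: "\<bar>q * a\<bar> \<ge> 2 * \<bar>a\<bar>" using q by (simp add: abs_mult)
  show "\<bar>a\<bar> < \<bar>b - q * a\<bar>" "\<bar>a\<bar> < \<bar>b + q * a\<bar>" using qa assms by linarith+
  have "\<bar>a\<bar> * \<bar>b\<bar> < \<bar>a\<bar> * \<bar>a\<bar>" using assms by (intro mult_strict_left_mono) auto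
  hence "\<bar>a * b\<bar> < a * a" by (simp add: abs_mult)
  moreover have "a * a \<le> q * (a * a)" using q by (simp add: mult_le_cancel_right1)
  ultimately show "a * (b - q * a) < 0" "0 < a * (b + q * a)"
    by (simp_all add: ring_distribs mult.left_commute)
qed

definition "flat = {k\<in>near. \<bar>snd k\<bar> < \<bar>fst k\<bar>}"
definition "steep = {k\<in>near. \<bar>fst k\<bar> < \<bar>snd k\<bar>}"

abbreviation "mass E \<equiv> \<Sum>k\<in>E. \<mu> k"

lemma mass_mono: "finite B \<Longrightarrow> A \<subseteq> B \<Longrightarrow> mass A \<le> mass B"
  by (rule sum_mono2) (use nonneg in auto)

lemma steep_far: "mass {k\<in>centered N. \<bar>fst k\<bar> < \<bar>snd k\<bar>} \<le> mass steep + out"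
proof -
  have "mass {k\<in>centered N. \<bar>fst k\<bar> < \<bar>snd k\<bar>} \<le> mass (steep \<union> far)"
    by (rule mass_mono) (auto simp: steep_def near_def far_def)
  also have "\<dots> \<le> mass steep + mass far"
    using sum_Un[of steep far \<mu>] finite_sets nonneg by (simp add: steep_def sum_nonneg)
  finally show ?thesis using outside by (simp add: far_def)
qed

lemma flat_far: "mass {k\<in>centered N. \<bar>snd k\<bar> < \<bar>fst k\<bar>} \<le> mass flat + out"
proof -
  have "mass {k\<in>centered N. \<bar>snd k\<bar> < \<bar>fst k\<bar>} \<le> mass (flat \<union> far)"
    by (rule mass_mono) (auto simp: flat_def near_def far_def)
  also have "\<dots> \<le> mass flat + mass far"
    using sum_Un[of flat far \<mu>] finite_sets nonneg by (simp add: flat_def sum_nonneg)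
  finally show ?thesis using outside by (simp add: far_def)
qed

text \<open>The two opposite shears carry two disjoint copies of \<open>flat\<close> into the steep
  cone. Each move costs \<open>err\<close>, and the part of the cone outside \<open>near\<close>
  costs \<open>out\<close>.\<close>

lemma two_flat: "2 * mass flat \<le> mass steep + out + 2 * err"
proof -
  let ?a = "\<lambda>k. (fst k, snd k - q * fst k)" and ?b = "\<lambda>k. (fst k, snd k + q * fst k)"
  have sub: "flat \<subseteq> centered N" and fin: "finite flat" by (auto simp: flat_def near_def)
  have "mass flat \<le> mass (?a ` flat) + err" by (rule moved_mass[OF sub inv1]) (auto simp: inj_on_def)
  moreover have "mass flat \<le> mass (?b ` flat) + err" by (rule moved_mass[OF sub inv1']) (auto simp: inj_on_def)
  moreover have "mass (?a ` flat) + mass (?b ` flat) = mass (?a ` flat \<union> ?b ` flat)"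
  proof (rule sum.union_disjoint[symmetric])
    have "fst k * snd k < 0" if "k \<in> ?a ` flat" for k using that shear_abs_less(3) by (auto simp: flat_def)
    moreover have "fst k * snd k > 0" if "k \<in> ?b ` flat" for k using that shear_abs_less(4) by (auto simp: flat_def)
    ultimately show "?a ` flat \<inter> ?b ` flat = {}" using less_asym by blast
  qed (use fin in auto)
  moreover have "mass (?a ` flat \<union> ?b ` flat) \<le> mass {k\<in>centered N. \<bar>fst k\<bar> < \<bar>snd k\<bar>}"
    by (rule mass_mono) (use near_centered shear_abs_less in \<open>auto simp: flat_def\<close>)
  ultimately show ?thesis using steep_far by linarith
qed

lemma two_steep: "2 * mass steep \<le> mass flat + out + 2 * err"
proof -
  let ?a = "\<lambda>k. (fst k - q * snd k, snd k)" and ?b = "\<lambda>k. (fst k + q * snd k, snd k)"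
  have sub: "steep \<subseteq> centered N" and fin: "finite steep" by (auto simp: steep_def near_def)
  have "mass steep \<le> mass (?a ` steep) + err" by (rule moved_mass[OF sub inv2]) (auto simp: inj_on_def)
  moreover have "mass steep \<le> mass (?b ` steep) + err" by (rule moved_mass[OF sub inv2']) (auto simp: inj_on_def)
  moreover have "mass (?a ` steep) + mass (?b ` steep) = mass (?a ` steep \<union> ?b ` steep)"
  proof (rule sum.union_disjoint[symmetric])
    have "snd k * fst k < 0" if "k \<in> ?a ` steep" for k using that shear_abs_less(3) by (auto simp: steep_def)
    moreover have "snd k * fst k > 0" if "k \<in> ?b ` steep" for k using that shear_abs_less(4) by (auto simp: steep_def)
    ultimately show "?a ` steep \<inter> ?b ` steep = {}" using less_asym by blast
  qed (use fin in auto)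
  moreover have "mass (?a ` steep \<union> ?b ` steep) \<le> mass {k\<in>centered N. \<bar>snd k\<bar> < \<bar>fst k\<bar>}"
    by (rule mass_mono) (use near_centered shear_abs_less in \<open>auto simp: steep_def\<close>)
  ultimately show ?thesis using flat_far by linarith
qed

text \<open>The diagonals belong to neither cone. One shear, with the sign for which the coordinates
  do not cancel, moves them into the steep one.\<close>

lemma diagonals:
  "mass {k\<in>near. fst k = - snd k \<and> fst k \<noteq> 0} \<le> mass steep + out + err"
  "mass {k\<in>near. fst k = snd k \<and> fst k \<noteq> 0} \<le> mass steep + out + err"
proof -
  let ?a = "\<lambda>k. (fst k, snd k - q * fst k)" and ?b = "\<lambda>k. (fst k, snd k + q * fst k)"
  let ?M = "{k\<in>near. fst k = - snd k \<and> fst k \<noteq> 0}" and ?P = "{k\<in>near. fst k = snd k \<and> fst k \<noteq> 0}"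
  have big: "\<bar>x\<bar> < \<bar>x + q * x\<bar>" "\<bar>x\<bar> < \<bar>- x - q * x\<bar>" if "x \<noteq> 0" for x :: int
  proof -
    have "\<bar>(1 + q) * x\<bar> = (1 + q) * \<bar>x\<bar>" using q by (simp add: abs_mult)
    moreover have "2 * \<bar>x\<bar> \<le> (1 + q) * \<bar>x\<bar>" using q by (intro mult_right_mono) auto
    moreover have "(1 + q) * x = x + q * x" by (simp add: algebra_simps)
    ultimately show "\<bar>x\<bar> < \<bar>x + q * x\<bar>" "\<bar>x\<bar> < \<bar>- x - q * x\<bar>" using that by linarith+
  qed
  have "mass ?M \<le> mass (?a ` ?M) + err"
    by (rule moved_mass[OF _ inv1]) (auto simp: inj_on_def near_def)
  also have "mass (?a ` ?M) \<le> mass {k\<in>centered N. \<bar>fst k\<bar> < \<bar>snd k\<bar>}"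
    by (rule mass_mono) (use near_centered(2) big(1) in \<open>force+\<close>)
  finally show "mass ?M \<le> mass steep + out + err" using steep_far by linarith
  have "mass ?P \<le> mass (?b ` ?P) + err"
    by (rule moved_mass[OF _ inv1']) (auto simp: inj_on_def near_def)
  also have "mass (?b ` ?P) \<le> mass {k\<in>centered N. \<bar>fst k\<bar> < \<bar>snd k\<bar>}"
    by (rule mass_mono) (use near_centered(3) big(1) in \<open>force+\<close>)
  finally show "mass ?P \<le> mass steep + out + err" using steep_far by linarith
qed

text \<open>Adding \<open>two_flat\<close> and \<open>two_steep\<close> bounds
  \<open>mass flat + mass steep\<close> by \<open>2 * out + 4 * err\<close>. The diagonals count
  \<open>steep\<close> twice more, so three times this bound is needed, besides
  \<open>2 * out + 2 * err\<close> from the diagonals and \<open>out\<close> from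
  \<open>far\<close>.\<close>

lemma total_bound: "T \<le> 9 * out + 14 * err"
proof -
  let ?M = "{k\<in>near. fst k = - snd k \<and> fst k \<noteq> 0}" and ?P = "{k\<in>near. fst k = snd k \<and> fst k \<noteq> 0}"
  have sub: "mass (A \<union> B) \<le> mass A + mass B" if "finite A" "finite B" for A B
    using sum_Un[OF that, of \<mu>] nonneg by (simp add: sum_nonneg)
  have "T \<le> mass ({(0, 0)} \<union> (far \<union> (flat \<union> (steep \<union> (?M \<union> ?P)))))"
    unfolding total by (rule mass_mono) (use finite_sets in \<open>auto simp: flat_def steep_def near_def prod_eq_iff\<close>)
  also have "\<dots> \<le> mass {(0, 0)} + (mass far + (mass flat + (mass steep + (mass ?M + mass ?P))))"
    using finite_sets by (intro sub[THEN order_trans] add_mono order_refl) (auto simp: flat_def steep_def)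
  also have "mass {(0, 0)} = 0" using zero by simp
  finally have "T \<le> mass far + (mass flat + (mass steep + (mass ?M + mass ?P)))" by simp
  moreover have "mass flat \<ge> 0" using nonneg by (simp add: sum_nonneg)
  ultimately show ?thesis
    using outside[folded far_def] two_flat two_steep diagonals by linarith
qed

end

text \<open>The Fourier transform turns a set that is almost invariant under the two unit translations and
  the two shears into a measure on the dual torus which is concentrated near \<open>0\<close> but vanishes there,
  and almost invariant under the transposed shears; a ping-pong argument excludes such measures.\<close>

theorem torus_expander:
  fixes q :: int
  assumes q: "q \<ge> 2"
  obtains c :: real where "c > 0"
    "\<And>N B. N > 0 \<Longrightarrow> B \<subseteq> torus N \<Longrightarrow> 2 * real (card B) \<le> real_of_int (N ^ 2) \<Longrightarrow>
       c * real (card B) \<le> (\<Sum>\<theta>\<leftarrow>torus_gens q. real (escape N B \<theta>))"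
proof -
  \<comment> \<open>The gap of a unit translation at the frequencies in \<open>far\<close>, where
    some coordinate is at least N / (2 (q + 1)) in absolute value.\<close>
  define \<delta> where "\<delta> = 2 - 2 * cos (2 * pi / real_of_int (2 * (q + 1)))"
  have \<delta>: "\<delta> > 0" unfolding \<delta>_def by (rule cis_gap_pos) (use q in simp)
  \<comment> \<open>The total mass will be bounded by its product with
    \<open>72 * \<eta> * (\<eta> / \<delta>) + 56 * \<eta>\<close>; the two minima make each summand
    at most 1/4.\<close>
  define \<eta> where "\<eta> = min (1 / 224) (\<delta> / 288)"
  have \<eta>: "\<eta> > 0" "\<eta> \<le> 1 / 224" "\<eta> \<le> \<delta> / 288" using \<delta> by (auto simp: \<eta>_def)
  have main: "\<eta>\<^sup>2 * real (card B) \<le> (\<Sum>\<theta>\<leftarrow>torus_gens q. real (escape N B \<theta>))"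
    if N: "N > 0" and B: "B \<subseteq> torus N" and half: "2 * real (card B) \<le> real_of_int (N ^ 2)" for N B
  proof (rule ccontr)
    assume "\<not> ?thesis"
    hence small: "real (escape N B \<theta>) \<le> \<eta>\<^sup>2 * real (card B)" if "\<theta> \<in> set (torus_gens q)" for \<theta>
      using that by (auto simp: torus_gens_def)
    have cB: "real (card B) > 0"
    proof (rule ccontr)
      assume "\<not> ?thesis"
      hence "B = {}" using finite_subset[OF B finite_torus] by simp
      thus False using \<open>\<not> _ \<le> _\<close> by (simp add: escape_def torus_gens_def)
    qed
    \<comment> \<open>Subtracting the density makes the transform vanish at frequency 0. Density at
      most 1/2 keeps at least half of the square norm of the indicator.\<close>
    define \<beta> where "\<beta> = real (card B) / real_of_int (N ^ 2)"
    have N2: "real_of_int (N ^ 2) > 0" using N by simp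
    have cW: "real (card (torus N)) = real_of_int (N ^ 2)" using N by (simp add: torus_def power2_eq_square)
    define f where "f w = (if res_pair N w \<in> B then 1 else 0) - \<beta>" for w
    have fper: "f (res_pair N w) = f w" for w by (simp add: f_def res_pair_def)
    have fW: "f w = (if w \<in> B then 1 else 0) - \<beta>" if "w \<in> torus N" for w
      using res_pair_id[OF that] by (simp add: f_def)
    have WB: "torus N \<inter> B = B" using B by blast
    have sum0: "(\<Sum>w\<in>torus N. f w) = 0"
      using fW cW N2 WB by (simp add: sum_subtractf sum.If_cases \<beta>_def cong: sum.cong)
    define E where "E = (\<Sum>w\<in>torus N. (f w)\<^sup>2)"
    have "E = (\<Sum>w\<in>torus N. (if w \<in> B then 1 - 2 * \<beta> else 0) + \<beta>\<^sup>2)"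
      unfolding E_def
    proof (rule sum.cong[OF refl])
      fix w assume "w \<in> torus N"
      thus "(f w)\<^sup>2 = (if w \<in> B then 1 - 2 * \<beta> else 0) + \<beta>\<^sup>2"
        unfolding fW[OF \<open>w \<in> torus N\<close>] by (cases "w \<in> B") (simp_all add: power2_eq_square algebra_simps)
    qed
    also have "\<dots> = real (card B) * (1 - 2 * \<beta>) + real_of_int (N ^ 2) * \<beta>\<^sup>2"
      using WB cW by (simp add: sum.distrib sum.If_cases)
    also have "real_of_int (N ^ 2) * \<beta>\<^sup>2 = real (card B) * \<beta>"
      using N2 by (simp add: \<beta>_def power2_eq_square)
    finally have E: "E = real (card B) * (1 - \<beta>)" by (simp add: algebra_simps)
    have "\<beta> \<le> 1 / 2" using half N2 by (simp add: \<beta>_def field_simps)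
    hence "real (card B) * (1 / 2) \<le> E" unfolding E using cB by (intro mult_left_mono) auto
    hence cE: "real (card B) \<le> 2 * E" by simp
    define T where "T = real_of_int (N ^ 2) * E"
    have T: "T > 0" using cE cB N2 by (auto simp: T_def zero_less_mult_iff)
    define F where "F = torus_fourier N f"
    have Fper: "F (res_pair N k) = F k" for k unfolding F_def by (rule torus_fourier_periodic[OF N])
    have almost: "(\<Sum>k\<in>centered N. (norm (torus_fourier N (\<lambda>w. f (\<theta> w)) k - F k))\<^sup>2) \<le> 4 * \<eta>\<^sup>2 * T"
      if \<theta>: "torus_automorphism N \<theta> \<theta>'" "\<theta> \<in> set (torus_gens q)" for \<theta> \<theta>'
    proof -
      let ?g = "\<lambda>w. f (\<theta> w) - f w"
      have "(\<Sum>k\<in>centered N. (norm (torus_fourier N (\<lambda>w. f (\<theta> w)) k - F k))\<^sup>2)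
          = (\<Sum>k\<in>centered N. (norm (torus_fourier N ?g k))\<^sup>2)"
        by (simp add: torus_fourier_diff F_def)
      also have "\<dots> = (\<Sum>k\<in>torus N. (norm (torus_fourier N ?g k))\<^sup>2)"
        by (rule centered_sum[OF N]) (simp add: torus_fourier_periodic[OF N])
      also have "\<dots> = real_of_int (N ^ 2) * (\<Sum>w\<in>torus N. (?g w)\<^sup>2)" by (rule torus_parseval[OF N])
      also have "(\<Sum>w\<in>torus N. (?g w)\<^sup>2) = 2 * real (escape N B \<theta>)"
        unfolding f_def by (rule escape_sum[OF N \<theta>(1) B])
      also have "\<dots> \<le> 2 * (\<eta>\<^sup>2 * (2 * E))"
        using small[OF \<theta>(2)] cE \<eta>(1) by (intro mult_left_mono order_trans[OF small[OF \<theta>(2)]]) auto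
      finally show ?thesis using N2 by (simp add: T_def mult_ac)
    qed
    have FT: "(\<Sum>k\<in>centered N. (norm (F k))\<^sup>2) = T"
    proof -
      have "(\<Sum>k\<in>centered N. (norm (F k))\<^sup>2) = (\<Sum>k\<in>torus N. (norm (F k))\<^sup>2)"
        by (rule centered_sum[OF N]) (simp add: Fper)
      thus ?thesis using torus_parseval[OF N, of f] by (simp add: F_def T_def E_def)
    qed
    have shifted: "(\<Sum>k\<in>centered N. (norm (F (\<theta> k)))\<^sup>2) = T" if "torus_automorphism N \<theta> \<theta>'" for \<theta> \<theta>'
    proof -
      have p: "F (\<theta> (res_pair N k)) = F (\<theta> k)" for k
        using that Fper unfolding torus_automorphism_def by metis
      have "(\<Sum>k\<in>centered N. (norm (F (\<theta> k)))\<^sup>2) = (\<Sum>k\<in>torus N. (norm (F (\<theta> k)))\<^sup>2)"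
        by (rule centered_sum[OF N]) (simp add: p)
      also have "\<dots> = (\<Sum>k\<in>torus N. (norm (F k))\<^sup>2)"
        by (rule torus_sum_automorphism[OF N that]) (simp add: Fper)
      also have "\<dots> = (\<Sum>k\<in>centered N. (norm (F k))\<^sup>2)"
        by (rule centered_sum[OF N, symmetric]) (simp add: Fper)
      finally show ?thesis using FT by simp
    qed
    \<comment> \<open>\<open>square_diff_bound\<close> with weight \<open>\<eta>\<close> balances
      the two terms: each of them contributes \<open>2 * \<eta> * T\<close>.\<close>
    have err: "(\<Sum>k\<in>centered N. \<bar>(norm (F (\<theta> k)))\<^sup>2 - (norm (F k))\<^sup>2\<bar>) \<le> 4 * \<eta> * T"
      if \<theta>: "torus_automorphism N \<theta> \<theta>'" and le: "(\<Sum>k\<in>centered N. (norm (F (\<theta> k) - F k))\<^sup>2) \<le> 4 * \<eta>\<^sup>2 * T" for \<theta> \<theta>'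
    proof -
      have "(\<Sum>k\<in>centered N. \<bar>(norm (F (\<theta> k)))\<^sup>2 - (norm (F k))\<^sup>2\<bar>)
         \<le> (\<Sum>k\<in>centered N. (norm (F (\<theta> k) - F k))\<^sup>2 / (2 * \<eta>) + \<eta> * ((norm (F (\<theta> k)))\<^sup>2 + (norm (F k))\<^sup>2))"
        by (intro sum_mono square_diff_bound \<eta>(1))
      also have "\<dots> = (\<Sum>k\<in>centered N. (norm (F (\<theta> k) - F k))\<^sup>2) / (2 * \<eta>) + \<eta> * (T + T)"
        by (simp add: sum.distrib sum_divide_distrib sum_distrib_left[symmetric] shifted[OF \<theta>] FT)
      also have "\<dots> \<le> 4 * \<eta>\<^sup>2 * T / (2 * \<eta>) + \<eta> * (T + T)"
        using le \<eta>(1) by (intro add_right_mono divide_right_mono) auto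
      also have "\<dots> = 4 * \<eta> * T" using \<eta>(1) by (simp add: power2_eq_square field_simps)
      finally show ?thesis .
    qed
    \<comment> \<open>On frequencies a shear acts through the inverse of its transpose, so the two
      shears exchange their roles.\<close>
    have s1: "torus_fourier N (\<lambda>w. f (fst w + q * snd w, snd w)) k = F (fst k, snd k - q * fst k)" for k
      unfolding torus_fourier_comp[where \<theta> = "\<lambda>w. (fst w + q * snd w, snd w)" and f = f, OF N shear1_automorphism fper]
      unfolding F_def torus_fourier_def
      by (simp add: pairing_def algebra_simps)
    have s2: "torus_fourier N (\<lambda>w. f (fst w, snd w + q * fst w)) k = F (fst k - q * snd k, snd k)" for k
      unfolding torus_fourier_comp[where \<theta> = "\<lambda>w. (fst w, snd w + q * fst w)" and f = f, OF N shear2_automorphism fper]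
      unfolding F_def torus_fourier_def
      by (simp add: pairing_def algebra_simps)
    have tr: "torus_fourier N (\<lambda>w. f (fst w + a, snd w + b)) k = int_char N (- pairing k (a, b)) * F k" for a b k
      unfolding torus_fourier_comp[where \<theta> = "\<lambda>w. (fst w + a, snd w + b)" and f = f, OF N translation_automorphism fper]
      unfolding F_def torus_fourier_def sum_distrib_left
      by (rule sum.cong[OF refl]) (simp add: int_char_add[symmetric] pairing_def algebra_simps)
    \<comment> \<open>A translation multiplies the transform by a character. Where the character
      stays away from 1, almost invariance forces the transform to be small.\<close>
    have trans_far: "\<delta> * (\<Sum>k\<in>K. (norm (F k))\<^sup>2) \<le> 4 * \<eta>\<^sup>2 * T"
      if K: "K \<subseteq> centered N" and ab: "(\<lambda>w. (fst w + a, snd w + b)) \<in> set (torus_gens q)"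
        and gap: "\<And>k. k \<in> K \<Longrightarrow> \<delta> \<le> (norm (int_char N (- pairing k (a, b)) - 1))\<^sup>2" for K a b
    proof -
      have "\<delta> * (\<Sum>k\<in>K. (norm (F k))\<^sup>2) \<le> (\<Sum>k\<in>K. (norm (int_char N (- pairing k (a, b)) - 1))\<^sup>2 * (norm (F k))\<^sup>2)"
        unfolding sum_distrib_left using gap by (intro sum_mono mult_right_mono) auto
      also have "\<dots> = (\<Sum>k\<in>K. (norm (torus_fourier N (\<lambda>w. f (fst w + a, snd w + b)) k - F k))\<^sup>2)"
      proof (rule sum.cong[OF refl])
        fix k
        have "torus_fourier N (\<lambda>w. f (fst w + a, snd w + b)) k - F k = (int_char N (- pairing k (a, b)) - 1) * F k"
          by (simp add: tr left_diff_distrib)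
        thus "(norm (int_char N (- pairing k (a, b)) - 1))\<^sup>2 * (norm (F k))\<^sup>2
          = (norm (torus_fourier N (\<lambda>w. f (fst w + a, snd w + b)) k - F k))\<^sup>2"
          by (simp add: norm_mult power_mult_distrib)
      qed
      also have "\<dots> \<le> (\<Sum>k\<in>centered N. (norm (torus_fourier N (\<lambda>w. f (fst w + a, snd w + b)) k - F k))\<^sup>2)"
        by (rule sum_mono2) (use K in auto)
      finally show ?thesis using almost[OF translation_automorphism ab] by linarith
    qed
    let ?K1 = "{k\<in>centered N. N \<le> 2 * (q + 1) * \<bar>fst k\<bar>}" and ?K2 = "{k\<in>centered N. N \<le> 2 * (q + 1) * \<bar>snd k\<bar>}"
    have cen: "2 * \<bar>x\<bar> \<le> N" if "- (N div 2) \<le> x" "x < N - N div 2" for x using that by linarith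
    have K1: "\<delta> * (\<Sum>k\<in>?K1. (norm (F k))\<^sup>2) \<le> 4 * \<eta>\<^sup>2 * T"
    proof (rule trans_far[of _ 1 0])
      fix k assume k: "k \<in> ?K1"
      show "\<delta> \<le> (norm (int_char N (- pairing k (1, 0)) - 1))\<^sup>2" unfolding \<delta>_def
        by (rule character_gap[OF N]) (use k q cen in \<open>auto simp: pairing_def centered_def\<close>)
    qed (auto simp: torus_gens_def)
    have K2: "\<delta> * (\<Sum>k\<in>?K2. (norm (F k))\<^sup>2) \<le> 4 * \<eta>\<^sup>2 * T"
    proof (rule trans_far[of _ 0 1])
      fix k assume k: "k \<in> ?K2"
      show "\<delta> \<le> (norm (int_char N (- pairing k (0, 1)) - 1))\<^sup>2" unfolding \<delta>_def
        by (rule character_gap[OF N]) (use k q cen in \<open>auto simp: pairing_def centered_def\<close>)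
    qed (auto simp: torus_gens_def)
    let ?K = "{k\<in>centered N. N \<le> 2 * (q + 1) * \<bar>fst k\<bar> \<or> N \<le> 2 * (q + 1) * \<bar>snd k\<bar>}"
    have "(\<Sum>k\<in>?K. (norm (F k))\<^sup>2) \<le> (\<Sum>k\<in>?K1. (norm (F k))\<^sup>2) + (\<Sum>k\<in>?K2. (norm (F k))\<^sup>2)"
    proof -
      have "?K = ?K1 \<union> ?K2" by blast
      thus ?thesis using sum_Un[of ?K1 ?K2 "\<lambda>k. (norm (F k))\<^sup>2"] by (simp add: sum_nonneg)
    qed
    hence "\<delta> * (\<Sum>k\<in>?K. (norm (F k))\<^sup>2) \<le> \<delta> * ((\<Sum>k\<in>?K1. (norm (F k))\<^sup>2) + (\<Sum>k\<in>?K2. (norm (F k))\<^sup>2))"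
      using \<delta> by (intro mult_left_mono) auto
    hence "\<delta> * (\<Sum>k\<in>?K. (norm (F k))\<^sup>2) \<le> 8 * \<eta>\<^sup>2 * T" using K1 K2 by (simp add: ring_distribs)
    hence out: "(\<Sum>k\<in>?K. (norm (F k))\<^sup>2) \<le> 8 * \<eta>\<^sup>2 * T / \<delta>" using \<delta> by (simp add: field_simps)
    interpret torus_almost_invariant N q "\<lambda>k. (norm (F k))\<^sup>2" "8 * \<eta>\<^sup>2 * T / \<delta>" "4 * \<eta> * T" T
    proof
      show "(norm (F (0, 0)))\<^sup>2 = 0"
        using sum0 by (simp add: F_def torus_fourier_def pairing_def int_char_def flip: of_real_sum)
      show "(\<Sum>k\<in>centered N. \<bar>(norm (F (fst k, snd k - q * fst k)))\<^sup>2 - (norm (F k))\<^sup>2\<bar>) \<le> 4 * \<eta> * T"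
        by (rule err[OF torus_automorphism_sym[OF shear2_automorphism]])
           (use almost[OF shear1_automorphism[of N q]] s1 in \<open>simp add: torus_gens_def\<close>)
      show "(\<Sum>k\<in>centered N. \<bar>(norm (F (fst k - q * snd k, snd k)))\<^sup>2 - (norm (F k))\<^sup>2\<bar>) \<le> 4 * \<eta> * T"
        by (rule err[OF torus_automorphism_sym[OF shear1_automorphism]])
           (use almost[OF shear2_automorphism[of N q]] s2 in \<open>simp add: torus_gens_def\<close>)
    qed (use N q FT out Fper in auto)
    have "T \<le> 9 * (8 * \<eta>\<^sup>2 * T / \<delta>) + 14 * (4 * \<eta> * T)" by (rule total_bound)
    also have "\<dots> = (72 * \<eta> * (\<eta> / \<delta>) + 56 * \<eta>) * T" by (simp add: power2_eq_square algebra_simps)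
    also have "\<dots> \<le> (1 / 4 + 1 / 4) * T"
    proof (rule mult_right_mono[OF add_mono])
      have "\<eta> / \<delta> \<le> 1 / 288" using \<eta>(3) \<delta> by (simp add: field_simps)
      hence "(72 * \<eta>) * (\<eta> / \<delta>) \<le> (72 * 1) * (1 / 288)" using \<eta> \<delta> by (intro mult_mono) auto
      thus "72 * \<eta> * (\<eta> / \<delta>) \<le> 1 / 4" by simp
    qed (use \<eta> T in auto)
    finally show False using T by simp
  qed
  show thesis by (rule that[of "\<eta>\<^sup>2"]) (use main \<eta>(1) in auto)
qed

section \<open>Growth of homology in subgroups of prime power index\<close>

context group begin

text \<open>The coset \<open>N\<close> is represented by \<open>\<one>\<close>, so that the Schreier
  element at the base coset of an element of \<open>N\<close> is that element itself.\<close>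

definition transversal :: "'a set \<Rightarrow> 'a set \<Rightarrow> 'a" where
  "transversal N C = (if C = N then \<one> else SOME g. g \<in> carrier G \<and> C = N #> g)"

lemma transversal:
  assumes N: "subgroup N G" and C: "C \<in> rcosets N"
  shows "transversal N C \<in> carrier G" "N #> transversal N C = C"
proof -
  have "transversal N C \<in> carrier G \<and> C = N #> transversal N C"
  proof (cases "C = N")
    case True thus ?thesis using subgroup.subset[OF N] by (simp add: transversal_def)
  next
    case False
    have "\<exists>g. g \<in> carrier G \<and> C = N #> g" using C rcosets_obtain by metis
    from someI_ex[OF this] show ?thesis using False by (simp add: transversal_def)
  qed
  thus "transversal N C \<in> carrier G" "N #> transversal N C = C" by auto
qed

text \<open>Schreier's generators, formed for all \<open>g\<close> and not only for generators; as
  functions of \<open>g\<close> they satisfy a cocycle law.\<close>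

definition schreier_elem :: "'a set \<Rightarrow> 'a set \<Rightarrow> 'a \<Rightarrow> 'a" where
  "schreier_elem N C g = transversal N C \<otimes> g \<otimes> inv (transversal N (C #> g))"

lemma schreier_elem_mem:
  assumes N: "subgroup N G" and C: "C \<in> rcosets N" and g: "g \<in> carrier G"
  shows "schreier_elem N C g \<in> N"
proof -
  have Cg: "C #> g \<in> rcosets N" using rcosets_mult_closed[OF N C g] .
  have "N #> (transversal N C \<otimes> g) = N #> transversal N (C #> g)"
    using transversal[OF N C] transversal[OF N Cg] g subgroup.subset[OF N] coset_mult_assoc by metis
  from iffD1[OF rcos_eq_iff[OF N _ transversal(1)[OF N Cg]] this] show ?thesis
    using transversal(1)[OF N C] g by (simp add: schreier_elem_def)
qed

lemma schreier_elem_mult: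
  assumes N: "subgroup N G" and C: "C \<in> rcosets N" and g: "g \<in> carrier G" and h: "h \<in> carrier G"
  shows "schreier_elem N C (g \<otimes> h) = schreier_elem N C g \<otimes> schreier_elem N (C #> g) h"
proof -
  have Cg: "C #> g \<in> rcosets N" and Cgh: "C #> g #> h \<in> rcosets N"
    using rcosets_mult_closed[OF N] C g h by auto
  have eq: "C #> (g \<otimes> h) = C #> g #> h" using rcosets_mult_assoc[OF N C g h] by simp
  let ?a = "transversal N C" and ?b = "transversal N (C #> g)" and ?c = "transversal N (C #> g #> h)"
  have c: "?a \<in> carrier G" "?b \<in> carrier G" "?c \<in> carrier G" using transversal[OF N] C Cg Cgh by auto
  have "?a \<otimes> g \<otimes> inv ?b \<otimes> (?b \<otimes> h \<otimes> inv ?c) = ?a \<otimes> g \<otimes> (inv ?b \<otimes> ?b) \<otimes> h \<otimes> inv ?c"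
    using c g h by (simp only: m_assoc m_closed inv_closed)
  thus ?thesis using c g h by (simp add: schreier_elem_def eq m_assoc)
qed

lemma schreier_elem_one: "subgroup N G \<Longrightarrow> C \<in> rcosets N \<Longrightarrow> schreier_elem N C \<one> = \<one>"
  using transversal[of N C] rcosets_mult_one[of N C] by (simp add: schreier_elem_def)

lemma schreier_elem_base:
  assumes N: "subgroup N G" and g: "g \<in> N" shows "schreier_elem N N g = g"
proof -
  have "g \<in> carrier G" using g subgroup.mem_carrier[OF N] by blast
  thus ?thesis using coset_join2[OF _ N g] by (simp add: schreier_elem_def transversal_def)
qed

text \<open>Schreier's lemma: by the cocycle law the Schreier elements of a word in \<open>S\<close>
  are products of those of its letters and their inverses.\<close>

lemma schreier_generate:
  assumes N: "subgroup N G" and fin: "finite (rcosets N)"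
    and S: "finite S" "S \<subseteq> carrier G" "generate G S = carrier G"
  shows "\<exists>X. finite X \<and> X \<subseteq> N \<and> generate G X = N"
proof (intro exI conjI)
  let ?X = "(\<lambda>(C, s). schreier_elem N C s) ` ((rcosets N) \<times> S)"
  show "finite ?X" using fin S(1) by simp
  show XN: "?X \<subseteq> N" using schreier_elem_mem[OF N] S(2) by auto
  have Xc: "?X \<subseteq> carrier G" using XN subgroup.subset[OF N] by blast
  have gX: "subgroup (generate G ?X) G" by (rule generate_is_subgroup[OF Xc])
  have step: "\<forall>C\<in>rcosets N. schreier_elem N C g \<in> generate G ?X" if "g \<in> generate G S" for g
    using that
  proof (induction rule: generate.induct)
    case one
    show ?case by (simp add: schreier_elem_one[OF N] generate.one)
  next
    case (incl s)
    thus ?case by (auto intro!: generate.incl)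
  next
    case (inv s)
    show ?case
    proof
      fix C assume C: "C \<in> rcosets N"
      have s: "s \<in> carrier G" using inv S(2) by blast
      have D: "C #> inv s \<in> rcosets N" using rcosets_mult_closed[OF N C] s by simp
      have "schreier_elem N C (inv s \<otimes> s) = schreier_elem N C (inv s) \<otimes> schreier_elem N (C #> inv s) s"
        by (rule schreier_elem_mult[OF N C]) (use s in auto)
      hence "schreier_elem N C (inv s) \<otimes> schreier_elem N (C #> inv s) s = \<one>"
        using s schreier_elem_one[OF N C] by simp
      hence "schreier_elem N C (inv s) = inv (schreier_elem N (C #> inv s) s)"
        using schreier_elem_mem[OF N C, of "inv s"] schreier_elem_mem[OF N D s] s subgroup.mem_carrier[OF N]
        by (metis inv_closed inv_equality inv_inv)
      moreover have "schreier_elem N (C #> inv s) s \<in> ?X" using D inv by force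
      ultimately show "schreier_elem N C (inv s) \<in> generate G ?X" using generate.inv by metis
    qed
  next
    case (eng g h)
    have "g \<in> carrier G" "h \<in> carrier G" using eng.hyps generate_in_carrier[OF S(2)] by auto
    thus ?case using eng.IH schreier_elem_mult[OF N] rcosets_mult_closed[OF N] generate.eng by metis
  qed
  show "generate G ?X = N"
  proof
    show "generate G ?X \<subseteq> N" by (rule generate_subgroup_incl[OF XN N])
    show "N \<subseteq> generate G ?X"
    proof
      fix g assume g: "g \<in> N"
      have "g \<in> generate G S" using g S(3) subgroup.subset[OF N] by blast
      hence "schreier_elem N N g \<in> generate G ?X" using step self_in_rcosets[OF N] by blast
      thus "g \<in> generate G ?X" using schreier_elem_base[OF N g] by simp
    qed
  qed
qed

end

section \<open>Counting homomorphisms by partial data\<close>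

lemma fp_homs_comb:
  assumes "f \<in> fp_homs p G" "g \<in> fp_homs p G" "p > 0" "group G"
  shows "(\<lambda>x\<in>carrier G. (f x + i * g x) mod int p) \<in> fp_homs p G"
proof -
  interpret group G by fact
  have "((f x + f y) mod int p + i * ((g x + g y) mod int p)) mod int p
     = ((f x + i * g x) mod int p + (f y + i * g y) mod int p) mod int p" for x y
  proof -
    have "((f x + f y) mod int p + i * ((g x + g y) mod int p)) mod int p = ((f x + f y) + i * (g x + g y)) mod int p"
      by (intro mod_add_cong mod_mult_cong; simp)
    also have "(f x + f y) + i * (g x + g y) = (f x + i * g x) + (f y + i * g y)" by (simp add: algebra_simps)
    finally show ?thesis by (simp add: mod_add_eq)
  qed
  hence "((f (x \<otimes>\<^bsub>G\<^esub> y) + i * g (x \<otimes>\<^bsub>G\<^esub> y)) mod int p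
     = ((f x + i * g x) mod int p + (f y + i * g y) mod int p) mod int p)" if "x \<in> carrier G" "y \<in> carrier G" for x y
    unfolding fp_homs_mult[OF assms(1) that] fp_homs_mult[OF assms(2) that] .
  thus ?thesis using assms(3) unfolding fp_homs_def by simp
qed

definition fp_diff :: "nat \<Rightarrow> ('a, 'b) monoid_scheme \<Rightarrow> ('a \<Rightarrow> int) \<Rightarrow> ('a \<Rightarrow> int) \<Rightarrow> 'a \<Rightarrow> int" where
  "fp_diff p G f g = (\<lambda>x\<in>carrier G. (f x - g x) mod int p)"

lemma fp_diff_homs:
  "f \<in> fp_homs p G \<Longrightarrow> g \<in> fp_homs p G \<Longrightarrow> p > 0 \<Longrightarrow> group G \<Longrightarrow> fp_diff p G f g \<in> fp_homs p G"
  using fp_homs_comb[of f p G g "- 1"] by (simp add: fp_diff_def)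

lemma fp_homs_eqI:
  assumes "f \<in> fp_homs p G" "g \<in> fp_homs p G" "\<And>x. x \<in> carrier G \<Longrightarrow> fp_diff p G f g x = 0"
  shows "f = g"
proof (rule PiE_ext[of f "carrier G" "\<lambda>_. {0..<int p}"])
  fix x assume x: "x \<in> carrier G"
  have "[f x = g x] (mod int p)" using assms(3)[OF x] x
    by (simp add: fp_diff_def cong_iff_dvd_diff dvd_eq_mod_eq_0)
  thus "f x = g x" using fp_homs_range[OF assms(1) x] fp_homs_range[OF assms(2) x] by (simp add: cong_def)
qed (use assms in \<open>auto simp: fp_homs_def\<close>)

lemma residue_eqI:
  fixes a b m :: int
  assumes "[a - b = 0] (mod m)" "0 \<le> a" "a < m" "0 \<le> b" "b < m" shows "a = b"
  using assms unfolding cong_diff_iff_cong_0 by (simp add: cong_def)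

text \<open>The fibres of a map that separates a set of homomorphisms modulo a subset \<open>F\<^sub>0\<close> are translates of subsets of \<open>F\<^sub>0\<close>.\<close>

lemma card_fp_homs_fibres:
  assumes G: "group G" "p > 0" and F: "F \<subseteq> fp_homs p G" and T: "finite T" "\<rho> ` F \<subseteq> T" and F0: "finite F0"
    and sep: "\<And>f g. f \<in> F \<Longrightarrow> g \<in> F \<Longrightarrow> \<rho> f = \<rho> g \<Longrightarrow> fp_diff p G f g \<in> F0"
  shows "finite F" "card F \<le> card T * card F0"
proof -
  define rep where "rep t = (SOME g. g \<in> F \<and> \<rho> g = t)" for t
  have rep: "rep (\<rho> f) \<in> F \<and> \<rho> (rep (\<rho> f)) = \<rho> f" if "f \<in> F" for f
    unfolding rep_def by (rule someI[where x = f]) (use that in simp)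
  let ?h = "\<lambda>f. (\<rho> f, fp_diff p G f (rep (\<rho> f)))"
  have inj: "inj_on ?h F"
  proof (rule inj_onI)
    fix f g assume f: "f \<in> F" and g: "g \<in> F" and eq: "?h f = ?h g"
    have r: "rep (\<rho> f) = rep (\<rho> g)" and d: "fp_diff p G f (rep (\<rho> g)) = fp_diff p G g (rep (\<rho> g))"
      using eq by auto
    show "f = g"
    proof (rule fp_homs_eqI)
      show "f \<in> fp_homs p G" "g \<in> fp_homs p G" using f g F by auto
      fix x assume x: "x \<in> carrier G"
      have "(f x - rep (\<rho> g) x) mod int p = (g x - rep (\<rho> g) x) mod int p"
        using fun_cong[OF d, of x] x by (simp add: fp_diff_def)
      hence "int p dvd (f x - rep (\<rho> g) x) - (g x - rep (\<rho> g) x)" by (simp add: mod_eq_dvd_iff)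
      thus "fp_diff p G f g x = 0" using x by (simp add: fp_diff_def)
    qed
  qed
  have im: "?h ` F \<subseteq> T \<times> F0" using T(2) rep sep by (fastforce)
  have fin: "finite (T \<times> F0)" using T F0 by simp
  show "finite F" using inj im fin by (meson finite_imageD finite_subset)
  have "card F = card (?h ` F)" using card_image[OF inj] by simp
  also have "\<dots> \<le> card (T \<times> F0)" by (rule card_mono[OF fin im])
  finally show "card F \<le> card T * card F0" by (simp add: card_cartesian_product)
qed

text \<open>Take \<open>X\<close> as large as possible with
  \<open>p ^ card X * card (Ann X) \<le> card (fp_homs p G)\<close>. If some \<open>f\<close>
  vanished on \<open>X\<close> but not at \<open>x\<close>, passing to \<open>insert x X\<close>
  would divide the annihilator by at least \<open>p\<close> and the inequality would persist. The
  resulting set has at most as many elements as a basis of the first homology.\<close>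

lemma (in group) fp_homs_separating:
  assumes p: "prime p" and fin: "finite (fp_homs p G)"
  obtains X where "finite X" "X \<subseteq> carrier G" "p ^ card X \<le> card (fp_homs p G)"
    "\<And>f. f \<in> fp_homs p G \<Longrightarrow> (\<forall>x\<in>X. f x = 0) \<Longrightarrow> (\<forall>x\<in>carrier G. f x = 0)"
proof -
  have p0: "p > 0" "p > 1" using prime_gt_0_nat[OF p] prime_gt_1_nat[OF p] by auto
  let ?F = "fp_homs p G"
  define Ann where "Ann X = {f\<in>?F. \<forall>x\<in>X. f x = 0}" for X
  define P where "P X \<longleftrightarrow> finite X \<and> X \<subseteq> carrier G \<and> p ^ card X * card (Ann X) \<le> card ?F" for X
  have zero: "(\<lambda>x\<in>carrier G. 0) \<in> Ann X" if "X \<subseteq> carrier G" for X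
    using that p0 by (auto simp: Ann_def fp_homs_def)
  have AnnF: "finite (Ann X)" for X using fin by (simp add: Ann_def)
  have bound: "card X \<le> card ?F" if "P X" for X
  proof -
    have "Ann X \<noteq> {}" using zero[of X] that by (auto simp: P_def)
    hence "card (Ann X) \<ge> 1" using AnnF[of X] by (simp add: Suc_le_eq card_gt_0_iff)
    hence "p ^ card X \<le> p ^ card X * card (Ann X)" by simp
    also have "\<dots> \<le> card ?F" using that by (simp add: P_def)
    finally have "p ^ card X \<le> card ?F" .
    moreover have "card X < p ^ card X" using p0 by (intro less_exp power_gt_expt) auto
    ultimately show ?thesis by linarith
  qed
  have "P {}" by (simp add: P_def Ann_def)
  hence "\<exists>X. P X \<and> (\<forall>Y. P Y \<longrightarrow> card Y \<le> card X)"
    by (rule ex_has_greatest_nat[where b = "Suc (card ?F)"]) (use bound in \<open>simp add: less_Suc_eq_le\<close>)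
  then obtain X where X: "P X" and max: "\<And>X'. P X' \<Longrightarrow> card X' \<le> card X" by blast
  have "\<forall>x\<in>carrier G. f x = 0" if f: "f \<in> ?F" "\<forall>x\<in>X. f x = 0" for f
  proof (rule ccontr)
    assume "\<not> ?thesis"
    then obtain x where x: "x \<in> carrier G" "f x \<noteq> 0" by blast
    let ?X = "insert x X"
    have xX: "x \<notin> X" using f x by blast
    \<comment> \<open>The pair (g, i) stands for g + i f; evaluation at \<open>x\<close>, where
      \<open>g\<close> vanishes and \<open>f\<close> does not, recovers \<open>i\<close>.\<close>
    let ?h = "\<lambda>(g, i). (\<lambda>y\<in>carrier G. (g y + i * f y) mod int p)"
    have inj: "inj_on ?h (Ann ?X \<times> {0..<int p})"
    proof (rule inj_onI, clarify)
      fix g i g' i'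
      assume g: "g \<in> Ann ?X" "g' \<in> Ann ?X" and i: "i \<in> {0..<int p}" "i' \<in> {0..<int p}"
        and eq: "(\<lambda>y\<in>carrier G. (g y + i * f y) mod int p) = (\<lambda>y\<in>carrier G. (g' y + i' * f y) mod int p)"
      have e: "(g y + i * f y) mod int p = (g' y + i' * f y) mod int p" if "y \<in> carrier G" for y
        using fun_cong[OF eq, of y] that by simp
      have "(i * f x) mod int p = (i' * f x) mod int p" using e[OF x(1)] g by (simp add: Ann_def)
      hence "int p dvd (i - i') * f x" by (simp add: mod_eq_dvd_iff left_diff_distrib)
      moreover have "\<not> int p dvd f x" using x fp_homs_range[OF f(1) x(1)] by (auto dest: zdvd_imp_le)
      ultimately have "int p dvd i - i'" using p prime_dvd_mult_iff[of "int p"] by auto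
      hence "i = i'" using i by (metis atLeastLessThan_iff mod_eq_dvd_iff mod_pos_pos_trivial)
      moreover have "g = g'"
      proof (rule PiE_ext[of g "carrier G" "\<lambda>_. {0..<int p}"])
        fix y assume y: "y \<in> carrier G"
        have "g y mod int p = g' y mod int p" using e[OF y] \<open>i = i'\<close> by (simp add: mod_eq_dvd_iff)
        thus "g y = g' y" using g fp_homs_range[OF _ y] by (auto simp: Ann_def)
      qed (use g in \<open>auto simp: Ann_def fp_homs_def\<close>)
      ultimately show "g = g' \<and> i = i'" by blast
    qed
    have im: "?h ` (Ann ?X \<times> {0..<int p}) \<subseteq> Ann X"
    proof clarify
      fix g i assume g: "g \<in> Ann ?X" and "i \<in> {0..<int p}"
      have "(\<lambda>y\<in>carrier G. (g y + i * f y) mod int p) \<in> ?F"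
        using fp_homs_comb[of g p G f i] g f p0 is_group by (auto simp: Ann_def)
      thus "(\<lambda>y\<in>carrier G. (g y + i * f y) mod int p) \<in> Ann X"
        using g f(2) X by (auto simp: Ann_def P_def)
    qed
    have "card (Ann ?X) * p = card (?h ` (Ann ?X \<times> {0..<int p}))"
      using card_image[OF inj] by (simp add: card_cartesian_product)
    also have "\<dots> \<le> card (Ann X)" by (rule card_mono[OF AnnF im])
    finally have "p ^ card X * (card (Ann ?X) * p) \<le> p ^ card X * card (Ann X)" by (rule mult_le_mono2)
    also have "\<dots> \<le> card ?F" using X by (simp add: P_def)
    finally have "p ^ Suc (card X) * card (Ann ?X) \<le> card ?F" by (simp add: mult_ac)
    moreover have "card ?X = Suc (card X)" using xX X by (simp add: P_def)
    ultimately have "P ?X" using X x by (simp only: P_def) simp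
    thus False using max[of ?X] \<open>card ?X = Suc (card X)\<close> by simp
  qed
  moreover have "p ^ card X \<le> card ?F"
  proof -
    have "Ann X \<noteq> {}" using zero[of X] X by (auto simp: P_def)
    hence "card (Ann X) \<ge> 1" using AnnF[of X] by (simp add: Suc_le_eq card_gt_0_iff)
    hence "p ^ card X \<le> p ^ card X * card (Ann X)" by simp
    also have "\<dots> \<le> card ?F" using X by (simp add: P_def)
    finally show ?thesis .
  qed
  ultimately show thesis using that X by (auto simp: P_def)
qed

text \<open>Integer values with a congruence as law, so that sums along paths need not be
  reduced.\<close>

definition coset_cocycle :: "nat \<Rightarrow> ('a, 'b) monoid_scheme \<Rightarrow> 'a set \<Rightarrow> ('a set \<Rightarrow> 'a \<Rightarrow> int) \<Rightarrow> bool" where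
  "coset_cocycle p G N c \<longleftrightarrow> (\<forall>C\<in>rcosets\<^bsub>G\<^esub> N. \<forall>g\<in>carrier G. \<forall>h\<in>carrier G.
     [c C (g \<otimes>\<^bsub>G\<^esub> h) = c C g + c (C #>\<^bsub>G\<^esub> g) h] (mod int p))"

context group begin

text \<open>The elements on which a cocycle vanishes form a subgroup containing a subgroup of \<open>p\<close>-power index, so it is
  everything as soon as it contains generators of the first homology.\<close>

lemma cocycle_vanishes:
  assumes p: "prime p" and N: "p_open p G N" and c: "coset_cocycle p G N c"
    and X: "X \<subseteq> carrier G" "\<And>f. f \<in> fp_homs p G \<Longrightarrow> (\<forall>x\<in>X. f x = 0) \<Longrightarrow> (\<forall>x\<in>carrier G. f x = 0)"
    and cX: "\<And>C x. C \<in> rcosets N \<Longrightarrow> x \<in> X \<Longrightarrow> [c C x = 0] (mod int p)"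
    and C: "C \<in> rcosets N" and g: "g \<in> carrier G"
  shows "[c C g = 0] (mod int p)"
proof -
  have Ns: "subgroup N G" and finN: "finite (rcosets N)" using N by (auto simp: p_open_def)
  have cc: "[c C (g \<otimes> h) = c C g + c (C #> g) h] (mod int p)" if "C \<in> rcosets N" "g \<in> carrier G" "h \<in> carrier G" for C g h
    using c that by (auto simp: coset_cocycle_def)
  have one: "[c C \<one> = 0] (mod int p)" if "C \<in> rcosets N" for C
    using cc[OF that, of \<one> \<one>] rcosets_mult_one[OF Ns that] by (simp add: cong_iff_dvd_diff)
  define L where "L = {g\<in>carrier G. \<forall>C\<in>rcosets N. [c C g = 0] (mod int p)}"
  have cinv: "[c C (inv g) = - c (C #> inv g) g] (mod int p)" if "C \<in> rcosets N" "g \<in> carrier G" for C g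
  proof -
    have "[c C (inv g) + c (C #> inv g) g = 0] (mod int p)"
      using cc[OF that(1), of "inv g" g] one[OF that(1)] that(2) by (simp add: cong_def)
    thus ?thesis by (simp add: cong_iff_dvd_diff)
  qed
  have L: "subgroup L G"
  proof (rule subgroupI)
    show "L \<noteq> {}" using one by (auto simp: L_def)
    fix a assume "a \<in> L"
    hence a: "a \<in> carrier G" "\<And>C. C \<in> rcosets N \<Longrightarrow> [c C a = 0] (mod int p)" by (auto simp: L_def)
    have "[c C (inv a) = 0] (mod int p)" if C: "C \<in> rcosets N" for C
      using cinv[OF C a(1)] a(2)[OF rcosets_mult_closed[OF Ns C inv_closed[OF a(1)]]]
      by (metis cong_minus_minus_iff cong_trans minus_zero)
    thus "inv a \<in> L" using a by (simp add: L_def)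
  next
    fix a b assume "a \<in> L" "b \<in> L"
    hence a: "a \<in> carrier G" "\<And>C. C \<in> rcosets N \<Longrightarrow> [c C a = 0] (mod int p)"
      and b: "b \<in> carrier G" "\<And>C. C \<in> rcosets N \<Longrightarrow> [c C b = 0] (mod int p)" by (auto simp: L_def)
    have "[c C (a \<otimes> b) = 0] (mod int p)" if C: "C \<in> rcosets N" for C
      using cc[OF C a(1) b(1)] cong_add[OF a(2)[OF C] b(2)[OF rcosets_mult_closed[OF Ns C a(1)]]]
      by (metis add.right_neutral cong_trans)
    thus "a \<otimes> b \<in> L" using a b by (simp add: L_def)
  qed (auto simp: L_def)
  have "p_open p G L"
    unfolding p_open_def
  proof (intro conjI)
    show "subgroup L G" by (rule L)
    obtain k where k: "\<forall>g\<in>carrier G. g [^] (p ^ k) \<in> N" using N by (auto simp: p_open_def)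
    \<comment> \<open>The first \<open>k\<close> factors of the exponent reach the core of
      \<open>N\<close>, where every coset is fixed; there the cocycle is additive on powers and one
      more factor \<open>p\<close> kills it.\<close>
    have "g [^] (p ^ Suc k) \<in> L" if g: "g \<in> carrier G" for g
    proof -
      let ?h = "g [^] (p ^ k)"
      have h: "?h \<in> carrier G" using g by simp
      have fixes_C: "C #> ?h = C" if "C \<in> rcosets N" for C
        using pow_mem_coset_core[OF Ns k g] that by (auto simp: coset_core_def)
      have "[c C (?h [^] n) = int n * c C ?h] (mod int p)" if C: "C \<in> rcosets N" for C and n :: nat
      proof (induction n)
        case 0 thus ?case using one[OF C] by simp
      next
        case (Suc n)
        have fixn: "C #> ?h [^] n = C" by (induction n) (use fixes_C[OF C] rcosets_mult_one[OF Ns C] h C in \<open>auto simp: rcosets_mult_assoc[OF Ns, symmetric]\<close>)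
        have "[c C (?h [^] n \<otimes> ?h) = c C (?h [^] n) + c C ?h] (mod int p)" using cc[OF C, of "?h [^] n" ?h] h fixn by simp
        moreover have "[c C (?h [^] n) + c C ?h = int n * c C ?h + c C ?h] (mod int p)" using Suc by (intro cong_add) auto
        ultimately have "[c C (?h [^] n \<otimes> ?h) = int n * c C ?h + c C ?h] (mod int p)" by (rule cong_trans)
        thus ?case by (simp add: algebra_simps)
      qed
      from this[of _ p] have "[c C (?h [^] p) = 0] (mod int p)" if "C \<in> rcosets N" for C
        using that by (metis cong_mult_self_left cong_trans)
      thus ?thesis using g by (simp add: L_def nat_pow_pow mult.commute)
    qed
    thus "\<exists>k. \<forall>g\<in>carrier G. g [^] (p ^ k) \<in> L" by blast
    \<comment> \<open>A coset of \<open>L\<close> is determined by the way a representative permutes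
      the cosets of \<open>N\<close> and by the residues of its cocycle values.\<close>
    define \<rho> where "\<rho> X = (\<lambda>C\<in>rcosets N. (C #> transversal L X, c C (transversal L X) mod int p))" for X
    have "\<rho> ` (rcosets L) \<subseteq> (rcosets N) \<rightarrow>\<^sub>E (rcosets N) \<times> {0..<int p}"
      using transversal[OF L] rcosets_mult_closed[OF Ns] prime_gt_0_nat[OF p] by (auto simp: \<rho>_def)
    moreover have "finite ((rcosets N) \<rightarrow>\<^sub>E (rcosets N) \<times> {0..<int p})" using finN by (intro finite_PiE) auto
    moreover have "inj_on \<rho> (rcosets L)"
    proof (rule inj_onI)
      fix X Y assume X: "X \<in> rcosets L" and Y: "Y \<in> rcosets L" and eq: "\<rho> X = \<rho> Y"
      let ?g = "transversal L X" and ?h = "transversal L Y"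
      have gh: "?g \<in> carrier G" "?h \<in> carrier G" using transversal[OF L] X Y by auto
      have "[c C (?g \<otimes> inv ?h) = 0] (mod int p)" if C: "C \<in> rcosets N" for C
      proof -
        have e: "C #> ?g = C #> ?h" "[c C ?g = c C ?h] (mod int p)"
          using fun_cong[OF eq, of C] C by (auto simp: \<rho>_def cong_def)
        have return: "C #> ?h #> inv ?h = C" using gh C by (simp add: rcosets_mult_assoc[OF Ns] rcosets_mult_one[OF Ns])
        have "[c C (?g \<otimes> inv ?h) = c C ?g + c (C #> ?h) (inv ?h)] (mod int p)"
          using cc[OF C gh(1), of "inv ?h"] gh e by simp
        also have "[c C ?g + c (C #> ?h) (inv ?h) = c C ?h + - c C ?h] (mod int p)"
          using e(2) cinv[OF rcosets_mult_closed[OF Ns C gh(2)] gh(2)] return by (intro cong_add) auto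
        finally show ?thesis by simp
      qed
      hence "?g \<otimes> inv ?h \<in> L" using gh by (simp add: L_def)
      hence "L #> ?g = L #> ?h" using rcos_eq_iff[OF L gh] by simp
      thus "X = Y" using transversal(2)[OF L] X Y by simp
    qed
    ultimately show "finite (rcosets L)" by (meson finite_imageD finite_subset)
  qed
  moreover have "X \<subseteq> L" using X(1) cX by (auto simp: L_def)
  ultimately have "L = carrier G" using p_open_hom[OF _ _ p, of L] X(2) by blast
  thus ?thesis using C g by (auto simp: L_def)
qed

text \<open>The cocycle on cosets that corresponds to \<open>f\<close> under Shapiro's lemma; at the
  base coset it restricts to \<open>f\<close>.\<close>

definition transfer_cocycle :: "'a set \<Rightarrow> ('a \<Rightarrow> int) \<Rightarrow> 'a set \<Rightarrow> 'a \<Rightarrow> int" where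
  "transfer_cocycle N f C g = f (schreier_elem N C g)"

lemma transfer_cocycle_mult:
  assumes N: "subgroup N G" and f: "f \<in> fp_homs p (G\<lparr>carrier := N\<rparr>)"
    and C: "C \<in> rcosets N" and g: "g \<in> carrier G" and h: "h \<in> carrier G"
  shows "[transfer_cocycle N f C (g \<otimes> h) = transfer_cocycle N f C g + transfer_cocycle N f (C #> g) h] (mod int p)"
proof -
  have "schreier_elem N C g \<in> N" "schreier_elem N (C #> g) h \<in> N"
    using schreier_elem_mem[OF N] C g h rcosets_mult_closed[OF N C g] by auto
  thus ?thesis
    using fp_homs_mult[OF f] schreier_elem_mult[OF N C g h] by (simp add: transfer_cocycle_def cong_def)
qed

lemma transfer_cocycle_base:
  assumes "subgroup N G" "g \<in> N" shows "transfer_cocycle N f N g = f g"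
  using schreier_elem_base[OF assms] by (simp add: transfer_cocycle_def)

lemma transfer_cocycle_diff:
  assumes N: "subgroup N G" and C: "C \<in> rcosets N" and g: "g \<in> carrier G"
  shows "[transfer_cocycle N (fp_diff p (G\<lparr>carrier := N\<rparr>) f f') C g = transfer_cocycle N f C g - transfer_cocycle N f' C g] (mod int p)"
  using schreier_elem_mem[OF N C g] by (simp add: transfer_cocycle_def fp_diff_def cong_def)

lemma index_pos: "subgroup N G \<Longrightarrow> finite (rcosets N) \<Longrightarrow> card (rcosets N) > 0"
  using self_in_rcosets by (metis card_gt_0_iff empty_iff)

text \<open>To the cocycle of \<open>f\<close> add the coboundary of a function on cosets that is 0
  at \<open>N\<close>. By \<open>cocycle_vanishes\<close> the values on \<open>rcosets N\<close>
  times \<open>X\<close> determine the pair, and the coboundaries account for the power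
  \<open>card (rcosets N) - 1\<close>. This is the analogue of Schreier's index formula for the
  rank.\<close>

lemma homs_index_bound:
  assumes p: "prime p" and N: "p_open p G N" and X: "finite X" "X \<subseteq> carrier G"
    and sep: "\<And>f. f \<in> fp_homs p G \<Longrightarrow> (\<forall>x\<in>X. f x = 0) \<Longrightarrow> (\<forall>x\<in>carrier G. f x = 0)"
  shows "card (fp_homs p (G\<lparr>carrier := N\<rparr>)) * p ^ (card (rcosets N) - 1) \<le> p ^ (card (rcosets N) * card X)"
proof -
  have Ns: "subgroup N G" and finN: "finite (rcosets N)" using N by (auto simp: p_open_def)
  have p0: "int p > 0" using prime_gt_0_nat[OF p] by simp
  interpret N: group "G\<lparr>carrier := N\<rparr>" using Ns subgroup_imp_group by blast
  let ?F = "fp_homs p (G\<lparr>carrier := N\<rparr>)" and ?V = "rcosets N"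
  let ?\<Phi> = "(?V - {N}) \<rightarrow>\<^sub>E {0..<int p}"
  define ext where "ext \<phi> C = (if C = N then 0 else \<phi> C)" for \<phi> :: "'a set \<Rightarrow> int" and C
  define c where "c f \<phi> C g = transfer_cocycle N f C g + ext \<phi> (C #> g) - ext \<phi> C" for f \<phi> C g
  define \<rho> where "\<rho> = (\<lambda>(f, \<phi>). \<lambda>y\<in>?V \<times> X. c f \<phi> (fst y) (snd y) mod int p)"
  have cocyc: "coset_cocycle p G N (\<lambda>C g. c f \<phi> C g - c f' \<phi>' C g)" if "f \<in> ?F" "f' \<in> ?F" for f f' \<phi> \<phi>'
    unfolding coset_cocycle_def
  proof (intro ballI)
    fix C g h assume C: "C \<in> ?V" and g: "g \<in> carrier G" and h: "h \<in> carrier G"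
    have eq: "C #> (g \<otimes> h) = C #> g #> h" using rcosets_mult_assoc[OF Ns C g h] by simp
    have "[transfer_cocycle N f C (g \<otimes> h) - transfer_cocycle N f' C (g \<otimes> h) =
      (transfer_cocycle N f C g + transfer_cocycle N f (C #> g) h) - (transfer_cocycle N f' C g + transfer_cocycle N f' (C #> g) h)] (mod int p)"
      by (intro cong_diff transfer_cocycle_mult[OF Ns _ C g h] that)
    thus "[c f \<phi> C (g \<otimes> h) - c f' \<phi>' C (g \<otimes> h) = c f \<phi> C g - c f' \<phi>' C g + (c f \<phi> (C #> g) h - c f' \<phi>' (C #> g) h)] (mod int p)"
      by (simp add: c_def eq cong_iff_dvd_diff algebra_simps)
  qed
  have inj: "inj_on \<rho> (?F \<times> ?\<Phi>)"
  proof (rule inj_onI, clarify)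
    fix f \<phi> f' \<phi>' assume f: "f \<in> ?F" "f' \<in> ?F" and \<phi>: "\<phi> \<in> ?\<Phi>" "\<phi>' \<in> ?\<Phi>" and eq: "\<rho> (f, \<phi>) = \<rho> (f', \<phi>')"
    have "[c f \<phi> C x - c f' \<phi>' C x = 0] (mod int p)" if "C \<in> ?V" "x \<in> X" for C x
      using fun_cong[OF eq, of "(C, x)"] that by (simp add: \<rho>_def cong_iff_dvd_diff mod_eq_dvd_iff)
    from cocycle_vanishes[OF p N cocyc[OF f] X(2) sep this]
    have van: "[c f \<phi> C g - c f' \<phi>' C g = 0] (mod int p)" if "C \<in> ?V" "g \<in> carrier G" for C g
      using that by blast
    have NV: "N \<in> ?V" using self_in_rcosets[OF Ns] .
    \<comment> \<open>Elements of \<open>N\<close> return to the base coset, where the coboundary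
      cancels, so \<open>f\<close> is recovered; afterwards walking from \<open>N\<close> to
      \<open>C\<close> recovers the function on cosets.\<close>
    have "f = f'"
    proof (rule PiE_ext[of f N "\<lambda>_. {0..<int p}"])
      fix g assume g: "g \<in> N"
      hence gc: "g \<in> carrier G" using subgroup.mem_carrier[OF Ns] by blast
      have "[f g - f' g = 0] (mod int p)"
        using van[OF NV gc] transfer_cocycle_base[OF Ns g] coset_join2[OF gc Ns g] by (simp add: c_def ext_def)
      thus "f g = f' g" by (rule residue_eqI) (use fp_homs_range[OF f(1), of g] fp_homs_range[OF f(2), of g] g in auto)
    qed (use f in \<open>auto simp: fp_homs_def\<close>)
    moreover have "\<phi> = \<phi>'"
    proof (rule PiE_ext[OF \<phi>])
      fix C assume C: "C \<in> ?V - {N}"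
      let ?g = "transversal N C"
      have g: "?g \<in> carrier G" "N #> ?g = C" using transversal[OF Ns] C by auto
      have "[\<phi> C - \<phi>' C = 0] (mod int p)" using van[OF NV g(1)] g C \<open>f = f'\<close> by (simp add: c_def ext_def)
      moreover have "\<phi> C \<in> {0..<int p}" "\<phi>' C \<in> {0..<int p}" using \<phi> C by blast+
      ultimately show "\<phi> C = \<phi>' C" by (intro residue_eqI) auto
    qed
    ultimately show "f = f' \<and> \<phi> = \<phi>'" by blast
  qed
  let ?T = "(?V \<times> X) \<rightarrow>\<^sub>E {0..<int p}"
  have "(\<lambda>y\<in>D. h y mod int p) \<in> D \<rightarrow>\<^sub>E {0..<int p}" for D and h :: "'a set \<times> 'a \<Rightarrow> int" using p0 by auto
  hence im: "\<rho> ` (?F \<times> ?\<Phi>) \<subseteq> ?T" unfolding \<rho>_def split_def by (intro image_subsetI)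
  have finT: "finite ?T" using finN X by (intro finite_PiE) auto
  have "card (?F \<times> ?\<Phi>) \<le> card ?T" by (rule card_inj_on_le[OF inj im finT])
  moreover have "card ?\<Phi> = p ^ card (?V - {N})"
    using finN by (simp add: card_PiE)
  moreover have "card (?V - {N}) = card ?V - 1"
    by (rule card_Diff_singleton[OF self_in_rcosets[OF Ns]])
  moreover have "card ?T = p ^ (card ?V * card X)"
    using finN X by (simp add: card_PiE card_cartesian_product)
  ultimately show ?thesis by (simp add: card_cartesian_product)
qed

end

section \<open>Cutting a coset graph\<close>

lemma word_equiv_invariant:
  assumes "(w, w') \<in> word_equiv L R"
    and "\<And>u r v. u \<in> lists L \<Longrightarrow> v \<in> lists L \<Longrightarrow> r \<in> R \<Longrightarrow> \<phi> (u @ r @ v) = \<phi> (u @ v)"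
  shows "\<phi> w = \<phi> w'"
  using assms(1) unfolding word_equiv_def
proof (induction rule: rtrancl_induct)
  case (step y z)
  have "\<phi> y = \<phi> z" if "(y, z) \<in> word_step L R" for y z
    using that assms(2) unfolding word_step_def by blast
  thus ?case using step by fastforce
qed simp

lemma (in group) common_kernel_p_open:
  assumes p: "prime p" and K: "finite K" "K \<subseteq> fp_homs p G"
  shows "p_open p G {x\<in>carrier G. \<forall>f\<in>K. f x = 0}"
proof -
  let ?J = "{x\<in>carrier G. \<forall>f\<in>K. f x = 0}"
  have ker: "subgroup {x\<in>carrier G. f x = 0} G" if "f \<in> K" for f
    using fp_hom_kernel(1)[OF _ p] K(2) that normal_imp_subgroup by blast
  have J: "subgroup ?J G"
  proof (rule subgroupI)
    show "?J \<noteq> {}" using fp_homs_one K(2) by blast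
    fix a assume "a \<in> ?J" thus "inv a \<in> ?J" using ker subgroup.m_inv_closed by fastforce
  next
    fix a b assume "a \<in> ?J" "b \<in> ?J" thus "a \<otimes> b \<in> ?J" using ker subgroup.m_closed by fastforce
  qed auto
  define \<rho> where "\<rho> X = (\<lambda>f\<in>K. f (transversal ?J X))" for X
  have "\<rho> ` (rcosets ?J) \<subseteq> K \<rightarrow>\<^sub>E {0..<int p}"
    using transversal(1)[OF J] K(2) fp_homs_range by (fastforce simp: \<rho>_def)
  moreover have "finite (K \<rightarrow>\<^sub>E {0..<int p})" using K by (intro finite_PiE) auto
  moreover have "inj_on \<rho> (rcosets ?J)"
  proof (rule inj_onI)
    fix X Y assume X: "X \<in> rcosets ?J" and Y: "Y \<in> rcosets ?J" and eq: "\<rho> X = \<rho> Y"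
    let ?g = "transversal ?J X" and ?h = "transversal ?J Y"
    have gh: "?g \<in> carrier G" "?h \<in> carrier G" using transversal(1)[OF J] X Y by auto
    have "f (?g \<otimes> inv ?h) = 0" if f: "f \<in> K" for f
    proof -
      have "f ?g = f ?h" using fun_cong[OF eq, of f] f by (simp add: \<rho>_def)
      moreover have f: "f \<in> fp_homs p G" using f K(2) by blast
      ultimately have "f (?g \<otimes> inv ?h) = f (?h \<otimes> inv ?h)"
        unfolding fp_homs_mult[OF f gh(1) inv_closed[OF gh(2)]] fp_homs_mult[OF f gh(2) inv_closed[OF gh(2)]] by simp
      thus ?thesis unfolding r_inv[OF gh(2)] fp_homs_one[OF f] .
    qed
    hence "?g \<otimes> inv ?h \<in> ?J" using gh by simp
    hence "?J #> ?g = ?J #> ?h" using rcos_eq_iff[OF J gh] by simp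
    thus "X = Y" using transversal(2)[OF J] X Y by simp
  qed
  ultimately have "finite (rcosets ?J)" by (meson finite_imageD finite_subset)
  moreover have "g [^] (p ^ 1) \<in> ?J" if "g \<in> carrier G" for g
    using that fp_homs_pow[of _ p g p] K(2) by auto
  ultimately show ?thesis unfolding p_open_def using J by blast
qed

primrec path_in :: "('a, 'b) monoid_scheme \<Rightarrow> ('l \<Rightarrow> 'a) \<Rightarrow> 'a set set \<Rightarrow> 'a set \<Rightarrow> 'l list \<Rightarrow> bool" where
  "path_in G ev P C [] \<longleftrightarrow> C \<in> P"
| "path_in G ev P C (l # w) \<longleftrightarrow> C \<in> P \<and> path_in G ev P (C #>\<^bsub>G\<^esub> ev l) w"

primrec path_edges :: "('a, 'b) monoid_scheme \<Rightarrow> ('l \<Rightarrow> 'a) \<Rightarrow> 'a set \<Rightarrow> 'l list \<Rightarrow> ('a set \<times> 'l) list" where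
  "path_edges G ev C [] = []"
| "path_edges G ev C (l # w) = (C, l) # path_edges G ev (C #>\<^bsub>G\<^esub> ev l) w"

text \<open>The vertices of a coset graph are cut into \<open>A\<close> and its complement, and \<open>F\<close> is a set of homomorphisms
  \<open>N \<rightarrow> \<int>/p\<close> whose cocycles vanish on every path along a word of \<open>W\<close> that crosses the cut.\<close>

locale coset_cut = group G for G (structure) +
  fixes L :: "'l set" and ev :: "'l \<Rightarrow> 'a" and Rel W :: "'l list set" and p :: nat
    and N :: "'a set" and A :: "'a set set" and F :: "('a \<Rightarrow> int) set"
  assumes pres: "monoid_presentation G L ev Rel" and p: "prime p"
    and N: "subgroup N G" and finN: "finite (rcosets N)" and A: "A \<subseteq> rcosets N"
    and W: "Rel \<subseteq> W" "\<And>l. l \<in> L \<Longrightarrow> [l] \<in> W" "W \<subseteq> lists L"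
    and F: "F \<subseteq> fp_homs p (G\<lparr>carrier := N\<rparr>)" and finF: "finite F"
    and near: "\<And>C w. C \<in> rcosets N \<Longrightarrow> w \<in> W \<Longrightarrow>
      path_in G ev A C w \<or> path_in G ev (rcosets N - A) C w \<or>
      (\<forall>f\<in>F. \<forall>(D, l)\<in>set (path_edges G ev C w). transfer_cocycle N f D (ev l) = 0)"
begin

abbreviation "V \<equiv> rcosets N"
abbreviation "tc \<equiv> transfer_cocycle N"
abbreviation "stays \<equiv> path_in G ev"
abbreviation "flat C w \<equiv> (\<forall>f\<in>F. \<forall>(D, l)\<in>set (path_edges G ev C w). tc f D (ev l) = 0)"

definition pos :: "'a set \<Rightarrow> 'l list \<Rightarrow> 'a set" where
  "pos C w = C #> word_val G ev w"

lemma ev_closed: "l \<in> L \<Longrightarrow> ev l \<in> carrier G" and Rel_lists: "Rel \<subseteq> lists L"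
  and finL: "finite L"
  using pres by (auto simp: monoid_presentation_def)

lemma ev_fun: "ev \<in> L \<rightarrow> carrier G" using ev_closed by auto

lemma val_closed: "w \<in> lists L \<Longrightarrow> word_val G ev w \<in> carrier G"
  by (rule word_val_closed[OF ev_fun])

lemma move_closed: "C \<in> V \<Longrightarrow> l \<in> L \<Longrightarrow> C #> ev l \<in> V"
  using rcosets_mult_closed[OF N] ev_closed by blast

lemma pos_closed: "C \<in> V \<Longrightarrow> w \<in> lists L \<Longrightarrow> pos C w \<in> V"
  unfolding pos_def using rcosets_mult_closed[OF N] val_closed by blast

lemma pos_Nil: "C \<in> V \<Longrightarrow> pos C [] = C"
  by (simp add: pos_def rcosets_mult_one[OF N])

lemma pos_append: "C \<in> V \<Longrightarrow> u \<in> lists L \<Longrightarrow> v \<in> lists L \<Longrightarrow> pos C (u @ v) = pos (pos C u) v"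
  unfolding pos_def using word_val_append[OF ev_fun] rcosets_mult_assoc[OF N] val_closed by metis

lemma pos_single: "l \<in> L \<Longrightarrow> pos C [l] = C #> ev l"
  by (simp add: pos_def ev_closed)

lemma pos_Cons:
  assumes "C \<in> V" "l \<in> L" "w \<in> lists L" shows "pos C (l # w) = pos (C #> ev l) w"
  using pos_append[OF assms(1) _ assms(3), of "[l]"] pos_single assms(2) by simp

lemma path_in_append:
  assumes "C \<in> V" "u \<in> lists L" "v \<in> lists L"
  shows "stays P C (u @ v) \<longleftrightarrow> stays P C u \<and> stays P (pos C u) v"
  using assms(2,1)
proof (induction u arbitrary: C)
  case Nil
  have "stays P C v \<Longrightarrow> C \<in> P" by (cases v) auto
  thus ?case using Nil by (auto simp: pos_Nil)
next
  case (Cons l u)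
  thus ?case using Cons.IH[OF move_closed] pos_Cons by auto
qed

lemma path_in_end: "C \<in> V \<Longrightarrow> w \<in> lists L \<Longrightarrow> stays P C w \<Longrightarrow> pos C w \<in> P"
  using path_in_append[of C w "[]" P] by simp

lemma path_in_start: "stays P C w \<Longrightarrow> C \<in> P"
  by (cases w) auto

text \<open>An edge counts for the side of its starting vertex. For \<open>f\<close> in
  \<open>F\<close> the edges of the cut have value 0, since one-letter words belong to
  \<open>W\<close>, so their attribution has no effect.\<close>

primrec part :: "('a \<Rightarrow> int) \<Rightarrow> bool \<Rightarrow> 'a set \<Rightarrow> 'l list \<Rightarrow> int" where
  "part f b C [] = 0"
| "part f b C (l # w) = (if (C \<in> A) = b then tc f C (ev l) else 0) + part f b (C #> ev l) w"

lemma part_append: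
  assumes "C \<in> V" "u \<in> lists L" "v \<in> lists L"
  shows "part f b C (u @ v) = part f b C u + part f b (pos C u) v"
  using assms(2,1)
proof (induction u arbitrary: C)
  case Nil thus ?case by (simp add: pos_Nil)
next
  case (Cons l u)
  thus ?case using Cons.IH[OF move_closed] pos_Cons by auto
qed

lemma tc_one: "f \<in> F \<Longrightarrow> C \<in> V \<Longrightarrow> tc f C \<one> = 0"
  using schreier_elem_one[OF N] group.fp_homs_one[OF subgroup_imp_group[OF N], of f p] F
  by (auto simp: transfer_cocycle_def)

lemma part_total:
  assumes f: "f \<in> F" and "C \<in> V" "w \<in> lists L"
  shows "[part f True C w + part f False C w = tc f C (word_val G ev w)] (mod int p)"
  using assms(3,2)
proof (induction w arbitrary: C)
  case Nil thus ?case using tc_one[OF f] by simp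
next
  case (Cons l w)
  have fN: "f \<in> fp_homs p (G\<lparr>carrier := N\<rparr>)" using f F by blast
  have "[part f True (C #> ev l) w + part f False (C #> ev l) w = tc f (C #> ev l) (word_val G ev w)] (mod int p)"
    using Cons move_closed by auto
  hence "[tc f C (ev l) + (part f True (C #> ev l) w + part f False (C #> ev l) w)
      = tc f C (ev l) + tc f (C #> ev l) (word_val G ev w)] (mod int p)" by (intro cong_add cong_refl)
  also have "[tc f C (ev l) + tc f (C #> ev l) (word_val G ev w) = tc f C (word_val G ev (l # w))] (mod int p)"
    using transfer_cocycle_mult[OF N fN Cons.prems, of "ev l" "word_val G ev w"] Cons.hyps ev_closed val_closed
    by (simp add: cong_sym)
  finally show ?case by (cases "C \<in> A") (simp_all add: add_ac)
qed

lemma part_other_side: "stays P C w \<Longrightarrow> P \<subseteq> {D. (D \<in> A) \<noteq> b} \<Longrightarrow> part f b C w = 0"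
  by (induction w arbitrary: C) auto

lemma part_flat: "flat C w \<Longrightarrow> f \<in> F \<Longrightarrow> part f b C w = 0"
  by (induction w arbitrary: C) auto

text \<open>The two partial sums add up to the value of the relator, which is 0. If the path stays
  on one side, the sum for the other side is empty; otherwise all its edges have value 0.\<close>

lemma part_relator:
  assumes f: "f \<in> F" and C: "C \<in> V" and r: "r \<in> Rel"
  shows "[part f b C r = 0] (mod int p)"
proof -
  have rl: "r \<in> lists L" using r Rel_lists by blast
  have "word_val G ev r = \<one>" using pres r by (auto simp: monoid_presentation_def)
  hence total: "[part f True C r + part f False C r = 0] (mod int p)"
    using part_total[OF f C rl] tc_one[OF f C] by simp
  consider "stays A C r" | "stays (V - A) C r" | "flat C r" using near[OF C] r W(1) by blast
  thus ?thesis
  proof cases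
    case 1
    hence "part f False C r = 0" by (rule part_other_side) auto
    thus ?thesis using total by (cases b) auto
  next
    case 2
    hence "part f True C r = 0" by (rule part_other_side) auto
    thus ?thesis using total by (cases b) auto
  next
    case 3
    thus ?thesis using part_flat f by simp
  qed
qed

lemma pos_relator: "C \<in> V \<Longrightarrow> r \<in> Rel \<Longrightarrow> pos C r = C"
  using pres rcosets_mult_one[OF N] by (auto simp: pos_def monoid_presentation_def)

lemma same_val_equiv:
  "w \<in> lists L \<Longrightarrow> w' \<in> lists L \<Longrightarrow> word_val G ev w = word_val G ev w' \<Longrightarrow> (w, w') \<in> word_equiv L Rel"
  using pres unfolding monoid_presentation_def by blast

lemma part_cong:
  assumes f: "f \<in> F" and C: "C \<in> V" and w: "w \<in> lists L" "w' \<in> lists L" "word_val G ev w = word_val G ev w'"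
  shows "[part f b C w = part f b C w'] (mod int p)"
proof -
  have "part f b C w mod int p = part f b C w' mod int p"
  proof (rule word_equiv_invariant[OF same_val_equiv[OF w]])
    fix u r v assume u: "u \<in> lists L" and v: "v \<in> lists L" and r: "r \<in> Rel"
    have rl: "r \<in> lists L" using r Rel_lists by blast
    have D: "pos C u \<in> V" using pos_closed[OF C u] .
    have "part f b C (u @ r @ v) = part f b C u + (part f b (pos C u) r + part f b (pos C u) v)"
      using part_append[OF C u, of "r @ v"] part_append[OF D rl v] rl v pos_relator[OF D r] by simp
    moreover have "part f b C (u @ v) = part f b C u + part f b (pos C u) v" by (rule part_append[OF C u v])
    moreover have "[part f b C u + (part f b (pos C u) r + part f b (pos C u) v) = part f b C u + (0 + part f b (pos C u) v)] (mod int p)"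
      by (intro cong_add cong_refl part_relator[OF f D r])
    ultimately show "part f b C (u @ r @ v) mod int p = part f b C (u @ v) mod int p" by (simp add: cong_def)
  qed
  thus ?thesis by (simp add: cong_def)
qed

section \<open>Words for group elements and reversed paths\<close>

definition wd :: "'a \<Rightarrow> 'l list" where
  "wd g = (SOME w. w \<in> lists L \<and> word_val G ev w = g)"

lemma wd: "g \<in> carrier G \<Longrightarrow> wd g \<in> lists L" "g \<in> carrier G \<Longrightarrow> word_val G ev (wd g) = g"
proof -
  assume "g \<in> carrier G"
  hence "\<exists>w. w \<in> lists L \<and> word_val G ev w = g" using pres unfolding monoid_presentation_def by blast
  from someI_ex[OF this] show "wd g \<in> lists L" "word_val G ev (wd g) = g" by (auto simp: wd_def)
qed

definition opp_letter :: "'l \<Rightarrow> 'l" where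
  "opp_letter l = (SOME l'. l' \<in> L \<and> ev l' = inv (ev l))"

definition opp :: "'l list \<Rightarrow> 'l list" where
  "opp w = map opp_letter (rev w)"

lemma opp_letter:
  assumes "l \<in> L" shows "opp_letter l \<in> L" "ev (opp_letter l) = inv (ev l)"
proof -
  have "\<exists>l'. l' \<in> L \<and> ev l' = inv (ev l)" using pres assms unfolding monoid_presentation_def by blast
  from someI_ex[OF this] show "opp_letter l \<in> L" "ev (opp_letter l) = inv (ev l)" by (auto simp: opp_letter_def)
qed

lemma opp_closed: "w \<in> lists L \<Longrightarrow> opp w \<in> lists L"
  using opp_letter by (auto simp: opp_def)

lemma opp_Cons: "opp (l # w) = opp w @ opp [l]"
  by (simp add: opp_def)

lemma opp_val: "w \<in> lists L \<Longrightarrow> word_val G ev (opp w) = inv (word_val G ev w)"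
proof (induction w)
  case (Cons l w)
  have l: "l \<in> L" "w \<in> lists L" using Cons.prems by auto
  have "word_val G ev (opp [l]) = inv (ev l)" using opp_letter[OF l(1)] ev_closed[OF l(1)] by (simp add: opp_def)
  thus ?case using Cons l opp_closed ev_closed val_closed
    by (simp add: opp_Cons[of l w] word_val_append[OF ev_fun] inv_mult_group del: in_lists_conv_set)
qed (simp add: opp_def)

lemma pos_opp: "C \<in> V \<Longrightarrow> w \<in> lists L \<Longrightarrow> pos (pos C w) (opp w) = C"
  by (simp add: pos_def opp_val val_closed rcosets_mult_assoc[OF N] rcosets_mult_one[OF N] del: in_lists_conv_set)

lemma stays_opp:
  assumes "C \<in> V" "w \<in> lists L" "stays P C w" shows "stays P (pos C w) (opp w)"
  using assms(2,1,3)
proof (induction w arbitrary: C)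
  case Nil thus ?case by (simp add: pos_Nil opp_def)
next
  case (Cons l w)
  let ?D = "C #> ev l"
  have D: "?D \<in> V" using Cons move_closed by blast
  have l: "[l] \<in> lists L" using Cons.hyps by simp
  have e: "pos C (l # w) = pos ?D w" using pos_Cons Cons by auto
  have "stays P (pos ?D w) (opp w)" using Cons D by simp
  moreover have "pos (pos ?D w) (opp w) = ?D" using pos_opp[OF D] Cons.hyps by blast
  moreover have "stays P ?D (opp [l])"
  proof -
    have "pos (pos C [l]) (opp [l]) = C" using pos_opp[OF Cons.prems(1) l] .
    hence "?D #> inv (ev l) = C" using pos_single Cons.hyps opp_val[OF l] ev_closed by (simp add: pos_def)
    moreover have "?D \<in> P" using Cons.prems path_in_start by auto
    ultimately show ?thesis using Cons.prems opp_letter(2)[OF Cons.hyps(1)] by (simp add: opp_def)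
  qed
  ultimately show ?case
    unfolding e opp_Cons[of l w] using path_in_append[OF pos_closed[OF D] opp_closed opp_closed[OF l]] Cons.hyps by simp
qed

lemma part_opp:
  assumes f: "f \<in> F" and C: "C \<in> V" and w: "w \<in> lists L"
  shows "[part f b (pos C w) (opp w) = - part f b C w] (mod int p)"
proof -
  have "[part f b C (w @ opp w) = part f b C []] (mod int p)"
    by (rule part_cong[OF f C]) (use w opp_closed[OF w] in \<open>simp_all add: word_val_append[OF ev_fun] opp_val val_closed del: in_lists_conv_set\<close>)
  thus ?thesis using part_append[OF C w opp_closed[OF w], of f b] by (simp add: cong_iff_dvd_diff add.commute)
qed

text \<open>A state records, for each \<open>f \<in> F\<close>, the sums modulo \<open>p\<close> of its cocycle over the edges walked on each side of the
  cut. Walking across the cut at state \<open>st\<close> multiplies by \<open>lam st\<close> or its inverse.\<close>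

definition shift :: "(('a \<Rightarrow> int) \<times> bool \<Rightarrow> int) \<Rightarrow> (('a \<Rightarrow> int) \<times> bool \<Rightarrow> int) \<Rightarrow> ('a \<Rightarrow> int) \<times> bool \<Rightarrow> int" where
  "shift st d = (\<lambda>x\<in>F \<times> UNIV. (st x + d x) mod int p)"

definition parts :: "'a set \<Rightarrow> 'l list \<Rightarrow> ('a \<Rightarrow> int) \<times> bool \<Rightarrow> int" where
  "parts C w = (\<lambda>(f, b). part f b C w)"

definition states :: "(('a \<Rightarrow> int) \<times> bool \<Rightarrow> int) set" where
  "states = F \<times> UNIV \<rightarrow>\<^sub>E {0..<int p}"

lemma shift_states: "shift st d \<in> states"
  using prime_gt_0_nat[OF p] by (auto simp: shift_def states_def)

lemma shift_zero: "st \<in> states \<Longrightarrow> (\<And>x. x \<in> F \<times> UNIV \<Longrightarrow> [d x = 0] (mod int p)) \<Longrightarrow> shift st d = st"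
proof
  fix x assume st: "st \<in> states" and d: "\<And>x. x \<in> F \<times> UNIV \<Longrightarrow> [d x = 0] (mod int p)"
  show "shift st d x = st x"
  proof (cases "x \<in> F \<times> UNIV")
    case True
    have "st x \<in> {0..<int p}" using st True unfolding states_def by blast
    moreover have "[st x + d x = st x + 0] (mod int p)" using d[OF True] by (intro cong_add cong_refl)
    ultimately show ?thesis using True by (simp add: shift_def cong_def)
  next
    case False
    thus ?thesis using PiE_arb[OF st[unfolded states_def] False] unfolding shift_def by (simp only: restrict_def if_False)
  qed
qed

lemma shift_cong: "(\<And>x. x \<in> F \<times> UNIV \<Longrightarrow> [d x = e x] (mod int p)) \<Longrightarrow> shift st d = shift st e"
  unfolding shift_def by (intro restrict_ext) (metis cong_add cong_def cong_refl)

lemma shift_shift: "shift (shift st d) e = shift st (\<lambda>x. d x + e x)"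
  unfolding shift_def by (intro restrict_ext) (simp add: mod_simps add_ac)

lemma shift_eqD:
  assumes "shift st d = shift st e" "x \<in> F \<times> UNIV" shows "[d x = e x] (mod int p)"
proof -
  have "(st x + d x) mod int p = (st x + e x) mod int p"
    using fun_cong[OF assms(1), of x] assms(2) by (simp add: shift_def)
  thus ?thesis by (simp add: cong_iff_dvd_diff mod_eq_dvd_iff)
qed

lemma parts_append:
  "C \<in> V \<Longrightarrow> u \<in> lists L \<Longrightarrow> v \<in> lists L \<Longrightarrow> parts C (u @ v) = (\<lambda>x. parts C u x + parts (pos C u) v x)"
  by (auto simp: parts_def part_append simp del: in_lists_conv_set)

fun lab :: "('c, 'd) monoid_scheme \<Rightarrow> ((('a \<Rightarrow> int) \<times> bool \<Rightarrow> int) \<Rightarrow> 'c) \<Rightarrow> (('a \<Rightarrow> int) \<times> bool \<Rightarrow> int) \<Rightarrow>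
    'a set \<Rightarrow> 'l list \<Rightarrow> 'c" where
  "lab T lam st C [] = \<one>\<^bsub>T\<^esub>"
| "lab T lam st C (l # w) =
    (if (C \<in> A) = (C #> ev l \<in> A) then \<one>\<^bsub>T\<^esub> else if C \<in> A then lam st else inv\<^bsub>T\<^esub> (lam st)) \<otimes>\<^bsub>T\<^esub>
    lab T lam (shift st (parts C [l])) (C #> ev l) w"

context
  fixes T :: "('c, 'd) monoid_scheme" and lam :: "(('a \<Rightarrow> int) \<times> bool \<Rightarrow> int) \<Rightarrow> 'c"
  assumes T: "group T" and lam: "\<And>st. lam st \<in> carrier T"
begin

interpretation T: group T by (rule T)

lemma lab_closed: "lab T lam st C w \<in> carrier T"
  by (induction w arbitrary: st C) (auto simp: lam)

lemma lab_append:
  assumes "C \<in> V" "u \<in> lists L" "v \<in> lists L" "st \<in> states"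
  shows "lab T lam st C (u @ v) = lab T lam st C u \<otimes>\<^bsub>T\<^esub> lab T lam (shift st (parts C u)) (pos C u) v"
  using assms(2,1,4)
proof (induction u arbitrary: C st)
  case Nil
  have "shift st (parts C []) = st" using Nil by (intro shift_zero) (auto simp: parts_def)
  thus ?case using Nil lab_closed by (simp add: pos_Nil)
next
  case (Cons l u)
  have C': "C #> ev l \<in> V" using Cons move_closed by blast
  have "shift (shift st (parts C [l])) (parts (C #> ev l) u) = shift st (parts C (l # u))"
    unfolding shift_shift by (rule shift_cong) (auto simp: parts_def)
  thus ?case
    using Cons.IH[OF C' shift_states, of st "parts C [l]"] pos_Cons[OF Cons.prems(1) Cons.hyps] lab_closed lam T.m_assoc
    by (auto split: if_splits)
qed

lemma lab_stays: "stays P C w \<Longrightarrow> P = A \<or> P \<inter> A = {} \<Longrightarrow> lab T lam st C w = \<one>\<^bsub>T\<^esub>"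
proof (induction w arbitrary: st C)
  case (Cons l w)
  have "C \<in> P" "C #> ev l \<in> P" using Cons.prems(1) path_in_start[of P "C #> ev l" w] by auto
  hence "(C \<in> A) = (C #> ev l \<in> A)" using Cons.prems(2) by blast
  thus ?case using Cons by simp
qed simp

lemma lab_flat:
  assumes "flat C w" "st \<in> states" "C \<in> V" "w \<in> lists L"
  shows "lab T lam st C w = (if (C \<in> A) = (pos C w \<in> A) then \<one>\<^bsub>T\<^esub> else if C \<in> A then lam st else inv\<^bsub>T\<^esub> (lam st))"
  using assms(4,1,3)
proof (induction w arbitrary: C)
  case Nil thus ?case by (simp add: pos_Nil)
next
  case (Cons l w)
  have C': "C #> ev l \<in> V" using Cons move_closed by blast
  have "shift st (parts C [l]) = st"
    using Cons.prems(1) by (intro shift_zero[OF assms(2)]) (auto simp: parts_def)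
  moreover have "flat (C #> ev l) w" using Cons.prems(1) by auto
  ultimately show ?case
    using Cons.IH[OF _ C'] pos_Cons[OF Cons.prems(2) Cons.hyps] lam by auto
qed

text \<open>A relator path without crossing has no labels to multiply. One that crosses is flat,
  hence read at a constant state: its crossings contribute \<open>lam st\<close> and its inverse
  alternately and cancel because the path closes up.\<close>

lemma lab_relator:
  assumes C: "C \<in> V" and r: "r \<in> Rel" and st: "st \<in> states"
  shows "lab T lam st C r = \<one>\<^bsub>T\<^esub>"
proof -
  have rl: "r \<in> lists L" using r Rel_lists by blast
  consider "stays A C r" | "stays (V - A) C r" | "flat C r" using near[OF C] r W(1) by blast
  thus ?thesis
  proof cases
    case 3
    thus ?thesis using lab_flat[OF 3 st C rl] pos_relator[OF C r] by simp
  qed (use lab_stays in auto)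
qed

lemma lab_cong:
  assumes C: "C \<in> V" and st: "st \<in> states" and w: "w \<in> lists L" "w' \<in> lists L" "word_val G ev w = word_val G ev w'"
  shows "lab T lam st C w = lab T lam st C w'"
proof (rule word_equiv_invariant[OF same_val_equiv[OF w]])
  fix u r v assume u: "u \<in> lists L" and v: "v \<in> lists L" and r: "r \<in> Rel"
  have rl: "r \<in> lists L" using r Rel_lists by blast
  have D: "pos C u \<in> V" using pos_closed[OF C u] .
  let ?s = "shift st (parts C u)"
  have s: "?s \<in> states" by (rule shift_states)
  have "shift ?s (parts (pos C u) r) = ?s"
    by (rule shift_zero[OF s]) (use part_relator D r in \<open>auto simp: parts_def\<close>)
  hence "lab T lam ?s (pos C u) (r @ v) = lab T lam ?s (pos C u) v"
    using lab_append[OF D rl v s] lab_relator[OF D r s] pos_relator[OF D r] lab_closed by simp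
  moreover have "r @ v \<in> lists L" using rl v by simp
  ultimately show "lab T lam st C (u @ r @ v) = lab T lam st C (u @ v)"
    using lab_append[OF C u _ st] v by simp
qed

end

section \<open>The subgroup that preserves the initial state\<close>

definition st0 :: "('a \<Rightarrow> int) \<times> bool \<Rightarrow> int" where
  "st0 = (\<lambda>x\<in>F \<times> UNIV. 0)"

lemma st0: "st0 \<in> states" using prime_gt_0_nat[OF p] by (auto simp: st0_def states_def)

lemma N_in_V: "N \<in> V" by (rule self_in_rcosets[OF N])

text \<open>By \<open>part_cong\<close> the contribution of one side depends only on the group
  element; modulo \<open>p\<close> each \<open>f\<close> in \<open>F\<close> is the sum of two
  homomorphisms of \<open>N\<close>, one for each side.\<close>

definition side_hom :: "('a \<Rightarrow> int) \<Rightarrow> bool \<Rightarrow> 'a \<Rightarrow> int" where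
  "side_hom f b = (\<lambda>g\<in>N. part f b N (wd g) mod int p)"

lemma pos_N: "g \<in> N \<Longrightarrow> pos N (wd g) = N"
  using wd coset_join2[OF _ N] subgroup.mem_carrier[OF N] by (simp add: pos_def)

lemma side_hom: "f \<in> F \<Longrightarrow> side_hom f b \<in> fp_homs p (G\<lparr>carrier := N\<rparr>)"
proof -
  assume f: "f \<in> F"
  have "part f b N (wd (g \<otimes> h)) mod int p = (part f b N (wd g) mod int p + part f b N (wd h) mod int p) mod int p"
    if gh: "g \<in> N" "h \<in> N" for g h
  proof -
    have c: "g \<in> carrier G" "h \<in> carrier G" using gh subgroup.mem_carrier[OF N] by auto
    have "[part f b N (wd (g \<otimes> h)) = part f b N (wd g @ wd h)] (mod int p)"
      by (rule part_cong[OF f N_in_V]) (use c wd in \<open>simp_all add: word_val_append[OF ev_fun] del: in_lists_conv_set\<close>)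
    thus ?thesis
      using part_append[OF N_in_V, of "wd g" "wd h" f b] wd c pos_N[OF gh(1)] by (simp add: cong_def mod_simps)
  qed
  thus ?thesis using prime_gt_0_nat[OF p] subgroup.m_closed[OF N]
    by (auto simp: fp_homs_def side_hom_def)
qed

text \<open>The elements of \<open>N\<close> along whose paths the initial state returns to itself.
  There the label is multiplicative, and as a finite intersection of kernels the subgroup is
  \<open>p_open\<close> in \<open>N\<close>.\<close>

definition stab :: "'a set" where
  "stab = {g\<in>N. \<forall>f\<in>F. \<forall>b. side_hom f b g = 0}"

lemma stab_p_open: "p_open p (G\<lparr>carrier := N\<rparr>) stab"
proof -
  interpret GN: group "G\<lparr>carrier := N\<rparr>" using N subgroup_imp_group by blast
  let ?K = "(\<lambda>(f, b). side_hom f b) ` (F \<times> UNIV)"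
  have "p_open p (G\<lparr>carrier := N\<rparr>) {x\<in>carrier (G\<lparr>carrier := N\<rparr>). \<forall>f\<in>?K. f x = 0}"
    by (rule GN.common_kernel_p_open[OF p]) (use finF side_hom in auto)
  moreover have "{x\<in>carrier (G\<lparr>carrier := N\<rparr>). \<forall>f\<in>?K. f x = 0} = stab" by (auto simp: stab_def)
  ultimately show ?thesis by simp
qed

lemma stab_parts:
  assumes "g \<in> stab" "x \<in> F \<times> UNIV" shows "[parts N (wd g) x = 0] (mod int p)"
  using assms by (auto simp: stab_def side_hom_def parts_def cong_def)

lemma stab_iff:
  assumes w: "w \<in> lists L" and g: "word_val G ev w \<in> N"
    and z: "\<And>x. x \<in> F \<times> UNIV \<Longrightarrow> [parts N w x = 0] (mod int p)"
  shows "word_val G ev w \<in> stab"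
proof -
  let ?g = "word_val G ev w"
  have c: "?g \<in> carrier G" using val_closed[OF w] .
  have "part f b N (wd ?g) mod int p = 0" if f: "f \<in> F" for f b
  proof -
    have "[part f b N (wd ?g) = part f b N w] (mod int p)"
      by (rule part_cong[OF f N_in_V wd(1)[OF c] w wd(2)[OF c]])
    moreover have "[part f b N w = 0] (mod int p)" using z[of "(f, b)"] f by (simp add: parts_def)
    ultimately show ?thesis by (simp add: cong_def)
  qed
  thus ?thesis using g by (simp add: stab_def side_hom_def)
qed

definition loops :: "'a set set \<Rightarrow> 'a set \<Rightarrow> 'l list set" where
  "loops P C = {w \<in> lists L. path_in G ev P C w \<and> pos C w = C}"

text \<open>The change of state caused by a loop inside one side, as an extensional function on
  \<open>F\<close> with reduced values, so that the number of different changes can be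
  counted.\<close>

definition loop_value :: "bool \<Rightarrow> 'a set \<Rightarrow> 'l list \<Rightarrow> ('a \<Rightarrow> int) \<Rightarrow> int" where
  "loop_value b C w = (\<lambda>f\<in>F. part f b C w mod int p)"

declare lab.simps [simp del]

text \<open>The commutator of \<open>u i\<close> with the loop \<open>m\<close> carried across the edge \<open>l\<close> crosses the cut four times, at the states
  \<open>s\<close>, \<open>s + \<eta>\<close>, \<open>s + \<eta> + \<delta> i\<close> and \<open>s + \<delta> i\<close>, where \<open>\<eta>\<close> and \<open>\<delta> i\<close> are the values of \<open>m\<close> and \<open>u i\<close>. Prescribing
  \<open>lam\<close> to be \<open>g i\<close> at the third of these states and trivial elsewhere sends the commutator to \<open>g i\<close>.\<close>

theorem stab_retract:
  assumes C: "C \<in> A" and l: "l \<in> L" "C #> ev l \<in> V - A"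
    and u: "\<And>i. i < q \<Longrightarrow> u i \<in> loops A C" "inj_on (\<lambda>i. loop_value True C (u i)) {..<q}"
      "\<And>i. i < q \<Longrightarrow> loop_value True C (u i) \<noteq> loop_value True C []"
    and m: "m \<in> loops (V - A) (C #> ev l)" "loop_value False (C #> ev l) m \<noteq> loop_value False (C #> ev l) []"
  obtains k :: "nat \<Rightarrow> 'a" where "\<And>i. i < q \<Longrightarrow> k i \<in> stab"
    "\<And>(T :: 'c monoid) g. group T \<Longrightarrow> (\<And>i. i < q \<Longrightarrow> g i \<in> carrier T) \<Longrightarrow>
       \<exists>\<omega>\<in>hom (G\<lparr>carrier := stab\<rparr>) T. \<forall>i<q. \<omega> (k i) = g i"
proof -
  let ?D = "C #> ev l"
  have CV: "C \<in> V" using C A by blast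
  have DV: "?D \<in> V" using l(2) by blast
  obtain c where c: "c \<in> carrier G" "C = N #> c" using CV by (rule rcosets_obtain)
  \<comment> \<open>A path from the base coset to the cut edge. Its label is removed at the end by a
    conjugation.\<close>
  define w0 where "w0 = wd c"
  have w0: "w0 \<in> lists L" "pos N w0 = C" using wd[OF c(1)] c(2) by (auto simp: w0_def pos_def)
  define l1 where "l1 = [l]"
  define l' where "l' = opp l1"
  have ll: "l1 \<in> lists L" using l by (simp add: l1_def)
  have l': "l' \<in> lists L" "pos ?D l' = C" "pos C l1 = ?D"
    using opp_closed[OF ll] pos_opp[OF CV ll] pos_single[OF l(1)] by (auto simp: l'_def l1_def)
  have ul: "u i \<in> lists L" "stays A C (u i)" "pos C (u i) = C" if "i < q" for i
    using u(1)[OF that] by (auto simp: loops_def)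
  have ml: "m \<in> lists L" "stays (V - A) ?D m" "pos ?D m = ?D" using m(1) by (auto simp: loops_def)
  have ou: "opp (u i) \<in> lists L" "stays A C (opp (u i))" "pos C (opp (u i)) = C" if "i < q" for i
    using opp_closed[OF ul(1)[OF that]] stays_opp[OF CV ul(1,2)[OF that]] pos_opp[OF CV ul(1)[OF that]] ul(3)[OF that] by auto
  have om: "opp m \<in> lists L" "stays (V - A) ?D (opp m)" "pos ?D (opp m) = ?D"
    using opp_closed[OF ml(1)] stays_opp[OF DV ml(1,2)] pos_opp[OF DV ml(1)] ml(3) by auto
  have flat_l: "flat C l1"
    using near[OF CV W(2)[OF l(1), folded l1_def]] l(2) C path_in_end[OF CV ll] l'(3) path_in_start by fastforce
  have flat_l': "flat ?D l'"
  proof -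
    have e: "l' = [opp_letter l]" by (simp add: l'_def l1_def opp_def)
    have "opp_letter l \<in> L" using opp_letter[OF l(1)] by blast
    hence "l' \<in> W" using W(2) e by simp
    thus ?thesis
      using near[OF DV] l(2) C path_in_end[OF DV l'(1)] l'(2) path_in_start by fastforce
  qed
  define \<eta> where "\<eta> = parts ?D m"
  define \<delta> where "\<delta> i = parts C (u i)" for i
  have parts_l: "parts C l1 x = 0" "parts ?D l' x = 0" if "x \<in> F \<times> UNIV" for x
    using that part_flat[OF flat_l] part_flat[OF flat_l'] by (auto simp: parts_def simp del: part.simps)
  have \<eta>T: "\<eta> (f, True) = 0" and \<delta>F: "i < q \<Longrightarrow> \<delta> i (f, False) = 0" for f i
  proof -
    have sub: "V - A \<subseteq> {D. (D \<in> A) \<noteq> True}" "A \<subseteq> {D. (D \<in> A) \<noteq> False}" by auto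
    show "\<eta> (f, True) = 0" using part_other_side[OF ml(2) sub(1)] by (simp add: \<eta>_def parts_def)
    show "i < q \<Longrightarrow> \<delta> i (f, False) = 0" using part_other_side[OF ul(2) sub(2)] by (simp add: \<delta>_def parts_def)
  qed
  have om_parts: "[parts ?D (opp m) x = - \<eta> x] (mod int p)" if "x \<in> F \<times> UNIV" for x
    using that part_opp[OF _ DV ml(1)] ml(3) by (auto simp: parts_def \<eta>_def)
  have ou_parts: "[parts C (opp (u i)) x = - \<delta> i x] (mod int p)" if "x \<in> F \<times> UNIV" "i < q" for x i
    using that part_opp[OF _ CV ul(1)] ul(3) by (auto simp: parts_def \<delta>_def)
  obtain f0 where f0: "f0 \<in> F" "\<not> [\<eta> (f0, False) = 0] (mod int p)"
  proof -
    have "\<exists>f\<in>F. part f False ?D m mod int p \<noteq> 0"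
    proof (rule ccontr)
      assume "\<not> ?thesis"
      hence "loop_value False ?D m = loop_value False ?D []" by (auto simp: loop_value_def)
      thus False using m(2) by blast
    qed
    thus thesis using that by (auto simp: \<eta>_def parts_def cong_def)
  qed
  have \<delta>_inj: "i = j" if ij: "i < q" "j < q" and e: "\<And>f. f \<in> F \<Longrightarrow> [\<delta> i (f, True) = \<delta> j (f, True)] (mod int p)" for i j
  proof -
    have "loop_value True C (u i) = loop_value True C (u j)"
      using e by (auto simp: loop_value_def \<delta>_def parts_def cong_def)
    thus ?thesis using inj_onD[OF u(2)] ij by auto
  qed
  have \<delta>_nz: "\<exists>f\<in>F. \<not> [\<delta> i (f, True) = 0] (mod int p)" if i: "i < q" for i
  proof (rule ccontr)
    assume "\<not> ?thesis"
    hence "loop_value True C (u i) = loop_value True C []"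
      by (auto simp: loop_value_def \<delta>_def parts_def cong_def)
    thus False using u(3)[OF i] by blast
  qed
  define U where "U i = l1 @ m @ l' @ u i @ l1 @ opp m @ l' @ opp (u i)" for i
  have Ul: "U i \<in> lists L" if "i < q" for i
    using ll ml(1) l'(1) ul(1)[OF that] om(1) ou(1)[OF that] by (simp add: U_def)
  have posU: "pos C (U i) = C" if "i < q" for i
    unfolding U_def using ll ml(1) l'(1) ul(1)[OF that] om(1) ou(1)[OF that] CV DV
    by (simp add: pos_append l'(2,3) ml(3) om(3) ul(3)[OF that] ou(3)[OF that] del: in_lists_conv_set append_Cons append_Nil)
  have partsU: "parts C (U i) x = parts C l1 x + (parts ?D m x + (parts ?D l' x + (parts C (u i) x + (parts C l1 x +
     (parts ?D (opp m) x + (parts ?D l' x + parts C (opp (u i)) x))))))" if "i < q" for i x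
    unfolding U_def using ll ml(1) l'(1) ul(1)[OF that] om(1) ou(1)[OF that] CV DV
    by (simp add: parts_append l'(2,3) ml(3) om(3) ul(3)[OF that] ou(3)[OF that] del: in_lists_conv_set append_Cons append_Nil)
  have U0: "[parts C (U i) x = 0] (mod int p)" if i: "i < q" and x: "x \<in> F \<times> UNIV" for i x
  proof -
    have "[parts C (U i) x = 0 + (\<eta> x + (0 + (\<delta> i x + (0 + (- \<eta> x + (0 + - \<delta> i x))))))] (mod int p)"
      unfolding partsU[OF i] parts_l[OF x]
      by (intro cong_add cong_refl om_parts[OF x] ou_parts[OF x i]) (simp_all add: \<eta>_def \<delta>_def)
    thus ?thesis by simp
  qed
  define w0' where "w0' = opp w0"
  have w0': "w0' \<in> lists L" "pos C w0' = N"
    using opp_closed[OF w0(1)] pos_opp[OF N_in_V w0(1)] w0(2) by (auto simp: w0'_def)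
  define K where "K i = w0 @ U i @ w0'" for i
  have Kl: "K i \<in> lists L" if "i < q" for i using w0 Ul[OF that] w0' by (simp add: K_def)
  have UWl: "U i @ w0' \<in> lists L" if "i < q" for i using Ul[OF that] w0' by simp
  have posK: "pos N (K i) = N" if "i < q" for i
    unfolding K_def
    using pos_append[OF N_in_V w0(1) UWl[OF that]] pos_append[OF CV Ul[OF that] w0'(1)] w0(2) posU[OF that] w0'(2) by simp
  have partsK: "[parts N (K i) x = 0] (mod int p)" if i: "i < q" and x: "x \<in> F \<times> UNIV" for i x
  proof -
    have "parts N (K i) x = parts N w0 x + (parts C (U i) x + parts C w0' x)"
      unfolding K_def
      using parts_append[OF N_in_V w0(1) UWl[OF i]] parts_append[OF CV Ul[OF i] w0'(1)] w0(2) posU[OF i] by simp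
    moreover have "[parts N w0 x + (parts C (U i) x + parts C w0' x) = parts N w0 x + (0 + - parts N w0 x)] (mod int p)"
    proof (intro cong_add cong_refl U0[OF i x])
      show "[parts C w0' x = - parts N w0 x] (mod int p)"
        using part_opp[OF _ N_in_V w0(1)] x w0(2) by (auto simp: parts_def w0'_def)
    qed
    ultimately show ?thesis by simp
  qed
  define k where "k i = word_val G ev (K i)" for i
  have kN: "k i \<in> N" if "i < q" for i
    using posK[OF that] val_closed[OF Kl[OF that]] coset_join1[OF _ _ N] by (simp add: k_def pos_def)
  have kstab: "k i \<in> stab" if "i < q" for i
    unfolding k_def by (rule stab_iff[OF Kl[OF that]]) (use kN[OF that] partsK[OF that] in \<open>auto simp: k_def\<close>)
  have stabN: "stab \<subseteq> N" by (auto simp: stab_def)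
  have main: "\<exists>\<omega>\<in>hom (G\<lparr>carrier := stab\<rparr>) T. \<forall>i<q. \<omega> (k i) = g i"
    if T: "group T" and g: "\<And>i. i < q \<Longrightarrow> g i \<in> carrier T" for T :: "'c monoid" and g
  proof -
    interpret T: group T by fact
    define s where "s = shift st0 (parts N w0)"
    have s: "s \<in> states" unfolding s_def by (rule shift_states)
    define target where "target i = shift s (\<lambda>x. \<delta> i x + \<eta> x)" for i
    define lam where "lam st = (if \<exists>i<q. st = target i then g (SOME i. i < q \<and> st = target i) else \<one>\<^bsub>T\<^esub>)" for st
    have target_inj: "i = j" if "i < q" "j < q" "target i = target j" for i j
    proof (rule \<delta>_inj[OF that(1,2)])
      fix f assume "f \<in> F"
      thus "[\<delta> i (f, True) = \<delta> j (f, True)] (mod int p)"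
        using shift_eqD[OF that(3)[unfolded target_def], of "(f, True)"] \<eta>T by simp
    qed
    have lam_target: "lam (target i) = g i" if i: "i < q" for i
    proof -
      have "(SOME j. j < q \<and> target i = target j) = i"
        by (rule some_equality) (use i target_inj in auto)
      thus ?thesis using i by (auto simp: lam_def)
    qed
    have lam_closed: "lam st \<in> carrier T" for st
    proof (cases "\<exists>i<q. st = target i")
      case True
      then obtain i where "i < q" "st = target i" by blast
      thus ?thesis using lam_target g by simp
    next
      case False
      hence "lam st = \<one>\<^bsub>T\<^esub>" unfolding lam_def by (rule if_not_P)
      thus ?thesis by simp
    qed
    note lab_facts = lab_append[where lam = lam, OF T lam_closed] lab_closed[where lam = lam, OF T lam_closed]
    \<comment> \<open>The state at the third crossing differs from \<open>s\<close> and from every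
      \<open>shift s (\<delta> i)\<close> in the coordinate \<open>(f0, False)\<close>, to which
      only the loop \<open>m\<close> contributes, and from \<open>shift s \<eta>\<close> in a
      coordinate of the side \<open>True\<close>, where the values of the loops \<open>u j\<close>
      are not all 0.\<close>
    have lam1: "lam s = \<one>\<^bsub>T\<^esub>" "lam (shift s \<eta>) = \<one>\<^bsub>T\<^esub>" "i < q \<Longrightarrow> lam (shift s (\<delta> i)) = \<one>\<^bsub>T\<^esub>" for i
    proof -
      have s0: "shift s (\<lambda>_. 0) = s" by (rule shift_zero[OF s]) simp
      have "s \<noteq> target j" if j: "j < q" for j
      proof
        assume "s = target j"
        hence "shift s (\<lambda>_. 0) = shift s (\<lambda>x. \<delta> j x + \<eta> x)" using s0 by (simp add: target_def)
        from shift_eqD[OF this, of "(f0, False)"] show False using f0 \<delta>F[OF j] by (simp add: cong_sym_eq)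
      qed
      thus "lam s = \<one>\<^bsub>T\<^esub>" by (auto simp: lam_def)
      have "shift s \<eta> \<noteq> target j" if j: "j < q" for j
      proof
        assume eq: "shift s \<eta> = target j"
        obtain f where "f \<in> F" "\<not> [\<delta> j (f, True) = 0] (mod int p)" using \<delta>_nz[OF j] by blast
        thus False using shift_eqD[OF eq[unfolded target_def], of "(f, True)"] \<eta>T by (simp add: cong_sym_eq)
      qed
      thus "lam (shift s \<eta>) = \<one>\<^bsub>T\<^esub>" by (auto simp: lam_def)
      assume i: "i < q"
      have "shift s (\<delta> i) \<noteq> target j" if j: "j < q" for j
      proof
        assume eq: "shift s (\<delta> i) = target j"
        show False using shift_eqD[OF eq[unfolded target_def], of "(f0, False)"] f0 \<delta>F[OF i] \<delta>F[OF j] by (simp add: cong_sym_eq)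
      qed
      thus "lam (shift s (\<delta> i)) = \<one>\<^bsub>T\<^esub>" by (auto simp: lam_def)
    qed
    define h0 where "h0 = lab T lam st0 N w0"
    have h0: "h0 \<in> carrier T" unfolding h0_def by (rule lab_facts(2))
    have ret: "lab T lam s C w0' = inv\<^bsub>T\<^esub> h0"
    proof -
      have "lab T lam st0 N (w0 @ w0') = lab T lam st0 N []"
        by (rule lab_cong[where lam = lam, OF T lam_closed N_in_V st0])
           (use w0 w0' in \<open>simp_all add: w0'_def word_val_append[OF ev_fun] opp_val val_closed del: in_lists_conv_set\<close>)
      hence "h0 \<otimes>\<^bsub>T\<^esub> lab T lam s C w0' = \<one>\<^bsub>T\<^esub>"
        using lab_facts(1)[OF N_in_V w0(1) w0'(1) st0] w0(2) by (simp add: h0_def s_def lab.simps(1))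
      thus ?thesis using T.inv_solve_left[OF h0 lab_facts(2) T.one_closed] T.r_one[OF T.inv_closed[OF h0]]
        T.inv_unique' by (metis T.inv_comm T.inv_equality h0 lab_facts(2))
    qed
    have cross: "lab T lam st C l1 = lam st" "lab T lam st ?D l' = inv\<^bsub>T\<^esub> (lam st)" if "st \<in> states" for st
      using lab_flat[where lam = lam, OF T lam_closed flat_l that CV ll] lab_flat[where lam = lam, OF T lam_closed flat_l' that DV l'(1)] l(2) C l'(2,3) by auto
    have shl: "shift st (parts C l1) = st" "shift st (parts ?D l') = st" if "st \<in> states" for st
      by (rule shift_zero[OF that], use parts_l in simp)+
    have labm: "lab T lam st ?D m = \<one>\<^bsub>T\<^esub>" "lab T lam st ?D (opp m) = \<one>\<^bsub>T\<^esub>" for st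
      using lab_stays[where lam = lam, OF T lam_closed ml(2)] lab_stays[where lam = lam, OF T lam_closed om(2)] by auto
    have labU: "lab T lam s C (U i) = g i" if i: "i < q" for i
    proof -
      have labu: "lab T lam st C (u i) = \<one>\<^bsub>T\<^esub>" "lab T lam st C (opp (u i)) = \<one>\<^bsub>T\<^esub>" for st
        using lab_stays[where lam = lam, OF T lam_closed ul(2)[OF i]] lab_stays[where lam = lam, OF T lam_closed ou(2)[OF i]] by auto
      note ss = shift_states
      have shm: "shift (target i) (parts ?D (opp m)) = shift s (\<delta> i)"
        unfolding target_def shift_shift
      proof (rule shift_cong)
        fix x assume x: "x \<in> F \<times> (UNIV :: bool set)"
        have "[\<delta> i x + \<eta> x + parts ?D (opp m) x = \<delta> i x + \<eta> x + - \<eta> x] (mod int p)"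
          by (intro cong_add cong_refl om_parts[OF x])
        thus "[\<delta> i x + \<eta> x + parts ?D (opp m) x = \<delta> i x] (mod int p)" by simp
      qed
      have shu: "shift (shift s \<eta>) (parts C (u i)) = target i"
        unfolding target_def shift_shift \<delta>_def[symmetric] by (simp add: add.commute)
      have tS: "target i \<in> states" unfolding target_def by (rule ss)
      note ll' = ll ml(1) l'(1) ul(1)[OF i] om(1) ou(1)[OF i]
      have L1: "l' @ opp (u i) \<in> lists L" "opp m @ l' @ opp (u i) \<in> lists L" "l1 @ opp m @ l' @ opp (u i) \<in> lists L"
        "u i @ l1 @ opp m @ l' @ opp (u i) \<in> lists L" "l' @ u i @ l1 @ opp m @ l' @ opp (u i) \<in> lists L"
        "m @ l' @ u i @ l1 @ opp m @ l' @ opp (u i) \<in> lists L"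
        using ll' by simp_all
      have e8: "lab T lam (shift s (\<delta> i)) ?D (l' @ opp (u i)) = \<one>\<^bsub>T\<^esub>"
        using lab_facts(1)[OF DV l'(1) ou(1)[OF i] ss] cross(2)[OF ss] shl(2)[OF ss] l'(2) lam1(3)[OF i] labu(2) by simp
      have e6: "lab T lam (target i) C (l1 @ opp m @ l' @ opp (u i)) = g i"
        using lab_facts(1)[OF CV ll L1(2) tS] lab_facts(1)[OF DV om(1) L1(1) tS] cross(1)[OF tS] shl(1)[OF tS] l'(3) om(3)
          labm(2) shm e8 lam_target[OF i] g[OF i] by simp
      have e4: "lab T lam (shift s \<eta>) C (u i @ l1 @ opp m @ l' @ opp (u i)) = g i"
        using lab_facts(1)[OF CV ul(1)[OF i] L1(3) ss] labu(1) shu ul(3)[OF i] e6 g[OF i] by simp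
      have e3: "lab T lam (shift s \<eta>) ?D (l' @ u i @ l1 @ opp m @ l' @ opp (u i)) = g i"
        using lab_facts(1)[OF DV l'(1) L1(4) ss] cross(2)[OF ss] shl(2)[OF ss] l'(2) lam1(2) e4 g[OF i] by simp
      have e2: "lab T lam s ?D (m @ l' @ u i @ l1 @ opp m @ l' @ opp (u i)) = g i"
        using lab_facts(1)[OF DV ml(1) L1(5) s] labm(1) ml(3) e3 g[OF i] by (simp add: \<eta>_def)
      show ?thesis
        unfolding U_def using lab_facts(1)[OF CV ll L1(6) s] cross(1)[OF s] shl(1)[OF s] l'(3) lam1(1) e2 g[OF i] by simp
    qed
    have labK: "lab T lam st0 N (K i) = h0 \<otimes>\<^bsub>T\<^esub> g i \<otimes>\<^bsub>T\<^esub> inv\<^bsub>T\<^esub> h0" if i: "i < q" for i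
    proof -
      have sU: "shift s (parts C (U i)) = s" by (rule shift_zero[OF s U0[OF i]])
      have "lab T lam s C (U i @ w0') = g i \<otimes>\<^bsub>T\<^esub> inv\<^bsub>T\<^esub> h0"
        using lab_facts(1)[OF CV Ul[OF i] w0'(1) s] labU[OF i] sU posU[OF i] ret by simp
      thus ?thesis
        unfolding K_def using lab_facts(1)[OF N_in_V w0(1) UWl[OF i] st0] w0(2) h0 g[OF i]
        by (simp add: h0_def[symmetric] s_def[symmetric] T.m_assoc)
    qed
    \<comment> \<open>Conjugation by \<open>h0\<close> cancels the label of the approach
      \<open>w0\<close>, so that the value at \<open>k i\<close> is \<open>g i\<close> itself and
      not a conjugate.\<close>
    define \<omega> where "\<omega> x = inv\<^bsub>T\<^esub> h0 \<otimes>\<^bsub>T\<^esub> lab T lam st0 N (wd x) \<otimes>\<^bsub>T\<^esub> h0" for x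
    have "\<omega> \<in> hom (G\<lparr>carrier := stab\<rparr>) T"
    proof (rule homI)
      show "\<omega> x \<in> carrier T" for x unfolding \<omega>_def using h0 lab_facts(2) by simp
      fix x y assume "x \<in> carrier (G\<lparr>carrier := stab\<rparr>)" "y \<in> carrier (G\<lparr>carrier := stab\<rparr>)"
      hence xy: "x \<in> stab" "y \<in> stab" by auto
      have xN: "x \<in> N" "y \<in> N" using xy stabN by auto
      have c: "x \<in> carrier G" "y \<in> carrier G" using xN subgroup.mem_carrier[OF N] by auto
      have "lab T lam st0 N (wd (x \<otimes> y)) = lab T lam st0 N (wd x @ wd y)"
        by (rule lab_cong[where lam = lam, OF T lam_closed N_in_V st0])
           (use c wd in \<open>simp_all add: word_val_append[OF ev_fun] del: in_lists_conv_set\<close>)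
      also have "\<dots> = lab T lam st0 N (wd x) \<otimes>\<^bsub>T\<^esub> lab T lam st0 N (wd y)"
        using lab_facts(1)[OF N_in_V wd(1)[OF c(1)] wd(1)[OF c(2)] st0] pos_N[OF xN(1)]
          shift_zero[OF st0, of "parts N (wd x)"] stab_parts[OF xy(1)] by simp
      finally have e: "lab T lam st0 N (wd (x \<otimes> y)) = lab T lam st0 N (wd x) \<otimes>\<^bsub>T\<^esub> lab T lam st0 N (wd y)" .
      let ?a = "lab T lam st0 N (wd x)" and ?b = "lab T lam st0 N (wd y)"
      have ab: "?a \<in> carrier T" "?b \<in> carrier T" using lab_facts(2) by auto
      have "inv\<^bsub>T\<^esub> h0 \<otimes>\<^bsub>T\<^esub> ?a \<otimes>\<^bsub>T\<^esub> h0 \<otimes>\<^bsub>T\<^esub> (inv\<^bsub>T\<^esub> h0 \<otimes>\<^bsub>T\<^esub> ?b \<otimes>\<^bsub>T\<^esub> h0)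
         = inv\<^bsub>T\<^esub> h0 \<otimes>\<^bsub>T\<^esub> ?a \<otimes>\<^bsub>T\<^esub> (h0 \<otimes>\<^bsub>T\<^esub> inv\<^bsub>T\<^esub> h0) \<otimes>\<^bsub>T\<^esub> ?b \<otimes>\<^bsub>T\<^esub> h0"
        using ab h0 by (simp only: T.m_assoc T.m_closed T.inv_closed)
      hence "\<omega> (x \<otimes> y) = \<omega> x \<otimes>\<^bsub>T\<^esub> \<omega> y" using ab h0 by (simp add: \<omega>_def e T.m_assoc)
      thus "\<omega> (x \<otimes>\<^bsub>G\<lparr>carrier := stab\<rparr>\<^esub> y) = \<omega> x \<otimes>\<^bsub>T\<^esub> \<omega> y" by simp
    qed
    moreover have "\<omega> (k i) = g i" if i: "i < q" for i
    proof -
      have kc: "k i \<in> carrier G" using val_closed[OF Kl[OF i]] by (simp add: k_def)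
      have "lab T lam st0 N (wd (k i)) = lab T lam st0 N (K i)"
        by (rule lab_cong[where lam = lam, OF T lam_closed N_in_V st0 wd(1)[OF kc] Kl[OF i]]) (use wd(2)[OF kc] in \<open>simp add: k_def\<close>)
      hence "\<omega> (k i) = inv\<^bsub>T\<^esub> h0 \<otimes>\<^bsub>T\<^esub> (h0 \<otimes>\<^bsub>T\<^esub> g i \<otimes>\<^bsub>T\<^esub> inv\<^bsub>T\<^esub> h0) \<otimes>\<^bsub>T\<^esub> h0" by (simp add: \<omega>_def labK[OF i])
      also have "\<dots> = (inv\<^bsub>T\<^esub> h0 \<otimes>\<^bsub>T\<^esub> h0) \<otimes>\<^bsub>T\<^esub> g i \<otimes>\<^bsub>T\<^esub> (inv\<^bsub>T\<^esub> h0 \<otimes>\<^bsub>T\<^esub> h0)"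
        using h0 g[OF i] by (simp only: T.m_assoc T.m_closed T.inv_closed)
      finally show ?thesis using h0 g[OF i] by simp
    qed
    ultimately show ?thesis by blast
  qed
  show thesis using that[OF kstab main] by blast
qed

end

section \<open>Counting homomorphisms across a cut\<close>

context coset_cut
begin

definition side :: "bool \<Rightarrow> 'a set set" where
  "side b = {D \<in> V. (D \<in> A) = b}"

lemma side_simps: "side True = A" "side False = V - A"
  using A by (auto simp: side_def)

lemma near_side:
  assumes "C \<in> V" "w \<in> W"
  shows "stays (side b) C w \<or> stays (side (\<not> b)) C w \<or> flat C w"
  using near[OF assms] by (cases b) (auto simp: side_simps)

lemma part_own_side:
  assumes "f \<in> F" "C \<in> V" "w \<in> lists L" "stays (side b) C w"
  shows "[part f b C w = tc f C (word_val G ev w)] (mod int p)"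
proof -
  have "part f (\<not> b) C w = 0" by (rule part_other_side[OF assms(4)]) (auto simp: side_def)
  thus ?thesis using part_total[OF assms(1-3)] by (cases b) auto
qed

definition rim :: "bool \<Rightarrow> 'a set set" where
  "rim b = {D \<in> side b. \<exists>l\<in>L. D #> ev l \<notin> side b}"

text \<open>Distinct rim vertices are tails of distinct boundary edges; this holds for either side
  because the boundary contains the edges that enter \<open>A\<close> as well as those that leave
  it.\<close>

lemma card_rim: "card (rim b) \<le> card (boundary N (ev ` L) A)"
proof -
  define t where "t D = (D, ev (SOME l. l \<in> L \<and> D #> ev l \<notin> side b))" for D
  have "t ` rim b \<subseteq> boundary N (ev ` L) A"
  proof (rule image_subsetI)
    fix D assume D: "D \<in> rim b"
    let ?l = "SOME l. l \<in> L \<and> D #> ev l \<notin> side b"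
    have "\<exists>l. l \<in> L \<and> D #> ev l \<notin> side b" using D by (auto simp: rim_def)
    from someI_ex[OF this] have l: "?l \<in> L" "D #> ev ?l \<notin> side b" by auto
    moreover have "D \<in> V" "(D \<in> A) = b" using D by (auto simp: rim_def side_def)
    ultimately show "t D \<in> boundary N (ev ` L) A"
      using move_closed by (auto simp: t_def boundary_eq side_def)
  qed
  moreover have "inj_on t (rim b)" by (auto simp: t_def inj_on_def)
  moreover have "finite (boundary N (ev ` L) A)" using finite_boundary finN finL by simp
  ultimately show ?thesis by (meson card_inj_on_le)
qed

lemma part_diff:
  assumes "C \<in> V" "w \<in> lists L"
  shows "[part (fp_diff p (G\<lparr>carrier := N\<rparr>) f g) b C w = part f b C w - part g b C w] (mod int p)"
  using assms(2,1)
proof (induction w arbitrary: C)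
  case (Cons l w)
  let ?h = "fp_diff p (G\<lparr>carrier := N\<rparr>) f g"
  have "[(if (C \<in> A) = b then tc ?h C (ev l) else 0) = (if (C \<in> A) = b then tc f C (ev l) else 0) - (if (C \<in> A) = b then tc g C (ev l) else 0)] (mod int p)"
    using transfer_cocycle_diff[OF N Cons.prems ev_closed] Cons.hyps by auto
  from cong_add[OF this Cons.IH[OF move_closed]] show ?case using Cons by (simp add: algebra_simps)
qed simp

text \<open>The set of vertices reachable inside the side is closed under letters and, through
  inverse letters, under walking edges backwards, so no edge of the side separates it from the
  rest.\<close>

lemma path_to:
  assumes con: "coset_connected (ev ` L) (side b)" and x: "x \<in> side b" and D: "D \<in> side b"
  shows "\<exists>w\<in>lists L. stays (side b) x w \<and> pos x w = D"
proof (rule ccontr)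
  let ?R = "{D \<in> side b. \<exists>w\<in>lists L. stays (side b) x w \<and> pos x w = D}"
  assume "\<not> ?thesis"
  hence "?R \<noteq> side b" using D by blast
  have xV: "x \<in> V" using x by (simp add: side_def)
  have "x \<in> ?R" using x pos_Nil[OF xV] by (intro CollectI conjI bexI[of _ "[]"]) auto
  have step: "E #> ev l \<in> ?R" if E: "E \<in> ?R" and l: "l \<in> L" "E #> ev l \<in> side b" for E l
  proof -
    obtain w where w: "w \<in> lists L" "stays (side b) x w" "pos x w = E" using E by blast
    have "w @ [l] \<in> lists L" "stays (side b) x (w @ [l])" "pos x (w @ [l]) = E #> ev l"
      using path_in_append[OF xV w(1), of "[l]"] pos_append[OF xV w(1), of "[l]"] pos_single[OF l(1)] w l E by auto
    thus ?thesis using l(2) by blast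
  qed
  obtain E s where E: "E \<in> side b" "s \<in> ev ` L" "E #> s \<in> side b" "(E \<in> ?R) \<noteq> (E #> s \<in> ?R)"
    using con \<open>?R \<noteq> side b\<close> \<open>x \<in> ?R\<close> unfolding coset_connected_def by (metis (no_types, lifting) empty_iff mem_Collect_eq subsetI)
  obtain l where l: "l \<in> L" "s = ev l" using E(2) by blast
  show False
  proof (cases "E \<in> ?R")
    case True
    have "E #> s \<in> ?R" using step[OF True l(1)] E(3) l(2) by simp
    thus False using True E(4) by simp
  next
    case False
    hence "E #> s \<in> ?R" using E(4) by blast
    moreover have "E #> s #> ev (opp_letter l) = E"
      using opp_letter[OF l(1)] ev_closed[OF l(1)] E(1) l(2)
      by (simp add: side_def rcosets_mult_assoc[OF N] rcosets_mult_one[OF N])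
    ultimately have "E \<in> ?R" using step[of "E #> s" "opp_letter l"] opp_letter[OF l(1)] E(1) by metis
    thus False using False by blast
  qed
qed

text \<open>If the cocycle of \<open>f\<close> has no periods on one side and its potential vanishes on the rim, then that side
  contributes nothing to \<open>f\<close>, which is therefore detected on the other side.\<close>

lemma hom_vanishes:
  assumes H: "subgroup H G" "N \<subseteq> H" and NH: "p_open p (G\<lparr>carrier := H\<rparr>) N"
    and X: "X \<subseteq> H" "\<And>f. f \<in> fp_homs p (G\<lparr>carrier := H\<rparr>) \<Longrightarrow> (\<forall>x\<in>X. f x = 0) \<Longrightarrow> (\<forall>x\<in>H. f x = 0)"
    and wX: "\<And>x. x \<in> X \<Longrightarrow> wx x \<in> W \<and> word_val G ev (wx x) = x"
    and x0: "x0 \<in> side b" and pw: "\<And>D. D \<in> side b \<Longrightarrow> pw D \<in> lists L \<and> stays (side b) x0 (pw D) \<and> pos x0 (pw D) = D"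
    and f: "f \<in> F" and periods: "\<And>w. w \<in> loops (side b) x0 \<Longrightarrow> [part f b x0 w = 0] (mod int p)"
    and rim0: "\<And>D. D \<in> rim b \<Longrightarrow> [part f b x0 (pw D) = 0] (mod int p)"
    and detect: "\<And>y x. y \<in> side (\<not> b) \<Longrightarrow> y \<in> rcosets\<^bsub>G\<lparr>carrier := H\<rparr>\<^esub> N \<Longrightarrow> x \<in> X \<Longrightarrow> tc f y x = 0"
    and n: "n \<in> N"
  shows "f n = 0"
proof -
  have x0V: "x0 \<in> V" using x0 by (simp add: side_def)
  \<comment> \<open>Absence of periods makes the sum along a path in the side depend on its end
    only. The extension by 0 fits together at the cut because the potential vanishes on the
    rim.\<close>
  define \<psi> where "\<psi> D = (if D \<in> side b then part f b x0 (pw D) else 0)" for D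
  have edge: "[part f b C [l] = \<psi> (C #> ev l) - \<psi> C] (mod int p)" if C: "C \<in> V" and l: "l \<in> L" for C l
  proof -
    have C': "C #> ev l \<in> V" using move_closed C l by blast
    have lw: "[l] \<in> lists L" using l by simp
    consider "C \<in> side b" "C #> ev l \<in> side b" | "C \<in> side b" "C #> ev l \<notin> side b"
      | "C \<notin> side b" "C #> ev l \<in> side b" | "C \<notin> side b" "C #> ev l \<notin> side b" by blast
    thus ?thesis
    proof cases
      case 1
      let ?u = "pw C" and ?v = "pw (C #> ev l)"
      note u = pw[OF 1(1)] and v = pw[OF 1(2)]
      have vo: "opp ?v \<in> lists L" using opp_closed v by blast
      have sv: "stays (side b) (C #> ev l) (opp ?v)" "pos (C #> ev l) (opp ?v) = x0"
        using stays_opp[OF x0V, of ?v] pos_opp[OF x0V, of ?v] v by auto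
      have lv: "[l] @ opp ?v \<in> lists L" using lw vo by simp
      have "stays (side b) C ([l] @ opp ?v)" "pos C ([l] @ opp ?v) = x0"
        using path_in_append[OF C lw vo] pos_append[OF C lw vo] pos_single[OF l] sv 1 by auto
      hence "?u @ [l] @ opp ?v \<in> loops (side b) x0"
        using path_in_append[OF x0V _ lv, of ?u] pos_append[OF x0V _ lv, of ?u] u lv by (auto simp: loops_def)
      from periods[OF this] have "[part f b x0 ?u + (part f b C [l] + part f b (C #> ev l) (opp ?v)) = 0] (mod int p)"
        using part_append[OF x0V _ lv, of ?u f b] part_append[OF C lw vo, of f b] u pos_single[OF l] by simp
      moreover have "[part f b (C #> ev l) (opp ?v) = - part f b x0 ?v] (mod int p)"
        using part_opp[OF f x0V, of ?v b] v by simp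
      ultimately have "[part f b x0 ?u + (part f b C [l] + - part f b x0 ?v) = 0] (mod int p)"
        by (meson cong_add cong_refl cong_sym cong_trans)
      thus ?thesis using 1 by (simp add: \<psi>_def cong_iff_dvd_diff algebra_simps)
    next
      case 2
      have "flat C [l]" using near_side[OF C W(2)[OF l], of b] 2 path_in_start[of _ "C #> ev l" "[]"] by (auto simp: side_def)
      hence "part f b C [l] = 0" using part_flat f by blast
      moreover have "[\<psi> C = 0] (mod int p)" using rim0[of C] 2 l by (auto simp: rim_def \<psi>_def)
      ultimately show ?thesis using 2 by (simp add: \<psi>_def cong_iff_dvd_diff)
    next
      case 3
      have "C #> ev l #> ev (opp_letter l) = C"
        using opp_letter[OF l] ev_closed[OF l] C by (simp add: rcosets_mult_assoc[OF N] rcosets_mult_one[OF N])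
      hence "C #> ev l \<in> rim b"
        unfolding rim_def using 3 opp_letter(1)[OF l] by (intro CollectI conjI bexI[of _ "opp_letter l"]) simp_all
      hence "[\<psi> (C #> ev l) = 0] (mod int p)" using rim0 3 by (auto simp: \<psi>_def)
      moreover have "(C \<in> A) \<noteq> b" using 3 C by (auto simp: side_def)
      ultimately show ?thesis using 3 by (simp add: \<psi>_def cong_sym)
    next
      case 4
      moreover have "(C \<in> A) \<noteq> b" using 4 C by (auto simp: side_def)
      ultimately show ?thesis by (simp add: \<psi>_def)
    qed
  qed
  have potential: "[part f b C w = \<psi> (pos C w) - \<psi> C] (mod int p)" if "w \<in> lists L" "C \<in> V" for C w
    using that
  proof (induction w arbitrary: C)
    case Nil thus ?case by (simp add: pos_Nil)
  next
    case (Cons l w)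
    have "[part f b C [l] + part f b (C #> ev l) w = (\<psi> (C #> ev l) - \<psi> C) + (\<psi> (pos (C #> ev l) w) - \<psi> (C #> ev l))] (mod int p)"
      by (intro cong_add edge Cons.IH move_closed Cons)
    thus ?case using pos_Cons[OF Cons.prems Cons.hyps] by simp
  qed
  interpret GH: group "G\<lparr>carrier := H\<rparr>" using H(1) subgroup_imp_group by blast
  let ?Y = "rcosets\<^bsub>G\<lparr>carrier := H\<rparr>\<^esub> N"
  have YV: "y \<in> V" if "y \<in> ?Y" for y
    using that subgroup.subset[OF H(1)] subgroup.subset[OF N] by (auto simp: rcosets_subgroup intro: rcosetsI)
  have Hc: "h \<in> carrier G" if "h \<in> H" for h using that subgroup.mem_carrier[OF H(1)] by blast
  \<comment> \<open>The contribution of the other side, a cocycle for the cosets of \<open>N\<close>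
    in \<open>H\<close>; it has to be tested on \<open>X\<close> only, where each path stays on one
    side or is flat.\<close>
  define c where "c y g = part f (\<not> b) y (wd g)" for y g
  have cocycle: "coset_cocycle p (G\<lparr>carrier := H\<rparr>) N c"
    unfolding coset_cocycle_def
  proof (intro ballI)
    fix y g h assume y: "y \<in> ?Y" and "g \<in> carrier (G\<lparr>carrier := H\<rparr>)" "h \<in> carrier (G\<lparr>carrier := H\<rparr>)"
    hence gh: "g \<in> carrier G" "h \<in> carrier G" using Hc by auto
    have "[part f (\<not> b) y (wd (g \<otimes> h)) = part f (\<not> b) y (wd g @ wd h)] (mod int p)"
      by (rule part_cong[OF f YV[OF y]]) (use gh wd in \<open>simp_all add: word_val_append[OF ev_fun] del: in_lists_conv_set\<close>)
    moreover have "y #>\<^bsub>G\<lparr>carrier := H\<rparr>\<^esub> g = pos y (wd g)" using wd(2)[OF gh(1)] by (simp add: pos_def r_coset_def)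
    ultimately show "[c y (g \<otimes>\<^bsub>G\<lparr>carrier := H\<rparr>\<^esub> h) = c y g + c (y #>\<^bsub>G\<lparr>carrier := H\<rparr>\<^esub> g) h] (mod int p)"
      using part_append[OF YV[OF y] wd(1)[OF gh(1)] wd(1)[OF gh(2)], of f "\<not> b"] by (simp add: c_def)
  qed
  have onX: "[c y x = 0] (mod int p)" if y: "y \<in> ?Y" and x: "x \<in> X" for y x
  proof -
    have xc: "x \<in> carrier G" using x X(1) Hc by blast
    have w: "wx x \<in> W" "wx x \<in> lists L" "word_val G ev (wx x) = x" using wX[OF x] W(3) by auto
    have "[c y x = part f (\<not> b) y (wx x)] (mod int p)"
      unfolding c_def by (rule part_cong[OF f YV[OF y]]) (use wd[OF xc] w in auto)
    moreover have "[part f (\<not> b) y (wx x) = 0] (mod int p)"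
    proof -
      consider "stays (side b) y (wx x)" | "stays (side (\<not> b)) y (wx x)" | "flat y (wx x)"
        using near_side[OF YV[OF y] w(1)] by blast
      thus ?thesis
      proof cases
        case 1
        have "part f (\<not> b) y (wx x) = 0" by (rule part_other_side[OF 1]) (auto simp: side_def)
        thus ?thesis by simp
      next
        case 2
        have "[part f (\<not> b) y (wx x) = tc f y x] (mod int p)" using part_own_side[OF f YV[OF y] w(2) 2] w(3) by simp
        thus ?thesis using detect[OF path_in_start[OF 2] y x] by simp
      next
        case 3
        thus ?thesis using part_flat f by simp
      qed
    qed
    ultimately show ?thesis by (rule cong_trans)
  qed
  have nH: "n \<in> carrier (G\<lparr>carrier := H\<rparr>)" and nc: "n \<in> carrier G" using n H Hc by auto
  have NY: "N \<in> ?Y" using NH GH.self_in_rcosets by (auto simp: p_open_def)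
  have sep: "\<And>g. g \<in> fp_homs p (G\<lparr>carrier := H\<rparr>) \<Longrightarrow> \<forall>x\<in>X. g x = 0 \<Longrightarrow> \<forall>x\<in>carrier (G\<lparr>carrier := H\<rparr>). g x = 0"
    using X(2) by simp
  have "[part f (\<not> b) N (wd n) = 0] (mod int p)"
    using GH.cocycle_vanishes[OF p NH cocycle _ sep onX NY nH] X(1) by (simp add: c_def)
  moreover have "[part f b N (wd n) = 0] (mod int p)"
    using potential[OF wd(1)[OF nc] N_in_V] pos_N[OF n] by simp
  ultimately have "[part f b N (wd n) + part f (\<not> b) N (wd n) = 0 + 0] (mod int p)" by (intro cong_add)
  moreover have "[part f True N (wd n) + part f False N (wd n) = f n] (mod int p)"
    using part_total[OF f N_in_V wd(1)[OF nc]] wd(2)[OF nc] transfer_cocycle_base[OF N n] by simp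
  ultimately have "[f n = 0] (mod int p)"
    by (cases b) (auto simp: cong_def add.commute)
  moreover have "0 \<le> f n" "f n < int p" using fp_homs_range[of f p "G\<lparr>carrier := N\<rparr>" n] f F n by auto
  ultimately show ?thesis by (simp add: cong_def)
qed

text \<open>Three successive fibre counts: one residue for each of at most \<open>q\<close> loop
  values, one for each rim vertex, and one for each pair of a coset of the other side inside
  \<open>H\<close> and an element of \<open>X\<close>. By \<open>hom_vanishes\<close> nothing but 0
  is left when all of them vanish.\<close>

lemma card_by_loop_values:
  assumes H: "subgroup H G" "N \<subseteq> H" and NH: "p_open p (G\<lparr>carrier := H\<rparr>) N"
    and X: "finite X" "X \<subseteq> H" "\<And>f. f \<in> fp_homs p (G\<lparr>carrier := H\<rparr>) \<Longrightarrow> (\<forall>x\<in>X. f x = 0) \<Longrightarrow> (\<forall>x\<in>H. f x = 0)"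
    and wX: "\<And>x. x \<in> X \<Longrightarrow> wx x \<in> W \<and> word_val G ev (wx x) = x"
    and con: "coset_connected (ev ` L) (side b)" and x0: "x0 \<in> side b"
    and diff: "\<And>f g. f \<in> F \<Longrightarrow> g \<in> F \<Longrightarrow> fp_diff p (G\<lparr>carrier := N\<rparr>) f g \<in> F"
    and few: "card (loop_value b x0 ` loops (side b) x0) \<le> q"
  shows "card F \<le> p ^ (q + card (boundary N (ev ` L) A) + card (side (\<not> b) \<inter> (rcosets\<^bsub>G\<lparr>carrier := H\<rparr>\<^esub> N)) * card X)"
proof -
  let ?d = "fp_diff p (G\<lparr>carrier := N\<rparr>)" and ?Y = "side (\<not> b) \<inter> (rcosets\<^bsub>G\<lparr>carrier := H\<rparr>\<^esub> N)"
  let ?\<beta> = "card (boundary N (ev ` L) A)"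
  have p0: "p > 0" "int p > 0" using prime_gt_0_nat[OF p] by auto
  have gN: "group (G\<lparr>carrier := N\<rparr>)" using N subgroup_imp_group by blast
  have x0V: "x0 \<in> V" using x0 by (simp add: side_def)
  define pw where "pw D = (SOME w. w \<in> lists L \<and> stays (side b) x0 w \<and> pos x0 w = D)" for D
  have pw: "pw D \<in> lists L \<and> stays (side b) x0 (pw D) \<and> pos x0 (pw D) = D" if "D \<in> side b" for D
    unfolding pw_def by (rule someI_ex) (use path_to[OF con x0 that] in blast)
  let ?LV = "loop_value b x0 ` loops (side b) x0"
  define F1 where "F1 = {f\<in>F. \<forall>w\<in>loops (side b) x0. part f b x0 w mod int p = 0}"
  define F2 where "F2 = {f\<in>F1. \<forall>D\<in>rim b. part f b x0 (pw D) mod int p = 0}"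
  define zero where "zero = (\<lambda>x\<in>N. 0 :: int)"
  have F12: "F2 \<subseteq> F1" "F1 \<subseteq> F" by (auto simp: F1_def F2_def)
  have finF2: "finite F2" and finF1: "finite F1"
    using finite_subset[OF F12(2) finF] finite_subset[OF F12(1)] by auto
  have finLV: "finite ?LV"
  proof (rule finite_subset)
    show "?LV \<subseteq> F \<rightarrow>\<^sub>E {0..<int p}"
    proof (rule image_subsetI)
      fix w
      show "loop_value b x0 w \<in> F \<rightarrow>\<^sub>E {0..<int p}"
        unfolding loop_value_def by (intro restrict_PiE_iff[THEN iffD2] ballI) (use p0 in simp)
    qed
    show "finite (F \<rightarrow>\<^sub>E {0..<int p})" using finF by (intro finite_PiE) auto
  qed
  have finrim: "finite (rim b)" by (rule finite_subset[of _ V]) (use finN in \<open>auto simp: rim_def side_def\<close>)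
  have pd: "part (?d f g) b x0 w mod int p = 0" if "part f b x0 w mod int p = part g b x0 w mod int p" "w \<in> lists L" for f g w
  proof -
    have "int p dvd part f b x0 w - part g b x0 w" using that(1) by (simp add: mod_eq_dvd_iff)
    hence "[part f b x0 w - part g b x0 w = 0] (mod int p)" by (simp add: cong_iff_dvd_diff)
    from cong_trans[OF part_diff[OF x0V that(2)] this] show ?thesis by (simp add: cong_def)
  qed
  have loopL: "w \<in> lists L" if "w \<in> loops (side b) x0" for w using that by (simp add: loops_def)
  have d1: "?d f g \<in> F1" if "f \<in> F" "g \<in> F" "\<And>w. w \<in> loops (side b) x0 \<Longrightarrow> part f b x0 w mod int p = part g b x0 w mod int p" for f g
    unfolding F1_def using diff that pd loopL by blast
  have range: "(\<lambda>y\<in>D. h y mod int p) \<in> D \<rightarrow>\<^sub>E {0..<int p}" for D and h :: "'z \<Rightarrow> int" using p0 by auto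
  have 1: "card F \<le> card (?LV \<rightarrow>\<^sub>E {0..<int p}) * card F1"
  proof (rule card_fp_homs_fibres(2)[OF gN p0(1) F, where \<rho> = "\<lambda>f. \<lambda>v\<in>?LV. v f mod int p"])
    show "finite (?LV \<rightarrow>\<^sub>E {0..<int p})" using finLV by (intro finite_PiE) auto
    show "(\<lambda>f. \<lambda>v\<in>?LV. v f mod int p) ` F \<subseteq> ?LV \<rightarrow>\<^sub>E {0..<int p}" by (intro image_subsetI) (use p0 in auto)
    fix f g assume f: "f \<in> F" and g: "g \<in> F" and eq: "(\<lambda>v\<in>?LV. v f mod int p) = (\<lambda>v\<in>?LV. v g mod int p)"
    show "?d f g \<in> F1"
    proof (rule d1[OF f g])
      fix w assume "w \<in> loops (side b) x0"
      thus "part f b x0 w mod int p = part g b x0 w mod int p"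
        using fun_cong[OF eq, of "loop_value b x0 w"] f g by (simp add: loop_value_def)
    qed
  qed (rule finF1)
  have F1F: "F1 \<subseteq> fp_homs p (G\<lparr>carrier := N\<rparr>)" "F2 \<subseteq> fp_homs p (G\<lparr>carrier := N\<rparr>)" using F12 F by auto
  have d2: "?d f g \<in> F2" if f: "f \<in> F1" and g: "g \<in> F1" and e: "\<And>D. D \<in> rim b \<Longrightarrow> part f b x0 (pw D) mod int p = part g b x0 (pw D) mod int p" for f g
  proof -
    have "?d f g \<in> F1" by (rule d1) (use f g in \<open>auto simp: F1_def\<close>)
    moreover have "part (?d f g) b x0 (pw D) mod int p = 0" if "D \<in> rim b" for D
      by (rule pd[OF e[OF that]]) (use pw that in \<open>auto simp: rim_def\<close>)
    ultimately show ?thesis by (simp add: F2_def)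
  qed
  have 2: "card F1 \<le> card (rim b \<rightarrow>\<^sub>E {0..<int p}) * card F2"
  proof (rule card_fp_homs_fibres(2)[OF gN p0(1) F1F(1), where \<rho> = "\<lambda>f. \<lambda>D\<in>rim b. part f b x0 (pw D) mod int p"])
    show "finite (rim b \<rightarrow>\<^sub>E {0..<int p})" using finrim by (intro finite_PiE) auto
    show "(\<lambda>f. \<lambda>D\<in>rim b. part f b x0 (pw D) mod int p) ` F1 \<subseteq> rim b \<rightarrow>\<^sub>E {0..<int p}"
      by (intro image_subsetI) (use p0 in auto)
    fix f g assume f: "f \<in> F1" and g: "g \<in> F1"
      and eq: "(\<lambda>D\<in>rim b. part f b x0 (pw D) mod int p) = (\<lambda>D\<in>rim b. part g b x0 (pw D) mod int p)"
    show "?d f g \<in> F2"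
    proof (rule d2[OF f g])
      fix D assume "D \<in> rim b"
      thus "part f b x0 (pw D) mod int p = part g b x0 (pw D) mod int p" using fun_cong[OF eq, of D] by simp
    qed
  qed (rule finF2)
  have finYX: "finite (?Y \<times> X)" using X(1) finN by (auto simp: side_def)
  have 3: "card F2 \<le> card ((?Y \<times> X) \<rightarrow>\<^sub>E {0..<int p}) * card {zero}"
  proof (rule card_fp_homs_fibres(2)[OF gN p0(1) F1F(2), where \<rho> = "\<lambda>f. \<lambda>z\<in>?Y \<times> X. tc f (fst z) (snd z) mod int p"])
    show "finite ((?Y \<times> X) \<rightarrow>\<^sub>E {0..<int p})" using finYX by (intro finite_PiE) auto
    show "(\<lambda>f. \<lambda>z\<in>?Y \<times> X. tc f (fst z) (snd z) mod int p) ` F2 \<subseteq> (?Y \<times> X) \<rightarrow>\<^sub>E {0..<int p}"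
      by (intro image_subsetI) (use p0 in auto)
    fix f g assume f: "f \<in> F2" and g: "g \<in> F2"
      and eq: "(\<lambda>z\<in>?Y \<times> X. tc f (fst z) (snd z) mod int p) = (\<lambda>z\<in>?Y \<times> X. tc g (fst z) (snd z) mod int p)"
    have h: "?d f g \<in> F2" by (rule d2) (use f g F12 in \<open>auto simp: F2_def\<close>)
    hence hF: "?d f g \<in> F" using F12 by blast
    have "?d f g n = 0" if n: "n \<in> N" for n
    proof (rule hom_vanishes[OF H NH X(2,3) wX x0 pw hF _ _ _ n])
      show "[part (?d f g) b x0 w = 0] (mod int p)" if "w \<in> loops (side b) x0" for w
        using h that by (auto simp: F2_def F1_def cong_def)
      show "[part (?d f g) b x0 (pw D) = 0] (mod int p)" if "D \<in> rim b" for D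
        using h that by (auto simp: F2_def cong_def)
      fix y x assume y: "y \<in> side (\<not> b)" "y \<in> rcosets\<^bsub>G\<lparr>carrier := H\<rparr>\<^esub> N" and x: "x \<in> X"
      have yV: "y \<in> V" using y by (simp add: side_def)
      have xc: "x \<in> carrier G" using x X(2) subgroup.mem_carrier[OF H(1)] by blast
      have "tc f y x mod int p = tc g y x mod int p" using fun_cong[OF eq, of "(y, x)"] y x by simp
      hence "[tc (?d f g) y x = 0] (mod int p)"
        using transfer_cocycle_diff[OF N yV xc, of p f g] by (simp add: cong_def mod_eq_dvd_iff)
      moreover have "0 \<le> tc (?d f g) y x" "tc (?d f g) y x < int p"
        using fp_homs_range[of "?d f g" p "G\<lparr>carrier := N\<rparr>"] hF F schreier_elem_mem[OF N yV xc]
        by (auto simp: transfer_cocycle_def)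
      ultimately show "tc (?d f g) y x = 0" by (simp add: cong_def)
    qed auto
    moreover have "?d f g n = undefined" if "n \<notin> N" for n using that by (simp add: fp_diff_def)
    ultimately have "?d f g = zero" by (auto simp: zero_def)
    thus "?d f g \<in> {zero}" by simp
  qed simp
  have "card F \<le> p ^ card ?LV * (p ^ card (rim b) * (p ^ (card ?Y * card X)))"
  proof -
    have "card (?LV \<rightarrow>\<^sub>E {0..<int p}) = p ^ card ?LV" using finLV by (simp add: card_PiE)
    moreover have "card (rim b \<rightarrow>\<^sub>E {0..<int p}) = p ^ card (rim b)" using finrim by (simp add: card_PiE)
    moreover have "card ((?Y \<times> X) \<rightarrow>\<^sub>E {0..<int p}) = p ^ (card ?Y * card X)"
      using finYX by (simp add: card_PiE card_cartesian_product)
    ultimately have c: "card F \<le> p ^ card ?LV * card F1" "card F1 \<le> p ^ card (rim b) * card F2" "card F2 \<le> p ^ (card ?Y * card X)"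
      using 1 2 3 by simp_all
    have "card F1 \<le> p ^ card (rim b) * p ^ (card ?Y * card X)" using c(2,3) by (meson mult_le_mono2 order_trans)
    thus ?thesis using c(1) by (meson mult_le_mono2 order_trans)
  qed
  also have "\<dots> \<le> p ^ q * (p ^ ?\<beta> * p ^ (card ?Y * card X))"
    using few card_rim[of b] p0(1) by (intro mult_le_mono power_increasing) auto
  finally show ?thesis by (simp add: power_add)
qed

end

lemma (in group) monoid_presentation_generates:
  assumes "monoid_presentation G L ev Rel"
  shows "generate G (ev ` L) = carrier G"
proof
  have ev: "ev ` L \<subseteq> carrier G" using assms by (auto simp: monoid_presentation_def)
  show "generate G (ev ` L) \<subseteq> carrier G" using generate_incl[OF ev] .
  have "word_val G ev w \<in> generate G (ev ` L)" if "w \<in> lists L" for w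
    using that by (induction w) (auto intro: generate.one generate.eng generate.incl)
  moreover have "\<forall>g\<in>carrier G. \<exists>w\<in>lists L. word_val G ev w = g" using assms by (simp add: monoid_presentation_def)
  ultimately show "carrier G \<subseteq> generate G (ev ` L)" by (intro subsetI) metis
qed

section \<open>Homomorphisms that vanish near a cut\<close>

lemma path_edges_length: "length (path_edges G ev C w) = length w"
  by (induction w arbitrary: C) auto

context group
begin

lemma finite_fp_homs:
  assumes "prime p" "finite X" "X \<subseteq> carrier G" "generate G X = carrier G"
  shows "finite (fp_homs p G)"
proof -
  have "card (fp_homs p G) > 0"
    using card_fp_homs[OF is_group assms] prime_gt_0_nat[OF assms(1)] by simp
  thus ?thesis by (simp add: card_ge_0_finite)
qed

lemma path_crossing:
  assumes N: "subgroup N G" and ev: "ev \<in> L \<rightarrow> carrier G"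
    and C: "C \<in> rcosets N" and w: "w \<in> lists L"
    and no: "\<not> path_in G ev A C w" "\<not> path_in G ev (rcosets N - A) C w"
  shows "\<exists>i<length w. (C #> word_val G ev (take i w), ev (w ! i)) \<in> boundary N (ev ` L) A"
  using w C no
proof (induction w arbitrary: C)
  case (Cons l w)
  have l: "l \<in> L" "w \<in> lists L" "ev l \<in> carrier G" using Cons.hyps ev by auto
  have C1: "C #> \<one> = C" using rcosets_mult_one[OF N] Cons.prems by blast
  have C': "C #> ev l \<in> rcosets N" using rcosets_mult_closed[OF N Cons.prems(1) l(3)] .
  show ?case
  proof (cases "(C \<in> A) = (C #> ev l \<in> A)")
    case False
    thus ?thesis using l Cons.prems(1) C1 by (intro exI[of _ 0]) (auto simp: boundary_eq)
  next
    case True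
    have start: "path_in G ev P D v \<Longrightarrow> D \<in> P" for P D v by (cases v) auto
    have "\<not> path_in G ev A (C #> ev l) w" "\<not> path_in G ev (rcosets N - A) (C #> ev l) w"
      using Cons.prems True start by auto
    from Cons.IH[OF C' this] obtain i where i: "i < length w"
      "(C #> ev l #> word_val G ev (take i w), ev (w ! i)) \<in> boundary N (ev ` L) A" by blast
    have "word_val G ev (take i w) \<in> carrier G"
      by (rule word_val_closed[OF ev]) (use l(2) in \<open>auto dest: in_set_takeD\<close>)
    thus ?thesis using i l(3) rcosets_mult_assoc[OF N Cons.prems(1)] by (intro exI[of _ "Suc i"]) simp
  qed
qed auto

text \<open>The largest set \<open>F\<close> of homomorphisms admissible in \<open>coset_cut\<close>
  for the words \<open>W\<close>.\<close>

definition near_homs :: "nat \<Rightarrow> ('l \<Rightarrow> 'a) \<Rightarrow> 'l list set \<Rightarrow> 'a set \<Rightarrow> 'a set set \<Rightarrow> ('a \<Rightarrow> int) set" where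
  "near_homs p ev W N A = {f\<in>fp_homs p (G\<lparr>carrier := N\<rparr>). \<forall>C\<in>rcosets N. \<forall>w\<in>W.
      path_in G ev A C w \<or> path_in G ev (rcosets N - A) C w \<or>
      (\<forall>(D, l)\<in>set (path_edges G ev C w). transfer_cocycle N f D (ev l) = 0)}"

lemma path_edges_in:
  assumes N: "subgroup N G" and ev: "ev \<in> L \<rightarrow> carrier G" and "C \<in> rcosets N" "w \<in> lists L" "(D, l) \<in> set (path_edges G ev C w)"
  shows "D \<in> rcosets N \<and> l \<in> L"
  using assms(4,3,5)
proof (induction w arbitrary: C)
  case (Cons k w)
  have "C #> ev k \<in> rcosets N" using rcosets_mult_closed[OF N Cons.prems(1)] Cons.hyps ev by auto
  thus ?case using Cons by auto
qed simp

lemma transfer_cocycle_diff_zero: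
  assumes N: "subgroup N G" and p: "p > 0" and C: "C \<in> rcosets N" and g: "g \<in> carrier G"
    and eq: "transfer_cocycle N f C g = transfer_cocycle N f' C g"
  shows "transfer_cocycle N (fp_diff p (G\<lparr>carrier := N\<rparr>) f f') C g = 0"
  using schreier_elem_mem[OF N C g] eq by (simp add: transfer_cocycle_def fp_diff_def)

lemma near_homs_diff:
  assumes N: "subgroup N G" and p: "p > 0" and ev: "ev \<in> L \<rightarrow> carrier G" and W: "W \<subseteq> lists L"
    and f: "f \<in> near_homs p ev W N A" and g: "g \<in> near_homs p ev W N A"
  shows "fp_diff p (G\<lparr>carrier := N\<rparr>) f g \<in> near_homs p ev W N A"
proof -
  have "transfer_cocycle N (fp_diff p (G\<lparr>carrier := N\<rparr>) f g) D (ev l) = 0"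
    if C: "C \<in> rcosets N" and w: "w \<in> W" and no: "\<not> path_in G ev A C w" "\<not> path_in G ev (rcosets N - A) C w"
      and D: "(D, l) \<in> set (path_edges G ev C w)" for C w D l
  proof -
    have "D \<in> rcosets N" "ev l \<in> carrier G" using path_edges_in[OF N ev C _ D] W w ev by auto
    moreover have "transfer_cocycle N f D (ev l) = 0" "transfer_cocycle N g D (ev l) = 0"
      using f g C w no D unfolding near_homs_def by blast+
    ultimately show ?thesis using transfer_cocycle_diff_zero[OF N p] by simp
  qed
  moreover have "fp_diff p (G\<lparr>carrier := N\<rparr>) f g \<in> fp_homs p (G\<lparr>carrier := N\<rparr>)"
    using fp_diff_homs[OF _ _ p] f g subgroup_imp_group[OF N] by (auto simp: near_homs_def)
  ultimately show ?thesis unfolding near_homs_def by blast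
qed

text \<open>An edge on a crossing path is determined by the word, the position of a crossing, the
  position of the edge and the cut edge crossed; hence the squares of the lengths. Each such edge
  imposes one linear condition.\<close>

lemma card_near_homs:
  assumes N: "subgroup N G" and fin: "finite (rcosets N)" "finite (fp_homs p (G\<lparr>carrier := N\<rparr>))" and p: "prime p"
    and ev: "ev \<in> L \<rightarrow> carrier G" "finite L" and W: "W \<subseteq> lists L" "finite W"
  shows "card (fp_homs p (G\<lparr>carrier := N\<rparr>)) \<le>
    p ^ ((\<Sum>w\<in>W. (length w)\<^sup>2) * card (boundary N (ev ` L) A)) * card (near_homs p ev W N A)"
proof -
  let ?F = "fp_homs p (G\<lparr>carrier := N\<rparr>)" and ?bd = "boundary N (ev ` L) A"
  have p0: "p > 0" "int p > 0" using prime_gt_0_nat[OF p] by auto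
  define I where "I = Sigma W (\<lambda>w. {..<length w} \<times> {..<length w})"
  have cI: "card I = (\<Sum>w\<in>W. (length w)\<^sup>2)"
    using W(2) by (simp add: I_def card_cartesian_product power2_eq_square)
  have fI: "finite I" using W(2) by (auto simp: I_def)
  have fbd: "finite ?bd" using finite_boundary fin(1) ev(2) by simp
  define edge where "edge x = (case x of ((w, i, j), (D, s :: 'a)) \<Rightarrow>
      path_edges G ev (D #> inv (word_val G ev (take i w))) w ! j)" for x
  define Bad where "Bad = edge ` (I \<times> ?bd) \<inter> (rcosets N) \<times> L"
  have fB: "finite Bad" using fI fbd by (simp add: Bad_def)
  have cB: "card Bad \<le> card I * card ?bd"
  proof -
    have "card Bad \<le> card (edge ` (I \<times> ?bd))" using fI fbd by (intro card_mono) (auto simp: Bad_def)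
    also have "\<dots> \<le> card (I \<times> ?bd)" using fI fbd by (intro card_image_le) auto
    finally show ?thesis by (simp add: card_cartesian_product)
  qed
  have bad: "(D, l) \<in> Bad"
    if C: "C \<in> rcosets N" and w: "w \<in> W" and no: "\<not> path_in G ev A C w" "\<not> path_in G ev (rcosets N - A) C w"
      and D: "(D, l) \<in> set (path_edges G ev C w)" for C w D l
  proof -
    have wl: "w \<in> lists L" using w W by blast
    obtain i where i: "i < length w" "(C #> word_val G ev (take i w), ev (w ! i)) \<in> ?bd"
      using path_crossing[OF N ev(1) C wl no] by blast
    obtain j where j: "j < length w" "path_edges G ev C w ! j = (D, l)"
      using D by (metis in_set_conv_nth path_edges_length)
    have v: "word_val G ev (take i w) \<in> carrier G"
      using word_val_closed[OF ev(1)] wl by (auto dest: in_set_takeD)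
    have "edge ((w, i, j), (C #> word_val G ev (take i w), ev (w ! i))) = (D, l)"
      using v C j by (simp add: edge_def rcosets_mult_assoc[OF N] rcosets_mult_one[OF N])
    moreover have "(w, i, j) \<in> I" using w i j by (simp add: I_def)
    ultimately have "(D, l) \<in> edge ` (I \<times> ?bd)" using i(2)
      by (intro image_eqI[where x = "((w, i, j), (C #> word_val G ev (take i w), ev (w ! i)))"]) simp_all
    thus ?thesis using path_edges_in[OF N ev(1) C wl D] by (simp add: Bad_def)
  qed
  let ?r = "\<lambda>f. \<lambda>(D, l)\<in>Bad. transfer_cocycle N f D (ev l)"
  have "card ?F \<le> card (Bad \<rightarrow>\<^sub>E {0..<int p}) * card (near_homs p ev W N A)"
  proof (rule card_fp_homs_fibres(2)[OF subgroup_imp_group[OF N] p0(1) order_refl, where \<rho> = ?r])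
    show "finite (Bad \<rightarrow>\<^sub>E {0..<int p})" using fB by (intro finite_PiE) auto
    show "finite (near_homs p ev W N A)" using fin(2) by (simp add: near_homs_def)
    show "?r ` ?F \<subseteq> Bad \<rightarrow>\<^sub>E {0..<int p}"
    proof (rule image_subsetI)
      fix f assume f: "f \<in> ?F"
      have "transfer_cocycle N f D (ev l) \<in> {0..<int p}" if "(D, l) \<in> Bad" for D l
      proof -
        have "schreier_elem N D (ev l) \<in> N" using that ev(1) by (intro schreier_elem_mem[OF N]) (auto simp: Bad_def)
        thus ?thesis using fp_homs_range[OF f, of "schreier_elem N D (ev l)"] by (simp add: transfer_cocycle_def)
      qed
      thus "?r f \<in> Bad \<rightarrow>\<^sub>E {0..<int p}" by (intro restrict_PiE_iff[THEN iffD2]) auto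
    qed
    fix f g assume f: "f \<in> ?F" and g: "g \<in> ?F" and eq: "?r f = ?r g"
    have z: "transfer_cocycle N (fp_diff p (G\<lparr>carrier := N\<rparr>) f g) D (ev l) = 0" if D: "(D, l) \<in> Bad" for D l
    proof (rule transfer_cocycle_diff_zero[OF N p0(1)])
      show "D \<in> rcosets N" "ev l \<in> carrier G" using D ev(1) by (auto simp: Bad_def)
      show "transfer_cocycle N f D (ev l) = transfer_cocycle N g D (ev l)" using fun_cong[OF eq, of "(D, l)"] D by simp
    qed
    show "fp_diff p (G\<lparr>carrier := N\<rparr>) f g \<in> near_homs p ev W N A"
      unfolding near_homs_def
    proof (intro CollectI conjI ballI)
      show "fp_diff p (G\<lparr>carrier := N\<rparr>) f g \<in> fp_homs p (G\<lparr>carrier := N\<rparr>)"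
        using fp_diff_homs[OF f g p0(1)] subgroup_imp_group[OF N] by blast
    qed (use bad z in blast)
  qed
  also have "card (Bad \<rightarrow>\<^sub>E {0..<int p}) = p ^ card Bad" using fB by (simp add: card_PiE)
  also have "p ^ card Bad * card (near_homs p ev W N A) \<le> p ^ (card I * card ?bd) * card (near_homs p ev W N A)"
    using cB p0(1) by (intro mult_le_mono1 power_increasing) auto
  finally show ?thesis unfolding cI .
qed

text \<open>With at most \<open>q + 1\<close> loop values on one side,
  \<open>card_by_loop_values\<close> would contradict \<open>many\<close>, taken for the opposite
  side as \<open>Q\<close>. So each side has at least \<open>q + 2\<close>, of which one may be that
  of the empty loop; this supplies the \<open>q\<close> loops in \<open>A\<close> and the one loop
  outside for \<open>stab_retract\<close>.\<close>

theorem cut_retract: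
  assumes pres: "monoid_presentation G L ev Rel" and p: "prime p"
    and N: "subgroup N G" and finN: "finite (rcosets N)" and fin: "finite (fp_homs p (G\<lparr>carrier := N\<rparr>))"
    and H: "subgroup H G" "N \<subseteq> H" "p_open p (G\<lparr>carrier := H\<rparr>) N"
    and X: "finite X" "X \<subseteq> H" "\<And>f. f \<in> fp_homs p (G\<lparr>carrier := H\<rparr>) \<Longrightarrow> (\<forall>x\<in>X. f x = 0) \<Longrightarrow> (\<forall>x\<in>H. f x = 0)"
    and wx: "\<And>x. x \<in> X \<Longrightarrow> wx x \<in> lists L \<and> word_val G ev (wx x) = x"
    and W_eq: "W = Rel \<union> (\<lambda>l. [l]) ` L \<union> wx ` X"
    and cut: "A \<subseteq> rcosets N" "A \<noteq> {}" "A \<noteq> rcosets N"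
    and con: "coset_connected (ev ` L) A" "coset_connected (ev ` L) (rcosets N - A)"
    and many: "\<And>Q. Q \<in> {A, rcosets N - A} \<Longrightarrow>
      p ^ ((\<Sum>w\<in>W. (length w)\<^sup>2) * card (boundary N (ev ` L) A) + (q + 1 + card (boundary N (ev ` L) A)
        + card (Q \<inter> (rcosets\<^bsub>G\<lparr>carrier := H\<rparr>\<^esub> N)) * card X)) < card (fp_homs p (G\<lparr>carrier := N\<rparr>))"
  obtains J and k :: "nat \<Rightarrow> 'a" where "p_open p (G\<lparr>carrier := N\<rparr>) J" "\<And>i. i < q \<Longrightarrow> k i \<in> J"
    "\<And>(T :: 'c monoid) g. group T \<Longrightarrow> (\<And>i. i < q \<Longrightarrow> g i \<in> carrier T) \<Longrightarrow>
       \<exists>\<omega>\<in>hom (G\<lparr>carrier := J\<rparr>) T. \<forall>i<q. \<omega> (k i) = g i"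
proof -
  define F where "F = near_homs p ev W N A"
  have p0: "p > 0" using prime_gt_0_nat[OF p] .
  have LR: "finite L" "finite Rel" "Rel \<subseteq> lists L" "ev \<in> L \<rightarrow> carrier G"
    using pres by (auto simp: monoid_presentation_def)
  have Wl: "W \<subseteq> lists L" using LR wx by (auto simp: W_eq)
  have finW: "finite W" using LR X(1) by (simp add: W_eq)
  interpret coset_cut G L ev Rel W p N A F
  proof (intro coset_cut.intro coset_cut_axioms.intro is_group pres p N finN cut(1) Wl)
    show "\<And>C w. C \<in> rcosets N \<Longrightarrow> w \<in> W \<Longrightarrow> path_in G ev A C w \<or> path_in G ev (rcosets N - A) C w \<or>
      (\<forall>f\<in>F. \<forall>(D, l)\<in>set (path_edges G ev C w). transfer_cocycle N f D (ev l) = 0)"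
      unfolding F_def near_homs_def by blast
    show "F \<subseteq> fp_homs p (G\<lparr>carrier := N\<rparr>)" "finite F" using fin by (auto simp: F_def near_homs_def)
    show "\<And>l. l \<in> L \<Longrightarrow> [l] \<in> W" "Rel \<subseteq> W" by (auto simp: W_eq)
  qed
  let ?bd = "card (boundary N (ev ` L) A)"
  have many_values: "card (loop_value b x0 ` loops (side b) x0) \<ge> q + 2" if x0: "x0 \<in> side b" for b x0
  proof (rule ccontr)
    assume "\<not> ?thesis"
    hence few: "card (loop_value b x0 ` loops (side b) x0) \<le> q + 1" by simp
    have con': "coset_connected (ev ` L) (side b)" using con by (cases b) (auto simp: side_simps)
    have wX: "wx x \<in> W \<and> word_val G ev (wx x) = x" if "x \<in> X" for x using wx[OF that] that by (simp add: W_eq)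
    have diff: "fp_diff p (G\<lparr>carrier := N\<rparr>) f g \<in> F" if "f \<in> F" "g \<in> F" for f g
      using near_homs_diff[OF N p0 LR(4) Wl] that by (simp add: F_def)
    let ?e = "q + 1 + ?bd + card (side (\<not> b) \<inter> (rcosets\<^bsub>G\<lparr>carrier := H\<rparr>\<^esub> N)) * card X"
    have "card (fp_homs p (G\<lparr>carrier := N\<rparr>)) \<le> p ^ ((\<Sum>w\<in>W. (length w)\<^sup>2) * ?bd) * card F"
      unfolding F_def by (rule card_near_homs[OF N finN fin p LR(4,1) Wl finW])
    also have "\<dots> \<le> p ^ ((\<Sum>w\<in>W. (length w)\<^sup>2) * ?bd) * p ^ ?e"
      by (intro mult_le_mono2 card_by_loop_values[OF H X wX con' x0 diff few])
    also have "\<dots> = p ^ ((\<Sum>w\<in>W. (length w)\<^sup>2) * ?bd + ?e)" by (simp only: power_add)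
    also have "\<dots> < card (fp_homs p (G\<lparr>carrier := N\<rparr>))"
      by (rule many) (cases b; simp add: side_simps)
    finally show False by simp
  qed
  have nontrivial: "card (loop_value b x0 ` loops (side b) x0 - {loop_value b x0 []}) \<ge> q + 1"
    if x0: "x0 \<in> side b" for b x0
    using many_values[OF x0] card_Diff1_le[of "loop_value b x0 ` loops (side b) x0" "loop_value b x0 []"]
    by (cases "loop_value b x0 [] \<in> loop_value b x0 ` loops (side b) x0") (simp_all add: card_Diff_singleton)
  obtain C l where C: "C \<in> A" "l \<in> L" "C #> ev l \<in> rcosets N - A"
  proof -
    have gen: "generate G (ev ` L) = carrier G"
      using monoid_presentation_generates[OF pres] .
    have "?bd > 0" by (rule boundary_nonempty[OF N finN _ _ gen cut]) (use LR in blast)+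
    then obtain C l where l: "C \<in> rcosets N" "l \<in> L" "(C \<in> A) \<noteq> (C #> ev l \<in> A)"
      by (force simp: card_gt_0_iff boundary_eq)
    show thesis
    proof (cases "C \<in> A")
      case True
      thus thesis using that[of C l] l move_closed by auto
    next
      case False
      have "C #> ev l #> ev (opp_letter l) = C"
        using opp_letter[OF l(2)] ev_closed[OF l(2)] l(1) by (simp add: rcosets_mult_assoc[OF N] rcosets_mult_one[OF N])
      thus thesis using that[of "C #> ev l" "opp_letter l"] l False opp_letter(1)[OF l(2)] by auto
    qed
  qed
  have sC: "C \<in> side True" "C #> ev l \<in> side False" using C by (simp_all add: side_simps)
  obtain B where B: "B \<subseteq> loop_value True C ` loops (side True) C - {loop_value True C []}" "card B = q" "finite B"
    using obtain_subset_with_card_n[of q] nontrivial[OF sC(1)] by (meson add_leD1)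
  obtain \<beta> where \<beta>: "bij_betw \<beta> {..<q} B"
    using ex_bij_betw_nat_finite[OF B(3)] B(2) by (auto simp: atLeast0LessThan)
  have "\<exists>w. w \<in> loops (side True) C \<and> loop_value True C w = \<beta> i" if "i < q" for i
  proof -
    have "\<beta> i \<in> loop_value True C ` loops (side True) C" using bij_betw_apply[OF \<beta>, of i] that B(1) by auto
    thus ?thesis by (force elim: imageE)
  qed
  hence "\<forall>i. \<exists>w. i < q \<longrightarrow> w \<in> loops (side True) C \<and> loop_value True C w = \<beta> i" by blast
  from choice[OF this] obtain u where u: "\<And>i. i < q \<Longrightarrow> u i \<in> loops (side True) C \<and> loop_value True C (u i) = \<beta> i"
    by blast
  have uA: "u i \<in> loops A C" if "i < q" for i using u[OF that] by (simp add: side_simps)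
  have inj: "inj_on (\<lambda>i. loop_value True C (u i)) {..<q}"
    using bij_betw_imp_inj_on[OF \<beta>] u by (auto simp: inj_on_def)
  have nz: "loop_value True C (u i) \<noteq> loop_value True C []" if "i < q" for i
    using u[OF that] bij_betwE[OF \<beta>] that B(1) by auto
  have "loop_value False (C #> ev l) ` loops (side False) (C #> ev l) - {loop_value False (C #> ev l) []} \<noteq> {}"
    using nontrivial[OF sC(2)] by (intro notI) simp
  then obtain m where m: "m \<in> loops (rcosets N - A) (C #> ev l)"
    "loop_value False (C #> ev l) m \<noteq> loop_value False (C #> ev l) []" unfolding side_simps by blast
  show thesis
    by (rule stab_retract[OF C uA inj nz m]) (use stab_p_open that in blast)+
qed

end

section \<open>Retractions from the failure of expansion\<close>

context group
begin

lemma finitely_generated_subgroup: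
  assumes S: "finite S" "S \<subseteq> carrier G" "generate G S = carrier G" and p: "prime p"
    and H: "subgroup H G" "finite (rcosets H)"
  shows "card (fp_homs p (G\<lparr>carrier := H\<rparr>)) = p ^ mod_homology_dim p (G\<lparr>carrier := H\<rparr>)"
    "finite (fp_homs p (G\<lparr>carrier := H\<rparr>))"
proof -
  obtain X where X: "finite X" "X \<subseteq> H" "generate G X = H" using schreier_generate[OF H S] by blast
  have "generate (G\<lparr>carrier := H\<rparr>) X = H" using generate_consistent[OF X(2) H(1)] X(3) by simp
  thus "card (fp_homs p (G\<lparr>carrier := H\<rparr>)) = p ^ mod_homology_dim p (G\<lparr>carrier := H\<rparr>)"
    using card_fp_homs[OF subgroup_imp_group[OF H(1)] p X(1)] X(2) by simp
  show "finite (fp_homs p (G\<lparr>carrier := H\<rparr>))"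
    using group.finite_fp_homs[OF subgroup_imp_group[OF H(1)] p X(1)] X(2) \<open>generate (G\<lparr>carrier := H\<rparr>) X = H\<close> by simp
qed

lemma separating_set:
  assumes S: "finite S" "S \<subseteq> carrier G" "generate G S = carrier G" and p: "prime p"
    and H: "subgroup H G" "finite (rcosets H)"
  obtains X where "finite X" "X \<subseteq> H" "card X \<le> mod_homology_dim p (G\<lparr>carrier := H\<rparr>)"
    "\<And>f. f \<in> fp_homs p (G\<lparr>carrier := H\<rparr>) \<Longrightarrow> (\<forall>x\<in>X. f x = 0) \<Longrightarrow> (\<forall>x\<in>H. f x = 0)"
proof -
  interpret H: group "G\<lparr>carrier := H\<rparr>" using subgroup_imp_group[OF H(1)] .
  note fg = finitely_generated_subgroup[OF S p H]
  obtain X where X: "finite X" "X \<subseteq> H" "p ^ card X \<le> card (fp_homs p (G\<lparr>carrier := H\<rparr>))"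
    "\<And>f. f \<in> fp_homs p (G\<lparr>carrier := H\<rparr>) \<Longrightarrow> (\<forall>x\<in>X. f x = 0) \<Longrightarrow> (\<forall>x\<in>H. f x = 0)"
    using H.fp_homs_separating[OF p fg(2)] by auto
  have "card X \<le> mod_homology_dim p (G\<lparr>carrier := H\<rparr>)"
    using X(3) fg(1) prime_gt_1_nat[OF p] by simp
  thus thesis using that X by blast
qed

text \<open>Written with d for the dimension, this is d(N) - 1 \<le> m (d(H) - 1), arranged to avoid
  truncated subtraction; it follows from \<open>homs_index_bound\<close> for a separating set with
  at most d(H) elements.\<close>

lemma homology_dim_index_bound:
  assumes S: "finite S" "S \<subseteq> carrier G" "generate G S = carrier G" and p: "prime p"
    and H: "subgroup H G" "finite (rcosets H)" and N: "p_open p (G\<lparr>carrier := H\<rparr>) N"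
  shows "mod_homology_dim p (G\<lparr>carrier := N\<rparr>) + card (rcosets\<^bsub>G\<lparr>carrier := H\<rparr>\<^esub> N)
    \<le> card (rcosets\<^bsub>G\<lparr>carrier := H\<rparr>\<^esub> N) * mod_homology_dim p (G\<lparr>carrier := H\<rparr>) + 1"
proof -
  interpret H: group "G\<lparr>carrier := H\<rparr>" using subgroup_imp_group[OF H(1)] .
  let ?m = "card (rcosets\<^bsub>G\<lparr>carrier := H\<rparr>\<^esub> N)" and ?d = "mod_homology_dim p (G\<lparr>carrier := N\<rparr>)"
  have Ns: "subgroup N (G\<lparr>carrier := H\<rparr>)" and fN: "finite (rcosets\<^bsub>G\<lparr>carrier := H\<rparr>\<^esub> N)"
    using N by (auto simp: p_open_def)
  have NG: "subgroup N G" "N \<subseteq> H" using incl_subgroup[OF H(1) Ns] subgroup.subset[OF Ns] by auto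
  have finN: "finite (rcosets N)" using finite_index_iff[OF H(1) NG] fN H(2) by blast
  obtain X where X: "finite X" "X \<subseteq> H" "card X \<le> mod_homology_dim p (G\<lparr>carrier := H\<rparr>)"
    "\<And>f. f \<in> fp_homs p (G\<lparr>carrier := H\<rparr>) \<Longrightarrow> (\<forall>x\<in>X. f x = 0) \<Longrightarrow> (\<forall>x\<in>H. f x = 0)"
    using separating_set[OF S p H] by blast
  have c: "carrier (G\<lparr>carrier := H\<rparr>) = H" by simp
  have "card (fp_homs p (G\<lparr>carrier := N\<rparr>)) * p ^ (?m - 1) \<le> p ^ (?m * card X)"
  proof -
    note * = H.homs_index_bound[OF p N X(1), unfolded c, OF X(2,4)]
    show ?thesis using * by simp
  qed
  hence "p ^ (?d + (?m - 1)) \<le> p ^ (?m * card X)"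
    unfolding finitely_generated_subgroup(1)[OF S p NG(1) finN] by (simp add: power_add)
  hence "?d + (?m - 1) \<le> ?m * card X" using prime_gt_1_nat[OF p] by simp
  also have "\<dots> \<le> ?m * mod_homology_dim p (G\<lparr>carrier := H\<rparr>)" using X(3) by simp
  finally show ?thesis by linarith
qed

text \<open>The cosets of \<open>N\<close> are covered by translates of those inside
  \<open>H\<close>, one translate for each coset of \<open>H\<close>. Moving a point of
  \<open>A\<close> back into \<open>H\<close> leaves it in \<open>A\<close> unless it is displaced,
  and \<open>displaced_bound\<close> controls the displaced points uniformly in \<open>N\<close> and
  \<open>A\<close>.\<close>

lemma block_intersection_bound:
  assumes S: "finite S" "S \<subseteq> carrier G" "generate G S = carrier G" and H: "subgroup H G" "finite (rcosets H)"
  obtains k where "\<And>N A. subgroup N G \<Longrightarrow> N \<subseteq> H \<Longrightarrow> finite (rcosets N) \<Longrightarrow> A \<subseteq> rcosets N \<Longrightarrow>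
    card A \<le> card (rcosets H) * card (A \<inter> (rcosets\<^bsub>G\<lparr>carrier := H\<rparr>\<^esub> N)) + k * card (boundary N S A)"
proof -
  let ?t = "transversal H"
  have t: "?t D \<in> carrier G" "H #> ?t D = D" if "D \<in> rcosets H" for D using transversal[OF H(1) that] by auto
  have "\<exists>k. \<forall>N A. subgroup N G \<longrightarrow> finite (rcosets N) \<longrightarrow> card (displaced N A (inv (?t D))) \<le> k * card (boundary N S A)"
    if "D \<in> rcosets H" for D using displaced_bound[OF S(1,2)] S(3) t(1)[OF that] by simp
  then obtain k where k: "\<And>D N A. D \<in> rcosets H \<Longrightarrow> subgroup N G \<Longrightarrow> finite (rcosets N) \<Longrightarrow>
      card (displaced N A (inv (?t D))) \<le> k D * card (boundary N S A)" by metis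
  show thesis
  proof (rule that[of "\<Sum>D\<in>rcosets H. k D"])
    fix N A assume N: "subgroup N G" "N \<subseteq> H" "finite (rcosets N)" and A: "A \<subseteq> rcosets N"
    let ?Y = "rcosets\<^bsub>G\<lparr>carrier := H\<rparr>\<^esub> N"
    have finA: "finite A" using A N(3) finite_subset by blast
    have "A \<subseteq> (\<Union>D\<in>rcosets H. {C\<in>A. C #> inv (?t D) \<in> ?Y})"
    proof
      fix C assume C: "C \<in> A"
      hence "C \<in> rcosets N" using A by blast
      then obtain g where g: "g \<in> carrier G" "C = N #> g" by (rule rcosets_obtain)
      have D: "H #> g \<in> rcosets H" using rcosetsI[OF subgroup.subset[OF H(1)] g(1)] .
      have "g \<otimes> inv (?t (H #> g)) \<in> H" using rcos_eq_iff[OF H(1) g(1) t(1)[OF D]] t(2)[OF D] by simp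
      hence "C #> inv (?t (H #> g)) \<in> ?Y"
        using g t(1)[OF D] subgroup.subset[OF N(1)] by (simp add: rcosets_subgroup coset_mult_assoc)
      thus "C \<in> (\<Union>D\<in>rcosets H. {C\<in>A. C #> inv (?t D) \<in> ?Y})" using C D by blast
    qed
    hence "card A \<le> card (\<Union>D\<in>rcosets H. {C\<in>A. C #> inv (?t D) \<in> ?Y})"
      using finA H(2) by (intro card_mono) auto
    also have "\<dots> \<le> (\<Sum>D\<in>rcosets H. card {C\<in>A. C #> inv (?t D) \<in> ?Y})" by (rule card_UN_le[OF H(2)])
    also have "\<dots> \<le> (\<Sum>D\<in>rcosets H. card (A \<inter> ?Y) + k D * card (boundary N S A))"
    proof (rule sum_mono)
      fix D assume D: "D \<in> rcosets H"
      let ?B = "{C\<in>A. C #> inv (?t D) \<in> A \<inter> ?Y}"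
      have "{C\<in>A. C #> inv (?t D) \<in> ?Y} \<subseteq> ?B \<union> displaced N A (inv (?t D))" using A by (auto simp: displaced_def)
      moreover have "finite (?B \<union> displaced N A (inv (?t D)))" using finA N(3) by (simp add: displaced_def)
      ultimately have "card {C\<in>A. C #> inv (?t D) \<in> ?Y} \<le> card (?B \<union> displaced N A (inv (?t D)))" by (meson card_mono)
      also have "\<dots> \<le> card ?B + card (displaced N A (inv (?t D)))" by (rule card_Un_le)
      also have "card ?B \<le> card (A \<inter> ?Y)"
      proof (rule card_inj_on_le)
        have "?B \<subseteq> rcosets N" using A by blast
        thus "inj_on (\<lambda>C. C #> inv (?t D)) ?B"
          using rcosets_mult_bij[OF N(1) inv_closed[OF t(1)[OF D]]] by (meson bij_betw_imp_inj_on inj_on_subset)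
      qed (use finA in auto)
      finally show "card {C\<in>A. C #> inv (?t D) \<in> ?Y} \<le> card (A \<inter> ?Y) + k D * card (boundary N S A)"
        using k[OF D N(1,3), of A] by linarith
    qed
    also have "\<dots> = card (rcosets H) * card (A \<inter> ?Y) + (\<Sum>D\<in>rcosets H. k D) * card (boundary N S A)"
      by (simp add: sum.distrib sum_distrib_right)
    finally show "card A \<le> card (rcosets H) * card (A \<inter> ?Y) + (\<Sum>D\<in>rcosets H. k D) * card (boundary N S A)" .
  qed
qed

end

section \<open>Choice of the level and the numerical estimate\<close>

lemma nonincreasing_almost_limit:
  fixes a :: "nat \<Rightarrow> real"
  assumes mono: "\<And>i j. i \<le> j \<Longrightarrow> a j \<le> a i" and c: "c > 0" "\<And>i. c \<le> a i" and \<delta>: "0 < \<delta>" "\<delta> < 1"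
  obtains i where "i0 \<le> i" "\<And>j. (1 - \<delta>) * a i \<le> a j"
proof -
  let ?I = "INF i. a i"
  have bdd: "bdd_below (range a)" by (rule bdd_belowI2[of _ c]) (rule c(2))
  have I: "?I \<le> a j" for j by (rule cINF_lower[OF bdd]) simp
  have "c \<le> ?I" by (rule cINF_greatest) (use c(2) in auto)
  hence "?I * (1 - \<delta>) < ?I * 1" using c(1) \<delta> by (intro mult_strict_left_mono) auto
  hence "?I < ?I / (1 - \<delta>)" using \<delta> by (simp add: pos_less_divide_eq)
  then obtain i where "a i < ?I / (1 - \<delta>)" using cINF_less_iff[OF _ bdd] by blast
  hence "(1 - \<delta>) * a i \<le> ?I" using \<delta> by (simp add: pos_less_divide_eq mult.commute)
  moreover have "(1 - \<delta>) * a (max i i0) \<le> (1 - \<delta>) * a i" using mono[of i "max i i0"] \<delta> by simp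
  ultimately have "(1 - \<delta>) * a (max i i0) \<le> a j" for j using I[of j] by linarith
  thus thesis using that[of "max i i0"] by simp
qed

context group
begin

text \<open>If the indices were bounded, the sequence would be constant from a term of largest index
  on.\<close>

lemma nested_index_unbounded:
  assumes K: "\<And>i. subgroup (K i) G" "\<And>i. finite (rcosets (K i))" "\<And>i. K (Suc i) \<subseteq> K i" and inf: "infinite (range K)"
  shows "\<exists>i. b \<le> card (rcosets (K i))"
proof (rule ccontr)
  assume "\<not> ?thesis"
  hence b: "card (rcosets (K i)) < b" for i by (simp add: not_le)
  have anti: "K j \<subseteq> K i" if "i \<le> j" for i j using lift_Suc_antimono_le[of K] K(3) that by blast
  obtain i where i: "\<And>j. card (rcosets (K j)) \<le> card (rcosets (K i))"
    using ex_has_greatest_nat[of "\<lambda>_. True" 0 "\<lambda>i. card (rcosets (K i))" b] b by auto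
  have same: "K j = K i" if "i \<le> j" for j
  proof -
    note sub = subgroup_incl[OF K(1)[of j] K(1)[of i] anti[OF that]]
    let ?m = "card (rcosets\<^bsub>G\<lparr>carrier := K i\<rparr>\<^esub> (K j))"
    have "card (rcosets (K j)) = ?m * card (rcosets (K i))" by (rule index_mult[OF K(1,1) anti[OF that]])
    moreover have "0 < card (rcosets (K j))" "0 < card (rcosets (K i))" using index_pos K by auto
    moreover note i[of j]
    ultimately have m: "?m = 1" by (cases ?m) auto
    have "K j #> h = K j" if h: "h \<in> K i" for h
    proof -
      have "K j #> h \<in> rcosets\<^bsub>G\<lparr>carrier := K i\<rparr>\<^esub> (K j)" "K j \<in> rcosets\<^bsub>G\<lparr>carrier := K i\<rparr>\<^esub> (K j)"
        using h group.self_in_rcosets[OF subgroup_imp_group[OF K(1)] sub] by (auto simp: rcosets_subgroup)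
      moreover obtain z where "rcosets\<^bsub>G\<lparr>carrier := K i\<rparr>\<^esub> (K j) = {z}" using card_1_singletonE[OF m] by blast
      ultimately show ?thesis by simp
    qed
    moreover have "h \<in> K j #> h" if "h \<in> K i" for h
      by (rule rcos_self[OF subgroup.mem_carrier[OF K(1) that] K(1)])
    ultimately have "K i \<subseteq> K j" by auto
    thus ?thesis using anti[OF that] by (rule equalityI[rotated])
  qed
  hence "K j \<in> K ` {..i}" for j
  proof (cases "i \<le> j")
    case True
    show ?thesis by (rule image_eqI[where x = i]) (simp_all add: same[OF True])
  qed simp
  hence "range K \<subseteq> K ` {..i}" by (rule image_subsetI)
  thus False using inf finite_subset by blast
qed

end

text \<open>Put \<open>r = 1 / (8 * real p)\<close>. The left side is at most
  \<open>m d - 2 r m d + m + q + 1\<close>, while \<open>dN\<close> is at least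
  \<open>m d - r m d - m + 1\<close>. So \<open>q + 2 m < r m d\<close> is wanted, and the bound on
  \<open>d\<close> gives \<open>q + 3 m \<le> r m d\<close>.\<close>

lemma cut_numerics:
  fixes p m d q V \<kappa> \<beta> dN yQ :: nat and e :: real
  assumes p: "p > 0" and m: "m \<ge> 1" and d: "8 * p * (q + 3) \<le> d"
    and dN: "(1 - 1 / (8 * real p)) * (real m * (real d - 1)) \<le> real dN - 1"
    and \<beta>: "(real \<kappa> + 1) * real \<beta> \<le> real m" and yQ: "real yQ \<le> real m * (1 - 1 / (4 * real p))"
    and x: "x \<le> d"
  shows "\<kappa> * \<beta> + (q + 1 + \<beta> + yQ * x) < dN"
proof -
  define r where "r = 1 / (8 * real p)"
  have r: "0 \<le> r" "r \<le> 1" using p by (auto simp: r_def field_simps)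
  note dN = dN[folded r_def]
  have "real yQ * real x \<le> real m * (1 - 1 / (4 * real p)) * real d"
    using yQ x by (intro mult_mono) (auto intro: order_trans[of _ "real yQ"])
  also have "\<dots> = real m * real d - 2 * r * (real m * real d)" by (simp add: r_def field_simps)
  finally have 1: "real yQ * real x \<le> real m * real d - 2 * r * (real m * real d)" .
  have "(1 - r) * (real m * (real d - 1)) = real m * real d - r * (real m * real d) - real m + r * real m"
    by (simp add: algebra_simps)
  moreover have "0 \<le> r * real m" using r by simp
  ultimately have 2: "real m * real d - r * (real m * real d) - real m + 1 \<le> real dN" using dN by linarith
  have "real (8 * p * (q + 3)) \<le> real d" using d of_nat_le_iff by blast
  hence "real q + 3 \<le> r * real d" using p by (simp add: r_def field_simps)
  hence "real m * (real q + 3) \<le> real m * (r * real d)" by (intro mult_left_mono) auto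
  hence 3: "real m * (real q + 3) \<le> r * (real m * real d)" by (simp only: mult_ac)
  have "1 * real q \<le> real m * real q" using m by (intro mult_right_mono) auto
  hence 4: "real q + 3 * real m \<le> real m * (real q + 3)" by (simp add: algebra_simps)
  have "real (\<kappa> * \<beta> + (q + 1 + \<beta> + yQ * x)) = (real \<kappa> + 1) * real \<beta> + real q + 1 + real yQ * real x"
    by (simp add: algebra_simps)
  also have "\<dots> < real dN" using 1 2 3 4 \<beta> m by linarith
  finally show ?thesis unfolding of_nat_less_iff .
qed

context group
begin

text \<open>\<open>homology_dim_index_bound\<close> divided by the index of \<open>N\<close>: a
  nonincreasing ratio along chains, whose infimum is a mod \<open>p\<close> homology
  gradient.\<close>

lemma homology_dim_ratio:
  assumes S: "finite S" "S \<subseteq> carrier G" "generate G S = carrier G" and p: "prime p"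
    and H: "p_open p G H" and N: "p_open p G N" and sub: "N \<subseteq> H"
  shows "(real (mod_homology_dim p (G\<lparr>carrier := N\<rparr>)) - 1) / real (card (rcosets N))
    \<le> (real (mod_homology_dim p (G\<lparr>carrier := H\<rparr>)) - 1) / real (card (rcosets H))"
proof -
  let ?m = "card (rcosets\<^bsub>G\<lparr>carrier := H\<rparr>\<^esub> N)" and ?V = "card (rcosets H)"
  let ?d = "\<lambda>N. real (mod_homology_dim p (G\<lparr>carrier := N\<rparr>))"
  have Hs: "subgroup H G" "finite (rcosets H)" and Ns: "subgroup N G" "finite (rcosets N)"
    using H N by (auto simp: p_open_def)
  have NH: "p_open p (G\<lparr>carrier := H\<rparr>) N" by (rule p_open_between(2)[OF N Hs(1) sub])
  have VN: "card (rcosets N) = ?m * ?V" by (rule index_mult[OF Hs(1) Ns(1) sub])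
  have pos: "real ?m > 0" "real ?V > 0" using index_pos[OF Ns] VN by (auto intro: Nat.gr0I)
  have "mod_homology_dim p (G\<lparr>carrier := N\<rparr>) + ?m \<le> ?m * mod_homology_dim p (G\<lparr>carrier := H\<rparr>) + 1"
    by (rule homology_dim_index_bound[OF S p Hs NH])
  hence "?d N + real ?m \<le> real ?m * ?d H + 1" by (metis of_nat_1 of_nat_add of_nat_le_iff of_nat_mult)
  hence "?d N - 1 \<le> real ?m * (?d H - 1)" by (simp add: algebra_simps)
  hence "(?d N - 1) / (real ?m * real ?V) \<le> (real ?m * (?d H - 1)) / (real ?m * real ?V)"
    using pos by (intro divide_right_mono) auto
  thus ?thesis using pos by (simp add: VN)
qed

text \<open>The order of the choices is essential. A term \<open>H\<close> with almost minimal ratio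
  comes first, then a separating set of \<open>H\<close> with words for its elements, then
  \<open>e\<close>, depending on the lengths of these words, and only then a term further down the
  sequence whose graph fails to expand by \<open>e\<close>.\<close>

theorem retracting_subgroup:
  assumes pres: "monoid_presentation G L ev Rel" and p: "prime p"
    and K: "\<And>i. p_open p G (K i)" "\<And>i. K (Suc i) \<subseteq> K i" "infinite (range K)"
    and c: "c > 0" "\<And>i. c * real (card (rcosets (K i))) \<le> real (mod_homology_dim p (G\<lparr>carrier := K i\<rparr>))"
    and no: "\<And>e. e > 0 \<Longrightarrow> \<exists>j. \<not> expands G (K j) (ev ` L) e"
  obtains J and k :: "nat \<Rightarrow> 'a" where "p_open p G J" "\<And>i. i < q \<Longrightarrow> k i \<in> J"
    "\<And>(T :: 'c monoid) g. group T \<Longrightarrow> (\<And>i. i < q \<Longrightarrow> g i \<in> carrier T) \<Longrightarrow>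
       \<exists>\<omega>\<in>hom (G\<lparr>carrier := J\<rparr>) T. \<forall>i<q. \<omega> (k i) = g i"
proof -
  let ?S = "ev ` L"
  have LR: "finite L" "finite Rel" "Rel \<subseteq> lists L" "ev \<in> L \<rightarrow> carrier G"
    using pres by (auto simp: monoid_presentation_def)
  have S: "finite ?S" "?S \<subseteq> carrier G" "generate G ?S = carrier G"
    using LR monoid_presentation_generates[OF pres] by auto
  have p0: "p > 0" using prime_gt_0_nat[OF p] .
  have Ks: "subgroup (K i) G" "finite (rcosets (K i))" for i using K(1) by (auto simp: p_open_def)
  have anti: "K j \<subseteq> K i" if "i \<le> j" for i j using lift_Suc_antimono_le[of K] K(2) that by blast
  let ?V = "\<lambda>H. real (card (rcosets H))" and ?d = "\<lambda>H. mod_homology_dim p (G\<lparr>carrier := H\<rparr>)"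
  define a where "a H = (real (?d H) - 1) / ?V H" for H
  have Vpos: "?V H > 0" if "p_open p G H" for H using index_pos that by (simp add: p_open_def)
  have mono: "a N \<le> a H" if "p_open p G H" "p_open p G N" "N \<subseteq> H" for H N
    unfolding a_def by (rule homology_dim_ratio[OF S p that])
  have unbounded: "\<exists>i. b \<le> card (rcosets (K i))" for b
    using nested_index_unbounded[OF Ks K(2,3)] .
  \<comment> \<open>The hypothesis bounds d / V, where d is the dimension and V the index. The bound
    passes to (d - 1) / V because this is nonincreasing and the difference 1 / V becomes arbitrarily
    small along the sequence.\<close>
  have low: "c \<le> a (K i)" for i
  proof (rule ccontr)
    assume "\<not> ?thesis"
    hence gap: "c - a (K i) > 0" by simp
    obtain b :: nat where b: "1 / (c - a (K i)) < real b" using reals_Archimedean2 by blast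
    obtain j where j: "b \<le> card (rcosets (K j))" using unbounded by blast
    let ?K = "K (max i j)"
    have "real (card (rcosets (K j))) \<le> ?V ?K"
      using index_mult[OF Ks(1)[of j] Ks(1)[of "max i j"] anti[of j "max i j"]] index_pos[OF Ks]
      by (metis Suc_leI gr_zeroI max.cobounded2 mult_is_0 mult_le_mono1 nat_mult_1 not_less_zero of_nat_mono One_nat_def)
    hence V: "1 / (c - a (K i)) < ?V ?K" using b j by linarith
    hence "1 < ?V ?K * (c - a (K i))" using gap by (simp add: pos_divide_less_eq)
    moreover have "a ?K \<le> a (K i)" by (rule mono[OF K(1) K(1) anti]) simp
    hence "?V ?K * a ?K \<le> ?V ?K * a (K i)" by (intro mult_left_mono) auto
    moreover have "?V ?K * a ?K = real (?d ?K) - 1" using Vpos[OF K(1)[of "max i j"]] by (simp add: a_def)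
    moreover have "c * ?V ?K \<le> real (?d ?K)" by (rule c(2))
    ultimately show False by (simp add: algebra_simps)
  qed
  \<comment> \<open>An index this large forces the lower bound on the dimension that
    \<open>cut_numerics\<close> asks for.\<close>
  obtain b :: nat where b: "real (8 * p * (q + 3)) / c < real b" using reals_Archimedean2 by blast
  obtain i0 where i0: "b \<le> card (rcosets (K i0))" using unbounded by blast
  have \<delta>: "0 < 1 / (8 * real p)" "1 / (8 * real p) < 1" using p0 by (auto simp: field_simps)
  have a_mono: "a (K j) \<le> a (K i)" if "i \<le> j" for i j by (rule mono[OF K(1) K(1) anti[OF that]])
  obtain i where i: "i0 \<le> i" "\<And>j. (1 - 1 / (8 * real p)) * a (K i) \<le> a (K j)"
    using nonincreasing_almost_limit[of "\<lambda>i. a (K i)" c "1 / (8 * real p)" i0, OF a_mono c(1) low \<delta>] by blast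
  define H where "H = K i"
  have Ho: "p_open p G H" and Hs: "subgroup H G" "finite (rcosets H)" using K(1) Ks by (auto simp: H_def)
  have dH: "8 * p * (q + 3) \<le> ?d H"
  proof -
    have "card (rcosets (K i0)) \<le> card (rcosets H)"
      using index_mult[OF Ks(1) Hs(1), of i0] anti[OF i(1)] index_pos[OF Hs] unfolding H_def
      by (metis Suc_leI gr_zeroI mult_is_0 mult_le_mono1 nat_mult_1 not_less_zero One_nat_def)
    hence "real b \<le> ?V H" using i0 by linarith
    hence "real (8 * p * (q + 3)) / c < ?V H" using b by linarith
    hence "real (8 * p * (q + 3)) < c * ?V H" using c(1) by (simp add: pos_divide_less_eq mult.commute)
    thus ?thesis using c(2)[of i] unfolding H_def by linarith
  qed
  obtain X where X: "finite X" "X \<subseteq> H" "card X \<le> ?d H"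
    "\<And>f. f \<in> fp_homs p (G\<lparr>carrier := H\<rparr>) \<Longrightarrow> (\<forall>x\<in>X. f x = 0) \<Longrightarrow> (\<forall>x\<in>H. f x = 0)"
    using separating_set[OF S p Hs] by blast
  have "\<forall>x\<in>X. \<exists>w. w \<in> lists L \<and> word_val G ev w = x"
    using pres X(2) subgroup.mem_carrier[OF Hs(1)] unfolding monoid_presentation_def by blast
  then obtain wx where wx: "\<And>x. x \<in> X \<Longrightarrow> wx x \<in> lists L \<and> word_val G ev (wx x) = x" by metis
  define W where "W = Rel \<union> (\<lambda>l. [l]) ` L \<union> wx ` X"
  define \<kappa> where "\<kappa> = (\<Sum>w\<in>W. (length w)\<^sup>2)"
  obtain \<tau> where \<tau>: "\<And>N A. subgroup N G \<Longrightarrow> N \<subseteq> H \<Longrightarrow> finite (rcosets N) \<Longrightarrow> A \<subseteq> rcosets N \<Longrightarrow>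
    card A \<le> card (rcosets H) * card (A \<inter> (rcosets\<^bsub>G\<lparr>carrier := H\<rparr>\<^esub> N)) + \<tau> * card (boundary N ?S A)"
    using block_intersection_bound[OF S Hs] by blast
  have "\<exists>e>0. expands G (K j) ?S e" for j by (rule expands_positive[OF Ks S])
  then obtain \<epsilon> where \<epsilon>: "\<And>j. \<epsilon> j > 0 \<and> expands G (K j) ?S (\<epsilon> j)" by metis
  \<comment> \<open>The first two entries keep the number of cut edges small against the word
    lengths in \<open>\<kappa>\<close> and the constant \<open>\<tau>\<close>. The entries
    \<open>\<epsilon>\<close> up to \<open>i\<close> let \<open>H\<close> expand by \<open>e\<close>
    and force the failing term to lie below \<open>H\<close>.\<close>
  define e where "e = Min (insert (1 / ((real \<kappa> + 1) * ?V H)) (insert (1 / (4 * real p * (real \<tau> + 1))) (\<epsilon> ` {..i})))"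
  have e0: "e > 0" unfolding e_def using \<epsilon> Vpos[OF Ho] p0 by (subst Min_gr_iff) (auto intro!: add_nonneg_pos)
  have e1: "e \<le> 1 / ((real \<kappa> + 1) * ?V H)" and e2: "e \<le> 1 / (4 * real p * (real \<tau> + 1))"
    unfolding e_def by (rule Min_le; simp)+
  have e3: "e \<le> \<epsilon> j" if "j \<le> i" for j unfolding e_def by (rule Min_le) (use that in auto)
  obtain j where j: "\<not> expands G (K j) ?S e" using no[OF e0] by blast
  have ij: "i \<le> j"
  proof (rule ccontr)
    assume "\<not> i \<le> j"
    hence "expands G (K j) ?S e" using expands_mono \<epsilon> e3[of j] by (meson nle_le)
    thus False using j by blast
  qed
  have KH: "p_open p (G\<lparr>carrier := H\<rparr>) (K j)"
    by (rule p_open_between(2)[OF K(1) Hs(1)]) (use anti[OF ij] in \<open>simp add: H_def\<close>)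
  have "expands G H ?S e" unfolding H_def using expands_mono \<epsilon> e3[of i] by blast
  \<comment> \<open>Expansion by \<open>e\<close> holds at \<open>H\<close> and fails at
    \<open>K j\<close>, so it is lost in a single step of index \<open>p\<close>, from
    \<open>M\<close> to \<open>N\<close>.\<close>
  from p_open_chain[OF is_group p Hs(1) KH, of "\<lambda>M. expands G M ?S e", OF this j]
  obtain M N where MN: "subgroup M G" "subgroup N G" "K j \<subseteq> N" "N \<subseteq> M" "M \<subseteq> H"
    "card (rcosets\<^bsub>G\<lparr>carrier := M\<rparr>\<^esub> N) = p" "expands G M ?S e" "\<not> expands G N ?S e" by blast
  have NH: "N \<subseteq> H" using MN(4,5) by blast
  have No: "p_open p G N" by (rule p_open_between(1)[OF K(1) MN(2,3)])
  have finN: "finite (rcosets N)" using No by (simp add: p_open_def)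
  have NHo: "p_open p (G\<lparr>carrier := H\<rparr>) N" by (rule p_open_between(2)[OF No Hs(1) NH])
  obtain A where A: "A \<subseteq> rcosets N" "0 < card A" "2 * card A \<le> card (rcosets N)"
    "real (card (boundary N ?S A)) < e * real (card A)"
    and con: "coset_connected ?S A" "coset_connected ?S (rcosets N - A)"
    using connected_small_boundary[OF MN(2) finN S MN(8)] by blast
  \<comment> \<open>Since \<open>M\<close> still expands, \<open>A\<close> contains more than a
    fraction 1 / (2 p) of all cosets of \<open>N\<close>; its complement contains at least half of
    them.\<close>
  have big: "card (rcosets M) < 2 * card A"
    by (rule sparse_projection_boundary[OF MN(1,2,4) finN S(1,2) MN(7) A(1,4)])
  let ?Y = "rcosets\<^bsub>G\<lparr>carrier := H\<rparr>\<^esub> N" and ?bd = "card (boundary N ?S A)"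
  define m where "m = card ?Y"
  have VN: "card (rcosets N) = m * card (rcosets H)" unfolding m_def by (rule index_mult[OF Hs(1) MN(2) NH])
  have VNM: "card (rcosets N) = p * card (rcosets M)" using index_mult[OF MN(1,2,4)] MN(6) by simp
  have m1: "m \<ge> 1" using index_pos[OF MN(2) finN] VN by (cases m) auto
  have finY: "finite ?Y" using NHo by (simp add: p_open_def)
  have YV: "?Y \<subseteq> rcosets N" using subgroup.mem_carrier[OF Hs(1)] subgroup.subset[OF MN(2)]
    by (auto simp: rcosets_subgroup intro!: rcosetsI)
  have cA: "card A \<le> card (rcosets N)" using A(3) by simp
  have bd: "real ?bd \<le> e * (real m * ?V H)"
  proof -
    have "real ?bd \<le> e * real (card A)" using A(4) by simp
    also have "\<dots> \<le> e * real (card (rcosets N))" using e0 cA by (intro mult_left_mono) auto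
    finally show ?thesis by (simp add: VN)
  qed
  have cancel: "x * (1 / (x * v) * (y * v)) = y" "x * (1 / (4 * v * x) * y) = y / (4 * v)" if "x > 0" "v > 0" for x v y :: real
    using that by simp_all
  have b1: "(real \<kappa> + 1) * real ?bd \<le> real m"
  proof -
    have "(real \<kappa> + 1) * real ?bd \<le> (real \<kappa> + 1) * (1 / ((real \<kappa> + 1) * ?V H) * (real m * ?V H))"
      using bd e1 by (intro mult_left_mono order_trans[OF bd] mult_right_mono) auto
    also have "\<dots> = real m" by (rule cancel(1)) (use Vpos[OF Ho] in auto)
    finally show ?thesis .
  qed
  have b2: "real \<tau> * real ?bd \<le> real m * ?V H / (4 * real p)"
  proof -
    have "real \<tau> * real ?bd \<le> (real \<tau> + 1) * (1 / (4 * real p * (real \<tau> + 1)) * (real m * ?V H))"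
      using bd e2 by (intro mult_mono order_trans[OF bd] mult_right_mono) auto
    also have "\<dots> = real m * ?V H / (4 * real p)" by (rule cancel(2)) (use p0 in auto)
    finally show ?thesis .
  qed
  \<comment> \<open>The fraction 1 / (2 p) passes from the whole graph to the cosets inside
    \<open>H\<close>, where half of it may be lost to the term with \<open>\<tau>\<close>.\<close>
  have inter: "real (card (P \<inter> ?Y)) \<ge> real m / (4 * real p)" if P: "P \<in> {A, rcosets N - A}" for P
  proof -
    have Psub: "P \<subseteq> rcosets N" and bdP: "boundary N ?S P = boundary N ?S A"
      using P A(1) boundary_compl[OF MN(2) S(2) A(1)] by auto
    have "card (rcosets N) \<le> p * (2 * card P)"
    proof (cases "P = A")
      case True thus ?thesis using big VNM by simp
    next
      case False
      hence "card P = card (rcosets N) - card A" using P A(1) finN by (simp add: card_Diff_subset finite_subset)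
      hence "card (rcosets N) \<le> 2 * card P" using A(3) by simp
      also have "\<dots> \<le> p * (2 * card P)" using p0 by simp
      finally show ?thesis .
    qed
    also have "\<dots> \<le> p * (2 * (card (rcosets H) * card (P \<inter> ?Y) + \<tau> * ?bd))"
      using \<tau>[OF MN(2) NH finN Psub] bdP by simp
    finally have "real (m * card (rcosets H)) \<le> real (p * (2 * (card (rcosets H) * card (P \<inter> ?Y) + \<tau> * ?bd)))"
      unfolding VN of_nat_le_iff .
    hence "real m * ?V H \<le> real p * (2 * (?V H * real (card (P \<inter> ?Y)) + real \<tau> * real ?bd))" by simp
    also have "\<dots> \<le> real p * (2 * (?V H * real (card (P \<inter> ?Y)) + real m * ?V H / (4 * real p)))"
      using b2 by (intro mult_left_mono add_left_mono) auto
    also have "\<dots> = ?V H * (2 * real p * real (card (P \<inter> ?Y)) + real m / 2)" using p0 by (simp add: field_simps)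
    finally have "?V H * real m \<le> ?V H * (2 * real p * real (card (P \<inter> ?Y)) + real m / 2)" by (simp add: mult.commute)
    hence "real m \<le> 2 * real p * real (card (P \<inter> ?Y)) + real m / 2" using Vpos[OF Ho] by simp
    thus ?thesis using p0 by (simp add: field_simps)
  qed
  have dN: "(1 - 1 / (8 * real p)) * (real m * (real (?d H) - 1)) \<le> real (?d N) - 1"
  proof -
    have "(1 - 1 / (8 * real p)) * a H \<le> a N"
      using i(2)[of j] mono[OF No K(1) MN(3)] unfolding H_def by linarith
    hence "(real m * ?V H) * ((1 - 1 / (8 * real p)) * a H) \<le> (real m * ?V H) * a N" by (intro mult_left_mono) auto
    moreover have "(real m * ?V H) * a N = real (?d N) - 1" using Vpos[OF Ho] m1 by (simp add: a_def VN)
    moreover have "(real m * ?V H) * ((1 - 1 / (8 * real p)) * a H) = (1 - 1 / (8 * real p)) * (real m * (?V H * a H))"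
      by (simp only: mult_ac)
    moreover have "?V H * a H = real (?d H) - 1" using Vpos[OF Ho] by (simp add: a_def)
    ultimately show ?thesis by simp
  qed
  note fgN = finitely_generated_subgroup[OF S p MN(2) finN]
  have many: "p ^ ((\<Sum>w\<in>W. (length w)\<^sup>2) * ?bd + (q + 1 + ?bd + card (Q \<inter> ?Y) * card X)) < card (fp_homs p (G\<lparr>carrier := N\<rparr>))"
    if Q: "Q \<in> {A, rcosets N - A}" for Q
  proof -
    \<comment> \<open>The share of the side opposite to \<open>Q\<close> is what keeps the share of
      \<open>Q\<close> below \<open>1 - 1 / (4 * real p)\<close>.\<close>
    let ?P = "rcosets N - Q"
    have P: "?P \<in> {A, rcosets N - A}" using Q A(1) by auto
    have "?Y = (Q \<inter> ?Y) \<union> (?P \<inter> ?Y)" using YV by blast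
    hence "m = card (Q \<inter> ?Y) + card (?P \<inter> ?Y)"
      unfolding m_def using finY by (metis card_Un_disjoint Diff_disjoint Int_Diff_disjoint finite_Int inf_assoc inf_bot_left inf_commute)
    hence "real m = real (card (Q \<inter> ?Y)) + real (card (?P \<inter> ?Y))" by linarith
    moreover have "real m * (1 - 1 / (4 * real p)) = real m - real m / (4 * real p)" by (simp add: right_diff_distrib)
    ultimately have "real (card (Q \<inter> ?Y)) \<le> real m * (1 - 1 / (4 * real p))" using inter[OF P] by linarith
    from cut_numerics[OF p0 m1 dH dN b1 this X(3)]
    show ?thesis unfolding fgN(1) \<kappa>_def[symmetric] using prime_gt_1_nat[OF p] by (intro power_strict_increasing) auto
  qed
  have ne: "A \<noteq> {}" "A \<noteq> rcosets N" using A(2,3) index_pos[OF MN(2) finN] by auto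
  show thesis
  proof (rule cut_retract[OF pres p MN(2) finN fgN(2) Hs(1) NH NHo X(1,2,4) wx W_def A(1) ne con many])
    fix J and k :: "nat \<Rightarrow> 'a"
    assume J: "p_open p (G\<lparr>carrier := N\<rparr>) J" "\<And>i. i < q \<Longrightarrow> k i \<in> J"
      "\<And>(T :: 'c monoid) g. group T \<Longrightarrow> (\<And>i. i < q \<Longrightarrow> g i \<in> carrier T) \<Longrightarrow>
         \<exists>\<omega>\<in>hom (G\<lparr>carrier := J\<rparr>) T. \<forall>i<q. \<omega> (k i) = g i"
    show thesis by (rule that[OF p_open_trans[OF No J(1)] J(2,3)])
  qed
qed

end

section \<open>Stabilisers of an action on the integral plane\<close>

definition pair_cong :: "int \<Rightarrow> int \<times> int \<Rightarrow> int \<times> int \<Rightarrow> bool" where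
  "pair_cong m w w' \<longleftrightarrow> [fst w = fst w'] (mod m) \<and> [snd w = snd w'] (mod m)"

lemma pair_cong_iff: "pair_cong m w w' \<longleftrightarrow> res_pair m w = res_pair m w'"
  by (simp add: pair_cong_def res_pair_def cong_def)

lemma pair_cong_refl [simp]: "pair_cong m w w" by (simp add: pair_cong_iff)

lemma pair_cong_res [simp]: "pair_cong m (res_pair m w) w"
  by (simp add: pair_cong_def res_pair_def cong_def)

text \<open>The condition expresses, without coordinates, that an affine map has linear part congruent to \<open>1\<close> modulo \<open>p\<close>; it
  makes the stabilisers of \<open>0\<close> modulo successive powers of \<open>p\<close> have exponent \<open>p\<close> in one another.\<close>

definition tame :: "nat \<Rightarrow> (int \<times> int \<Rightarrow> int \<times> int) \<Rightarrow> bool" where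
  "tame p \<theta> \<longleftrightarrow> (\<forall>n w w'. pair_cong (int p ^ n) w w' \<longrightarrow>
     pair_cong (int p ^ Suc n) (fst (\<theta> w) - fst w, snd (\<theta> w) - snd w) (fst (\<theta> w') - fst w', snd (\<theta> w') - snd w'))"

lemma tameD:
  assumes "tame p \<theta>" "pair_cong (int p ^ n) w w'"
  shows "[fst (\<theta> w) - fst w = fst (\<theta> w') - fst w'] (mod int p ^ Suc n)"
    "[snd (\<theta> w) - snd w = snd (\<theta> w') - snd w'] (mod int p ^ Suc n)"
  using assms unfolding tame_def pair_cong_def by fastforce+

lemma tame_cong:
  assumes "tame p \<theta>" "pair_cong (int p ^ n) w w'" shows "pair_cong (int p ^ n) (\<theta> w) (\<theta> w')"
proof -
  have "int p ^ n dvd int p ^ Suc n" by simp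
  hence "[fst (\<theta> w) - fst w = fst (\<theta> w') - fst w'] (mod int p ^ n)"
    "[snd (\<theta> w) - snd w = snd (\<theta> w') - snd w'] (mod int p ^ n)"
    using tameD[OF assms] cong_dvd_modulus by blast+
  from this[THEN cong_add, of "fst w" "fst w'"] this[THEN cong_add, of "snd w" "snd w'"] assms(2)
  show ?thesis by (simp add: pair_cong_def)
qed

lemma tame_comp:
  assumes "tame p \<theta>" "tame p \<theta>'" shows "tame p (\<theta>' \<circ> \<theta>)"
  unfolding tame_def
proof (intro allI impI)
  fix n w w' assume w: "pair_cong (int p ^ n) w w'"
  note a = tameD[OF assms(1) w] tameD[OF assms(2) tame_cong[OF assms(1) w]]
  from cong_add[OF a(1,3)] cong_add[OF a(2,4)]
  show "pair_cong (int p ^ Suc n) (fst ((\<theta>' \<circ> \<theta>) w) - fst w, snd ((\<theta>' \<circ> \<theta>) w) - snd w)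
      (fst ((\<theta>' \<circ> \<theta>) w') - fst w', snd ((\<theta>' \<circ> \<theta>) w') - snd w')"
    by (simp add: pair_cong_def)
qed

lemma tame_id: "tame p id" by (simp add: tame_def)

lemma tame_translation: "tame p (\<lambda>w. (fst w + a, snd w + b))"
  by (simp add: tame_def)

text \<open>An entry divisible by \<open>p\<close> improves a congruence modulo \<open>p ^ n\<close>
  to one modulo \<open>p ^ Suc n\<close>.\<close>

lemma tame_shear:
  assumes "int p dvd q" shows "tame p (\<lambda>w. (fst w + q * snd w, snd w))" "tame p (\<lambda>w. (fst w, snd w + q * fst w))"
proof -
  have "[q * x = q * y] (mod int p ^ Suc n)" if "[x = y] (mod int p ^ n)" for x y n
  proof -
    have "int p * int p ^ n dvd q * (x - y)" using that assms by (intro mult_dvd_mono) (auto simp: cong_iff_dvd_diff)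
    thus ?thesis by (simp add: cong_iff_dvd_diff right_diff_distrib)
  qed
  thus "tame p (\<lambda>w. (fst w + q * snd w, snd w))" "tame p (\<lambda>w. (fst w, snd w + q * fst w))"
    by (auto simp: tame_def pair_cong_def)
qed

text \<open>The number \<open>u i w\<close> is the amount by which generator \<open>i\<close> raises
  the last coordinate above the point \<open>w\<close>; see \<open>skew_group_gens\<close>.\<close>

type_synonym labelling = "nat \<Rightarrow> int \<times> int \<Rightarrow> int"

definition periodic :: "int \<Rightarrow> labelling \<Rightarrow> bool" where
  "periodic m u \<longleftrightarrow> (\<forall>i w w'. pair_cong m w w' \<longrightarrow> u i w = u i w')"

text \<open>The pair \<open>(\<theta>, h)\<close> acts on \<open>\<int>\<^sup>2 \<times> \<int>\<close> on the right, through \<open>(w, z) \<mapsto> (\<theta> w, z + h w u)\<close> for every labelling \<open>u\<close>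
  simultaneously, and this action descends modulo every power of \<open>p\<close>.\<close>

definition skew_group :: "nat \<Rightarrow> ((int \<times> int \<Rightarrow> int \<times> int) \<times> (int \<times> int \<Rightarrow> labelling \<Rightarrow> int)) monoid" where
  "skew_group p = \<lparr>carrier = {(\<theta>, h). tame p \<theta> \<and> (\<exists>\<theta>'. tame p \<theta>' \<and> \<theta>' \<circ> \<theta> = id \<and> \<theta> \<circ> \<theta>' = id) \<and>
       (\<forall>n u w w'. periodic (int p ^ n) u \<longrightarrow> pair_cong (int p ^ n) w w' \<longrightarrow> h w u = h w' u)},
     monoid.mult = (\<lambda>x y. (fst y \<circ> fst x, \<lambda>w u. snd x w u + snd y (fst x w) u)),
     one = (id, \<lambda>w u. 0)\<rparr>"

lemma skew_group: "group (skew_group p)"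
proof (rule groupI)
  fix x y z
  assume x: "x \<in> carrier (skew_group p)" and y: "y \<in> carrier (skew_group p)"
  obtain \<theta> h where xe: "x = (\<theta>, h)" by (cases x)
  obtain \<eta> k where ye: "y = (\<eta>, k)" by (cases y)
  have X: "tame p \<theta>" "\<And>n u w w'. periodic (int p ^ n) u \<Longrightarrow> pair_cong (int p ^ n) w w' \<Longrightarrow> h w u = h w' u"
    and Y: "tame p \<eta>" "\<And>n u w w'. periodic (int p ^ n) u \<Longrightarrow> pair_cong (int p ^ n) w w' \<Longrightarrow> k w u = k w' u"
    using x y by (auto simp: skew_group_def xe ye)
  obtain \<theta>' where t: "tame p \<theta>'" "\<theta>' \<circ> \<theta> = id" "\<theta> \<circ> \<theta>' = id" using x by (auto simp: skew_group_def xe)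
  obtain \<eta>' where e: "tame p \<eta>'" "\<eta>' \<circ> \<eta> = id" "\<eta> \<circ> \<eta>' = id" using y by (auto simp: skew_group_def ye)
  have "tame p (\<theta>' \<circ> \<eta>')" "(\<theta>' \<circ> \<eta>') \<circ> (\<eta> \<circ> \<theta>) = id" "(\<eta> \<circ> \<theta>) \<circ> (\<theta>' \<circ> \<eta>') = id"
    using tame_comp[OF e(1) t(1)] pointfree_idE[OF t(2)] pointfree_idE[OF t(3)] pointfree_idE[OF e(2)] pointfree_idE[OF e(3)]
    by (simp_all add: fun_eq_iff del: split_paired_All)
  moreover have "h w u + k (\<theta> w) u = h w' u + k (\<theta> w') u" if "periodic (int p ^ n) u" "pair_cong (int p ^ n) w w'" for n u w w'
    using X(2)[OF that] Y(2)[OF that(1) tame_cong[OF X(1) that(2)]] by simp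
  ultimately show "x \<otimes>\<^bsub>skew_group p\<^esub> y \<in> carrier (skew_group p)"
    using tame_comp[OF X(1) Y(1)] unfolding skew_group_def xe ye by auto
  let ?x' = "(\<theta>', \<lambda>w u. - h (\<theta>' w) u)"
  have "?x' \<in> carrier (skew_group p)"
    using t X(1) X(2)[OF _ tame_cong[OF t(1)]] by (auto simp: skew_group_def)
  moreover have "?x' \<otimes>\<^bsub>skew_group p\<^esub> x = \<one>\<^bsub>skew_group p\<^esub>"
    using t(3) by (simp add: skew_group_def xe)
  ultimately show "\<exists>x'\<in>carrier (skew_group p). x' \<otimes>\<^bsub>skew_group p\<^esub> x = \<one>\<^bsub>skew_group p\<^esub>" by blast
qed (auto simp: skew_group_def tame_id fun_eq_iff intro!: exI[of _ id])

lemma skew_group_gens: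
  assumes i: "i < 4"
  shows "(torus_gens (int p) ! i, \<lambda>w u. u i w) \<in> carrier (skew_group p)"
proof -
  \<comment> \<open>\<open>torus_automorphism\<close> serves here for its inverse equations, in
    which the modulus does not occur; any modulus would do.\<close>
  have inv: "\<exists>\<theta>'. tame p \<theta>' \<and> \<theta>' \<circ> \<theta> = id \<and> \<theta> \<circ> \<theta>' = id" if "tame p \<theta>'" "torus_automorphism 1 \<theta> \<theta>'" for \<theta> \<theta>'
    using that by (intro exI[of _ \<theta>']) (auto simp: torus_automorphism_def fun_eq_iff)
  have t: "tame p (\<lambda>w. (fst w - int p * snd w, snd w))" "tame p (\<lambda>w. (fst w, snd w - int p * fst w))"
    using tame_shear[of p "- int p"] by simp_all
  have "tame p (torus_gens (int p) ! i) \<and> (\<exists>\<theta>'. tame p \<theta>' \<and> \<theta>' \<circ> torus_gens (int p) ! i = id \<and> torus_gens (int p) ! i \<circ> \<theta>' = id)"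
  proof -
    consider "i = 0" | "i = 1" | "i = 2" | "i = 3" using i by linarith
    thus ?thesis
    proof cases
      case 1
      thus ?thesis using tame_translation[of p 1 0] inv[OF tame_translation[of p "-1" 0] ] translation_automorphism[of 1 1 0]
        by (simp add: torus_gens_def)
    next
      case 2
      thus ?thesis using tame_translation[of p 0 1] inv[OF tame_translation[of p 0 "-1"] ] translation_automorphism[of 1 0 1]
        by (simp add: torus_gens_def)
    next
      case 3
      thus ?thesis using tame_shear(1)[of p "int p"] inv[OF t(1) shear1_automorphism]
        by (simp add: torus_gens_def numeral_eq_Suc)
    next
      case 4
      thus ?thesis using tame_shear(2)[of p "int p"] inv[OF t(2) shear2_automorphism]
        by (simp add: torus_gens_def numeral_eq_Suc)
    qed
  qed
  thus ?thesis by (auto simp: skew_group_def periodic_def)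
qed

section \<open>Stabilisers modulo the powers of p\<close>

locale torus_action = group G for G (structure) +
  fixes p :: nat and J :: "'a set" and k :: "nat \<Rightarrow> 'a"
    and \<omega> :: "'a \<Rightarrow> (int \<times> int \<Rightarrow> int \<times> int) \<times> (int \<times> int \<Rightarrow> labelling \<Rightarrow> int)"
  assumes p: "prime p" and J: "p_open p G J" and k: "\<And>i. i < 4 \<Longrightarrow> k i \<in> J"
    and \<omega>: "\<omega> \<in> hom (G\<lparr>carrier := J\<rparr>) (skew_group p)"
    and \<omega>_k: "\<And>i. i < 4 \<Longrightarrow> \<omega> (k i) = (torus_gens (int p) ! i, \<lambda>w u. u i w)"
begin

abbreviation "act g \<equiv> fst (\<omega> g)"
abbreviation "height g \<equiv> snd (\<omega> g)"
abbreviation "orig \<equiv> (0 :: int, 0 :: int)"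

lemma p_pos: "p > 0" "int p ^ n > 0" using prime_gt_0_nat[OF p] by auto

lemma J_sub: "subgroup J G" "finite (rcosets J)" using J by (auto simp: p_open_def)

lemma JG: "g \<in> J \<Longrightarrow> g \<in> carrier G" using subgroup.mem_carrier[OF J_sub(1)] .

lemma \<omega>_mult: "g \<in> J \<Longrightarrow> h \<in> J \<Longrightarrow> act (g \<otimes> h) w = act h (act g w)"
  "g \<in> J \<Longrightarrow> h \<in> J \<Longrightarrow> height (g \<otimes> h) w u = height g w u + height h (act g w) u"
  using hom_mult[OF \<omega>, of g h] by (auto simp: skew_group_def)

lemma \<omega>_carrier: "g \<in> J \<Longrightarrow> \<omega> g \<in> carrier (skew_group p)"
  using hom_in_carrier[OF \<omega>] by simp

lemma act_tame: "g \<in> J \<Longrightarrow> tame p (act g)"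
  using \<omega>_carrier[of g] by (cases "\<omega> g") (auto simp: skew_group_def)

lemmas act_cong = tame_cong[OF act_tame]

lemma height_cong: "g \<in> J \<Longrightarrow> periodic (int p ^ n) u \<Longrightarrow> pair_cong (int p ^ n) w w' \<Longrightarrow> height g w u = height g w' u"
  using \<omega>_carrier[of g] by (cases "\<omega> g") (auto simp: skew_group_def simp del: split_paired_All)

lemma act_one [simp]: "act \<one> w = w"
proof -
  have "\<omega> \<one>\<^bsub>G\<lparr>carrier := J\<rparr>\<^esub> = \<one>\<^bsub>skew_group p\<^esub>"
    by (rule hom_one[OF \<omega> subgroup_imp_group[OF J_sub(1)] skew_group])
  thus ?thesis by (simp add: skew_group_def)
qed

lemma J_closed: "g \<in> J \<Longrightarrow> h \<in> J \<Longrightarrow> g \<otimes> h \<in> J" "g \<in> J \<Longrightarrow> inv g \<in> J" "\<one> \<in> J"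
  using J_sub(1) by (auto simp: subgroup.m_closed subgroup.m_inv_closed subgroup.one_closed)

lemma act_inv: "g \<in> J \<Longrightarrow> act (inv g) (act g w) = w" "g \<in> J \<Longrightarrow> act g (act (inv g) w) = w"
  using \<omega>_mult(1)[of g "inv g" w] \<omega>_mult(1)[of "inv g" g w] J_closed JG[of g] by simp_all

definition level :: "nat \<Rightarrow> 'a set" where
  "level n = {g \<in> J. pair_cong (int p ^ n) (act g orig) orig}"

lemma level_J: "level n \<subseteq> J" by (auto simp: level_def)

lemma pair_cong_sym: "pair_cong m w w' \<Longrightarrow> pair_cong m w' w" by (simp add: pair_cong_iff)

lemma pair_cong_trans [trans]: "pair_cong m w w' \<Longrightarrow> pair_cong m w' w'' \<Longrightarrow> pair_cong m w w''"
  by (simp add: pair_cong_iff)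

lemma level_subgroup: "subgroup (level n) G"
proof (rule subgroupI)
  show "level n \<subseteq> carrier G" using JG by (auto simp: level_def)
  show "level n \<noteq> {}" using J_closed(3) by (auto simp: level_def intro!: exI[of _ \<one>])
  fix g assume g: "g \<in> level n"
  hence gJ: "g \<in> J" "pair_cong (int p ^ n) (act g orig) orig" by (auto simp: level_def)
  have "pair_cong (int p ^ n) (act (inv g) (act g orig)) (act (inv g) orig)"
    by (rule act_cong[OF J_closed(2)[OF gJ(1)] gJ(2)])
  thus "inv g \<in> level n" using act_inv(1)[OF gJ(1)] J_closed(2)[OF gJ(1)] by (auto simp: level_def intro: pair_cong_sym)
  fix h assume h: "h \<in> level n"
  hence hJ: "h \<in> J" "pair_cong (int p ^ n) (act h orig) orig" by (auto simp: level_def)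
  have "pair_cong (int p ^ n) (act h (act g orig)) (act h orig)" by (rule act_cong[OF hJ(1) gJ(2)])
  thus "g \<otimes> h \<in> level n" using pair_cong_trans hJ gJ J_closed(1) by (auto simp: level_def \<omega>_mult)
qed

definition point :: "nat \<Rightarrow> 'a \<Rightarrow> int \<times> int" where
  "point n g = res_pair (int p ^ n) (act g orig)"

lemma point_torus: "point n g \<in> torus (int p ^ n)"
  unfolding point_def using p_pos by (intro res_pair_torus)

lemma level_coset_eq:
  assumes g: "g \<in> J" and h: "h \<in> J"
  shows "level n #> g = level n #> h \<longleftrightarrow> point n g = point n h"
proof -
  have i: "inv h \<in> J" using J_closed(2)[OF h] .
  have "level n #> g = level n #> h \<longleftrightarrow> g \<otimes> inv h \<in> level n"
    by (rule rcos_eq_iff[OF level_subgroup JG[OF g] JG[OF h]])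
  also have "\<dots> \<longleftrightarrow> pair_cong (int p ^ n) (act (inv h) (act g orig)) orig"
    using J_closed(1)[OF g i] \<omega>_mult(1)[OF g i] by (simp add: level_def)
  also have "\<dots> \<longleftrightarrow> pair_cong (int p ^ n) (act g orig) (act h orig)"
    using act_cong[OF h, of n "act (inv h) (act g orig)" orig] act_cong[OF i, of n "act g orig" "act h orig"]
      act_inv[OF h] by auto
  finally show ?thesis by (simp add: point_def pair_cong_iff)
qed

lemma act_k: "i < 4 \<Longrightarrow> act (k i) w = (torus_gens (int p) ! i) w"
  by (simp add: \<omega>_k)

lemma point_mult_k:
  assumes "g \<in> J" "i < 4"
  shows "point n (g \<otimes> k i) = res_pair (int p ^ n) ((torus_gens (int p) ! i) (point n g))"
proof -
  have "pair_cong (int p ^ n) (act (k i) (point n g)) (act (k i) (act g orig))"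
    by (rule act_cong[OF k[OF assms(2)]]) (simp add: point_def)
  thus ?thesis using \<omega>_mult(1)[OF assms(1) k[OF assms(2)]] act_k[OF assms(2)]
    by (simp add: point_def pair_cong_iff)
qed

lemma J_pow: "g \<in> J \<Longrightarrow> g [^] (n::nat) \<in> J"
  using pow_mem_subgroup[OF J_sub(1)] .

lemma act_pow_translation:
  "act (k 0 [^] (n::nat)) w = (fst w + int n, snd w)" "act (k 1 [^] (n::nat)) w = (fst w, snd w + int n)"
proof (induction n)
  case (Suc n)
  { case 1 thus ?case using Suc(1) \<omega>_mult(1)[OF J_pow k, of "k 0" 0] k[of 0] act_k[of 0] by (simp add: torus_gens_def) }
  { case 2 thus ?case using Suc(2) \<omega>_mult(1)[OF J_pow k, of "k 1" 1] k[of 1] act_k[of 1] by (simp add: torus_gens_def) }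
qed simp_all

text \<open>Powers of the two translations carry 0 to any point with nonnegative coordinates. Hence
  \<open>J\<close> is transitive on every torus, and the cosets of \<open>level n\<close> in
  \<open>J\<close> are its points.\<close>

definition mover :: "int \<times> int \<Rightarrow> 'a" where
  "mover w = k 0 [^] nat (fst w) \<otimes> k 1 [^] nat (snd w)"

lemma mover: "mover w \<in> J" "w \<in> torus N \<Longrightarrow> act (mover w) orig = w"
proof -
  have k01: "k 0 [^] nat (fst w) \<in> J" "k 1 [^] nat (snd w) \<in> J" using J_pow k by auto
  thus "mover w \<in> J" using J_closed by (simp add: mover_def)
  show "w \<in> torus N \<Longrightarrow> act (mover w) orig = w"
    unfolding mover_def \<omega>_mult(1)[OF k01] act_pow_translation by (cases w) (auto simp: torus_def)
qed

lemma point_mover: "w \<in> torus (int p ^ n) \<Longrightarrow> point n (mover w) = w"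
  using mover(2) by (simp add: point_def res_pair_id)

abbreviation "blocks n \<equiv> rcosets\<^bsub>G\<lparr>carrier := J\<rparr>\<^esub> (level n)"

lemma orbit_bij: "bij_betw (\<lambda>w. level n #> mover w) (torus (int p ^ n)) (blocks n)"
proof (rule bij_betwI')
  fix w w' assume "w \<in> torus (int p ^ n)" "w' \<in> torus (int p ^ n)"
  thus "(level n #> mover w = level n #> mover w') = (w = w')"
    using level_coset_eq[OF mover(1) mover(1)] point_mover by simp
next
  fix w show "level n #> mover w \<in> blocks n" using mover(1) by (auto simp: rcosets_subgroup)
next
  fix C assume "C \<in> blocks n"
  then obtain g where g: "g \<in> J" "C = level n #> g" by (auto simp: rcosets_subgroup)
  thus "\<exists>w\<in>torus (int p ^ n). C = level n #> mover w"
    using level_coset_eq[OF g(1) mover(1)] point_mover[OF point_torus] point_torus by (intro bexI[of _ "point n g"]) auto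
qed

lemma card_torus: "card (torus (int p ^ n)) = (p ^ n)\<^sup>2"
  by (simp add: torus_def card_cartesian_product power2_eq_square nat_power_eq)

lemma card_orbit: "card (blocks n) = (p ^ n)\<^sup>2" "finite (blocks n)"
  using bij_betw_same_card[OF orbit_bij] card_torus bij_betw_finite[OF orbit_bij] by auto

lemma level_Suc: "level (Suc n) \<subseteq> level n"
proof -
  have "int p ^ n dvd int p ^ Suc n" by simp
  hence "[x = y] (mod int p ^ n)" if "[x = y] (mod int p ^ Suc n)" for x y
    using cong_dvd_modulus[OF that] by blast
  thus ?thesis unfolding level_def pair_cong_def by blast
qed

text \<open>By tameness \<open>g\<close> moves all points congruent to 0 modulo \<open>p ^ n\<close>
  by one and the same vector modulo \<open>p ^ Suc n\<close>. So \<open>g [^] p\<close> moves 0 by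
  \<open>p\<close> times a vector divisible by \<open>p ^ n\<close>.\<close>

lemma level_pow:
  assumes g: "g \<in> level n" shows "g [^] p \<in> level (Suc n)"
proof -
  have gJ: "g \<in> J" "pair_cong (int p ^ n) (act g orig) orig" using g by (auto simp: level_def)
  let ?a = "act g orig"
  have "pair_cong (int p ^ n) (act (g [^] i) orig) orig \<and>
    pair_cong (int p ^ Suc n) (act (g [^] i) orig) (int i * fst ?a, int i * snd ?a)" for i :: nat
  proof (induction i)
    case (Suc i)
    let ?b = "act (g [^] i) orig"
    have e: "act (g [^] Suc i) orig = act g ?b" using \<omega>_mult(1)[OF J_pow[OF gJ(1)] gJ(1)] by simp
    have "pair_cong (int p ^ n) (act g ?b) (act g orig)" using act_cong[OF gJ(1)] Suc by blast
    hence 1: "pair_cong (int p ^ n) (act g ?b) orig" using gJ(2) by (rule pair_cong_trans)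
    have 2: "[fst (act g ?b) - fst ?b = fst ?a - 0] (mod int p ^ Suc n)" "[snd (act g ?b) - snd ?b = snd ?a - 0] (mod int p ^ Suc n)"
      using tameD[OF act_tame[OF gJ(1)] conjunct1[OF Suc]] by simp_all
    have 3: "[fst ?b = int i * fst ?a] (mod int p ^ Suc n)" "[snd ?b = int i * snd ?a] (mod int p ^ Suc n)"
      using Suc by (auto simp: pair_cong_def)
    from cong_add[OF 2(1) 3(1)] cong_add[OF 2(2) 3(2)]
    have "pair_cong (int p ^ Suc n) (act g ?b) (int (Suc i) * fst ?a, int (Suc i) * snd ?a)"
      by (simp add: pair_cong_def algebra_simps)
    thus ?case using 1 e by simp
  qed simp
  hence *: "pair_cong (int p ^ Suc n) (act (g [^] p) orig) (int p * fst ?a, int p * snd ?a)" by blast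
  have "int p ^ n dvd fst ?a" "int p ^ n dvd snd ?a" using gJ(2) by (auto simp: pair_cong_def cong_0_iff)
  hence "pair_cong (int p ^ Suc n) (int p * fst ?a, int p * snd ?a) orig"
    by (auto simp: pair_cong_def cong_0_iff intro: mult_dvd_mono)
  thus ?thesis using pair_cong_trans[OF *] J_pow[OF gJ(1)] by (simp add: level_def)
qed

lemma level_p_open_J: "p_open p (G\<lparr>carrier := J\<rparr>) (level n)"
proof -
  have "g [^] (p ^ n) \<in> level n" if g: "g \<in> J" for g
  proof (induction n)
    case 0
    show ?case using g JG by (simp add: level_def pair_cong_def)
  next
    case (Suc n)
    thus ?case using level_pow[OF Suc] JG[OF g] by (simp add: nat_pow_pow mult.commute)
  qed
  thus ?thesis unfolding p_open_def
    using card_orbit(2) subgroup_incl[OF level_subgroup J_sub(1) level_J]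
    by (auto simp: nat_pow_consistent[symmetric])
qed

lemma level_p_open: "p_open p G (level n)"
  by (rule p_open_trans[OF J level_p_open_J])

lemma level_index: "card (rcosets (level n)) = (p ^ n)\<^sup>2 * card (rcosets J)"
  using index_mult[OF J_sub(1) level_subgroup level_J] card_orbit(1) by simp

lemma level_infinite: "infinite (range level)"
proof -
  have "inj level"
  proof (rule injI)
    fix m n assume e: "level m = level n"
    have "(p ^ m)\<^sup>2 * card (rcosets J) = (p ^ n)\<^sup>2 * card (rcosets J)" unfolding level_index[symmetric] e by (rule refl)
    moreover have "card (rcosets J) \<noteq> 0" using index_pos[OF J_sub] by simp
    ultimately have "(p ^ m)\<^sup>2 = (p ^ n)\<^sup>2" using mult_right_cancel by blast
    hence "p ^ m = p ^ n" by simp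
    thus "m = n" using prime_gt_1_nat[OF p] by simp
  qed
  thus ?thesis using finite_imageD infinite_UNIV_nat by blast
qed

end

context torus_action
begin

text \<open>A labelling of period \<open>p ^ n\<close> has \<open>4 * (p ^ n)\<^sup>2\<close> free
  residues. Its height at 0 is a homomorphism on \<open>level n\<close>, and this homomorphism
  together with the heights of the representatives \<open>mover w\<close>, which are
  \<open>(p ^ n)\<^sup>2\<close> further residues, determines the labelling. The difference is the
  factor 3.\<close>

lemma level_homology:
  assumes S: "finite S" "S \<subseteq> carrier G" "generate G S = carrier G"
  shows "3 * (p ^ n)\<^sup>2 \<le> mod_homology_dim p (G\<lparr>carrier := level n\<rparr>)"
proof -
  define N where "N = int p ^ n"
  let ?T = "torus N" and ?P = "{0..<int p}" and ?G = "G\<lparr>carrier := level n\<rparr>"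
  have N0: "N > 0" using p_pos by (simp add: N_def)
  have ip: "int p > 0" using p_pos by simp
  have cT: "card ?T = (p ^ n)\<^sup>2" using card_torus by (simp add: N_def)
  note fg = finitely_generated_subgroup[OF S p level_subgroup]
  have fin: "finite (rcosets (level n))" using level_p_open by (simp add: p_open_def)
  \<comment> \<open>Periodic in the point, and 0 for the numbers that do not belong to one of the
    four generators.\<close>
  define u where "u f i w = (if i < 4 then f (i, res_pair N w) else 0)" for f :: "nat \<times> int \<times> int \<Rightarrow> int" and i :: nat and w
  have per: "periodic (int p ^ n) (u f)" for f
    by (simp add: periodic_def u_def N_def pair_cong_iff)
  define H where "H f g = height g orig (u f)" for f g
  define \<chi> where "\<chi> f = (\<lambda>x\<in>level n. H f x mod int p)" for f
  have H_level: "H f (x \<otimes> y) = H f x + H f y" if x: "x \<in> level n" and y: "y \<in> J" for f x y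
  proof -
    have "x \<in> J" "pair_cong (int p ^ n) (act x orig) orig" using x by (auto simp: level_def)
    thus ?thesis using \<omega>_mult(2) y height_cong[OF y per] by (simp add: H_def)
  qed
  have \<chi>: "\<chi> f \<in> fp_homs p ?G" for f
    using ip H_level level_J subgroup.m_closed[OF level_subgroup]
    by (auto simp: fp_homs_def \<chi>_def mod_simps subset_iff)
  define \<Phi> where "\<Phi> f = (\<chi> f, \<lambda>w\<in>?T. H f (mover w) mod int p)" for f
  let ?F = "({..<4 :: nat} \<times> ?T) \<rightarrow>\<^sub>E ?P"
  \<comment> \<open>Closing an edge of the torus up by the representatives of its ends gives an
    element of \<open>level n\<close>; its height is the label of the edge up to the heights of the
    representatives.\<close>
  have key: "[f (i, w) = H f (mover w \<otimes> k i \<otimes> inv (mover w')) + H f (mover w') - H f (mover w)] (mod int p)"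
    "mover w \<otimes> k i \<otimes> inv (mover w') \<in> level n" "w' \<in> ?T"
    if i: "i < 4" and w: "w \<in> ?T" and w': "w' = point n (mover w \<otimes> k i)" for f i w w'
  proof -
    let ?m = "mover w \<otimes> k i" and ?m' = "mover w'"
    let ?x = "?m \<otimes> inv ?m'"
    have mJ: "?m \<in> J" "?m' \<in> J" "mover w \<in> J" using mover(1) k[OF i] J_closed by auto
    show w'T: "w' \<in> ?T" using point_torus by (simp add: w' N_def)
    have "point n ?m = point n ?m'" using point_mover[of w' n] w'T by (simp add: w' N_def)
    hence "level n #> ?m = level n #> ?m'" using level_coset_eq[OF mJ(1,2)] by simp
    thus x: "?x \<in> level n" using rcos_eq_iff[OF level_subgroup JG[OF mJ(1)] JG[OF mJ(2)]] by simp
    have e: "?x \<otimes> ?m' = ?m"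
      using JG[OF mJ(1)] JG[OF mJ(2)] by (simp only: m_assoc inv_closed l_inv r_one)
    have "H f ?m = H f (mover w) + f (i, w)"
      using \<omega>_mult(2)[OF mJ(3) k[OF i], of orig "u f"] mover(2)[OF w] \<omega>_k[OF i] i res_pair_id[OF w]
      by (simp add: H_def u_def)
    moreover have "H f ?m = H f ?x + H f ?m'" using H_level[OF x mJ(2), of f] unfolding e .
    ultimately show "[f (i, w) = H f ?x + H f ?m' - H f (mover w)] (mod int p)" by simp
  qed
  have inj: "inj_on \<Phi> ?F"
  proof (rule inj_onI)
    fix f g assume f: "f \<in> ?F" and g: "g \<in> ?F" and eq: "\<Phi> f = \<Phi> g"
    have \<chi>e: "[H f x = H g x] (mod int p)" if "x \<in> level n" for x
    proof -
      have "\<chi> f x = \<chi> g x" using eq by (simp add: \<Phi>_def)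
      thus ?thesis using that by (simp add: \<chi>_def cong_def)
    qed
    have me: "[H f (mover w) = H g (mover w)] (mod int p)" if "w \<in> ?T" for w
    proof -
      have "(\<lambda>w\<in>?T. H f (mover w) mod int p) w = (\<lambda>w\<in>?T. H g (mover w) mod int p) w" using eq by (simp add: \<Phi>_def)
      thus ?thesis using that by (simp add: cong_def)
    qed
    show "f = g"
    proof (rule PiE_ext[OF f g])
      fix z assume "z \<in> {..<4 :: nat} \<times> ?T"
      then obtain i w where z: "z = (i, w)" "i < 4" "w \<in> ?T" by auto
      let ?w = "point n (mover w \<otimes> k i)"
      let ?x = "mover w \<otimes> k i \<otimes> inv (mover ?w)"
      have "[H f ?x + H f (mover ?w) - H f (mover w) = H g ?x + H g (mover ?w) - H g (mover w)] (mod int p)"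
        by (intro cong_add cong_diff \<chi>e me key(2)[OF z(2,3) refl] key(3)[OF z(2,3) refl] z(3))
      hence "[f z = g z] (mod int p)"
        unfolding z(1) using key(1)[OF z(2,3) refl] by (meson cong_sym cong_trans)
      moreover have "f z \<in> ?P" "g z \<in> ?P" using PiE_mem[OF f] PiE_mem[OF g] z by auto
      ultimately show "f z = g z" by (simp add: cong_def)
    qed
  qed
  have fT: "finite (?T \<rightarrow>\<^sub>E ?P)" by (intro finite_PiE) auto
  have "card ?F \<le> card (fp_homs p ?G \<times> (?T \<rightarrow>\<^sub>E ?P))"
  proof (rule card_inj_on_le[OF inj])
    show "\<Phi> ` ?F \<subseteq> fp_homs p ?G \<times> (?T \<rightarrow>\<^sub>E ?P)"
      using \<chi> ip by (auto simp: \<Phi>_def)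
    show "finite (fp_homs p ?G \<times> (?T \<rightarrow>\<^sub>E ?P))" using fg(2)[OF fin] fT by simp
  qed
  moreover have "card ?F = p ^ (4 * (p ^ n)\<^sup>2)" by (simp add: card_PiE card_cartesian_product cT)
  moreover have "card (?T \<rightarrow>\<^sub>E ?P) = p ^ (p ^ n)\<^sup>2" by (simp add: card_PiE cT)
  ultimately have "p ^ (4 * (p ^ n)\<^sup>2) \<le> p ^ (mod_homology_dim p ?G + (p ^ n)\<^sup>2)"
    using fg(1)[OF fin] by (simp add: card_cartesian_product power_add)
  hence "4 * (p ^ n)\<^sup>2 \<le> mod_homology_dim p ?G + (p ^ n)\<^sup>2" using prime_gt_1_nat[OF p] by simp
  thus ?thesis by simp
qed

text \<open>On the cosets inside \<open>J\<close> the four elements \<open>k i\<close> act as the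
  generators in \<open>torus_expander\<close>, and each displaces at most a constant times the
  boundary for \<open>S\<close>. From there \<open>block_intersection_bound\<close> reaches the
  whole graph.\<close>

lemma level_expands:
  assumes S: "finite S" "S \<subseteq> carrier G" "generate G S = carrier G"
  shows "\<exists>e>0. \<forall>n. expands G (level n) S e"
proof -
  obtain c where c: "c > 0" "\<And>N B. N > 0 \<Longrightarrow> B \<subseteq> torus N \<Longrightarrow> 2 * real (card B) \<le> real_of_int (N ^ 2) \<Longrightarrow>
      c * real (card B) \<le> (\<Sum>\<theta>\<leftarrow>torus_gens (int p). real (escape N B \<theta>))"
    using torus_expander[of "int p"] prime_ge_2_nat[OF p] by auto
  obtain \<tau> where \<tau>: "\<And>N A. subgroup N G \<Longrightarrow> N \<subseteq> J \<Longrightarrow> finite (rcosets N) \<Longrightarrow> A \<subseteq> rcosets N \<Longrightarrow>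
    card A \<le> card (rcosets J) * card (A \<inter> (rcosets\<^bsub>G\<lparr>carrier := J\<rparr>\<^esub> N)) + \<tau> * card (boundary N S A)"
    using block_intersection_bound[OF S J_sub] by blast
  have "\<exists>t. \<forall>H A. subgroup H G \<longrightarrow> finite (rcosets H) \<longrightarrow> card (displaced H A (k i)) \<le> t * card (boundary H S A)"
    if "i < 4" for i using displaced_bound[OF S(1,2)] S(3) JG[OF k[OF that]] by simp
  then obtain t where t: "\<And>i H A. i < 4 \<Longrightarrow> subgroup H G \<Longrightarrow> finite (rcosets H) \<Longrightarrow>
      card (displaced H A (k i)) \<le> t i * card (boundary H S A)" by metis
  define s where "s = (\<Sum>i<4. t i)"
  define v where "v = card (rcosets J)"
  \<comment> \<open>The intersection with the block is at most \<open>s / c\<close> times the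
    boundary, and the whole set at most \<open>v\<close> times the intersection plus
    \<open>\<tau>\<close> times the boundary; the summand 1 makes \<open>K\<close> positive.\<close>
  define K where "K = real v * real s / c + real \<tau> + 1"
  have K: "K > 0" using c(1) by (auto simp: K_def intro!: add_nonneg_pos)
  have "expands G (level n) S (1 / K)" for n
    unfolding expands_def
  proof (intro allI impI)
    fix A assume A: "A \<subseteq> rcosets (level n)" "0 < card A" "2 * card A \<le> card (rcosets (level n))"
    define N where "N = int p ^ n"
    let ?V = "rcosets (level n)"
    have N0: "N > 0" using p_pos by (simp add: N_def)
    have fin: "finite ?V" using level_p_open by (simp add: p_open_def)
    define pt where "pt w = level n #> mover w" for w
    have bij: "bij_betw pt (torus N) (blocks n)" using orbit_bij unfolding pt_def[abs_def] N_def .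
    \<comment> \<open>This is applied to whichever of \<open>A\<close> and its complement has at
      most half of the block. As the complement is no smaller than \<open>A\<close>, a bound for it
      is enough.\<close>
    have main: "real (card P) \<le> K * real (card (boundary (level n) S A))"
      if P: "P \<in> {A, ?V - A}" and small: "2 * card (P \<inter> blocks n) \<le> card (blocks n)" for P
    proof -
      have PV: "P \<subseteq> ?V" and bdP: "boundary (level n) S P = boundary (level n) S A"
        using P A(1) boundary_compl[OF level_subgroup S(2) A(1)] by auto
      let ?bd = "card (boundary (level n) S A)"
      define B where "B = {w\<in>torus N. pt w \<in> P}"
      have "bij_betw pt B (P \<inter> blocks n)"
      proof (rule bij_betw_subset[OF bij])
        show "B \<subseteq> torus N" by (auto simp: B_def)
        show "pt ` B = P \<inter> blocks n" unfolding B_def bij_betw_imp_surj_on[OF bij, symmetric] by blast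
      qed
      hence cB: "card B = card (P \<inter> blocks n)" by (rule bij_betw_same_card)
      have "2 * real (card B) \<le> real_of_int (N ^ 2)"
      proof -
        have "real (2 * card B) \<le> real ((p ^ n)\<^sup>2)" using small card_orbit(1) cB by (metis of_nat_le_iff)
        thus ?thesis by (simp add: N_def)
      qed
      hence 1: "c * real (card B) \<le> (\<Sum>\<theta>\<leftarrow>torus_gens (int p). real (escape N B \<theta>))"
        by (intro c(2)[OF N0]) (auto simp: B_def)
      have esc: "escape N B (torus_gens (int p) ! i) \<le> t i * ?bd" if i: "i < 4" for i
      proof -
        let ?\<theta> = "torus_gens (int p) ! i"
        have move: "pt w #> k i = pt (res_pair N (?\<theta> w))" if w: "w \<in> torus N" for w
        proof -
          have "res_pair N (?\<theta> w) \<in> torus N" using res_pair_torus[OF N0] .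
          hence "point n (mover w \<otimes> k i) = point n (mover (res_pair N (?\<theta> w)))"
            using point_mult_k[OF mover(1) i] point_mover w by (simp add: N_def)
          hence "level n #> (mover w \<otimes> k i) = pt (res_pair N (?\<theta> w))"
            using level_coset_eq[OF J_closed(1)[OF mover(1) k[OF i]] mover(1)] by (simp add: pt_def)
          thus ?thesis unfolding pt_def
            using coset_mult_assoc[OF subgroup.subset[OF level_subgroup] JG[OF mover(1)] JG[OF k[OF i]]] by simp
        qed
        have "card {w\<in>B. res_pair N (?\<theta> w) \<notin> B} \<le> card (displaced (level n) P (k i))"
        proof (rule card_inj_on_le)
          show "inj_on pt {w\<in>B. res_pair N (?\<theta> w) \<notin> B}"
            by (rule inj_on_subset[OF bij_betw_imp_inj_on[OF bij]]) (auto simp: B_def)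
          show "finite (displaced (level n) P (k i))" using fin by (simp add: displaced_def)
          show "pt ` {w\<in>B. res_pair N (?\<theta> w) \<notin> B} \<subseteq> displaced (level n) P (k i)"
            using move PV res_pair_torus[OF N0] by (auto simp: B_def displaced_def)
        qed
        also have "\<dots> \<le> t i * ?bd" using t[OF i level_subgroup fin, of P] bdP by simp
        finally show ?thesis by (simp add: escape_def)
      qed
      have "(\<Sum>\<theta>\<leftarrow>torus_gens (int p). real (escape N B \<theta>)) = (\<Sum>i<4. real (escape N B (torus_gens (int p) ! i)))"
        by (simp add: torus_gens_def numeral_eq_Suc)
      also have "\<dots> \<le> (\<Sum>i<4. real (t i * ?bd))" using esc by (intro sum_mono) (simp only: of_nat_le_iff lessThan_iff)
      also have "\<dots> = real s * real ?bd" by (simp add: s_def sum_distrib_right)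
      finally have "real (card B) \<le> real s / c * real ?bd" using 1 c(1) by (simp add: pos_le_divide_eq mult.commute)
      hence "real v * real (card B) \<le> real v * (real s / c * real ?bd)" by (intro mult_left_mono) auto
      moreover have "real (card P) \<le> real v * real (card B) + real \<tau> * real ?bd"
      proof -
        have "card P \<le> v * card B + \<tau> * ?bd" using \<tau>[OF level_subgroup level_J fin PV] bdP cB by (simp add: v_def)
        thus ?thesis by (metis of_nat_add of_nat_le_iff of_nat_mult)
      qed
      ultimately show ?thesis by (simp add: K_def algebra_simps)
    qed
    have "real (card A) \<le> K * real (card (boundary (level n) S A))"
    proof (cases "2 * card (A \<inter> blocks n) \<le> card (blocks n)")
      case True thus ?thesis using main[of A] by simp
    next
      case False
      have "blocks n \<subseteq> ?V" using JG subgroup.subset[OF level_subgroup] by (auto simp: rcosets_subgroup intro!: rcosetsI)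
      hence "blocks n = (A \<inter> blocks n) \<union> ((?V - A) \<inter> blocks n)" by blast
      moreover have "card ((A \<inter> blocks n) \<union> ((?V - A) \<inter> blocks n)) = card (A \<inter> blocks n) + card ((?V - A) \<inter> blocks n)"
        using card_orbit(2) by (intro card_Un_disjoint) auto
      ultimately have "card (blocks n) = card (A \<inter> blocks n) + card ((?V - A) \<inter> blocks n)" by simp
      hence "2 * card ((?V - A) \<inter> blocks n) \<le> card (blocks n)" using False by linarith
      from main[OF _ this] have "real (card (?V - A)) \<le> K * real (card (boundary (level n) S A))" by simp
      moreover have "card (?V - A) = card ?V - card A" using A(1) fin by (simp add: card_Diff_subset finite_subset)
      ultimately show ?thesis using A(3) by linarith
    qed
    thus "1 / K * real (card A) \<le> real (card (boundary (level n) S A))" using K by (simp add: pos_divide_le_eq mult.commute)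
  qed
  thus ?thesis using K by (intro exI[of _ "1 / K"]) simp
qed

end

section \<open>From uniform expansion to Property tau and the theorem\<close>

lemma (in group) property_tau_expands:
  assumes S: "finite S" "S \<subseteq> carrier G" "generate G S = carrier G"
    and \<H>: "\<forall>H\<in>\<H>. subgroup H G \<and> finite (rcosets H)" and e: "e > 0" "\<forall>H\<in>\<H>. expands G H S e"
  shows "property_tau G \<H>"
proof -
  have "ereal e \<le> (INF H\<in>\<H>. cheeger_constant (schreier_graph G H S))"
    by (rule INF_greatest) (use e(2) in \<open>simp add: cheeger_ge_iff\<close>)
  moreover have "0 < ereal e" using e(1) by simp
  ultimately have "0 < (INF H\<in>\<H>. cheeger_constant (schreier_graph G H S))" by (rule less_le_trans[rotated])
  thus ?thesis unfolding property_tau_def using \<H> S by blast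
qed

theorem theorem1p3:
  fixes G :: "('a, 'b) monoid_scheme" and p :: nat
  assumes "group G" and "finitely_presented G" and "prime p"
    and "\<exists>K :: nat \<Rightarrow> 'a set. infinite_nested_sequence G K \<and>
           (\<forall>i. subnormal (K i) G \<and> (\<exists>m. subgroup_index G (K i) = p ^ m)) \<and>
           linear_growth_mod_homology p G (range K)"
  shows "\<exists>L :: nat \<Rightarrow> 'a set. infinite_nested_sequence G L \<and>
           (\<forall>i. subnormal (L i) G \<and> (\<exists>m. subgroup_index G (L i) = p ^ m)) \<and>
           linear_growth_mod_homology p G (range L) \<and>
           property_tau G (range L)"
proof -
  interpret group G by (rule assms(1))
  note p = assms(3)
  obtain K :: "nat \<Rightarrow> 'a set" where K: "infinite_nested_sequence G K"
    "\<And>i. subnormal (K i) G" "\<And>i. \<exists>m. subgroup_index G (K i) = p ^ m" "linear_growth_mod_homology p G (range K)"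
    using assms(4) by blast
  obtain A :: "(nat \<times> bool) set" and ev R where pres: "monoid_presentation G A ev R"
    using finitely_presented_monoid_presentation[OF assms(1,2)] by blast
  let ?S = "ev ` A"
  have S: "finite ?S" "?S \<subseteq> carrier G" "generate G ?S = carrier G"
    using pres monoid_presentation_generates[OF pres] by (auto simp: monoid_presentation_def)
  have Ko: "p_open p G (K i)" for i
    using subnormal_imp_p_open[OF assms(1) K(2)] K(3) p by blast
  have Kfin: "\<forall>H\<in>range K. subgroup H G \<and> finite (rcosets\<^bsub>G\<^esub> H)" using Ko by (auto simp: p_open_def)
  have tau: "property_tau G (range L)"
    if "\<forall>H\<in>range L. subgroup H G \<and> finite (rcosets\<^bsub>G\<^esub> H)" "e > 0" "\<And>j. expands G (L j) ?S e"
    for L :: "nat \<Rightarrow> 'a set" and e using property_tau_expands[OF S, of "range L" e] that by blast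
  show ?thesis
  proof (cases "\<exists>e>0. \<forall>j. expands G (K j) ?S e")
    case True
    thus ?thesis using K tau[OF Kfin] by blast
  next
    case False
    hence no: "\<exists>j. \<not> expands G (K j) ?S e" if "e > 0" for e using that by blast
    let ?q = "\<lambda>H. real (mod_homology_dim p (G\<lparr>carrier := H\<rparr>)) / real (subgroup_index G H)"
    have "(INF H\<in>range K. ereal (?q H)) > 0" using K(4) by (simp add: linear_growth_mod_homology_def)
    \<comment> \<open>A number strictly between 0 and the infimum is below every quotient, hence
      finite, and serves as the uniform constant.\<close>
    then obtain z where z: "0 < z" "z < (INF H\<in>range K. ereal (?q H))" using dense by blast
    have "z < ereal (?q (K i))" for i using z(2) INF_lower[of "K i" "range K" "\<lambda>H. ereal (?q H)"] less_le_trans by blast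
    moreover from this[of 0] z(1) obtain c where c: "z = ereal c" by (cases z) auto
    ultimately have "c < ?q (K i)" for i by simp
    moreover have "real (subgroup_index G (K i)) > 0" for i
      using index_pos Ko by (simp add: p_open_def subgroup_index_def)
    ultimately have "c * real (card (rcosets\<^bsub>G\<^esub> (K i))) \<le> real (mod_homology_dim p (G\<lparr>carrier := K i\<rparr>))" for i
      by (metis less_imp_le pos_less_divide_eq subgroup_index_def)
    note growth = this
    have c0: "c > 0" using z(1) c by simp
    have Kn: "K (Suc i) \<subseteq> K i" "infinite (range K)" for i using K(1) by (auto simp: infinite_nested_sequence_def)
    show ?thesis
    \<comment> \<open>Four elements are needed, for the two translations and the two shears; the
      target group will be \<open>skew_group p\<close>.\<close>
    proof (rule retracting_subgroup[where q = 4, OF pres p Ko Kn c0 growth no])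
      fix J and k :: "nat \<Rightarrow> 'a"
      assume J: "p_open p G J" "\<And>i. i < 4 \<Longrightarrow> k i \<in> J"
        and ex: "\<And>(T :: ((int \<times> int \<Rightarrow> int \<times> int) \<times> (int \<times> int \<Rightarrow> labelling \<Rightarrow> int)) monoid) g.
          group T \<Longrightarrow> (\<And>i. i < 4 \<Longrightarrow> g i \<in> carrier T) \<Longrightarrow> \<exists>\<omega>\<in>hom (G\<lparr>carrier := J\<rparr>) T. \<forall>i<4. \<omega> (k i) = g i"
      obtain \<omega> where \<omega>: "\<omega> \<in> hom (G\<lparr>carrier := J\<rparr>) (skew_group p)"
        "\<And>i. i < 4 \<Longrightarrow> \<omega> (k i) = (torus_gens (int p) ! i, \<lambda>w u. u i w)"
        using ex[OF skew_group[of p], of "\<lambda>i. (torus_gens (int p) ! i, \<lambda>w u. u i w)"] skew_group_gens by blast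
      interpret torus_action G p J k \<omega> by unfold_locales (use p J \<omega> in auto)
      let ?v = "real (card (rcosets\<^bsub>G\<^esub> J))"
      have v: "?v > 0" using index_pos[OF J_sub] by simp
      have fin: "\<forall>H\<in>range level. subgroup H G \<and> finite (rcosets\<^bsub>G\<^esub> H)" using level_p_open by (auto simp: p_open_def)
      \<comment> \<open>The index of \<open>level n\<close> is \<open>(p ^ n)\<^sup>2\<close> times
        that of \<open>J\<close>, so the bound of \<open>level_homology\<close> leaves a ratio that
        does not depend on \<open>n\<close>.\<close>
      have "3 / ?v \<le> ?q (level n)" for n
      proof -
        have "real (3 * (p ^ n)\<^sup>2) \<le> real (mod_homology_dim p (G\<lparr>carrier := level n\<rparr>))"
          using level_homology[OF S, of n] of_nat_le_iff by blast
        hence "real (3 * (p ^ n)\<^sup>2) / (real ((p ^ n)\<^sup>2) * ?v) \<le> ?q (level n)"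
          unfolding subgroup_index_def level_index of_nat_mult by (intro divide_right_mono) auto
        moreover have "real (3 * (p ^ n)\<^sup>2) / (real ((p ^ n)\<^sup>2) * ?v) = 3 / ?v" using p_pos by simp
        ultimately show ?thesis by simp
      qed
      hence "ereal (3 / ?v) \<le> (INF H\<in>range level. ereal (?q H))" by (auto intro!: INF_greatest)
      hence "(INF H\<in>range level. ereal (?q H)) > 0" 
        by (rule less_le_trans[rotated]) (use v in simp)
      hence "linear_growth_mod_homology p G (range level)" using fin by (simp add: linear_growth_mod_homology_def)
      moreover have "property_tau G (range level)" using level_expands[OF S] tau[OF fin] by blast
      moreover have "infinite_nested_sequence G level"
        using level_subgroup level_Suc level_infinite by (simp add: infinite_nested_sequence_def)
      moreover have "subnormal (level i) G" "\<exists>m. subgroup_index G (level i) = p ^ m" for i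
        using p_open_imp_subnormal[OF assms(1) level_p_open p] p_open_index[OF level_p_open p] by (auto simp: subgroup_index_def)
      ultimately show ?thesis by blast
    qed
  qed
qed

end
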